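(* Let $\theta=\{\theta_t:U_{t^{-1}}\to U_t\}_{t\in G}$ be a continuous partial action of a countable discrete group $G$ on a compact metric space $X$, and let $C(X)\rtimes_\lambda G$ be the reduced crossed product of the induced partial action of $G$ on $C(X)$. (1) If $C(X)\rtimes_\lambda G$ is RFD, then the action $\theta$ is RFD. (2) If $\theta$ is RFD and $C^*_\lambda(G)$ is RFD, then $C(X)\rtimes_\lambda G$ is RFD. (3) If $G$ is amenable and residually finite and $\theta$ is RFD, then $C(X)\rtimes_\lambda G$ is RFD.
   Context: Groups are discrete with neutral element $e$; $C^*_\lambda(G)$ is the reduced group C*-algebra; $M_d$ is the algebra of complex $d\times d$ matrices. A partial action of $G$ on a set $X$ consists of subsets $U_t\subseteq X$ and maps $\theta_t:U_{t^{-1}}\to U_t$ ($t\in G$) with $U_e=X$, $\theta_e=\mathrm{id}_X$, and $\theta_{st}$ extending $\theta_s\circ\theta_t$ (if $x\in U_{t^{-1}}$ and $\theta_t(x)\in U_{s^{-1}}$, then $x\in U_{(st)^{-1}}$ and $\theta_{st}(x)=\theta_s(\theta_t(x))$). It is continuous if $X$ is a topological space, each $U_t$ is open and each $\theta_t$ is a homeomorphism. The induced (dual) partial action $\alpha$ on $C(X)$ consists of the ideals $D_t=C_0(U_t)=\{f\in C(X): f=0\text{ off }U_t\}$ and $*$-isomorphisms $\alpha_t:D_{t^{-1}}\to D_t$, $\alpha_t(f)=f\circ\theta_{t^{-1}}$ on $U_t$ (and $0$ off $U_t$). $\theta$ is RFD (residually finite-dimensional), where $d$ is the metric of $X$, if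 for every $\delta>0$ there are a finite set $Z$, a partial action $\eta=\{\eta_t:V_{t^{-1}}\to V_t\}_{t\in G}$ of $G$ on $Z$ and a map $\rho:Z\to X$ such that: (i) $\rho(V_t)\subseteq U_t$ and $\rho^{-1}(U_t)\subseteq V_t$ for all $t\in G$; (ii) $\rho(\eta_t(z))=\theta_t(\rho(z))$ for all $t\in G$, $z\in V_{t^{-1}}$; (iii) $\rho(Z)$ is $\delta$-dense in $X$ (every $x\in X$ has some $z\in Z$ with $d(\rho(z),x)<\delta$). Reduced crossed product: with $A=C(X)$, the Fell bundle $\mathcal{A}_\alpha=\{A_t\}_{t\in G}$ has fibers $A_s=D_s\times\{s\}$ with linear structure and norm of $D_s$, product $(a,s)(b,t)=(\alpha_s(\alpha_{s^{-1}}(a)b),st)$, involution $(a,s)^*=(\alpha_{s^{-1}}(a^* ),s^{-1})$, and $A\rtimes_\lambda G:=C^*_\lambda(\mathcal{A}_\alpha)$. Here, for a Fell bundle $\mathcal{B}=\{B_t\}_{t\in G}$, $C_c(\mathcal{B})$ is the $*$-algebra of finitely supported sections ($x(t)\in B_t$) with $(xy)(s)=\sum_t x(t)y(t^{-1}s)$, $x^*(s)=x(s^{-1})^*$; $\ell_2(\mathcal{B})$ is the Hilbert $B_e$-module completion of $C_c(\mathcal{B})$ with $(\xi\cdot b)(s)=\xi(s)b$, $\langle\xi,\eta\rangle=\sum_t\xi(t)^*\eta(t)$; for $b\in B_s$, $\lambda_s(b)$ is the adjointable operator $(\lambda_s(b)\xi)(t)=b\,\xi(s^{-1}t)$; and $C^*_\lambda(\mathcal{B})$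 is the completion of $C_c(\mathcal{B})$ in the norm $\|x\|_\lambda=\|\sum_t\lambda_t(x(t))\|$. A C*-algebra $A$ is RFD if for every $\varepsilon>0$ and finite $\Omega\subseteq A$ there are $d\in\mathbb{N}$ and a $*$-homomorphism $\varphi:A\to M_d$ with $\|\varphi(a)\|\ge\|a\|-\varepsilon$ for all $a\in\Omega$. *)

theory Defs
  imports
    "HOL-Analysis.Analysis"
    "HOL-Algebra.Coset"
    "HOL-Library.Function_Algebras"
    "Jordan_Normal_Form.Schur_Decomposition"
begin

section \<open>Normed spaces and normed star-algebras with explicit carriers, and their completions\<close>

record 'a nspace = "'a partial_object" +
  vadd :: "'a \<Rightarrow> 'a \<Rightarrow> 'a"
  vscale :: "complex \<Rightarrow> 'a \<Rightarrow> 'a"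
  vnorm :: "'a \<Rightarrow> real"

record 'a star_alg = "'a nspace" +
  amult :: "'a \<Rightarrow> 'a \<Rightarrow> 'a"
  astar :: "'a \<Rightarrow> 'a"

definition vdist :: "('a, 'm) nspace_scheme \<Rightarrow> 'a \<Rightarrow> 'a \<Rightarrow> real" where
  "vdist V x y = vnorm V (vadd V x (vscale V (- 1) y))"

definition cauchy_seqs :: "('a, 'm) nspace_scheme \<Rightarrow> (nat \<Rightarrow> 'a) set" where
  "cauchy_seqs V = {x. (\<forall>n. x n \<in> carrier V) \<and>
     (\<forall>\<epsilon>>0. \<exists>N. \<forall>m\<ge>N. \<forall>n\<ge>N. vdist V (x m) (x n) < \<epsilon>)}"

definition null_rel :: "('a, 'm) nspace_scheme \<Rightarrow> ((nat \<Rightarrow> 'a) \<times> (nat \<Rightarrow> 'a)) set" where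
  "null_rel V = {(x, y). x \<in> cauchy_seqs V \<and> y \<in> cauchy_seqs V \<and>
     (\<lambda>n. vdist V (x n) (y n)) \<longlonglongrightarrow> 0}"

text \<open>Points of the completion are classes of Cauchy sequences modulo null sequences.  Operations
  are lifted to classes through representatives, independently of the choice of representatives
  whenever the operations are uniformly continuous on bounded sets.\<close>

definition lift1 ::
  "('a, 'm) nspace_scheme \<Rightarrow> ('a \<Rightarrow> 'a) \<Rightarrow> (nat \<Rightarrow> 'a) set \<Rightarrow> (nat \<Rightarrow> 'a) set" where
  "lift1 V T P = (\<Union>x\<in>P. null_rel V `` {\<lambda>n. T (x n)})"

definition lift2 ::
  "('a, 'm) nspace_scheme \<Rightarrow> ('a \<Rightarrow> 'a \<Rightarrow> 'a) \<Rightarrow>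
    (nat \<Rightarrow> 'a) set \<Rightarrow> (nat \<Rightarrow> 'a) set \<Rightarrow> (nat \<Rightarrow> 'a) set" where
  "lift2 V T P Q = (\<Union>x\<in>P. \<Union>y\<in>Q. null_rel V `` {\<lambda>n. T (x n) (y n)})"

definition completion_norm :: "('a, 'm) nspace_scheme \<Rightarrow> (nat \<Rightarrow> 'a) set \<Rightarrow> real" where
  "completion_norm V P = (THE r. \<forall>x\<in>P. (\<lambda>n. vnorm V (x n)) \<longlonglongrightarrow> r)"

definition nspace_completion :: "('a, 'm) nspace_scheme \<Rightarrow> (nat \<Rightarrow> 'a) set nspace" where
  "nspace_completion V =
    \<lparr> carrier = cauchy_seqs V // null_rel V,
      vadd = lift2 V (vadd V),
      vscale = (\<lambda>c. lift1 V (vscale V c)),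
      vnorm = completion_norm V \<rparr>"

definition star_alg_completion :: "('a, 'm) star_alg_scheme \<Rightarrow> (nat \<Rightarrow> 'a) set star_alg" where
  "star_alg_completion A =
    \<lparr> carrier = cauchy_seqs A // null_rel A,
      vadd = lift2 A (vadd A),
      vscale = (\<lambda>c. lift1 A (vscale A c)),
      vnorm = completion_norm A,
      amult = lift2 A (amult A),
      astar = lift1 A (astar A) \<rparr>"

definition op_norm :: "('a, 'm) nspace_scheme \<Rightarrow> ('a \<Rightarrow> 'a) \<Rightarrow> real" where
  "op_norm V T = Sup {vnorm V (T v) | v. v \<in> carrier V \<and> vnorm V v \<le> 1}"


section \<open>Residually finite-dimensional C*-algebras\<close>

definition vec_l2norm :: "complex Matrix.vec \<Rightarrow> real" where
  "vec_l2norm v = L2_set (\<lambda>i. cmod (vec_index v i)) {..<dim_vec v}"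

definition mat_norm :: "complex mat \<Rightarrow> real" where
  "mat_norm M = Sup {vec_l2norm (M *\<^sub>v v) | v. v \<in> carrier_vec (dim_col M) \<and> vec_l2norm v \<le> 1}"

definition star_hom_mat :: "('a, 'm) star_alg_scheme \<Rightarrow> nat \<Rightarrow> ('a \<Rightarrow> complex mat) \<Rightarrow> bool" where
  "star_hom_mat A d \<phi> \<longleftrightarrow>
    (\<forall>a\<in>carrier A. \<phi> a \<in> carrier_mat d d) \<and>
    (\<forall>a\<in>carrier A. \<forall>b\<in>carrier A. \<phi> (vadd A a b) = \<phi> a + \<phi> b) \<and>
    (\<forall>c. \<forall>a\<in>carrier A. \<phi> (vscale A c a) = c \<cdot>\<^sub>m \<phi> a) \<and>
    (\<forall>a\<in>carrier A. \<forall>b\<in>carrier A. \<phi> (amult A a b) = \<phi> a * \<phi> b) \<and>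
    (\<forall>a\<in>carrier A. \<phi> (astar A a) = mat_adjoint (\<phi> a))"

definition RFD_algebra :: "('a, 'm) star_alg_scheme \<Rightarrow> bool" where
  "RFD_algebra A \<longleftrightarrow>
    (\<forall>\<epsilon>>0. \<forall>\<Omega>. finite \<Omega> \<and> \<Omega> \<subseteq> carrier A \<longrightarrow>
      (\<exists>d\<ge>1. \<exists>\<phi>. star_hom_mat A d \<phi> \<and> (\<forall>a\<in>\<Omega>. mat_norm (\<phi> a) \<ge> vnorm A a - \<epsilon>)))"


section \<open>Groups\<close>

definition residually_finite :: "('g, 'c) monoid_scheme \<Rightarrow> bool" where
  "residually_finite G \<longleftrightarrow>
    (\<forall>g\<in>carrier G. g \<noteq> \<one>\<^bsub>G\<^esub> \<longrightarrow> (\<exists>N. N \<lhd> G \<and> finite (carrier (G Mod N)) \<and> g \<notin> N))"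

text \<open>Amenability: there is a left-invariant mean on the bounded real functions on the group.
  Positivity refers to values on the carrier only, so the mean of a function does not depend on
  its values off the carrier.\<close>

definition amenable :: "('g, 'c) monoid_scheme \<Rightarrow> bool" where
  "amenable G \<longleftrightarrow> (\<exists>m :: ('g \<Rightarrow> real) \<Rightarrow> real.
    (\<forall>f h. bounded (f ` carrier G) \<and> bounded (h ` carrier G) \<longrightarrow>
       m (\<lambda>t. f t + h t) = m f + m h) \<and>
    (\<forall>c f. bounded (f ` carrier G) \<longrightarrow> m (\<lambda>t. c * f t) = c * m f) \<and>
    (\<forall>f. bounded (f ` carrier G) \<and> (\<forall>t\<in>carrier G. f t \<ge> 0) \<longrightarrow> m f \<ge> 0) \<and>
    m (\<lambda>t. 1) = 1 \<and>
    (\<forall>s\<in>carrier G. \<forall>f. bounded (f ` carrier G) \<longrightarrow> m (\<lambda>t. f (s \<otimes>\<^bsub>G\<^esub> t)) = m f))"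

definition l2_group :: "('g, 'c) monoid_scheme \<Rightarrow> ('g \<Rightarrow> complex) nspace" where
  "l2_group G =
    \<lparr> carrier = {\<xi>. (\<forall>t. t \<notin> carrier G \<longrightarrow> \<xi> t = 0) \<and>
        (\<lambda>t. (cmod (\<xi> t))\<^sup>2) summable_on carrier G},
      vadd = (\<lambda>\<xi> \<eta> t. \<xi> t + \<eta> t),
      vscale = (\<lambda>c \<xi> t. c * \<xi> t),
      vnorm = (\<lambda>\<xi>. sqrt (\<Sum>\<^sub>\<infinity>t\<in>carrier G. (cmod (\<xi> t))\<^sup>2)) \<rparr>"

text \<open>The image of a finitely supported function under the left regular representation.\<close>

definition left_regular ::
  "('g, 'c) monoid_scheme \<Rightarrow> ('g \<Rightarrow> complex) \<Rightarrow> ('g \<Rightarrow> complex) \<Rightarrow> 'g \<Rightarrow> complex" where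
  "left_regular G x \<xi> = (\<lambda>t. if t \<in> carrier G
     then \<Sum>s\<in>{s\<in>carrier G. x s \<noteq> 0}. x s * \<xi> (inv\<^bsub>G\<^esub> s \<otimes>\<^bsub>G\<^esub> t) else 0)"

text \<open>The complex group algebra, normed by the left regular representation.\<close>

definition group_alg :: "('g, 'c) monoid_scheme \<Rightarrow> ('g \<Rightarrow> complex) star_alg" where
  "group_alg G =
    \<lparr> carrier = {x. (\<forall>t. t \<notin> carrier G \<longrightarrow> x t = 0) \<and> finite {t. x t \<noteq> 0}},
      vadd = (\<lambda>x y t. x t + y t),
      vscale = (\<lambda>c x t. c * x t),
      vnorm = (\<lambda>x. op_norm (l2_group G) (left_regular G x)),
      amult = (\<lambda>x y s. if s \<in> carrier G
        then \<Sum>t\<in>{t\<in>carrier G. x t \<noteq> 0}. x t * y (inv\<^bsub>G\<^esub> t \<otimes>\<^bsub>G\<^esub> s) else 0),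
      astar = (\<lambda>x s. if s \<in> carrier G then cnj (x (inv\<^bsub>G\<^esub> s)) else 0) \<rparr>"

definition reduced_group_cstar :: "('g, 'c) monoid_scheme \<Rightarrow> (nat \<Rightarrow> 'g \<Rightarrow> complex) set star_alg"
  where "reduced_group_cstar G = star_alg_completion (group_alg G)"


section \<open>Partial actions\<close>

definition partial_action ::
  "('g, 'c) monoid_scheme \<Rightarrow> 'x set \<Rightarrow> ('g \<Rightarrow> 'x set) \<Rightarrow> ('g \<Rightarrow> 'x \<Rightarrow> 'x) \<Rightarrow> bool" where
  "partial_action G X U \<theta> \<longleftrightarrow>
    (\<forall>t\<in>carrier G. U t \<subseteq> X \<and> \<theta> t ` U (inv\<^bsub>G\<^esub> t) \<subseteq> U t) \<and>
    U \<one>\<^bsub>G\<^esub> = X \<and> (\<forall>x\<in>X. \<theta> \<one>\<^bsub>G\<^esub> x = x) \<and>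
    (\<forall>s\<in>carrier G. \<forall>t\<in>carrier G. \<forall>x\<in>U (inv\<^bsub>G\<^esub> t). \<theta> t x \<in> U (inv\<^bsub>G\<^esub> s) \<longrightarrow>
       x \<in> U (inv\<^bsub>G\<^esub> (s \<otimes>\<^bsub>G\<^esub> t)) \<and> \<theta> (s \<otimes>\<^bsub>G\<^esub> t) x = \<theta> s (\<theta> t x))"

definition continuous_partial_action ::
  "('g, 'c) monoid_scheme \<Rightarrow> 'x::topological_space set \<Rightarrow> ('g \<Rightarrow> 'x set) \<Rightarrow>
    ('g \<Rightarrow> 'x \<Rightarrow> 'x) \<Rightarrow> bool" where
  "continuous_partial_action G X U \<theta> \<longleftrightarrow>
    partial_action G X U \<theta> \<and>
    (\<forall>t\<in>carrier G. openin (top_of_set X) (U t) \<and>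
      (\<exists>h. homeomorphism (U (inv\<^bsub>G\<^esub> t)) (U t) (\<theta> t) h))"

text \<open>Every finite set is in bijection with a finite set of natural numbers, so letting Z range
  over finite subsets of \<open>nat\<close> loses no generality.\<close>

definition RFD_partial_action ::
  "('g, 'c) monoid_scheme \<Rightarrow> 'x::metric_space set \<Rightarrow> ('g \<Rightarrow> 'x set) \<Rightarrow>
    ('g \<Rightarrow> 'x \<Rightarrow> 'x) \<Rightarrow> bool" where
  "RFD_partial_action G X U \<theta> \<longleftrightarrow>
    (\<forall>\<delta>>0. \<exists>(Z :: nat set) V \<eta> \<rho>.
      finite Z \<and> partial_action G Z V \<eta> \<and> \<rho> ` Z \<subseteq> X \<and>
      (\<forall>t\<in>carrier G. \<rho> ` V t \<subseteq> U t \<and> {z\<in>Z. \<rho> z \<in> U t} \<subseteq> V t) \<and>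
      (\<forall>t\<in>carrier G. \<forall>z\<in>V (inv\<^bsub>G\<^esub> t). \<rho> (\<eta> t z) = \<theta> t (\<rho> z)) \<and>
      (\<forall>x\<in>X. \<exists>z\<in>Z. dist (\<rho> z) x < \<delta>))"


section \<open>Fell bundles and their reduced C*-algebras\<close>

text \<open>The fibre of a Fell bundle over \<open>t\<close> is presented as \<open>E\<^sub>t \<times> {t}\<close>, where \<open>E\<^sub>t\<close> (\<open>fib B t\<close>) is a
  subset of a fixed type carrying the addition.  Thus \<open>(a, s)(b, t) = (fmult B s a t b, st)\<close> and
  \<open>(a, s)\<^sup>* = (fstar B s a, inv s)\<close>.  A section is a function \<open>x\<close> with \<open>x t \<in> E\<^sub>t\<close>, extended by
  0 off the carrier of the group.\<close>

record ('g, 'b) fell_bundle =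
  fib :: "'g \<Rightarrow> 'b set"
  fscale :: "complex \<Rightarrow> 'b \<Rightarrow> 'b"
  fmult :: "'g \<Rightarrow> 'b \<Rightarrow> 'g \<Rightarrow> 'b \<Rightarrow> 'b"
  fstar :: "'g \<Rightarrow> 'b \<Rightarrow> 'b"
  fnorm :: "'b \<Rightarrow> real"

definition supp_on :: "('g, 'c) monoid_scheme \<Rightarrow> ('g \<Rightarrow> 'b::zero) \<Rightarrow> 'g set" where
  "supp_on G x = {t\<in>carrier G. x t \<noteq> 0}"

definition sections ::
  "('g, 'c) monoid_scheme \<Rightarrow> ('g, 'b::comm_monoid_add) fell_bundle \<Rightarrow> ('g \<Rightarrow> 'b) set" where
  "sections G B = {x. (\<forall>t\<in>carrier G. x t \<in> fib B t) \<and> (\<forall>t. t \<notin> carrier G \<longrightarrow> x t = 0) \<and>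
     finite (supp_on G x)}"

definition section_inner ::
  "('g, 'c) monoid_scheme \<Rightarrow> ('g, 'b::comm_monoid_add) fell_bundle \<Rightarrow>
    ('g \<Rightarrow> 'b) \<Rightarrow> ('g \<Rightarrow> 'b) \<Rightarrow> 'b" where
  "section_inner G B \<xi> \<eta> =
    (\<Sum>t\<in>supp_on G \<xi>. fmult B (inv\<^bsub>G\<^esub> t) (fstar B t (\<xi> t)) t (\<eta> t))"

definition pre_l2 ::
  "('g, 'c) monoid_scheme \<Rightarrow> ('g, 'b::comm_monoid_add) fell_bundle \<Rightarrow> ('g \<Rightarrow> 'b) nspace" where
  "pre_l2 G B =
    \<lparr> carrier = sections G B,
      vadd = (\<lambda>\<xi> \<eta> t. \<xi> t + \<eta> t),
      vscale = (\<lambda>c \<xi> t. if t \<in> carrier G then fscale B c (\<xi> t) else 0),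
      vnorm = (\<lambda>\<xi>. sqrt (fnorm B (section_inner G B \<xi> \<xi>))) \<rparr>"

text \<open>The Banach space underlying the Hilbert module \<open>\<ell>\<^sub>2\<close> of the bundle; the norm of an adjointable
  operator is its operator norm on this space.\<close>

definition l2_bundle ::
  "('g, 'c) monoid_scheme \<Rightarrow> ('g, 'b::comm_monoid_add) fell_bundle \<Rightarrow>
    (nat \<Rightarrow> 'g \<Rightarrow> 'b) set nspace" where
  "l2_bundle G B = nspace_completion (pre_l2 G B)"

text \<open>The operator \<open>\<lambda>\<^sub>s(b)\<close>, for \<open>b\<close> in the fibre over \<open>s\<close>, on finitely supported sections.\<close>

definition bundle_lambda ::
  "('g, 'c) monoid_scheme \<Rightarrow> ('g, 'b::comm_monoid_add) fell_bundle \<Rightarrow>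
    'g \<Rightarrow> 'b \<Rightarrow> ('g \<Rightarrow> 'b) \<Rightarrow> 'g \<Rightarrow> 'b" where
  "bundle_lambda G B s b \<xi> = (\<lambda>t. if t \<in> carrier G
     then fmult B s b (inv\<^bsub>G\<^esub> s \<otimes>\<^bsub>G\<^esub> t) (\<xi> (inv\<^bsub>G\<^esub> s \<otimes>\<^bsub>G\<^esub> t)) else 0)"

text \<open>The operator \<open>\<Sum>\<^sub>t \<lambda>\<^sub>t(x(t))\<close> on \<open>\<ell>\<^sub>2\<close>, obtained from finitely supported sections by continuous
  extension.\<close>

definition bundle_regular ::
  "('g, 'c) monoid_scheme \<Rightarrow> ('g, 'b::comm_monoid_add) fell_bundle \<Rightarrow> ('g \<Rightarrow> 'b) \<Rightarrow>
    (nat \<Rightarrow> 'g \<Rightarrow> 'b) set \<Rightarrow> (nat \<Rightarrow> 'g \<Rightarrow> 'b) set" where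
  "bundle_regular G B x =
    lift1 (pre_l2 G B) (\<lambda>\<xi> r. \<Sum>t\<in>supp_on G x. bundle_lambda G B t (x t) \<xi> r)"

definition section_alg ::
  "('g, 'c) monoid_scheme \<Rightarrow> ('g, 'b::comm_monoid_add) fell_bundle \<Rightarrow> ('g \<Rightarrow> 'b) star_alg" where
  "section_alg G B =
    \<lparr> carrier = sections G B,
      vadd = (\<lambda>x y t. x t + y t),
      vscale = (\<lambda>c x t. if t \<in> carrier G then fscale B c (x t) else 0),
      vnorm = (\<lambda>x. op_norm (l2_bundle G B) (bundle_regular G B x)),
      amult = (\<lambda>x y s. if s \<in> carrier G
        then \<Sum>t\<in>supp_on G x. fmult B t (x t) (inv\<^bsub>G\<^esub> t \<otimes>\<^bsub>G\<^esub> s) (y (inv\<^bsub>G\<^esub> t \<otimes>\<^bsub>G\<^esub> s)) else 0),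
      astar = (\<lambda>x s. if s \<in> carrier G then fstar B (inv\<^bsub>G\<^esub> s) (x (inv\<^bsub>G\<^esub> s)) else 0) \<rparr>"

definition reduced_bundle_cstar ::
  "('g, 'c) monoid_scheme \<Rightarrow> ('g, 'b::comm_monoid_add) fell_bundle \<Rightarrow>
    (nat \<Rightarrow> 'g \<Rightarrow> 'b) set star_alg" where
  "reduced_bundle_cstar G B = star_alg_completion (section_alg G B)"


section \<open>The reduced crossed product\<close>

text \<open>Continuous functions on \<open>X\<close> are extended by 0 off \<open>X\<close>, hence the supremum over the whole type
  in \<open>sup_norm\<close> is the supremum over \<open>X\<close> (and 0 if \<open>X\<close> is empty).\<close>

definition CX :: "'x::topological_space set \<Rightarrow> ('x \<Rightarrow> complex) set" where
  "CX X = {f. continuous_on X f \<and> (\<forall>x. x \<notin> X \<longrightarrow> f x = 0)}"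

definition sup_norm :: "('x \<Rightarrow> complex) \<Rightarrow> real" where
  "sup_norm f = (SUP x. cmod (f x))"

definition dual_ideal ::
  "'x::topological_space set \<Rightarrow> ('g \<Rightarrow> 'x set) \<Rightarrow> 'g \<Rightarrow> ('x \<Rightarrow> complex) set" where
  "dual_ideal X U t = {f \<in> CX X. \<forall>x. x \<notin> U t \<longrightarrow> f x = 0}"

definition dual_action ::
  "('g, 'c) monoid_scheme \<Rightarrow> ('g \<Rightarrow> 'x set) \<Rightarrow> ('g \<Rightarrow> 'x \<Rightarrow> 'x) \<Rightarrow> 'g \<Rightarrow>
    ('x \<Rightarrow> complex) \<Rightarrow> 'x \<Rightarrow> complex" where
  "dual_action G U \<theta> t f = (\<lambda>x. if x \<in> U t then f (\<theta> (inv\<^bsub>G\<^esub> t) x) else 0)"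

definition action_bundle ::
  "('g, 'c) monoid_scheme \<Rightarrow> 'x::topological_space set \<Rightarrow> ('g \<Rightarrow> 'x set) \<Rightarrow>
    ('g \<Rightarrow> 'x \<Rightarrow> 'x) \<Rightarrow> ('g, 'x \<Rightarrow> complex) fell_bundle" where
  "action_bundle G X U \<theta> =
    \<lparr> fib = dual_ideal X U,
      fscale = (\<lambda>c a x. c * a x),
      fmult = (\<lambda>s a t b. dual_action G U \<theta> s (\<lambda>x. dual_action G U \<theta> (inv\<^bsub>G\<^esub> s) a x * b x)),
      fstar = (\<lambda>s a. dual_action G U \<theta> (inv\<^bsub>G\<^esub> s) (\<lambda>x. cnj (a x))),
      fnorm = sup_norm \<rparr>"

definition reduced_crossed_product ::
  "('g, 'c) monoid_scheme \<Rightarrow> 'x::topological_space set \<Rightarrow> ('g \<Rightarrow> 'x set) \<Rightarrow>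
    ('g \<Rightarrow> 'x \<Rightarrow> 'x) \<Rightarrow> (nat \<Rightarrow> 'g \<Rightarrow> 'x \<Rightarrow> complex) set star_alg" where
  "reduced_crossed_product G X U \<theta> = reduced_bundle_cstar G (action_bundle G X U \<theta>)"

end

theory Submission
  imports Defs "Jordan_Normal_Form.Spectral_Radius"
begin

text \<open>
  The reduced norm of a section \<open>a\<close> is the supremum over \<open>x\<close> of the operator norms of the kernels
  \<open>a (t r\<^sup>-\<^sup>1) (\<theta>\<^sub>t x)\<close> on finitely supported functions over \<open>{t. x \<in> U (inv t)}\<close>.  A Neumann series shows that
  a star-homomorphism from the completion to matrices is contractive, so residual
  finite-dimensionality can be tested on the dense star-algebra of sections.

  (1) The closed set of points of \<open>X\<close> that supports the restriction to \<open>C(X)\<close> of a finite-dimensional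
  representation is finite and invariant, and it meets every open set on which the representation
  does not vanish.

  (2) A finite model \<open>Z\<close> turns a section into a matrix over the group algebra indexed by \<open>Z\<close>, to
  whose entries representations of the group algebra are applied.  The orbit kernels over \<open>Z\<close> and
  the entries bound each other up to constants, which disappear when \<open>a\<close> is replaced by high powers
  of \<open>a\<^sup>*a\<close>.

  (3) An invariant mean yields Reiter's property by a minimax argument on finite subsets and
  compactness.  By Fell absorption the representations of \<open>G\<close> on its finite quotients are then
  contractive for the reduced norm, and by residual finiteness they are almost isometric on
  finite sets, so (2) applies.
\<close>

section \<open>Kernels acting on finitely supported vectors\<close>

text \<open>Two obstacles shape the argument. Both reduced norms are operator norms on
  infinite-dimensional spaces, one of them an abstract completion. Kernels with finite rows and
  columns keep adjoints, products and inner products finite sums, and the relation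
  \<open>kbounded K C\<close> in place of a norm turns the C*-identity into a statement about bounds
  alone. Secondly, (2) needs lower bounds that can be seen from finitely many points. A vector that
  witnesses a lower bound at one point extends to a section, which witnesses it on a whole
  neighbourhood by continuity, and a dense enough model has a point over that neighbourhood. The
  factors lost between a block matrix and its blocks depend on the size of the matrix only.
  Iterating b -> b* b raises norms to the power 2^m without changing these factors, so exact norms
  of matrices over the group algebra are avoided. In (3) amenability is given by an invariant mean,
  from which finitely supported almost invariant functions have to be extracted; hence the minimax
  step.\<close>

definition fsupp :: "('i \<Rightarrow> complex) \<Rightarrow> bool" where
  "fsupp \<xi> \<longleftrightarrow> finite {t. \<xi> t \<noteq> 0}"

text \<open>The l2-norm of a finitely supported function. On an infinite support the sum takes its
  default value 0, so most statements about \<open>nrm\<close> carry \<open>fsupp\<close>.\<close>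

definition nrm :: "('i \<Rightarrow> complex) \<Rightarrow> real" where
  "nrm \<xi> = L2_set (\<lambda>t. cmod (\<xi> t)) {t. \<xi> t \<noteq> 0}"

definition ip :: "('i \<Rightarrow> complex) \<Rightarrow> ('i \<Rightarrow> complex) \<Rightarrow> complex" where
  "ip \<xi> \<eta> = (\<Sum>t | \<xi> t \<noteq> 0. \<xi> t * cnj (\<eta> t))"

text \<open>Finite rows make products of kernels finite sums; finite columns make
  \<open>kapply\<close> preserve finite support. The condition is symmetric, so adjoints satisfy it
  too.\<close>

definition row_col_finite :: "('i \<Rightarrow> 'i \<Rightarrow> complex) \<Rightarrow> bool" where
  "row_col_finite K \<longleftrightarrow> (\<forall>t. finite {r. K t r \<noteq> 0}) \<and> (\<forall>r. finite {t. K t r \<noteq> 0})"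

definition kapply :: "('i \<Rightarrow> 'i \<Rightarrow> complex) \<Rightarrow> ('i \<Rightarrow> complex) \<Rightarrow> 'i \<Rightarrow> complex" where
  "kapply K \<xi> t = (\<Sum>r | \<xi> r \<noteq> 0. K t r * \<xi> r)"

definition kmul :: "('i \<Rightarrow> 'i \<Rightarrow> complex) \<Rightarrow> ('i \<Rightarrow> 'i \<Rightarrow> complex) \<Rightarrow> 'i \<Rightarrow> 'i \<Rightarrow> complex" where
  "kmul K L t r = (\<Sum>q | K t q \<noteq> 0. K t q * L q r)"

definition kadj :: "('i \<Rightarrow> 'i \<Rightarrow> complex) \<Rightarrow> 'i \<Rightarrow> 'i \<Rightarrow> complex" where
  "kadj K t r = cnj (K r t)"

text \<open>A relation in place of an operator norm: no supremum has to exist, and \<open>C\<close>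
  may be any number above the norm.\<close>

definition kbounded :: "('i \<Rightarrow> 'i \<Rightarrow> complex) \<Rightarrow> real \<Rightarrow> bool" where
  "kbounded K C \<longleftrightarrow> 0 \<le> C \<and> (\<forall>\<xi>. fsupp \<xi> \<longrightarrow> nrm (kapply K \<xi>) \<le> C * nrm \<xi>)"

lemma nrm_eq: "finite S \<Longrightarrow> {t. \<xi> t \<noteq> 0} \<subseteq> S \<Longrightarrow> nrm \<xi> = L2_set (\<lambda>t. cmod (\<xi> t)) S"
  unfolding nrm_def L2_set_def
  by (rule arg_cong[where f = sqrt], rule sum.mono_neutral_left) auto

lemma ip_eq: "finite S \<Longrightarrow> {t. \<xi> t \<noteq> 0} \<subseteq> S \<Longrightarrow> ip \<xi> \<eta> = (\<Sum>t\<in>S. \<xi> t * cnj (\<eta> t))"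
  unfolding ip_def by (rule sum.mono_neutral_left) auto

lemma kapply_eq: "finite S \<Longrightarrow> {t. \<xi> t \<noteq> 0} \<subseteq> S \<Longrightarrow> kapply K \<xi> t = (\<Sum>r\<in>S. K t r * \<xi> r)"
  unfolding kapply_def by (rule sum.mono_neutral_left) auto

lemma kmul_eq: "finite S \<Longrightarrow> {q. K t q \<noteq> 0} \<subseteq> S \<Longrightarrow> kmul K L t r = (\<Sum>q\<in>S. K t q * L q r)"
  unfolding kmul_def by (rule sum.mono_neutral_left) auto

lemma nrm_nonneg [simp]: "0 \<le> nrm \<xi>"
  by (simp add: nrm_def)

lemma nrm_sq: "finite S \<Longrightarrow> {t. \<xi> t \<noteq> 0} \<subseteq> S \<Longrightarrow> (nrm \<xi>)\<^sup>2 = (\<Sum>t\<in>S. (cmod (\<xi> t))\<^sup>2)"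
  by (simp add: nrm_eq L2_set_def sum_nonneg)

lemma nrm_zero [simp]: "nrm (\<lambda>t. 0) = 0"
  by (simp add: nrm_def)

lemma fsupp_zero [simp]: "fsupp (\<lambda>t. 0)"
  by (simp add: fsupp_def)

lemma fsupp_subset: "finite S \<Longrightarrow> {t. \<xi> t \<noteq> 0} \<subseteq> S \<Longrightarrow> fsupp \<xi>"
  unfolding fsupp_def by (rule finite_subset)

lemma fsupp_add: "fsupp \<xi> \<Longrightarrow> fsupp \<eta> \<Longrightarrow> fsupp (\<lambda>t. \<xi> t + \<eta> t)"
  unfolding fsupp_def by (rule finite_subset[of _ "{t. \<xi> t \<noteq> 0} \<union> {t. \<eta> t \<noteq> 0}"]) auto

lemma fsupp_scale: "fsupp \<xi> \<Longrightarrow> fsupp (\<lambda>t. c * \<xi> t)"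
  unfolding fsupp_def by (rule finite_subset[of _ "{t. \<xi> t \<noteq> 0}"]) auto

lemma fsupp_restrict: "fsupp \<xi> \<Longrightarrow> fsupp (\<lambda>t. if P t then \<xi> t else 0)"
  unfolding fsupp_def by (rule finite_subset[of _ "{t. \<xi> t \<noteq> 0}"]) auto

lemma fsupp_sum: "finite I \<Longrightarrow> (\<And>i. i \<in> I \<Longrightarrow> fsupp (f i)) \<Longrightarrow> fsupp (\<lambda>t. \<Sum>i\<in>I. f i t)"
  by (induction I rule: finite_induct) (auto intro: fsupp_add)

lemma nrm_triangle:
  assumes "fsupp \<xi>" "fsupp \<eta>"
  shows "nrm (\<lambda>t. \<xi> t + \<eta> t) \<le> nrm \<xi> + nrm \<eta>"
proof -
  define S where "S = {t. \<xi> t \<noteq> 0} \<union> {t. \<eta> t \<noteq> 0}"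
  have S: "finite S" using assms by (auto simp: S_def fsupp_def)
  have "nrm (\<lambda>t. \<xi> t + \<eta> t) = L2_set (\<lambda>t. cmod (\<xi> t + \<eta> t)) S"
    by (rule nrm_eq[OF S]) (auto simp: S_def)
  also have "\<dots> \<le> L2_set (\<lambda>t. cmod (\<xi> t) + cmod (\<eta> t)) S"
    by (rule L2_set_mono) (auto intro: norm_triangle_ineq)
  also have "\<dots> \<le> L2_set (\<lambda>t. cmod (\<xi> t)) S + L2_set (\<lambda>t. cmod (\<eta> t)) S"
    by (rule L2_set_triangle_ineq)
  also have "\<dots> = nrm \<xi> + nrm \<eta>"
    by (subst (1 2) nrm_eq[OF S]) (auto simp: S_def)
  finally show ?thesis .
qed

lemma nrm_scale: "nrm (\<lambda>t. c * \<xi> t) = cmod c * nrm \<xi>"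
  by (cases "c = 0") (auto simp: nrm_def norm_mult L2_set_right_distrib)

lemma nrm_sum: "finite I \<Longrightarrow> (\<And>i. i \<in> I \<Longrightarrow> fsupp (f i)) \<Longrightarrow> nrm (\<lambda>t. \<Sum>i\<in>I. f i t) \<le> (\<Sum>i\<in>I. nrm (f i))"
proof (induction I rule: finite_induct)
  case (insert i I)
  have "nrm (\<lambda>t. f i t + (\<Sum>i\<in>I. f i t)) \<le> nrm (f i) + nrm (\<lambda>t. \<Sum>i\<in>I. f i t)"
    by (rule nrm_triangle) (auto intro: fsupp_sum insert)
  then show ?case using insert by simp
qed simp

lemma nrm_mono:
  assumes "fsupp \<eta>" "\<And>t. cmod (\<xi> t) \<le> cmod (\<eta> t)"
  shows "nrm \<xi> \<le> nrm \<eta>"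
proof -
  have sub: "{t. \<xi> t \<noteq> 0} \<subseteq> {t. \<eta> t \<noteq> 0}"
    using assms(2) by (metis (mono_tags, lifting) Collect_mono norm_le_zero_iff norm_zero)
  have "nrm \<xi> = L2_set (\<lambda>t. cmod (\<xi> t)) {t. \<eta> t \<noteq> 0}"
    by (rule nrm_eq) (use assms sub in \<open>auto simp: fsupp_def\<close>)
  also have "\<dots> \<le> nrm \<eta>" unfolding nrm_def by (rule L2_set_mono) (use assms in auto)
  finally show ?thesis .
qed

lemma nrm_restrict: "fsupp \<xi> \<Longrightarrow> nrm (\<lambda>t. if P t then \<xi> t else 0) \<le> nrm \<xi>"
  by (rule nrm_mono) auto

lemma nrm_disjoint:
  assumes "fsupp \<xi>" "fsupp \<eta>" "\<And>t. \<xi> t = 0 \<or> \<eta> t = 0"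
  shows "(nrm (\<lambda>t. \<xi> t + \<eta> t))\<^sup>2 = (nrm \<xi>)\<^sup>2 + (nrm \<eta>)\<^sup>2"
proof -
  define S where "S = {t. \<xi> t \<noteq> 0} \<union> {t. \<eta> t \<noteq> 0}"
  have S: "finite S" using assms by (auto simp: S_def fsupp_def)
  have "(nrm (\<lambda>t. \<xi> t + \<eta> t))\<^sup>2 = (\<Sum>t\<in>S. (cmod (\<xi> t + \<eta> t))\<^sup>2)"
    by (rule nrm_sq[OF S]) (auto simp: S_def)
  also have "\<dots> = (\<Sum>t\<in>S. (cmod (\<xi> t))\<^sup>2 + (cmod (\<eta> t))\<^sup>2)"
  proof (rule sum.cong)
    fix t show "(cmod (\<xi> t + \<eta> t))\<^sup>2 = (cmod (\<xi> t))\<^sup>2 + (cmod (\<eta> t))\<^sup>2" using assms(3)[of t] by auto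
  qed simp
  also have "\<dots> = (nrm \<xi>)\<^sup>2 + (nrm \<eta>)\<^sup>2"
    by (subst (1 2) nrm_sq[OF S]) (auto simp: S_def sum.distrib)
  finally show ?thesis .
qed

text \<open>Injectivity on \<open>D\<close> means that no coordinate of \<open>f\<close> is read
  twice, so the norm can only drop. This serves translations in a group as well as the passage to
  and from one block of a block matrix.\<close>

lemma nrm_translate:
  assumes inj: "inj_on g D" and f: "fsupp f"
  shows "fsupp (\<lambda>t. if t \<in> D then f (g t) else 0)" "nrm (\<lambda>t. if t \<in> D then f (g t) else 0) \<le> nrm f"
proof -
  define T where "T = {t \<in> D. f (g t) \<noteq> 0}"
  have "finite (g ` T)" by (rule finite_subset[of _ "{r. f r \<noteq> 0}"]) (use f in \<open>auto simp: T_def fsupp_def\<close>)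
  moreover have injT: "inj_on g T" by (rule inj_on_subset[OF inj]) (auto simp: T_def)
  ultimately have T: "finite T" by (rule finite_imageD)
  have s: "{t. (if t \<in> D then f (g t) else 0) \<noteq> 0} \<subseteq> T" by (auto simp: T_def)
  show "fsupp (\<lambda>t. if t \<in> D then f (g t) else 0)" by (rule fsupp_subset[OF T s])
  have "(nrm (\<lambda>t. if t \<in> D then f (g t) else 0))\<^sup>2 = (\<Sum>t\<in>T. (cmod (f (g t)))\<^sup>2)"
    unfolding nrm_sq[OF T s] by (rule sum.cong) (auto simp: T_def)
  also have "\<dots> = (\<Sum>r\<in>g ` T. (cmod (f r))\<^sup>2)" by (simp add: sum.reindex[OF injT])
  also have "\<dots> \<le> (\<Sum>r | f r \<noteq> 0. (cmod (f r))\<^sup>2)"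
    by (rule sum_mono2) (use f in \<open>auto simp: T_def fsupp_def\<close>)
  also have "\<dots> = (nrm f)\<^sup>2" by (rule nrm_sq[symmetric]) (use f in \<open>auto simp: fsupp_def\<close>)
  finally show "nrm (\<lambda>t. if t \<in> D then f (g t) else 0) \<le> nrm f" by (rule power2_le_imp_le) simp
qed

lemma nrm_eq_0_iff: "fsupp \<xi> \<Longrightarrow> nrm \<xi> = 0 \<longleftrightarrow> \<xi> = (\<lambda>t. 0)"
  by (auto simp: nrm_def fsupp_def L2_set_eq_0_iff fun_eq_iff)

lemma ip_self: "ip \<xi> \<xi> = complex_of_real ((nrm \<xi>)\<^sup>2)"
  by (simp add: ip_def nrm_def L2_set_def sum_nonneg complex_norm_square[symmetric] flip: of_real_power)

lemma ip_bound:
  assumes "fsupp \<xi>" "fsupp \<eta>"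
  shows "cmod (ip \<xi> \<eta>) \<le> nrm \<xi> * nrm \<eta>"
proof -
  define S where "S = {t. \<xi> t \<noteq> 0} \<union> {t. \<eta> t \<noteq> 0}"
  have S: "finite S" using assms by (auto simp: S_def fsupp_def)
  have "cmod (ip \<xi> \<eta>) = cmod (\<Sum>t\<in>S. \<xi> t * cnj (\<eta> t))"
    by (subst ip_eq[OF S]) (auto simp: S_def)
  also have "\<dots> \<le> (\<Sum>t\<in>S. \<bar>cmod (\<xi> t)\<bar> * \<bar>cmod (\<eta> t)\<bar>)"
    by (rule order_trans[OF norm_sum]) (simp add: norm_mult)
  also have "\<dots> \<le> L2_set (\<lambda>t. cmod (\<xi> t)) S * L2_set (\<lambda>t. cmod (\<eta> t)) S"
    by (rule L2_set_mult_ineq)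
  also have "\<dots> = nrm \<xi> * nrm \<eta>"
    by (subst (1 2) nrm_eq[OF S]) (auto simp: S_def)
  finally show ?thesis .
qed

lemma kapply_fsupp:
  assumes "row_col_finite K" "fsupp \<xi>"
  shows "fsupp (kapply K \<xi>)"
proof (rule fsupp_subset)
  show "finite (\<Union>r\<in>{r. \<xi> r \<noteq> 0}. {t. K t r \<noteq> 0})"
    using assms by (auto simp: row_col_finite_def fsupp_def)
  show "{t. kapply K \<xi> t \<noteq> 0} \<subseteq> (\<Union>r\<in>{r. \<xi> r \<noteq> 0}. {t. K t r \<noteq> 0})"
  proof
    fix t assume "t \<in> {t. kapply K \<xi> t \<noteq> 0}"
    then have "\<exists>r\<in>{r. \<xi> r \<noteq> 0}. K t r * \<xi> r \<noteq> 0"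
      unfolding kapply_def by (metis (mono_tags, lifting) mem_Collect_eq sum.neutral)
    then show "t \<in> (\<Union>r\<in>{r. \<xi> r \<noteq> 0}. {t. K t r \<noteq> 0})" by auto
  qed
qed

lemma row_col_finite_kadj: "row_col_finite K \<Longrightarrow> row_col_finite (kadj K)"
  by (auto simp: row_col_finite_def kadj_def)

lemma kmul_nonzero: "kmul K L t r \<noteq> 0 \<Longrightarrow> \<exists>q. K t q \<noteq> 0 \<and> L q r \<noteq> 0"
  unfolding kmul_def by (metis (mono_tags, lifting) mem_Collect_eq mult_not_zero sum.neutral)

lemma row_col_finite_kmul:
  assumes "row_col_finite K" "row_col_finite L"
  shows "row_col_finite (kmul K L)"
proof -
  have "finite {r. kmul K L t r \<noteq> 0}" for t
  proof (rule finite_subset)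
    show "{r. kmul K L t r \<noteq> 0} \<subseteq> (\<Union>q\<in>{q. K t q \<noteq> 0}. {r. L q r \<noteq> 0})"
      by (auto dest: kmul_nonzero)
  qed (use assms in \<open>auto simp: row_col_finite_def\<close>)
  moreover have "finite {t. kmul K L t r \<noteq> 0}" for r
  proof (rule finite_subset)
    show "{t. kmul K L t r \<noteq> 0} \<subseteq> (\<Union>q\<in>{q. L q r \<noteq> 0}. {t. K t q \<noteq> 0})"
      by (auto dest: kmul_nonzero)
  qed (use assms in \<open>auto simp: row_col_finite_def\<close>)
  ultimately show ?thesis by (simp add: row_col_finite_def)
qed

lemma kapply_kmul:
  assumes "row_col_finite K" "row_col_finite L" "fsupp \<xi>"
  shows "kapply (kmul K L) \<xi> = kapply K (kapply L \<xi>)"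
proof
  fix t
  define S where "S = {q. K t q \<noteq> 0} \<union> {q. kapply L \<xi> q \<noteq> 0}"
  have S: "finite S"
    using assms kapply_fsupp[OF assms(2,3)] by (auto simp: S_def row_col_finite_def fsupp_def)
  have "kapply (kmul K L) \<xi> t = (\<Sum>r | \<xi> r \<noteq> 0. (\<Sum>q\<in>S. K t q * L q r) * \<xi> r)"
    unfolding kapply_def by (subst kmul_eq[OF S]) (auto simp: S_def)
  also have "\<dots> = (\<Sum>q\<in>S. \<Sum>r | \<xi> r \<noteq> 0. K t q * (L q r * \<xi> r))"
    by (subst sum.swap) (simp add: sum_distrib_right mult.assoc)
  also have "\<dots> = (\<Sum>q\<in>S. K t q * kapply L \<xi> q)"
    by (simp add: kapply_def sum_distrib_left)
  also have "\<dots> = kapply K (kapply L \<xi>) t"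
    by (rule kapply_eq[symmetric, OF S]) (auto simp: S_def)
  finally show "kapply (kmul K L) \<xi> t = kapply K (kapply L \<xi>) t" .
qed

lemma ip_kapply:
  assumes "row_col_finite K" "fsupp \<xi>" "fsupp \<eta>"
  shows "ip (kapply K \<xi>) \<eta> = ip \<xi> (kapply (kadj K) \<eta>)"
proof -
  define S where "S = {q. \<eta> q \<noteq> 0} \<union> {q. kapply K \<xi> q \<noteq> 0}"
  have S: "finite S"
    using assms kapply_fsupp[OF assms(1,2)] by (auto simp: S_def fsupp_def)
  have "ip (kapply K \<xi>) \<eta> = (\<Sum>t\<in>S. (\<Sum>r | \<xi> r \<noteq> 0. K t r * \<xi> r) * cnj (\<eta> t))"
    by (subst ip_eq[OF S]) (auto simp: S_def kapply_def)
  also have "\<dots> = (\<Sum>r | \<xi> r \<noteq> 0. \<xi> r * (\<Sum>t\<in>S. K t r * cnj (\<eta> t)))"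
    unfolding sum_distrib_left sum_distrib_right by (subst sum.swap) (simp add: mult_ac)
  also have "\<dots> = (\<Sum>r | \<xi> r \<noteq> 0. \<xi> r * cnj (kapply (kadj K) \<eta> r))"
    by (subst kapply_eq[OF S]) (auto simp: S_def kadj_def)
  finally show ?thesis by (simp add: ip_def)
qed

lemma kbdD: "kbounded K C \<Longrightarrow> fsupp \<xi> \<Longrightarrow> nrm (kapply K \<xi>) \<le> C * nrm \<xi>"
  by (simp add: kbounded_def)

lemma kbounded_nonneg: "kbounded K C \<Longrightarrow> 0 \<le> C"
  by (simp add: kbounded_def)

lemma kbounded_mono: "kbounded K C \<Longrightarrow> C \<le> D \<Longrightarrow> kbounded K D"
  unfolding kbounded_def by (meson mult_right_mono nrm_nonneg order_trans)

lemma kbounded_add: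
  assumes "row_col_finite K" "row_col_finite L" "kbounded K C" "kbounded L D"
  shows "kbounded (\<lambda>t r. K t r + L t r) (C + D)"
  unfolding kbounded_def
proof (intro conjI allI impI)
  fix \<xi> :: "'a \<Rightarrow> complex" assume \<xi>: "fsupp \<xi>"
  have "kapply (\<lambda>t r. K t r + L t r) \<xi> = (\<lambda>t. kapply K \<xi> t + kapply L \<xi> t)"
    by (simp add: kapply_def fun_eq_iff sum.distrib algebra_simps)
  then have "nrm (kapply (\<lambda>t r. K t r + L t r) \<xi>) \<le> nrm (kapply K \<xi>) + nrm (kapply L \<xi>)"
    using nrm_triangle kapply_fsupp \<xi> assms(1,2) by metis
  also have "\<dots> \<le> (C + D) * nrm \<xi>"
    using kbdD[OF assms(3) \<xi>] kbdD[OF assms(4) \<xi>] by (simp add: algebra_simps)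
  finally show "nrm (kapply (\<lambda>t r. K t r + L t r) \<xi>) \<le> (C + D) * nrm \<xi>" .
qed (use assms kbounded_nonneg in \<open>auto intro: add_nonneg_nonneg\<close>)

lemma kapply_scale: "kapply (\<lambda>t r. c * K t r) \<xi> = (\<lambda>t. c * kapply K \<xi> t)"
  by (simp add: kapply_def fun_eq_iff sum_distrib_left mult_ac)

lemma kbounded_scale: "kbounded K C \<Longrightarrow> kbounded (\<lambda>t r. c * K t r) (cmod c * C)"
  by (auto simp: kbounded_def kapply_scale nrm_scale mult.assoc intro: mult_left_mono)

lemma kbounded_kmul:
  assumes "row_col_finite K" "row_col_finite L" "kbounded K C" "kbounded L D"
  shows "kbounded (kmul K L) (C * D)"
  unfolding kbounded_def
proof (intro conjI allI impI)
  fix \<xi> :: "'a \<Rightarrow> complex" assume \<xi>: "fsupp \<xi>"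
  have "nrm (kapply (kmul K L) \<xi>) = nrm (kapply K (kapply L \<xi>))" by (simp add: kapply_kmul assms \<xi>)
  also have "\<dots> \<le> C * nrm (kapply L \<xi>)" by (rule kbdD) (use assms kapply_fsupp \<xi> in auto)
  also have "\<dots> \<le> C * (D * nrm \<xi>)"
    by (rule mult_left_mono) (use kbdD[OF assms(4) \<xi>] kbounded_nonneg assms in auto)
  finally show "nrm (kapply (kmul K L) \<xi>) \<le> C * D * nrm \<xi>" by simp
qed (use assms kbounded_nonneg mult_nonneg_nonneg in blast)

text \<open>With z the image of \<eta> under the adjoint, |z|^2 = <K z, \<eta>> is at most C |z|
  |\<eta>|, and one factor |z| cancels.\<close>

lemma kbounded_kadj:
  assumes "row_col_finite K" "kbounded K C"
  shows "kbounded (kadj K) C"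
  unfolding kbounded_def
proof (intro conjI allI impI)
  fix \<eta> :: "'a \<Rightarrow> complex" assume \<eta>: "fsupp \<eta>"
  define \<zeta> where "\<zeta> = kapply (kadj K) \<eta>"
  have \<zeta>: "fsupp \<zeta>" unfolding \<zeta>_def by (rule kapply_fsupp) (use assms row_col_finite_kadj \<eta> in auto)
  have "ip (kapply K \<zeta>) \<eta> = ip \<zeta> \<zeta>" unfolding ip_kapply[OF assms(1) \<zeta> \<eta>] by (simp add: \<zeta>_def)
  then have "(nrm \<zeta>)\<^sup>2 = cmod (ip (kapply K \<zeta>) \<eta>)" by (simp add: ip_self norm_power)
  also have "\<dots> \<le> nrm (kapply K \<zeta>) * nrm \<eta>" by (rule ip_bound[OF kapply_fsupp[OF assms(1) \<zeta>] \<eta>])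
  also have "\<dots> \<le> C * nrm \<zeta> * nrm \<eta>" by (rule mult_right_mono[OF kbdD[OF assms(2) \<zeta>]]) simp
  finally have "nrm \<zeta> * nrm \<zeta> \<le> nrm \<zeta> * (C * nrm \<eta>)" by (simp add: power2_eq_square mult_ac)
  then show "nrm (kapply (kadj K) \<eta>) \<le> C * nrm \<eta>"
    using kbounded_nonneg[OF assms(2)] nrm_nonneg[of \<zeta>] mult_le_cancel_left_pos[of "nrm \<zeta>" "nrm \<zeta>" "C * nrm \<eta>"]
    unfolding \<zeta>_def[symmetric] by (cases "nrm \<zeta> = 0") auto
qed (use assms kbounded_nonneg in auto)

text \<open>The half of the C*-identity that is not submultiplicativity: |K \<xi>|^2 = <\<xi>, K*K
  \<xi>>. A bound on K*K thus yields its square root as a bound on K.\<close>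

lemma kbounded_sqrt:
  assumes "row_col_finite K" "kbounded (kmul (kadj K) K) (C\<^sup>2)" "0 \<le> C"
  shows "kbounded K C"
  unfolding kbounded_def
proof (intro conjI allI impI)
  fix \<xi> :: "'a \<Rightarrow> complex" assume \<xi>: "fsupp \<xi>"
  have K: "fsupp (kapply K \<xi>)" by (rule kapply_fsupp[OF assms(1) \<xi>])
  have "(nrm (kapply K \<xi>))\<^sup>2 = cmod (ip (kapply K \<xi>) (kapply K \<xi>))" by (simp add: ip_self norm_power)
  also have "\<dots> = cmod (ip \<xi> (kapply (kmul (kadj K) K) \<xi>))"
    by (simp add: ip_kapply[OF assms(1) \<xi> K] kapply_kmul[OF row_col_finite_kadj[OF assms(1)] assms(1) \<xi>])
  also have "\<dots> \<le> nrm \<xi> * nrm (kapply (kmul (kadj K) K) \<xi>)"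
    by (rule ip_bound[OF \<xi> kapply_fsupp[OF row_col_finite_kmul[OF row_col_finite_kadj[OF assms(1)] assms(1)] \<xi>]])
  also have "\<dots> \<le> nrm \<xi> * (C\<^sup>2 * nrm \<xi>)"
    by (rule mult_left_mono[OF kbdD[OF assms(2) \<xi>]]) simp
  finally have "(nrm (kapply K \<xi>))\<^sup>2 \<le> (C * nrm \<xi>)\<^sup>2" by (simp add: power2_eq_square mult_ac)
  then show "nrm (kapply K \<xi>) \<le> C * nrm \<xi>" using assms(3) by (simp add: power2_le_iff_abs_le)
qed (use assms in auto)

lemma row_col_finite_finite:
  assumes "finite J" "\<And>i j. K i j \<noteq> 0 \<Longrightarrow> i \<in> J \<and> j \<in> J"
  shows "row_col_finite K"
  unfolding row_col_finite_def using assms(2) by (auto intro!: finite_subset[OF _ assms(1)])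

lemma kbounded_entry:
  assumes "row_col_finite K" "kbounded K C"
  shows "cmod (K i j) \<le> C"
proof -
  define e where "e = (\<lambda>t. if t = j then 1 else (0::complex))"
  have e: "{t. e t \<noteq> 0} = {j}" by (auto simp: e_def)
  have fe: "fsupp e" by (simp add: fsupp_def e)
  have ne: "nrm e = 1" by (simp add: nrm_def e) (simp add: e_def)
  have ke: "kapply K e = (\<lambda>t. K t j)" by (simp add: kapply_def e fun_eq_iff) (simp add: e_def)
  have f: "fsupp (\<lambda>t. K t j)" using assms by (simp add: fsupp_def row_col_finite_def)
  have "cmod (K i j) \<le> nrm (\<lambda>t. K t j)"
  proof (cases "K i j = 0")
    case False
    then show ?thesis unfolding nrm_def
      by (intro member_le_L2_set) (use f in \<open>auto simp: fsupp_def\<close>)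
  qed simp
  also have "\<dots> \<le> C" using kbdD[OF assms(2) fe] by (simp add: ne ke)
  finally show ?thesis .
qed

lemma nrm_le_sum: "finite S \<Longrightarrow> {t. \<xi> t \<noteq> 0} \<subseteq> S \<Longrightarrow> nrm \<xi> \<le> (\<Sum>t\<in>S. cmod (\<xi> t))"
  by (simp add: nrm_eq L2_set_le_sum)

text \<open>Deliberately crude: a bound that is linear in the entries is enough, because in the
  essential application the factor depending on the size of \<open>J\<close> is removed by taking
  high powers.\<close>

lemma kbounded_finite:
  assumes J: "finite J" "\<And>i j. K i j \<noteq> 0 \<Longrightarrow> i \<in> J \<and> j \<in> J"
  shows "kbounded K (\<Sum>i\<in>J. \<Sum>j\<in>J. cmod (K i j))"
  unfolding kbounded_def
proof (intro conjI allI impI)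
  fix \<xi> :: "'a \<Rightarrow> complex" assume \<xi>: "fsupp \<xi>"
  have k: "kapply K \<xi> t = (\<Sum>j\<in>J. K t j * \<xi> j)" for t
  proof -
    have "kapply K \<xi> t = (\<Sum>j\<in>J \<union> {j. \<xi> j \<noteq> 0}. K t j * \<xi> j)"
      by (rule kapply_eq) (use J \<xi> in \<open>auto simp: fsupp_def\<close>)
    also have "\<dots> = (\<Sum>j\<in>J. K t j * \<xi> j)"
      by (rule sum.mono_neutral_right) (use J \<xi> in \<open>auto simp: fsupp_def\<close>)
    finally show ?thesis .
  qed
  have c: "cmod (\<xi> j) \<le> nrm \<xi>" for j
  proof (cases "\<xi> j = 0")
    case False
    then show ?thesis unfolding nrm_def
      by (intro member_le_L2_set) (use \<xi> in \<open>auto simp: fsupp_def\<close>)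
  qed simp
  have "nrm (kapply K \<xi>) \<le> (\<Sum>t\<in>J. cmod (kapply K \<xi> t))"
  proof (rule nrm_le_sum[OF J(1)], rule)
    fix t assume "t \<in> {t. kapply K \<xi> t \<noteq> 0}"
    then have "\<exists>j\<in>J. K t j * \<xi> j \<noteq> 0" unfolding k
      by (metis (mono_tags, lifting) mem_Collect_eq sum.neutral)
    then show "t \<in> J" using J(2) by auto
  qed
  also have "\<dots> \<le> (\<Sum>t\<in>J. \<Sum>j\<in>J. cmod (K t j) * nrm \<xi>)"
    unfolding k by (intro sum_mono order_trans[OF norm_sum])
      (auto simp: norm_mult intro!: mult_left_mono c)
  finally show "nrm (kapply K \<xi>) \<le> (\<Sum>i\<in>J. \<Sum>j\<in>J. cmod (K i j)) * nrm \<xi>"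
    by (simp add: sum_distrib_right)
qed (simp add: sum_nonneg)

lemma kapply_zero: "kapply (\<lambda>t r. 0) \<xi> = (\<lambda>t. 0)"
  by (simp add: kapply_def fun_eq_iff)

lemma kapply_zero_right: "kapply K (\<lambda>t. 0) = (\<lambda>t. 0)"
  by (simp add: kapply_def fun_eq_iff)

lemma kapply_alt:
  assumes "row_col_finite K" "fsupp \<xi>"
  shows "kapply K \<xi> t = (\<Sum>q | K t q \<noteq> 0. K t q * \<xi> q)"
proof -
  have f: "finite {q. K t q \<noteq> 0}" "finite {q. \<xi> q \<noteq> 0}" using assms by (auto simp: row_col_finite_def fsupp_def)
  have "kapply K \<xi> t = (\<Sum>q\<in>{q. \<xi> q \<noteq> 0} \<union> {q. K t q \<noteq> 0}. K t q * \<xi> q)"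
    by (rule kapply_eq) (use f in auto)
  also have "\<dots> = (\<Sum>q | K t q \<noteq> 0. K t q * \<xi> q)"
    by (rule sum.mono_neutral_right) (use f in auto)
  finally show ?thesis .
qed

lemma kbounded_translate:
  assumes inj: "inj_on f D" and u: "\<And>t. t \<in> D \<Longrightarrow> cmod (u t) \<le> M" and M: "0 \<le> M"
  defines "K \<equiv> (\<lambda>t r. if t \<in> D \<and> r = f t then u t else 0)"
  shows "kbounded K M" "row_col_finite K"
proof -
  have fin: "finite {t \<in> D. f t \<in> R}" if "finite R" for R
    by (rule finite_imageD[of f]) (use that in \<open>auto intro: finite_subset inj_on_subset[OF inj]\<close>)
  show "row_col_finite K"
    unfolding row_col_finite_def
  proof (intro conjI allI)
    fix t show "finite {r. K t r \<noteq> 0}" by (rule finite_subset[of _ "{f t}"]) (auto simp: K_def)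
  next
    fix r show "finite {t. K t r \<noteq> 0}"
      by (rule finite_subset[OF _ fin[of "{r}"]]) (auto simp: K_def split: if_splits)
  qed
  show "kbounded K M"
    unfolding kbounded_def
  proof (intro conjI allI impI M)
    fix \<xi> :: "'a \<Rightarrow> complex" assume \<xi>: "fsupp \<xi>"
    have k: "kapply K \<xi> t = (if t \<in> D then u t * \<xi> (f t) else 0)" for t
    proof -
      have "kapply K \<xi> t = (\<Sum>r\<in>{r. \<xi> r \<noteq> 0} \<union> {f t}. K t r * \<xi> r)"
        by (rule kapply_eq) (use \<xi> in \<open>auto simp: fsupp_def\<close>)
      also have "\<dots> = (\<Sum>r\<in>{f t}. K t r * \<xi> r)"
        by (rule sum.mono_neutral_right) (use \<xi> in \<open>auto simp: fsupp_def K_def\<close>)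
      finally show ?thesis by (simp add: K_def)
    qed
    note T = nrm_translate[OF inj \<xi>]
    have "nrm (kapply K \<xi>) \<le> nrm (\<lambda>t. complex_of_real M * (if t \<in> D then \<xi> (f t) else 0))"
      by (rule nrm_mono[OF fsupp_scale[OF T(1)]]) (auto simp: k norm_mult M intro!: mult_right_mono u)
    also have "\<dots> \<le> M * nrm \<xi>"
      unfolding nrm_scale using mult_left_mono[OF T(2) M] M by simp
    finally show "nrm (kapply K \<xi>) \<le> M * nrm \<xi>" .
  qed
qed

text \<open>\<open>gker\<close> and \<open>sker\<close> are finite sums of weighted partial
  translations t -> inv s t, one for each s in the support; this gives l1-type bounds for
  both.\<close>

lemma kbounded_translates:
  fixes f :: "'s \<Rightarrow> 'a \<Rightarrow> 'a"
  assumes "finite S" "\<And>s. s \<in> S \<Longrightarrow> inj_on (f s) D"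
    and "\<And>s t. s \<in> S \<Longrightarrow> t \<in> D \<Longrightarrow> cmod (u s t) \<le> M s" "\<And>s. s \<in> S \<Longrightarrow> 0 \<le> M s"
  shows "kbounded (\<lambda>t r. \<Sum>s\<in>S. if t \<in> D \<and> r = f s t then u s t else 0) (\<Sum>s\<in>S. M s) \<and>
    row_col_finite (\<lambda>t r. \<Sum>s\<in>S. if t \<in> D \<and> r = f s t then u s t else 0)"
  using assms
proof (induction S rule: finite_induct)
  case empty
  show ?case by (auto simp: kbounded_def row_col_finite_def kapply_zero)
next
  case (insert s S)
  let ?K = "\<lambda>t r. if t \<in> D \<and> r = f s t then u s t else 0"
  let ?L = "\<lambda>t r. \<Sum>s\<in>S. if t \<in> D \<and> r = f s t then u s t else 0"
  have 1: "kbounded ?K (M s)" "row_col_finite ?K" using insert.prems by (auto intro!: kbounded_translate)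
  have 2: "kbounded ?L (\<Sum>s\<in>S. M s)" "row_col_finite ?L" using insert by auto
  have "row_col_finite (\<lambda>t r. ?K t r + ?L t r)"
    unfolding row_col_finite_def
  proof (intro conjI allI)
    fix t show "finite {r. ?K t r + ?L t r \<noteq> 0}"
      by (rule finite_subset[of _ "{r. ?K t r \<noteq> 0} \<union> {r. ?L t r \<noteq> 0}"])
        (use 1(2) 2(2) in \<open>auto simp: row_col_finite_def simp del: sum.neutral\<close>)
  next
    fix r show "finite {t. ?K t r + ?L t r \<noteq> 0}"
      by (rule finite_subset[of _ "{t. ?K t r \<noteq> 0} \<union> {t. ?L t r \<noteq> 0}"])
        (use 1(2) 2(2) in \<open>auto simp: row_col_finite_def simp del: sum.neutral\<close>)
  qed
  then show ?case using kbounded_add[OF 1(2) 2(2) 1(1) 2(1)] insert.hyps by simp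
qed

text \<open>Bounds survive relabelling. This passes between an arbitrary finite index set and an
  initial segment of the natural numbers, in both directions.\<close>

lemma kbounded_reindex:
  fixes K :: "'j \<Rightarrow> 'j \<Rightarrow> complex" and L :: "'i \<Rightarrow> 'i \<Rightarrow> complex"
  assumes J: "finite J" and h: "bij_betw h N J"
    and K: "\<And>i j. K i j \<noteq> 0 \<Longrightarrow> i \<in> J \<and> j \<in> J"
    and L: "\<And>i j. L i j \<noteq> 0 \<Longrightarrow> i \<in> N \<and> j \<in> N"
    and e: "\<And>i j. i \<in> N \<Longrightarrow> j \<in> N \<Longrightarrow> L i j = K (h i) (h j)"
    and bd: "kbounded K C"
  shows "kbounded L C"
  unfolding kbounded_def
proof (intro conjI allI impI)
  show "0 \<le> C" by (rule kbounded_nonneg[OF bd])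
  fix \<xi> :: "'i \<Rightarrow> complex" assume \<xi>: "fsupp \<xi>"
  have N: "finite N" using bij_betw_finite[OF h] J by simp
  define g where "g = the_inv_into N h"
  have g: "bij_betw g J N" unfolding g_def by (rule bij_betw_the_inv_into[OF h])
  have gh: "g (h i) = i" if "i \<in> N" for i
    unfolding g_def by (rule the_inv_into_f_f) (use h that in \<open>auto simp: bij_betw_def\<close>)
  define \<eta> where "\<eta> = (\<lambda>j. if j \<in> J then \<xi> (g j) else 0)"
  have hJ: "h i \<in> J" if "i \<in> N" for i using h that by (auto simp: bij_betw_def)
  have s\<eta>: "{j. \<eta> j \<noteq> 0} \<subseteq> J" by (auto simp: \<eta>_def)
  have "nrm \<eta> = L2_set (\<lambda>j. cmod (\<eta> j)) J" by (rule nrm_eq[OF J s\<eta>])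
  also have "\<dots> = L2_set (\<lambda>i. cmod (\<xi> i)) N"
    unfolding L2_set_def sum.reindex_bij_betw[OF h, symmetric] by (simp add: \<eta>_def hJ gh)
  also have "\<dots> = nrm (\<lambda>i. if i \<in> N then \<xi> i else 0)"
    by (subst nrm_eq[OF N]) (auto intro!: L2_set_cong)
  also have "\<dots> \<le> nrm \<xi>" by (rule nrm_restrict[OF \<xi>])
  finally have n\<eta>: "nrm \<eta> \<le> nrm \<xi>" .
  have kL: "kapply L \<xi> i = (if i \<in> N then kapply K \<eta> (h i) else 0)" for i
  proof -
    have "kapply L \<xi> i = (\<Sum>j\<in>{j. \<xi> j \<noteq> 0} \<union> N. L i j * \<xi> j)"
      by (rule kapply_eq) (use \<xi> N in \<open>auto simp: fsupp_def\<close>)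
    also have "\<dots> = (\<Sum>j\<in>N. L i j * \<xi> j)"
      by (rule sum.mono_neutral_right) (use \<xi> N L in \<open>auto simp: fsupp_def\<close>)
    also have "\<dots> = (if i \<in> N then \<Sum>j\<in>N. K (h i) (h j) * \<eta> (h j) else 0)"
    proof (cases "i \<in> N")
      case True
      then show ?thesis by (auto simp: e \<eta>_def hJ gh intro!: sum.cong)
    next
      case False
      then have "L i j = 0" for j using L by blast
      then show ?thesis using False by simp
    qed
    also have "\<dots> = (if i \<in> N then kapply K \<eta> (h i) else 0)"
      by (simp add: kapply_eq[OF J s\<eta>] sum.reindex_bij_betw[OF h, of "\<lambda>j. K (h i) j * \<eta> j"])
    finally show ?thesis .
  qed
  have "{j. kapply K \<eta> j \<noteq> 0} \<subseteq> J"
  proof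
    fix t assume "t \<in> {j. kapply K \<eta> j \<noteq> 0}"
    then have "\<exists>j\<in>J. K t j * \<eta> j \<noteq> 0" unfolding kapply_eq[OF J s\<eta>]
      by (metis (mono_tags, lifting) mem_Collect_eq sum.neutral)
    then show "t \<in> J" using K by auto
  qed
  note sk = nrm_eq[OF J this]
  have "nrm (kapply L \<xi>) = L2_set (\<lambda>i. cmod (kapply L \<xi> i)) N" by (rule nrm_eq[OF N]) (auto simp: kL)
  also have "\<dots> = L2_set (\<lambda>i. cmod (kapply K \<eta> (h i))) N" by (rule L2_set_cong) (auto simp: kL)
  also have "\<dots> = nrm (kapply K \<eta>)"
    unfolding sk L2_set_def by (simp add: sum.reindex_bij_betw[OF h, of "\<lambda>j. (cmod (kapply K \<eta> j))\<^sup>2"])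
  also have "\<dots> \<le> C * nrm \<eta>" by (rule kbdD[OF bd fsupp_subset[OF J s\<eta>]])
  also have "\<dots> \<le> C * nrm \<xi>" by (rule mult_left_mono[OF n\<eta> kbounded_nonneg[OF bd]])
  finally show "nrm (kapply L \<xi>) \<le> C * nrm \<xi>" .
qed

text \<open>Power estimates and almost invariant vectors reach the desired bound only up to a
  margin; this removes the margin.\<close>

lemma kbounded_dense:
  assumes "0 \<le> E" "\<And>F. E < F \<Longrightarrow> kbounded K F"
  shows "kbounded K E"
  unfolding kbounded_def
proof (intro conjI allI impI)
  fix \<xi> :: "'a \<Rightarrow> complex" assume \<xi>: "fsupp \<xi>"
  have le: "nrm (kapply K \<xi>) \<le> F * nrm \<xi>" if "E < F" for F by (rule kbdD[OF assms(2)[OF that] \<xi>])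
  show "nrm (kapply K \<xi>) \<le> E * nrm \<xi>"
  proof (cases "nrm \<xi> = 0")
    case True
    then show ?thesis using le[of "E + 1"] by simp
  next
    case False
    then have p: "nrm \<xi> > 0" using nrm_nonneg[of \<xi>] by linarith
    have "nrm (kapply K \<xi>) / nrm \<xi> \<le> E"
      by (rule dense_ge) (use le p in \<open>simp add: field_simps\<close>)
    then show ?thesis using p by (simp add: field_simps)
  qed
qed (rule assms)

section \<open>Completions of seminormed spaces\<close>

text \<open>The type provides the group structure, and the operations of the record are tied to it
  on the carrier only.\<close>

locale seminormed_space =
  fixes V :: "('a::ab_group_add, 'm) nspace_scheme" (structure)
  assumes vadd_eq: "\<And>x y. x \<in> carrier V \<Longrightarrow> y \<in> carrier V \<Longrightarrow> vadd V x y = x + y"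
    and zero_closed: "0 \<in> carrier V"
    and add_closed: "\<And>x y. x \<in> carrier V \<Longrightarrow> y \<in> carrier V \<Longrightarrow> x + y \<in> carrier V"
    and scale_closed: "\<And>c x. x \<in> carrier V \<Longrightarrow> vscale V c x \<in> carrier V"
    and scale_minus_one: "\<And>x. x \<in> carrier V \<Longrightarrow> vscale V (- 1) x = - x"
    and scale_add: "\<And>c x y. x \<in> carrier V \<Longrightarrow> y \<in> carrier V \<Longrightarrow>
      vscale V c (x + y) = vscale V c x + vscale V c y"
    and norm_nonneg: "\<And>x. x \<in> carrier V \<Longrightarrow> 0 \<le> vnorm V x"
    and norm_triangle: "\<And>x y. x \<in> carrier V \<Longrightarrow> y \<in> carrier V \<Longrightarrow>
      vnorm V (x + y) \<le> vnorm V x + vnorm V y"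
    and norm_scale: "\<And>c x. x \<in> carrier V \<Longrightarrow> vnorm V (vscale V c x) = cmod c * vnorm V x"
    and norm_zero: "vnorm V 0 = 0"
begin

lemma minus_closed: "x \<in> carrier V \<Longrightarrow> - x \<in> carrier V"
  using scale_closed[of x "- 1"] scale_minus_one[of x] by simp

lemma diff_closed: "x \<in> carrier V \<Longrightarrow> y \<in> carrier V \<Longrightarrow> x - y \<in> carrier V"
  using add_closed[of x "- y"] minus_closed by simp

lemma norm_minus: "x \<in> carrier V \<Longrightarrow> vnorm V (- x) = vnorm V x"
  using norm_scale[of x "- 1"] scale_minus_one[of x] by simp

lemma norm_diff_commute: "x \<in> carrier V \<Longrightarrow> y \<in> carrier V \<Longrightarrow> vnorm V (x - y) = vnorm V (y - x)"
  using norm_minus[of "x - y"] diff_closed by simp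

lemma norm_diff_triangle:
  "x \<in> carrier V \<Longrightarrow> y \<in> carrier V \<Longrightarrow> z \<in> carrier V \<Longrightarrow>
    vnorm V (x - z) \<le> vnorm V (x - y) + vnorm V (y - z)"
  using norm_triangle[of "x - y" "y - z"] diff_closed by simp

lemma norm_diff_le: "x \<in> carrier V \<Longrightarrow> y \<in> carrier V \<Longrightarrow> \<bar>vnorm V x - vnorm V y\<bar> \<le> vnorm V (x - y)"
  using norm_triangle[of "x - y" y] norm_triangle[of "y - x" x] norm_diff_commute[of x y] diff_closed
  by auto

lemma vdist_eq: "x \<in> carrier V \<Longrightarrow> y \<in> carrier V \<Longrightarrow> vdist V x y = vnorm V (x - y)"
  using minus_closed by (simp add: vdist_def scale_minus_one vadd_eq)

lemma cauchy_closed: "x \<in> cauchy_seqs V \<Longrightarrow> x n \<in> carrier V"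
  by (simp add: cauchy_seqs_def)

lemma cauchyI:
  assumes "\<And>n. x n \<in> carrier V"
    and "\<And>\<epsilon>. \<epsilon> > 0 \<Longrightarrow> \<exists>N. \<forall>m\<ge>N. \<forall>n\<ge>N. vnorm V (x m - x n) < \<epsilon>"
  shows "x \<in> cauchy_seqs V"
  using assms by (simp add: cauchy_seqs_def vdist_eq)

lemma cauchyD:
  assumes "x \<in> cauchy_seqs V" "\<epsilon> > 0"
  shows "\<exists>N. \<forall>m\<ge>N. \<forall>n\<ge>N. vnorm V (x m - x n) < \<epsilon>"
proof -
  have "vdist V (x m) (x n) = vnorm V (x m - x n)" for m n
    using assms(1) by (simp add: vdist_eq cauchy_closed)
  then show ?thesis using assms unfolding cauchy_seqs_def by simp
qed

lemma null_rel_iff: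
  "(x, y) \<in> null_rel V \<longleftrightarrow>
    x \<in> cauchy_seqs V \<and> y \<in> cauchy_seqs V \<and> (\<lambda>n. vnorm V (x n - y n)) \<longlonglongrightarrow> 0"
  by (auto simp: null_rel_def vdist_eq cauchy_closed)

lemma equiv_null_rel: "equiv (cauchy_seqs V) (null_rel V)"
proof (rule equivI)
  show "null_rel V \<subseteq> cauchy_seqs V \<times> cauchy_seqs V" by (auto simp: null_rel_iff)
  show "refl_on (cauchy_seqs V) (null_rel V)" by (auto simp: refl_on_def null_rel_iff norm_zero)
  show "sym (null_rel V)"
    by (rule symI) (auto simp: null_rel_iff norm_diff_commute cauchy_closed)
  show "trans (null_rel V)"
  proof (rule transI)
    fix x y z assume a: "(x, y) \<in> null_rel V" "(y, z) \<in> null_rel V"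
    then have l: "(\<lambda>n. vnorm V (x n - y n) + vnorm V (y n - z n)) \<longlonglongrightarrow> 0 + 0"
      by (intro tendsto_add) (auto simp: null_rel_iff)
    have "(\<lambda>n. vnorm V (x n - z n)) \<longlonglongrightarrow> 0"
      by (rule tendsto_sandwich[OF _ _ tendsto_const l[simplified]])
        (use a in \<open>auto simp: null_rel_iff cauchy_closed diff_closed norm_nonneg norm_diff_triangle\<close>)
    then show "(x, z) \<in> null_rel V" using a by (auto simp: null_rel_iff)
  qed
qed

definition cauchy_class :: "(nat \<Rightarrow> 'a) \<Rightarrow> (nat \<Rightarrow> 'a) set" where
  "cauchy_class x = null_rel V `` {x}"

lemma cauchy_class_eq_iff: "x \<in> cauchy_seqs V \<Longrightarrow> y \<in> cauchy_seqs V \<Longrightarrow> cauchy_class x = cauchy_class y \<longleftrightarrow> (x, y) \<in> null_rel V"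
  unfolding cauchy_class_def by (rule eq_equiv_class_iff[OF equiv_null_rel])

lemma in_cauchy_class_iff: "y \<in> cauchy_class x \<longleftrightarrow> (x, y) \<in> null_rel V"
  by (simp add: cauchy_class_def)

lemma cauchy_class_in_quotient: "x \<in> cauchy_seqs V \<Longrightarrow> cauchy_class x \<in> cauchy_seqs V // null_rel V"
  unfolding cauchy_class_def by (rule quotientI)

lemma quotient_cases:
  assumes "P \<in> cauchy_seqs V // null_rel V"
  obtains x where "x \<in> cauchy_seqs V" "P = cauchy_class x"
  using assms by (auto simp: quotient_def cauchy_class_def)

lemma const_cauchy: "x \<in> carrier V \<Longrightarrow> (\<lambda>n. x) \<in> cauchy_seqs V"
  by (rule cauchyI) (auto simp: norm_zero)

lemma norm_convergent:
  assumes "x \<in> cauchy_seqs V"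
  shows "convergent (\<lambda>n. vnorm V (x n))"
proof (rule Cauchy_convergent, rule CauchyI)
  fix e :: real assume "e > 0"
  from cauchyD[OF assms this] obtain N where "\<forall>m\<ge>N. \<forall>n\<ge>N. vnorm V (x m - x n) < e" by auto
  then show "\<exists>M. \<forall>m\<ge>M. \<forall>n\<ge>M. norm (vnorm V (x m) - vnorm V (x n)) < e"
    using norm_diff_le cauchy_closed[OF assms]
    by (intro exI[of _ N] allI impI, subst real_norm_def) (meson order_le_less_trans)
qed

text \<open>\<open>completion_norm\<close> asks for one number that is the limit along every
  representative, so the limit is transferred to all members of the class by the reverse triangle
  inequality.\<close>

lemma completion_norm_eq:
  assumes "x \<in> cauchy_seqs V" "(\<lambda>n. vnorm V (x n)) \<longlonglongrightarrow> r"
  shows "completion_norm V (cauchy_class x) = r"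
  unfolding completion_norm_def
proof (rule the_equality)
  show "\<forall>y\<in>cauchy_class x. (\<lambda>n. vnorm V (y n)) \<longlonglongrightarrow> r"
  proof
    fix y assume "y \<in> cauchy_class x"
    then have y: "y \<in> cauchy_seqs V" "(\<lambda>n. vnorm V (x n - y n)) \<longlonglongrightarrow> 0"
      by (auto simp: in_cauchy_class_iff null_rel_iff)
    have "(\<lambda>n. vnorm V (y n) - vnorm V (x n)) \<longlonglongrightarrow> 0"
    proof (rule Lim_null_comparison[OF _ y(2)], rule always_eventually, rule)
      fix n show "norm (vnorm V (y n) - vnorm V (x n)) \<le> vnorm V (x n - y n)"
        using norm_diff_le[of "y n" "x n"] norm_diff_commute[of "x n" "y n"] cauchy_closed y(1) assms(1)
        by simp
    qed
    from tendsto_add[OF this assms(2)] show "(\<lambda>n. vnorm V (y n)) \<longlonglongrightarrow> r" by simp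
  qed
next
  fix r' assume "\<forall>y\<in>cauchy_class x. (\<lambda>n. vnorm V (y n)) \<longlonglongrightarrow> r'"
  moreover have "x \<in> cauchy_class x" using equiv_null_rel assms(1) by (auto simp: in_cauchy_class_iff null_rel_iff norm_zero)
  ultimately show "r' = r" using assms(2) LIMSEQ_unique by blast
qed

lemma completion_norm_tendsto:
  assumes "x \<in> cauchy_seqs V"
  shows "(\<lambda>n. vnorm V (x n)) \<longlonglongrightarrow> completion_norm V (cauchy_class x)"
  using norm_convergent[OF assms] completion_norm_eq[OF assms] by (auto simp: convergent_def)

lemma completion_norm_const: "x \<in> carrier V \<Longrightarrow> completion_norm V (cauchy_class (\<lambda>n. x)) = vnorm V x"
  by (rule completion_norm_eq) (auto intro: const_cauchy)

lemma cauchy_bounded: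
  assumes "x \<in> cauchy_seqs V"
  obtains B where "B > 0" "\<And>n. vnorm V (x n) \<le> B"
proof -
  have "Bseq (\<lambda>n. vnorm V (x n))" by (rule convergent_imp_Bseq[OF norm_convergent[OF assms]])
  then show ?thesis using that by (auto simp: Bseq_def) (meson abs_le_D1)
qed

text \<open>Lifting forms a union over all representatives. Lipschitz continuity makes all the
  classes in this union equal.\<close>

lemma lift1_cauchy_class:
  assumes "\<And>x. x \<in> carrier V \<Longrightarrow> T x \<in> carrier V"
    and "\<And>x y. x \<in> carrier V \<Longrightarrow> y \<in> carrier V \<Longrightarrow> vnorm V (T x - T y) \<le> C * vnorm V (x - y)"
    and x: "x \<in> cauchy_seqs V"
  shows "(\<lambda>n. T (x n)) \<in> cauchy_seqs V" "lift1 V T (cauchy_class x) = cauchy_class (\<lambda>n. T (x n))"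
proof -
  \<comment> \<open>A positive Lipschitz constant, so that division by it makes sense even if
    \<open>C\<close> is zero or negative.\<close>
  define D where "D = max C 1"
  have D: "vnorm V (T x - T y) \<le> D * vnorm V (x - y)" if "x \<in> carrier V" "y \<in> carrier V" for x y
    using assms(2)[OF that] mult_right_mono[of C D "vnorm V (x - y)"] norm_nonneg diff_closed that
    by (force simp: D_def)
  have D0: "D > 0" by (simp add: D_def)
  have c: "(\<lambda>n. T (y n)) \<in> cauchy_seqs V" if y: "y \<in> cauchy_seqs V" for y
  proof (rule cauchyI)
    fix \<epsilon> :: real assume "\<epsilon> > 0"
    then have "\<epsilon> / D > 0" using D0 by simp
    from cauchyD[OF y this] obtain N where N: "\<forall>m\<ge>N. \<forall>n\<ge>N. vnorm V (y m - y n) < \<epsilon> / D" by auto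
    have "vnorm V (T (y m) - T (y n)) < \<epsilon>" if "m \<ge> N" "n \<ge> N" for m n
    proof -
      have "vnorm V (T (y m) - T (y n)) \<le> D * vnorm V (y m - y n)"
        by (rule D) (auto simp: cauchy_closed y)
      also have "\<dots> < D * (\<epsilon> / D)" using N that D0 by (intro mult_strict_left_mono) auto
      finally show ?thesis using D0 by simp
    qed
    then show "\<exists>N. \<forall>m\<ge>N. \<forall>n\<ge>N. vnorm V (T (y m) - T (y n)) < \<epsilon>" by blast
  qed (use assms(1) cauchy_closed y in auto)
  show "(\<lambda>n. T (x n)) \<in> cauchy_seqs V" by (rule c[OF x])
  have r: "((\<lambda>n. T (x n)), (\<lambda>n. T (y n))) \<in> null_rel V" if "(x, y) \<in> null_rel V" for y
  proof -
    have y: "y \<in> cauchy_seqs V" "(\<lambda>n. vnorm V (x n - y n)) \<longlonglongrightarrow> 0" using that by (auto simp: null_rel_iff)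
    have "(\<lambda>n. vnorm V (T (x n) - T (y n))) \<longlonglongrightarrow> 0"
    proof (rule tendsto_sandwich[OF _ _ tendsto_const])
      show "(\<lambda>n. D * vnorm V (x n - y n)) \<longlonglongrightarrow> 0" using tendsto_mult_right_zero[OF y(2)] by simp
    qed (use x y D assms(1) in \<open>auto simp: cauchy_closed diff_closed norm_nonneg\<close>)
    then show ?thesis using c x y by (auto simp: null_rel_iff)
  qed
  have "lift1 V T (cauchy_class x) = (\<Union>y\<in>cauchy_class x. cauchy_class (\<lambda>n. T (y n)))" by (simp add: lift1_def cauchy_class_def)
  also have "\<dots> = (\<Union>y\<in>cauchy_class x. cauchy_class (\<lambda>n. T (x n)))"
  proof (rule SUP_cong[OF refl])
    fix y assume "y \<in> cauchy_class x"
    then have "(x, y) \<in> null_rel V" by (simp add: in_cauchy_class_iff)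
    then show "cauchy_class (\<lambda>n. T (y n)) = cauchy_class (\<lambda>n. T (x n))"
      using r[of y] cauchy_class_eq_iff[of "\<lambda>n. T (x n)" "\<lambda>n. T (y n)"] by (auto simp: null_rel_iff)
  qed
  also have "\<dots> = cauchy_class (\<lambda>n. T (x n))"
  proof -
    have "x \<in> cauchy_class x" using x by (auto simp: in_cauchy_class_iff null_rel_iff norm_zero)
    then show ?thesis by auto
  qed
  finally show "lift1 V T (cauchy_class x) = cauchy_class (\<lambda>n. T (x n))" .
qed

text \<open>For a bilinear \<open>T\<close>, T x y - T x' y' = T (x - x') y + T x' (y - y'), which
  explains why the hypothesis bounds exactly \<open>y\<close> and \<open>x'\<close>.\<close>

lemma lift2_cauchy_class:
  assumes cl: "\<And>x y. x \<in> carrier V \<Longrightarrow> y \<in> carrier V \<Longrightarrow> T x y \<in> carrier V"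
    and bd: "\<And>B x y x' y'. B > 0 \<Longrightarrow> x \<in> carrier V \<Longrightarrow> y \<in> carrier V \<Longrightarrow> x' \<in> carrier V \<Longrightarrow> y' \<in> carrier V \<Longrightarrow>
      vnorm V x' \<le> B \<Longrightarrow> vnorm V y \<le> B \<Longrightarrow>
      vnorm V (T x y - T x' y') \<le> L B * vnorm V (x - x') + L B * vnorm V (y - y')"
    and x: "x \<in> cauchy_seqs V" and y: "y \<in> cauchy_seqs V"
  shows "(\<lambda>n. T (x n) (y n)) \<in> cauchy_seqs V"
    "lift2 V T (cauchy_class x) (cauchy_class y) = cauchy_class (\<lambda>n. T (x n) (y n))"
proof -
  have c: "(\<lambda>n. T (x n) (y n)) \<in> cauchy_seqs V"
    if x: "x \<in> cauchy_seqs V" and y: "y \<in> cauchy_seqs V" for x y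
  proof (rule cauchyI)
    fix \<epsilon> :: real assume e: "\<epsilon> > 0"
    obtain B1 where B1: "B1 > 0" "\<And>n. vnorm V (x n) \<le> B1" using cauchy_bounded[OF x] by blast
    obtain B2 where B2: "B2 > 0" "\<And>n. vnorm V (y n) \<le> B2" using cauchy_bounded[OF y] by blast
    define B where "B = max B1 B2"
    have B: "B > 0" "\<And>n. vnorm V (x n) \<le> B" "\<And>n. vnorm V (y n) \<le> B"
      using B1 B2 by (auto simp: B_def intro: order_trans le_max_iff_disj[THEN iffD2])
    define D where "D = max (L B) 1"
    have D: "D > 0" "L B \<le> D" by (auto simp: D_def)
    have "\<epsilon> / (2 * D) > 0" using e D by simp
    from cauchyD[OF x this] obtain N1 where
      N1: "\<forall>m\<ge>N1. \<forall>n\<ge>N1. vnorm V (x m - x n) < \<epsilon> / (2 * D)" by auto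
    from cauchyD[OF y \<open>\<epsilon> / (2 * D) > 0\<close>] obtain N2 where
      N2: "\<forall>m\<ge>N2. \<forall>n\<ge>N2. vnorm V (y m - y n) < \<epsilon> / (2 * D)" by auto
    have "vnorm V (T (x m) (y m) - T (x n) (y n)) < \<epsilon>" if "m \<ge> max N1 N2" "n \<ge> max N1 N2" for m n
    proof -
      have "vnorm V (T (x m) (y m) - T (x n) (y n)) \<le> L B * vnorm V (x m - x n) + L B * vnorm V (y m - y n)"
        by (rule bd) (auto simp: cauchy_closed x y B)
      also have "\<dots> \<le> D * vnorm V (x m - x n) + D * vnorm V (y m - y n)"
        by (intro add_mono mult_right_mono) (auto simp: D cauchy_closed x y diff_closed norm_nonneg)
      also have "\<dots> < D * (\<epsilon> / (2 * D)) + D * (\<epsilon> / (2 * D))"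
        using N1 N2 that D by (intro add_strict_mono mult_strict_left_mono) auto
      finally show ?thesis using D by simp
    qed
    then show "\<exists>N. \<forall>m\<ge>N. \<forall>n\<ge>N. vnorm V (T (x m) (y m) - T (x n) (y n)) < \<epsilon>" by blast
  qed (use cl cauchy_closed x y in auto)
  show "(\<lambda>n. T (x n) (y n)) \<in> cauchy_seqs V" by (rule c[OF x y])
  have r: "((\<lambda>n. T (x n) (y n)), (\<lambda>n. T (x' n) (y' n))) \<in> null_rel V"
    if x': "(x, x') \<in> null_rel V" and y': "(y, y') \<in> null_rel V" for x' y'
  proof -
    have X: "x' \<in> cauchy_seqs V" "(\<lambda>n. vnorm V (x n - x' n)) \<longlonglongrightarrow> 0" using x' by (auto simp: null_rel_iff)
    have Y: "y' \<in> cauchy_seqs V" "(\<lambda>n. vnorm V (y n - y' n)) \<longlonglongrightarrow> 0" using y' by (auto simp: null_rel_iff)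
    obtain B1 where B1: "B1 > 0" "\<And>n. vnorm V (x' n) \<le> B1" using cauchy_bounded[OF X(1)] by blast
    obtain B2 where B2: "B2 > 0" "\<And>n. vnorm V (y n) \<le> B2" using cauchy_bounded[OF y] by blast
    define B where "B = max B1 B2"
    have B: "B > 0" "\<And>n. vnorm V (x' n) \<le> B" "\<And>n. vnorm V (y n) \<le> B"
      using B1 B2 by (auto simp: B_def intro: order_trans le_max_iff_disj[THEN iffD2])
    have "(\<lambda>n. vnorm V (T (x n) (y n) - T (x' n) (y' n))) \<longlonglongrightarrow> 0"
    proof (rule tendsto_sandwich[OF _ _ tendsto_const])
      show "(\<lambda>n. L B * vnorm V (x n - x' n) + L B * vnorm V (y n - y' n)) \<longlonglongrightarrow> 0"
        using tendsto_add[OF tendsto_mult_right_zero[OF X(2), of "L B"] tendsto_mult_right_zero[OF Y(2), of "L B"]]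
        by simp
    qed (use x y X Y B in \<open>auto simp: cauchy_closed cl diff_closed norm_nonneg intro!: always_eventually bd\<close>)
    then show ?thesis using c x y X Y by (auto simp: null_rel_iff)
  qed
  have "lift2 V T (cauchy_class x) (cauchy_class y) = (\<Union>x'\<in>cauchy_class x. \<Union>y'\<in>cauchy_class y. cauchy_class (\<lambda>n. T (x' n) (y' n)))"
    by (simp add: lift2_def cauchy_class_def)
  also have "\<dots> = (\<Union>x'\<in>cauchy_class x. \<Union>y'\<in>cauchy_class y. cauchy_class (\<lambda>n. T (x n) (y n)))"
  proof (intro SUP_cong[OF refl])
    fix x' y' assume "x' \<in> cauchy_class x" "y' \<in> cauchy_class y"
    then have "(x, x') \<in> null_rel V" "(y, y') \<in> null_rel V" by (simp_all add: in_cauchy_class_iff)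
    then show "cauchy_class (\<lambda>n. T (x' n) (y' n)) = cauchy_class (\<lambda>n. T (x n) (y n))"
      using r[of x' y'] cauchy_class_eq_iff[of "\<lambda>n. T (x n) (y n)" "\<lambda>n. T (x' n) (y' n)"] by (auto simp: null_rel_iff)
  qed
  also have "\<dots> = cauchy_class (\<lambda>n. T (x n) (y n))"
  proof -
    have "x \<in> cauchy_class x" "y \<in> cauchy_class y" using x y by (auto simp: in_cauchy_class_iff null_rel_iff norm_zero)
    then show ?thesis by auto
  qed
  finally show "lift2 V T (cauchy_class x) (cauchy_class y) = cauchy_class (\<lambda>n. T (x n) (y n))" .
qed

lemma lift2_vadd:
  assumes "x \<in> cauchy_seqs V" "y \<in> cauchy_seqs V"
  shows "(\<lambda>n. x n + y n) \<in> cauchy_seqs V" "lift2 V (vadd V) (cauchy_class x) (cauchy_class y) = cauchy_class (\<lambda>n. x n + y n)"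
proof -
  have b: "vnorm V (vadd V u v - vadd V u' v') \<le> 1 * vnorm V (u - u') + 1 * vnorm V (v - v')"
    if "u \<in> carrier V" "v \<in> carrier V" "u' \<in> carrier V" "v' \<in> carrier V" for u v u' v'
    using norm_triangle[of "u - u'" "v - v'"] that
    by (simp add: vadd_eq diff_closed algebra_simps)
  have eq: "(\<lambda>n. vadd V (x n) (y n)) = (\<lambda>n. x n + y n)"
    using assms by (auto simp: vadd_eq cauchy_closed)
  show "(\<lambda>n. x n + y n) \<in> cauchy_seqs V" "lift2 V (vadd V) (cauchy_class x) (cauchy_class y) = cauchy_class (\<lambda>n. x n + y n)"
    using lift2_cauchy_class[of "vadd V" "\<lambda>_. 1", OF _ b assms] by (simp_all add: eq vadd_eq add_closed)
qed

lemma scale_diff: "x \<in> carrier V \<Longrightarrow> y \<in> carrier V \<Longrightarrow> vscale V c (x - y) = vscale V c x - vscale V c y"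
  using scale_add[of "x - y" y c] diff_closed by (simp add: algebra_simps)

lemma lift1_vscale:
  assumes "x \<in> cauchy_seqs V"
  shows "(\<lambda>n. vscale V c (x n)) \<in> cauchy_seqs V" "lift1 V (vscale V c) (cauchy_class x) = cauchy_class (\<lambda>n. vscale V c (x n))"
  using lift1_cauchy_class[of "vscale V c" "cmod c", OF _ _ assms]
  by (simp_all add: scale_closed scale_diff[symmetric] norm_scale diff_closed)

lemma op_norm_bounds:
  assumes T: "\<And>v. v \<in> carrier V \<Longrightarrow> T v \<in> carrier V"
    and sc: "\<And>c v. v \<in> carrier V \<Longrightarrow> T (vscale V c v) = vscale V c (T v)"
    and bd: "\<And>v. v \<in> carrier V \<Longrightarrow> vnorm V (T v) \<le> C * vnorm V v" and C: "0 \<le> C"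
  shows "op_norm V T \<le> C" "0 \<le> op_norm V T"
    "\<And>v. v \<in> carrier V \<Longrightarrow> vnorm V (T v) \<le> op_norm V T * vnorm V v"
proof -
  let ?S = "{vnorm V (T v) | v. v \<in> carrier V \<and> vnorm V v \<le> 1}"
  have le: "s \<le> C" if "s \<in> ?S" for s
    using that bd C by auto (meson mult_left_le order_trans)
  have T0: "vnorm V (T 0) \<in> ?S" using zero_closed norm_zero by force
  show "op_norm V T \<le> C" unfolding op_norm_def by (rule cSup_least) (use T0 le in auto)
  have ub: "s \<le> op_norm V T" if "s \<in> ?S" for s
    unfolding op_norm_def by (rule cSup_upper[OF that]) (use le in \<open>auto simp: bdd_above_def\<close>)
  show "0 \<le> op_norm V T" using ub[OF T0] norm_nonneg[OF T[OF zero_closed]] by linarith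
  fix v assume v: "v \<in> carrier V"
  show "vnorm V (T v) \<le> op_norm V T * vnorm V v"
  proof (cases "vnorm V v = 0")
    case True
    then show ?thesis using bd[OF v] by simp
  next
    case False
    then have p: "vnorm V v > 0" using norm_nonneg[OF v] by simp
    let ?w = "vscale V (complex_of_real (1 / vnorm V v)) v"
    have "vnorm V (T ?w) \<le> op_norm V T"
      by (rule ub) (use p v scale_closed in \<open>auto simp: norm_scale norm_divide intro!: exI[of _ ?w]\<close>)
    then show ?thesis using p v T by (simp add: sc norm_scale norm_divide field_simps)
  qed
qed

text \<open>The norm of a section is defined by an operator on the completed module; this brings it
  back to finitely supported sections. Constant sequences give one inequality, limits along a
  representative the other.\<close>

lemma op_norm_completion:
  assumes T: "\<And>v. v \<in> carrier V \<Longrightarrow> T v \<in> carrier V"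
    and sc: "\<And>c v. v \<in> carrier V \<Longrightarrow> T (vscale V c v) = vscale V c (T v)"
    and df: "\<And>v w. v \<in> carrier V \<Longrightarrow> w \<in> carrier V \<Longrightarrow> T (v - w) = T v - T w"
    and bd: "\<And>v. v \<in> carrier V \<Longrightarrow> vnorm V (T v) \<le> C * vnorm V v" and C: "0 \<le> C"
  shows "op_norm (nspace_completion V) (lift1 V T) = op_norm V T"
proof (rule antisym)
  have ob: "0 \<le> op_norm V T" "v \<in> carrier V \<Longrightarrow> vnorm V (T v) \<le> op_norm V T * vnorm V v" for v
    using op_norm_bounds(2,3)[of T C] T sc bd C by blast+
  have lip: "vnorm V (T x - T y) \<le> C * vnorm V (x - y)" if "x \<in> carrier V" "y \<in> carrier V" for x y
    using bd[of "x - y"] that by (simp add: df diff_closed)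
  have l1: "(\<lambda>n. T (x n)) \<in> cauchy_seqs V" "lift1 V T (cauchy_class x) = cauchy_class (\<lambda>n. T (x n))"
    if "x \<in> cauchy_seqs V" for x
    using lift1_cauchy_class[of T C x] T lip that by blast+
  let ?S = "{completion_norm V (lift1 V T P) | P. P \<in> cauchy_seqs V // null_rel V \<and> completion_norm V P \<le> 1}"
  have S: "op_norm (nspace_completion V) (lift1 V T) = Sup ?S"
    by (simp add: op_norm_def nspace_completion_def)
  have le: "s \<le> op_norm V T" if s: "s \<in> ?S" for s
  proof -
    obtain P where P: "P \<in> cauchy_seqs V // null_rel V" "completion_norm V P \<le> 1"
      "s = completion_norm V (lift1 V T P)" using s by auto
    obtain x where x: "x \<in> cauchy_seqs V" "P = cauchy_class x" using quotient_cases[OF P(1)] .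
    have "s \<le> op_norm V T * completion_norm V P"
    proof (rule LIMSEQ_le)
      show "(\<lambda>n. vnorm V (T (x n))) \<longlonglongrightarrow> s"
        unfolding P(3) x(2) l1(2)[OF x(1)] by (rule completion_norm_tendsto[OF l1(1)[OF x(1)]])
      show "(\<lambda>n. op_norm V T * vnorm V (x n)) \<longlonglongrightarrow> op_norm V T * completion_norm V P"
        unfolding x(2) by (intro tendsto_mult tendsto_const completion_norm_tendsto x(1))
      show "\<exists>N. \<forall>n\<ge>N. vnorm V (T (x n)) \<le> op_norm V T * vnorm V (x n)"
        using ob(2) cauchy_closed[OF x(1)] by simp
    qed
    also have "\<dots> \<le> op_norm V T" using ob(1) P(2) by (simp add: mult_left_le)
    finally show ?thesis .
  qed
  have mem: "vnorm V (T v) \<in> ?S" if v: "v \<in> carrier V" "vnorm V v \<le> 1" for v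
  proof -
    have "lift1 V T (cauchy_class (\<lambda>n. v)) = cauchy_class (\<lambda>n. T v)" using l1(2)[OF const_cauchy[OF v(1)]] by simp
    then have "vnorm V (T v) = completion_norm V (lift1 V T (cauchy_class (\<lambda>n. v)))"
      using completion_norm_const T v by simp
    then show ?thesis
      using cauchy_class_in_quotient[OF const_cauchy[OF v(1)]] completion_norm_const[OF v(1)] v(2) by auto
  qed
  show "op_norm (nspace_completion V) (lift1 V T) \<le> op_norm V T"
    unfolding S by (rule cSup_least) (use le mem[OF zero_closed] norm_zero in auto)
  show "op_norm V T \<le> op_norm (nspace_completion V) (lift1 V T)"
    unfolding S unfolding op_norm_def
  proof (rule cSup_mono)
    show "{vnorm V (T v) | v. v \<in> carrier V \<and> vnorm V v \<le> 1} \<noteq> {}"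
      using zero_closed norm_zero by force
    show "bdd_above ?S" using le by (auto simp: bdd_above_def)
  qed (use mem in blast)
qed

end

section \<open>Matrices as kernels\<close>

text \<open>Extension by zero makes matrices of all sizes kernels over one index type, so the kernel
  calculus applies to them.\<close>

definition kmat :: "complex mat \<Rightarrow> nat \<Rightarrow> nat \<Rightarrow> complex" where
  "kmat M i j = (if i < dim_row M \<and> j < dim_col M then M $$ (i, j) else 0)"

definition vext :: "complex Matrix.vec \<Rightarrow> nat \<Rightarrow> complex" where
  "vext v i = (if i < dim_vec v then vec_index v i else 0)"

lemma kmat_support: "kmat M i j \<noteq> 0 \<Longrightarrow> i < dim_row M \<and> j < dim_col M"
  by (auto simp: kmat_def split: if_splits)

lemma row_col_finite_kmat: "row_col_finite (kmat M)"
  by (rule row_col_finite_finite[of "{..<max (dim_row M) (dim_col M)}"]) (auto dest: kmat_support)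

lemma vext_support: "{i. vext v i \<noteq> 0} \<subseteq> {..<dim_vec v}"
  by (auto simp: vext_def)

lemma fsupp_vext: "fsupp (vext v)"
  by (rule fsupp_subset[OF _ vext_support]) simp

lemma vec_l2norm_eq: "vec_l2norm v = nrm (vext v)"
  unfolding nrm_eq[OF finite_lessThan vext_support] vec_l2norm_def by (rule L2_set_cong) (auto simp: vext_def)

lemma kapply_kmat:
  assumes "dim_vec v = dim_col M"
  shows "kapply (kmat M) (vext v) = vext (M *\<^sub>v v)"
proof
  fix t
  have "kapply (kmat M) (vext v) t = (\<Sum>j<dim_vec v. kmat M t j * vext v j)"
    by (rule kapply_eq[OF _ vext_support]) simp
  also have "\<dots> = vext (M *\<^sub>v v) t"
    using assms by (auto simp: kmat_def vext_def scalar_prod_def atLeast0LessThan intro!: sum.cong)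
  finally show "kapply (kmat M) (vext v) t = vext (M *\<^sub>v v) t" .
qed

lemma kmat_mult:
  assumes "A \<in> carrier_mat d d" "B \<in> carrier_mat d d"
  shows "kmat (A * B) = kmul (kmat A) (kmat B)"
proof (intro ext)
  fix i j
  have "kmul (kmat A) (kmat B) i j = (\<Sum>q<d. kmat A i q * kmat B q j)"
    by (rule kmul_eq) (use assms in \<open>auto dest: kmat_support\<close>)
  also have "\<dots> = kmat (A * B) i j"
    using assms by (auto simp: kmat_def scalar_prod_def atLeast0LessThan intro!: sum.cong)
  finally show "kmat (A * B) i j = kmul (kmat A) (kmat B) i j" by simp
qed

lemma adjoint_carrier: "A \<in> carrier_mat d d \<Longrightarrow> mat_adjoint A \<in> carrier_mat d d"
  by (auto simp: mat_adjoint_def)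

lemma adjoint_index:
  "A \<in> carrier_mat d d \<Longrightarrow> i < d \<Longrightarrow> j < d \<Longrightarrow> mat_adjoint A $$ (i, j) = cnj (A $$ (j, i))"
  by (auto simp: mat_adjoint_def mat_of_rows_def)

lemma kmat_adjoint: "A \<in> carrier_mat d d \<Longrightarrow> kmat (mat_adjoint A) = kadj (kmat A)"
  using adjoint_carrier[of A d] by (auto simp: kmat_def kadj_def fun_eq_iff adjoint_index)

lemma kmat_add: "A \<in> carrier_mat d d \<Longrightarrow> B \<in> carrier_mat d d \<Longrightarrow> kmat (A + B) = (\<lambda>i j. kmat A i j + kmat B i j)"
  by (auto simp: kmat_def fun_eq_iff)

lemma kmat_smult: "kmat (c \<cdot>\<^sub>m A) = (\<lambda>i j. c * kmat A i j)"
  by (auto simp: kmat_def fun_eq_iff)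

lemma mat_norm_least:
  assumes "kbounded (kmat M) C"
  shows "mat_norm M \<le> C"
  unfolding mat_norm_def
proof (rule cSup_least)
  have "vec_l2norm (0\<^sub>v (dim_col M)) = 0"
    by (simp add: vec_l2norm_def L2_set_def)
  then show "{vec_l2norm (M *\<^sub>v v) |v. v \<in> carrier_vec (dim_col M) \<and> vec_l2norm v \<le> 1} \<noteq> {}"
    by (auto intro!: exI[of _ "0\<^sub>v (dim_col M)"])
next
  fix s assume "s \<in> {vec_l2norm (M *\<^sub>v v) |v. v \<in> carrier_vec (dim_col M) \<and> vec_l2norm v \<le> 1}"
  then obtain v where v: "s = vec_l2norm (M *\<^sub>v v)" "dim_vec v = dim_col M" "vec_l2norm v \<le> 1" by auto
  have "s = nrm (kapply (kmat M) (vext v))" by (simp add: v kapply_kmat vec_l2norm_eq)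
  also have "\<dots> \<le> C * nrm (vext v)" by (rule kbdD[OF assms fsupp_vext])
  also have "\<dots> \<le> C" using v(3) kbounded_nonneg[OF assms] by (simp add: vec_l2norm_eq mult_left_le)
  finally show "s \<le> C" .
qed

text \<open>Any bound makes the supremum in \<open>mat_norm\<close> finite; truncating to the first
  \<open>dim_col M\<close> coordinates and normalising then reduces an arbitrary vector to the unit
  ball.\<close>

lemma kbounded_mat_norm: "kbounded (kmat M) (mat_norm M)"
proof -
  define J where "J = {..<max (dim_row M) (dim_col M)}"
  have "kbounded (kmat M) (\<Sum>i\<in>J. \<Sum>j\<in>J. cmod (kmat M i j))"
    by (rule kbounded_finite) (auto simp: J_def dest: kmat_support)
  then obtain C where C: "kbounded (kmat M) C" by blast
  let ?S = "{vec_l2norm (M *\<^sub>v v) |v. v \<in> carrier_vec (dim_col M) \<and> vec_l2norm v \<le> 1}"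
  have "bdd_above ?S"
    unfolding bdd_above_def
  proof (intro exI[of _ C] ballI)
    fix s assume "s \<in> ?S"
    then obtain v where v: "s = vec_l2norm (M *\<^sub>v v)" "dim_vec v = dim_col M" "vec_l2norm v \<le> 1" by auto
    have "s = nrm (kapply (kmat M) (vext v))" by (simp add: v kapply_kmat vec_l2norm_eq)
    also have "\<dots> \<le> C * nrm (vext v)" by (rule kbdD[OF C fsupp_vext])
    also have "\<dots> \<le> C" using v(3) kbounded_nonneg[OF C] by (simp add: vec_l2norm_eq mult_left_le)
    finally show "s \<le> C" .
  qed
  then have ub: "vec_l2norm (M *\<^sub>v v) \<le> mat_norm M" if "dim_vec v = dim_col M" "vec_l2norm v \<le> 1" for v
    unfolding mat_norm_def 
    using that by (intro cSup_upper) (auto intro!: exI[of _ v] carrier_vecI)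
  have nn: "0 \<le> mat_norm M"
    using ub[of "0\<^sub>v (dim_col M)"] by (simp add: vec_l2norm_def L2_set_def)
  show ?thesis unfolding kbounded_def
  proof (intro conjI allI impI nn)
    fix \<xi> :: "nat \<Rightarrow> complex" assume \<xi>: "fsupp \<xi>"
    define \<zeta> where "\<zeta> = (\<lambda>i. if i < dim_col M then \<xi> i else 0)"
    have nz: "nrm \<zeta> \<le> nrm \<xi>" unfolding \<zeta>_def by (rule nrm_restrict[OF \<xi>])
    have k: "kapply (kmat M) \<xi> = kapply (kmat M) \<zeta>"
    proof
      fix t
      have "kapply (kmat M) \<xi> t = (\<Sum>j\<in>{j. \<xi> j \<noteq> 0}. kmat M t j * \<zeta> j)"
        unfolding kapply_def \<zeta>_def by (rule sum.cong) (auto simp: kmat_def)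
      also have "\<dots> = kapply (kmat M) \<zeta> t"
        by (rule kapply_eq[symmetric]) (use \<xi> in \<open>auto simp: fsupp_def \<zeta>_def\<close>)
      finally show "kapply (kmat M) \<xi> t = kapply (kmat M) \<zeta> t" .
    qed
    have fz: "fsupp \<zeta>" unfolding \<zeta>_def by (rule fsupp_restrict[OF \<xi>])
    show "nrm (kapply (kmat M) \<xi>) \<le> mat_norm M * nrm \<xi>"
    proof (cases "nrm \<zeta> = 0")
      case True
      then have "\<zeta> = (\<lambda>_. 0)" using nrm_eq_0_iff[OF fz] by simp
      then have "kapply (kmat M) \<xi> = (\<lambda>_. 0)" by (simp add: k kapply_def fun_eq_iff)
      then show ?thesis using nn by simp
    next
      case False
      then have p: "nrm \<zeta> > 0" using nrm_nonneg[of \<zeta>] by linarith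
      define c where "c = complex_of_real (1 / nrm \<zeta>)"
      define v where "v = Matrix.vec (dim_col M) (\<lambda>i. c * \<zeta> i)"
      have cc: "cmod c = 1 / nrm \<zeta>" using p by (simp add: c_def norm_divide)
      have v: "vext v = (\<lambda>i. c * \<zeta> i)" by (auto simp: v_def vext_def \<zeta>_def fun_eq_iff)
      have "vec_l2norm v \<le> 1" using p by (simp add: vec_l2norm_eq v nrm_scale cc)
      then have "vec_l2norm (M *\<^sub>v v) \<le> mat_norm M" by (intro ub) (simp_all add: v_def)
      moreover have "vext (M *\<^sub>v v) = kapply (kmat M) (\<lambda>i. c * \<zeta> i)"
        using kapply_kmat[of v M] v by (simp add: v_def)
      moreover have "kapply (kmat M) (\<lambda>i. c * \<zeta> i) = (\<lambda>i. c * kapply (kmat M) \<zeta> i)"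
      proof -
        have "c \<noteq> 0" using cc p by auto
        then show ?thesis by (auto simp: kapply_def fun_eq_iff sum_distrib_left mult_ac)
      qed
      ultimately have "1 / nrm \<zeta> * nrm (kapply (kmat M) \<zeta>) \<le> mat_norm M"
        by (simp add: vec_l2norm_eq nrm_scale cc)
      then have "nrm (kapply (kmat M) \<zeta>) \<le> mat_norm M * nrm \<zeta>" using p by (simp add: field_simps)
      also have "\<dots> \<le> mat_norm M * nrm \<xi>" by (rule mult_left_mono[OF nz nn])
      finally show ?thesis by (simp add: k)
    qed
  qed
qed

lemma mat_norm_nonneg: "0 \<le> mat_norm M"
  using kbounded_mat_norm kbounded_nonneg by blast

lemma mat_norm_entry: "i < dim_row M \<Longrightarrow> j < dim_col M \<Longrightarrow> cmod (M $$ (i, j)) \<le> mat_norm M"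
  using kbounded_entry[OF row_col_finite_kmat kbounded_mat_norm, of M i j] by (simp add: kmat_def)

lemma mat_norm_add:
  "A \<in> carrier_mat d d \<Longrightarrow> B \<in> carrier_mat d d \<Longrightarrow> mat_norm (A + B) \<le> mat_norm A + mat_norm B"
  by (rule mat_norm_least) (simp add: kmat_add kbounded_add row_col_finite_kmat kbounded_mat_norm)

lemma mat_norm_smult: "mat_norm (c \<cdot>\<^sub>m A) \<le> cmod c * mat_norm A"
  by (rule mat_norm_least) (simp add: kmat_smult kbounded_scale kbounded_mat_norm)

lemma mat_norm_mult:
  "A \<in> carrier_mat d d \<Longrightarrow> B \<in> carrier_mat d d \<Longrightarrow> mat_norm (A * B) \<le> mat_norm A * mat_norm B"
  by (rule mat_norm_least) (simp add: kmat_mult kbounded_kmul row_col_finite_kmat kbounded_mat_norm)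

lemma mat_norm_adjoint: "A \<in> carrier_mat d d \<Longrightarrow> mat_norm (mat_adjoint A) \<le> mat_norm A"
  by (rule mat_norm_least) (simp add: kmat_adjoint kbounded_kadj row_col_finite_kmat kbounded_mat_norm)

lemma mat_norm_cstar:
  assumes A: "A \<in> carrier_mat d d"
  shows "mat_norm (mat_adjoint A * A) = (mat_norm A)\<^sup>2"
proof (rule antisym)
  show "mat_norm (mat_adjoint A * A) \<le> (mat_norm A)\<^sup>2"
    using order_trans[OF mat_norm_mult[OF adjoint_carrier[OF A] A]
        mult_right_mono[OF mat_norm_adjoint[OF A] mat_norm_nonneg[of A]]]
    by (simp add: power2_eq_square)
  have "kbounded (kmul (kadj (kmat A)) (kmat A)) ((sqrt (mat_norm (mat_adjoint A * A)))\<^sup>2)"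
    using kbounded_mat_norm[of "mat_adjoint A * A"] mat_norm_nonneg[of "mat_adjoint A * A"]
    by (simp add: kmat_mult[OF adjoint_carrier[OF A] A] kmat_adjoint[OF A])
  then have "kbounded (kmat A) (sqrt (mat_norm (mat_adjoint A * A)))"
    by (rule kbounded_sqrt[OF row_col_finite_kmat]) (simp add: mat_norm_nonneg)
  then have "mat_norm A \<le> sqrt (mat_norm (mat_adjoint A * A))" by (rule mat_norm_least)
  then show "(mat_norm A)\<^sup>2 \<le> mat_norm (mat_adjoint A * A)"
    using mat_norm_nonneg by (simp add: real_le_rsqrt sqrt_le_D le_real_sqrt_sumsq real_le_lsqrt mat_norm_nonneg)
      (metis mat_norm_nonneg power_mono real_sqrt_pow2)
qed

lemma mat_norm_le_sum:
  assumes "M \<in> carrier_mat d d"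
  shows "mat_norm M \<le> (\<Sum>i<d. \<Sum>j<d. cmod (M $$ (i, j)))"
proof -
  have "kbounded (kmat M) (\<Sum>i<d. \<Sum>j<d. cmod (kmat M i j))"
    by (rule kbounded_finite) (use assms in \<open>auto dest: kmat_support\<close>)
  then have "mat_norm M \<le> (\<Sum>i<d. \<Sum>j<d. cmod (kmat M i j))" by (rule mat_norm_least)
  also have "\<dots> = (\<Sum>i<d. \<Sum>j<d. cmod (M $$ (i, j)))"
    using assms by (intro sum.cong) (auto simp: kmat_def)
  finally show ?thesis .
qed

lemma mat_norm_zero_imp:
  assumes "M \<in> carrier_mat d d" "mat_norm M \<le> 0"
  shows "M = 0\<^sub>m d d"
proof (rule eq_matI)
  fix i j assume "i < dim_row (0\<^sub>m d d :: complex mat)" "j < dim_col (0\<^sub>m d d :: complex mat)"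
  then show "M $$ (i, j) = 0\<^sub>m d d $$ (i, j)"
    using order_trans[OF mat_norm_entry[of i M j] assms(2)] assms(1) by auto
qed (use assms in auto)

lemma pow_mat_add: "A \<in> carrier_mat d d \<Longrightarrow> A ^\<^sub>m (m + n) = A ^\<^sub>m m * A ^\<^sub>m n"
  for A :: "complex mat"
  by (induction n) (simp_all add: assoc_mult_mat[of _ d d _ d _ d])

text \<open>For Hermitian matrices the norms of the powers \<open>B ^ 2 ^ k\<close> are multiplicative, whereas they stay
  bounded as soon as the spectral radius is less than 1.\<close>

lemma hermitian_mat_norm_le:
  assumes B: "B \<in> carrier_mat d d" and h: "mat_adjoint B = B" and c: "0 < c"
    and ev: "\<And>\<mu> v. v \<in> carrier_vec d \<Longrightarrow> v \<noteq> 0\<^sub>v d \<Longrightarrow> B *\<^sub>v v = \<mu> \<cdot>\<^sub>v v \<Longrightarrow> cmod \<mu> < c"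
  shows "mat_norm B \<le> c"
proof (cases "d = 0")
  case True
  then have "mat_norm B \<le> 0" using mat_norm_le_sum[OF B] by simp
  then show ?thesis using c by simp
next
  case False
  \<comment> \<open>After this scaling all eigenvalues lie strictly inside the unit disc.\<close>
  define A where "A = complex_of_real (1 / c) \<cdot>\<^sub>m B"
  have A: "A \<in> carrier_mat d d" using B by (simp add: A_def)
  have hA: "mat_adjoint A = A"
  proof (rule eq_matI)
    fix i j assume ij: "i < dim_row A" "j < dim_col A"
    have "mat_adjoint B $$ (i, j) = B $$ (i, j)" by (simp add: h)
    then show "mat_adjoint A $$ (i, j) = A $$ (i, j)"
      using ij A B by (simp add: adjoint_index[OF A] adjoint_index[OF B]) (simp add: A_def)
  qed (use A adjoint_carrier[OF A] in auto)
  have "spectral_radius A < 1"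
  proof -
    have "spectral_radius A \<in> norm ` spectrum A" using spectral_radius_mem_max(1)[OF A] False by simp
    then obtain \<mu> where \<mu>: "eigenvalue A \<mu>" "spectral_radius A = cmod \<mu>" by (auto simp: spectrum_def)
    then obtain v where v: "v \<in> carrier_vec d" "v \<noteq> 0\<^sub>v d" "A *\<^sub>v v = \<mu> \<cdot>\<^sub>v v"
      using A by (auto simp: eigenvalue_def eigenvector_def)
    have "B *\<^sub>v v = (complex_of_real c * \<mu>) \<cdot>\<^sub>v v"
    proof -
      have "complex_of_real c \<cdot>\<^sub>v (A *\<^sub>v v) = B *\<^sub>v v"
        using B v(1) c by (intro eq_vecI) (auto simp: A_def)
      then show ?thesis using v(1) by (simp add: v(3) smult_smult_assoc)
    qed
    from ev[OF v(1,2) this] show ?thesis using c \<mu>(2) by (simp add: norm_mult)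
  qed
  \<comment> \<open>The Jordan normal form bounds the entries of all powers of \<open>A\<close> by a
    single number.\<close>
  from spectral_radius_jnf_norm_bound_less_1_upper_triangular[OF A this]
  obtain b where b: "\<And>k. norm_bound (A ^\<^sub>m k) b" by auto
  have car: "A ^\<^sub>m k \<in> carrier_mat d d" for k using A by simp
  have pb: "mat_norm (A ^\<^sub>m k) \<le> real (d * d) * b" for k
  proof -
    have "mat_norm (A ^\<^sub>m k) \<le> (\<Sum>i<d. \<Sum>j<d. cmod ((A ^\<^sub>m k) $$ (i, j)))" by (rule mat_norm_le_sum[OF car])
    also have "\<dots> \<le> (\<Sum>i<d. \<Sum>j<d. b)"
      using b[of k] A by (intro sum_mono) (auto simp: norm_bound_def)
    finally show ?thesis by (simp add: algebra_simps)
  qed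
  have p: "mat_adjoint (A ^\<^sub>m 2 ^ k) = A ^\<^sub>m 2 ^ k \<and> mat_norm (A ^\<^sub>m 2 ^ k) = mat_norm A ^ 2 ^ k" for k
  proof (induction k)
    case 0
    have "A ^\<^sub>m 1 = A" using A by simp
    then show ?case using hA by simp
  next
    case (Suc k)
    define E where "E = A ^\<^sub>m 2 ^ k"
    have E: "E \<in> carrier_mat d d" using A by (simp add: E_def)
    have "A ^\<^sub>m 2 ^ Suc k = E * E"
      using pow_mat_add[OF A, of "2 ^ k" "2 ^ k"] by (simp add: E_def mult_2)
    moreover have hE: "mat_adjoint E = E" and nE: "mat_norm E = mat_norm A ^ 2 ^ k"
      using Suc by (auto simp: E_def)
    moreover have "mat_adjoint (E * E) = E * E"
    proof -
      have EE: "E * E \<in> carrier_mat d d" using E by simp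
      have e: "cnj (E $$ (j, i)) = E $$ (i, j)" if "i < d" "j < d" for i j
        using adjoint_index[OF E that] hE by simp
      show ?thesis
        by (rule eq_matI) (use E EE adjoint_carrier[OF EE] in
          \<open>auto simp: adjoint_index[OF EE] scalar_prod_def e mult.commute intro!: sum.cong\<close>)
    qed
    ultimately show ?case using mat_norm_cstar[OF E] by (simp add: power_mult[symmetric] mult.commute)
  qed
  \<comment> \<open>Otherwise the norms of the powers with exponent 2^n, being powers of the norm,
    would exceed the uniform bound.\<close>
  have "mat_norm A \<le> 1"
  proof (rule ccontr)
    assume "\<not> mat_norm A \<le> 1"
    then have g: "mat_norm A > 1" by simp
    from real_arch_pow[OF g] obtain n where n: "real (d * d) * b < mat_norm A ^ n" by blast
    have "mat_norm A ^ n \<le> mat_norm A ^ 2 ^ n" using g by (intro power_increasing) auto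
    then show False using pb[of "2 ^ n"] p[of n] n by simp
  qed
  then have cA: "c * mat_norm A \<le> c" using c by (simp add: mult_left_le)
  have Bc: "B = complex_of_real c \<cdot>\<^sub>m A"
    using B c by (intro eq_matI) (auto simp: A_def)
  have "mat_norm B \<le> cmod (complex_of_real c) * mat_norm A"
    by (subst Bc) (rule mat_norm_smult)
  also have "\<dots> = c * mat_norm A" using c by simp
  also note cA
  finally show ?thesis .
qed

lemma mat_mult_index:
  "A \<in> carrier_mat d d \<Longrightarrow> B \<in> carrier_mat d d \<Longrightarrow> i < d \<Longrightarrow> j < d \<Longrightarrow>
    (A * B) $$ (i, j) = (\<Sum>k<d. A $$ (i, k) * B $$ (k, j))"
  by (simp add: scalar_prod_def atLeast0LessThan)

section \<open>Residual finite-dimensionality of completions\<close>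

locale pre_star_alg = seminormed_space A
  for A :: "('a::ab_group_add, 'm) star_alg_scheme" (structure) +
  assumes mult_closed: "\<And>x y. x \<in> carrier A \<Longrightarrow> y \<in> carrier A \<Longrightarrow> amult A x y \<in> carrier A"
    and star_closed: "\<And>x. x \<in> carrier A \<Longrightarrow> astar A x \<in> carrier A"
    and mult_add_left: "\<And>x y z. x \<in> carrier A \<Longrightarrow> y \<in> carrier A \<Longrightarrow> z \<in> carrier A \<Longrightarrow>
      amult A (x + y) z = amult A x z + amult A y z"
    and mult_add_right: "\<And>x y z. x \<in> carrier A \<Longrightarrow> y \<in> carrier A \<Longrightarrow> z \<in> carrier A \<Longrightarrow>
      amult A z (x + y) = amult A z x + amult A z y"
    and star_add: "\<And>x y. x \<in> carrier A \<Longrightarrow> y \<in> carrier A \<Longrightarrow> astar A (x + y) = astar A x + astar A y"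
    and norm_mult_le: "\<And>x y. x \<in> carrier A \<Longrightarrow> y \<in> carrier A \<Longrightarrow>
      vnorm A (amult A x y) \<le> vnorm A x * vnorm A y"
    and norm_star_le: "\<And>x. x \<in> carrier A \<Longrightarrow> vnorm A (astar A x) \<le> vnorm A x"

text \<open>Contractivity is part of the definition because it is what lets a star-homomorphism on
  the dense algebra extend to the completion.\<close>

definition pre_RFD :: "('a, 'm) star_alg_scheme \<Rightarrow> bool" where
  "pre_RFD A \<longleftrightarrow> (\<forall>\<epsilon>>0. \<forall>\<Omega>. finite \<Omega> \<and> \<Omega> \<subseteq> carrier A \<longrightarrow>
    (\<exists>d\<ge>1. \<exists>\<phi>. star_hom_mat A d \<phi> \<and> (\<forall>a\<in>carrier A. mat_norm (\<phi> a) \<le> vnorm A a) \<and>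
      (\<forall>a\<in>\<Omega>. vnorm A a - \<epsilon> \<le> mat_norm (\<phi> a))))"

context pre_star_alg
begin

lemma mult_diff_left: "x \<in> carrier A \<Longrightarrow> y \<in> carrier A \<Longrightarrow> z \<in> carrier A \<Longrightarrow>
    amult A (x - y) z = amult A x z - amult A y z"
  using mult_add_left[of "x - y" y z] diff_closed by (simp add: algebra_simps)

lemma mult_diff_right: "x \<in> carrier A \<Longrightarrow> y \<in> carrier A \<Longrightarrow> z \<in> carrier A \<Longrightarrow>
    amult A z (x - y) = amult A z x - amult A z y"
  using mult_add_right[of "x - y" y z] diff_closed by (simp add: algebra_simps)

lemma star_diff: "x \<in> carrier A \<Longrightarrow> y \<in> carrier A \<Longrightarrow> astar A (x - y) = astar A x - astar A y"
  using star_add[of "x - y" y] diff_closed by (simp add: algebra_simps)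

lemma lift2_amult:
  assumes "x \<in> cauchy_seqs A" "y \<in> cauchy_seqs A"
  shows "(\<lambda>n. amult A (x n) (y n)) \<in> cauchy_seqs A"
    "lift2 A (amult A) (cauchy_class x) (cauchy_class y) = cauchy_class (\<lambda>n. amult A (x n) (y n))"
proof -
  have b: "vnorm A (amult A u v - amult A u' v') \<le> B * vnorm A (u - u') + B * vnorm A (v - v')"
    if "B > 0" "u \<in> carrier A" "v \<in> carrier A" "u' \<in> carrier A" "v' \<in> carrier A"
      "vnorm A u' \<le> B" "vnorm A v \<le> B" for B u v u' v'
  proof -
    have "amult A u v - amult A u' v' = amult A (u - u') v + amult A u' (v - v')"
      using that by (simp add: mult_diff_left mult_diff_right)
    then have "vnorm A (amult A u v - amult A u' v') \<le> vnorm A (amult A (u - u') v) + vnorm A (amult A u' (v - v'))"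
      using norm_triangle that by (simp add: mult_closed diff_closed)
    also have "\<dots> \<le> vnorm A (u - u') * vnorm A v + vnorm A u' * vnorm A (v - v')"
      using that by (intro add_mono norm_mult_le diff_closed)
    also have "\<dots> \<le> vnorm A (u - u') * B + B * vnorm A (v - v')"
      using that by (intro add_mono mult_left_mono mult_right_mono norm_nonneg diff_closed)
    finally show ?thesis by (simp add: mult.commute)
  qed
  show "(\<lambda>n. amult A (x n) (y n)) \<in> cauchy_seqs A"
    "lift2 A (amult A) (cauchy_class x) (cauchy_class y) = cauchy_class (\<lambda>n. amult A (x n) (y n))"
    using lift2_cauchy_class[of "amult A" "\<lambda>B. B", OF _ b assms] mult_closed by simp_all
qed

lemma lift1_astar:
  assumes "x \<in> cauchy_seqs A"
  shows "(\<lambda>n. astar A (x n)) \<in> cauchy_seqs A" "lift1 A (astar A) (cauchy_class x) = cauchy_class (\<lambda>n. astar A (x n))"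
  using lift1_cauchy_class[of "astar A" 1, OF _ _ assms]
  by (simp_all add: star_closed star_diff[symmetric] norm_star_le diff_closed)

lemmas const_lift =
  lift2_amult(2)[OF const_cauchy const_cauchy] lift1_astar(2)[OF const_cauchy]
  lift2_vadd(2)[OF const_cauchy const_cauchy] lift1_vscale(2)[OF const_cauchy]

lemma star_hom_const:
  assumes "star_hom_mat (star_alg_completion A) d \<phi>"
  shows "star_hom_mat A d (\<lambda>a. \<phi> (cauchy_class (\<lambda>n. a)))"
  using assms
  by (auto simp: star_hom_mat_def star_alg_completion_def vadd_eq const_lift[symmetric]
      cauchy_class_in_quotient const_cauchy mult_closed star_closed scale_closed add_closed)

text \<open>\<open>s\<close> represents the sum x + x^2 + ..., characterised by s = x + s x. This
  quasi-inverse form makes sense without a unit element.\<close>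

lemma neumann_series:
  assumes x: "x \<in> carrier A" and r: "vnorm A x < 1"
  obtains s where "s \<in> cauchy_seqs A" "cauchy_class s = cauchy_class (\<lambda>n. x + amult A (s n) x)"
proof -
  define r where "r = vnorm A x"
  have r: "0 \<le> r" "r < 1" using assms norm_nonneg by (auto simp: r_def)
  define s where "s = rec_nat 0 (\<lambda>_ y. x + amult A y x)"
  have s0: "s 0 = 0" and sS: "s (Suc n) = x + amult A (s n) x" for n by (simp_all add: s_def)
  have sc: "s n \<in> carrier A" for n
    by (induction n) (simp_all add: s0 sS zero_closed add_closed mult_closed x)
  \<comment> \<open>The fixed point of y -> r + y r, hence a bound that the recursion
    preserves.\<close>
  define M where "M = r / (1 - r)"
  have M: "0 \<le> M" "r + M * r = M" using r by (simp_all add: M_def field_simps)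
  have bd: "vnorm A (s n) \<le> M" for n
  proof (induction n)
    case (Suc n)
    have "vnorm A (s (Suc n)) \<le> r + vnorm A (s n) * r"
      using norm_triangle[OF x mult_closed[OF sc[of n] x]] norm_mult_le[OF sc[of n] x] by (simp add: sS r_def)
    also have "\<dots> \<le> r + M * r" using Suc r by (intro add_left_mono mult_right_mono)
    finally show ?case using M by simp
  qed (simp add: s0 norm_zero M)
  have df: "vnorm A (s (n + k) - s n) \<le> r ^ n * M" for n k
  proof (induction n)
    case 0
    then show ?case using bd by (simp add: s0)
  next
    case (Suc n)
    have "s (Suc n + k) - s (Suc n) = amult A (s (n + k) - s n) x"
      by (simp add: sS mult_diff_left sc x)
    then have "vnorm A (s (Suc n + k) - s (Suc n)) \<le> vnorm A (s (n + k) - s n) * r"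
      using norm_mult_le[OF diff_closed[OF sc sc] x] by (simp add: r_def)
    also have "\<dots> \<le> r ^ n * M * r" using Suc r by (intro mult_right_mono)
    finally show ?case by (simp add: mult_ac)
  qed
  have lim: "(\<lambda>n. r ^ n * M) \<longlonglongrightarrow> 0"
    using tendsto_mult_left_zero[OF LIMSEQ_power_zero[of r]] r by simp
  have c: "s \<in> cauchy_seqs A"
  proof (rule cauchyI[OF sc])
    fix \<epsilon> :: real assume "\<epsilon> > 0"
    then have "\<forall>\<^sub>F n in sequentially. r ^ n * M < \<epsilon> / 2"
      using order_tendstoD(2)[OF lim, of "\<epsilon> / 2"] by simp
    then obtain N where N: "r ^ N * M < \<epsilon> / 2" by (auto simp: eventually_sequentially)
    have "vnorm A (s m - s n) < \<epsilon>" if "m \<ge> N" "n \<ge> N" for m n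
    proof -
      have "vnorm A (s m - s n) \<le> vnorm A (s m - s N) + vnorm A (s N - s n)"
        by (rule norm_diff_triangle) (rule sc)+
      also have "\<dots> = vnorm A (s m - s N) + vnorm A (s n - s N)"
        using norm_diff_commute[OF sc sc] by simp
      also have "\<dots> \<le> r ^ N * M + r ^ N * M"
        using df[of N "m - N"] df[of N "n - N"] that by (intro add_mono) simp_all
      finally show ?thesis using N by linarith
    qed
    then show "\<exists>N. \<forall>m\<ge>N. \<forall>n\<ge>N. vnorm A (s m - s n) < \<epsilon>" by blast
  qed
  have c': "(\<lambda>n. x + amult A (s n) x) \<in> cauchy_seqs A"
    using lift2_vadd(1)[OF const_cauchy[OF x] lift2_amult(1)[OF c const_cauchy[OF x]]] .
  have "(s, \<lambda>n. x + amult A (s n) x) \<in> null_rel A"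
    unfolding null_rel_iff
  proof (intro conjI c c')
    show "(\<lambda>n. vnorm A (s n - (x + amult A (s n) x))) \<longlonglongrightarrow> 0"
    proof (rule tendsto_sandwich[OF _ _ tendsto_const lim])
      show "\<forall>\<^sub>F n in sequentially. vnorm A (s n - (x + amult A (s n) x)) \<le> r ^ n * M"
        unfolding sS[symmetric] using df[of _ 1] norm_diff_commute[OF sc sc] by simp
      show "\<forall>\<^sub>F n in sequentially. 0 \<le> vnorm A (s n - (x + amult A (s n) x))"
        unfolding sS[symmetric] by (simp add: norm_nonneg diff_closed sc)
    qed
  qed
  then have "cauchy_class s = cauchy_class (\<lambda>n. x + amult A (s n) x)" using cauchy_class_eq_iff[OF c c'] by simp
  with c show ?thesis by (rule that)
qed

text \<open>If \<open>\<mu>\<close> is larger than the norm of \<open>b = a\<^sup>*a\<close>, then \<open>b / \<mu>\<close> is quasi-invertible in the completion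
  by the Neumann series, so \<open>\<mu>\<close> is no eigenvalue of the image of \<open>b\<close>.\<close>

lemma star_hom_contractive:
  assumes hom: "star_hom_mat (star_alg_completion A) d \<phi>" and a: "a \<in> carrier A"
  shows "mat_norm (\<phi> (cauchy_class (\<lambda>n. a))) \<le> vnorm A a"
proof -
  define \<psi> where "\<psi> = (\<lambda>a. \<phi> (cauchy_class (\<lambda>n. a)))"
  have \<psi>: "star_hom_mat A d \<psi>" unfolding \<psi>_def by (rule star_hom_const[OF hom])
  define b where "b = amult A (astar A a) a"
  have b: "b \<in> carrier A" using a by (simp add: b_def mult_closed star_closed)
  have Ca: "\<psi> a \<in> carrier_mat d d" and Cb: "\<psi> b \<in> carrier_mat d d"
    using \<psi> a b by (auto simp: star_hom_mat_def)
  have Bb: "\<psi> b = mat_adjoint (\<psi> a) * \<psi> a"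
    using \<psi> a by (simp add: star_hom_mat_def b_def star_closed)
  have herm: "mat_adjoint (\<psi> b) = \<psi> b"
  proof (rule eq_matI)
    fix i j assume "i < dim_row (\<psi> b)" "j < dim_col (\<psi> b)"
    then have ij: "i < d" "j < d" using Cb by auto
    show "mat_adjoint (\<psi> b) $$ (i, j) = \<psi> b $$ (i, j)"
      unfolding adjoint_index[OF Cb ij] using Ca adjoint_carrier[OF Ca] ij
      by (auto simp: Bb scalar_prod_def adjoint_index[OF Ca] mult.commute intro!: sum.cong)
  qed (use Cb adjoint_carrier[OF Cb] in auto)
  have "mat_norm (\<psi> b) \<le> c" if c: "vnorm A b < c" for c
  proof (rule hermitian_mat_norm_le[OF Cb herm])
    show c0: "0 < c" using c norm_nonneg[OF b] by linarith
    fix \<mu> v assume v: "v \<in> carrier_vec d" "v \<noteq> 0\<^sub>v d" "\<psi> b *\<^sub>v v = \<mu> \<cdot>\<^sub>v v"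
    show "cmod \<mu> < c"
    proof (rule ccontr)
      assume "\<not> cmod \<mu> < c"
      then have m: "cmod \<mu> > vnorm A b" "\<mu> \<noteq> 0" using c c0 by auto
      define x where "x = vscale A (1 / \<mu>) b"
      have x: "x \<in> carrier A" using b by (simp add: x_def scale_closed)
      have "vnorm A x < 1" using m b norm_nonneg[OF b] by (simp add: x_def norm_scale norm_divide field_simps)
      from neumann_series[OF x this] obtain s where
        s: "s \<in> cauchy_seqs A" "cauchy_class s = cauchy_class (\<lambda>n. x + amult A (s n) x)" .
      let ?C = "star_alg_completion A"
      have P: "cauchy_class s \<in> carrier ?C" "cauchy_class (\<lambda>n. x) \<in> carrier ?C"
        using cauchy_class_in_quotient[OF s(1)] x by (simp_all add: star_alg_completion_def cauchy_class_in_quotient const_cauchy)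
      have M: "cauchy_class (\<lambda>n. amult A (s n) x) \<in> carrier ?C"
        using lift2_amult(1)[OF s(1) const_cauchy[OF x]] by (simp add: star_alg_completion_def cauchy_class_in_quotient)
      have e1: "amult ?C (cauchy_class s) (cauchy_class (\<lambda>n. x)) = cauchy_class (\<lambda>n. amult A (s n) x)"
        using lift2_amult(2)[OF s(1) const_cauchy[OF x]] by (simp add: star_alg_completion_def)
      have e2: "vadd ?C (cauchy_class (\<lambda>n. x)) (cauchy_class (\<lambda>n. amult A (s n) x)) = cauchy_class s"
        using lift2_vadd(2)[OF const_cauchy[OF x] lift2_amult(1)[OF s(1) const_cauchy[OF x]]] s(2)
        by (simp add: star_alg_completion_def)
      have eq: "\<phi> (cauchy_class s) = \<psi> x + \<phi> (cauchy_class s) * \<psi> x"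
      proof -
        have "\<phi> (cauchy_class s) = \<phi> (vadd ?C (cauchy_class (\<lambda>n. x)) (cauchy_class (\<lambda>n. amult A (s n) x)))"
          by (simp only: e2)
        also have "\<dots> = \<phi> (cauchy_class (\<lambda>n. x)) + \<phi> (cauchy_class (\<lambda>n. amult A (s n) x))"
          using hom P(2) M by (simp add: star_hom_mat_def)
        also have "\<phi> (cauchy_class (\<lambda>n. amult A (s n) x)) = \<phi> (amult ?C (cauchy_class s) (cauchy_class (\<lambda>n. x)))"
          by (simp only: e1)
        also have "\<dots> = \<phi> (cauchy_class s) * \<phi> (cauchy_class (\<lambda>n. x))"
          using hom P by (simp add: star_hom_mat_def)
        finally show ?thesis unfolding \<psi>_def .
      qed
      have Cs: "\<phi> (cauchy_class s) \<in> carrier_mat d d" using hom P by (simp add: star_hom_mat_def)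
      have Cx: "\<psi> x \<in> carrier_mat d d" using \<psi> x by (simp add: star_hom_mat_def)
      have "\<psi> x = (1 / \<mu>) \<cdot>\<^sub>m \<psi> b" using \<psi> b by (simp add: star_hom_mat_def x_def)
      then have "\<psi> x *\<^sub>v v = (1 / \<mu>) \<cdot>\<^sub>v (\<psi> b *\<^sub>v v)"
        using Cb v(1) by (intro eq_vecI) auto
      then have xv: "\<psi> x *\<^sub>v v = v" using m v(1) by (simp add: v(3) smult_smult_assoc)
      \<comment> \<open>Inserting \<psi>(x) v = v into \<phi>(s) = \<psi>(x) + \<phi>(s) \<psi>(x)
        leaves v = 0.\<close>
      have "\<phi> (cauchy_class s) *\<^sub>v v = (\<psi> x + \<phi> (cauchy_class s) * \<psi> x) *\<^sub>v v"
        by (rule arg_cong[OF eq])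
      also have "\<dots> = \<psi> x *\<^sub>v v + (\<phi> (cauchy_class s) * \<psi> x) *\<^sub>v v"
        by (rule add_mult_distrib_mat_vec[OF Cx mult_carrier_mat[OF Cs Cx] v(1)])
      also have "(\<phi> (cauchy_class s) * \<psi> x) *\<^sub>v v = \<phi> (cauchy_class s) *\<^sub>v v"
        using assoc_mult_mat_vec[OF Cs Cx v(1)] xv by simp
      finally have z: "\<phi> (cauchy_class s) *\<^sub>v v = v + \<phi> (cauchy_class s) *\<^sub>v v" unfolding xv .
      have "v = 0\<^sub>v d"
      proof (rule eq_vecI)
        fix i assume "i < dim_vec (0\<^sub>v d :: complex Matrix.vec)"
        then show "vec_index v i = vec_index (0\<^sub>v d) i"
          using arg_cong[OF z, of "\<lambda>w. vec_index w i"] Cs v(1) by simp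
      qed (use v in auto)
      then show False using v by simp
    qed
  qed
  then have "mat_norm (\<psi> b) \<le> vnorm A b" by (meson dense not_le)
  also have "\<dots> \<le> vnorm A (astar A a) * vnorm A a"
    unfolding b_def by (rule norm_mult_le) (simp_all add: a star_closed)
  also have "\<dots> \<le> vnorm A a * vnorm A a"
    by (rule mult_right_mono[OF norm_star_le[OF a] norm_nonneg[OF a]])
  finally have "(mat_norm (\<psi> a))\<^sup>2 \<le> (vnorm A a)\<^sup>2"
    by (simp add: Bb mat_norm_cstar[OF Ca] power2_eq_square)
  then show ?thesis unfolding \<psi>_def by (rule power2_le_imp_le) (rule norm_nonneg[OF a])
qed

lemma RFD_completionD:
  assumes "RFD_algebra (star_alg_completion A)"
  shows "pre_RFD A"
  unfolding pre_RFD_def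
proof (intro allI impI, elim conjE)
  fix \<epsilon> :: real and \<Omega> assume e: "0 < \<epsilon>" and \<Omega>: "finite \<Omega>" "\<Omega> \<subseteq> carrier A"
  let ?C = "star_alg_completion A"
  have "(\<lambda>a. cauchy_class (\<lambda>n. a)) ` \<Omega> \<subseteq> carrier ?C"
    using \<Omega> by (auto simp: star_alg_completion_def intro!: cauchy_class_in_quotient const_cauchy)
  then obtain d \<phi> where d: "d \<ge> 1" "star_hom_mat ?C d \<phi>"
    and n: "\<forall>P\<in>(\<lambda>a. cauchy_class (\<lambda>n. a)) ` \<Omega>. mat_norm (\<phi> P) \<ge> vnorm ?C P - \<epsilon>"
    using assms e \<Omega> unfolding RFD_algebra_def by (metis finite_imageI)
  show "\<exists>d\<ge>1. \<exists>\<phi>. star_hom_mat A d \<phi> \<and> (\<forall>a\<in>carrier A. mat_norm (\<phi> a) \<le> vnorm A a) \<and>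
      (\<forall>a\<in>\<Omega>. vnorm A a - \<epsilon> \<le> mat_norm (\<phi> a))"
  proof (intro exI conjI ballI)
    show "star_hom_mat A d (\<lambda>a. \<phi> (cauchy_class (\<lambda>n. a)))" by (rule star_hom_const[OF d(2)])
    show "mat_norm (\<phi> (cauchy_class (\<lambda>n. a))) \<le> vnorm A a" if "a \<in> carrier A" for a
      by (rule star_hom_contractive[OF d(2) that])
    fix a assume a: "a \<in> \<Omega>"
    then have "vnorm ?C (cauchy_class (\<lambda>n. a)) = vnorm A a"
      using \<Omega> completion_norm_const by (auto simp: star_alg_completion_def)
    then show "vnorm A a - \<epsilon> \<le> mat_norm (\<phi> (cauchy_class (\<lambda>n. a)))" using n a by force
  qed (rule d(1))
qed

text \<open>The matrix entries of a contractive \<phi> are Lipschitz, so they converge along Cauchy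
  sequences. The extension is defined entrywise, and the algebraic laws pass to the limit.\<close>

lemma RFD_completionI:
  assumes "pre_RFD A"
  shows "RFD_algebra (star_alg_completion A)"
  unfolding RFD_algebra_def
proof (intro allI impI, elim conjE)
  let ?C = "star_alg_completion A"
  fix \<epsilon> :: real and \<Omega> assume e: "0 < \<epsilon>" and \<Omega>: "finite \<Omega>" "\<Omega> \<subseteq> carrier ?C"
  have "\<exists>x. x \<in> cauchy_seqs A \<and> P = cauchy_class x" if "P \<in> carrier ?C" for P
    using that quotient_cases[of P] by (auto simp: star_alg_completion_def)
  then obtain rep where rep: "\<And>P. P \<in> carrier ?C \<Longrightarrow> rep P \<in> cauchy_seqs A \<and> P = cauchy_class (rep P)" by metis
  \<comment> \<open>Each class is replaced by one member of its representative, close to the tail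
    and of almost the right norm; to these elements of the dense algebra the hypothesis
    applies.\<close>
  have "\<exists>N. (\<forall>n\<ge>N. vnorm A (rep P N - rep P n) < \<epsilon> / 4) \<and> \<bar>vnorm A (rep P N) - vnorm ?C P\<bar> < \<epsilon> / 4"
    if P: "P \<in> carrier ?C" for P
  proof -
    obtain N1 where N1: "\<forall>m\<ge>N1. \<forall>n\<ge>N1. vnorm A (rep P m - rep P n) < \<epsilon> / 4"
      using cauchyD[of "rep P" "\<epsilon> / 4"] rep[OF P] e by auto
    have "(\<lambda>n. vnorm A (rep P n)) \<longlonglongrightarrow> vnorm ?C P"
      using completion_norm_tendsto[of "rep P"] rep[OF P] by (simp add: star_alg_completion_def)
    then have "\<exists>N2. \<forall>n\<ge>N2. norm (vnorm A (rep P n) - vnorm ?C P) < \<epsilon> / 4"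
      by (rule LIMSEQ_D) (use e in simp)
    then obtain N2 where N2: "\<forall>n\<ge>N2. \<bar>vnorm A (rep P n) - vnorm ?C P\<bar> < \<epsilon> / 4" by auto
    show ?thesis using N1 N2 by (intro exI[of _ "max N1 N2"]) auto
  qed
  then obtain idx where idx: "\<And>P n. P \<in> carrier ?C \<Longrightarrow> n \<ge> idx P \<Longrightarrow> vnorm A (rep P (idx P) - rep P n) < \<epsilon> / 4"
    "\<And>P. P \<in> carrier ?C \<Longrightarrow> \<bar>vnorm A (rep P (idx P)) - vnorm ?C P\<bar> < \<epsilon> / 4" by metis
  define \<Omega>' where "\<Omega>' = (\<lambda>P. rep P (idx P)) ` \<Omega>"
  have "finite \<Omega>'" "\<Omega>' \<subseteq> carrier A" using \<Omega> rep cauchy_closed by (auto simp: \<Omega>'_def)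
  then obtain d \<phi> where d: "d \<ge> 1" and hom: "star_hom_mat A d \<phi>"
    and con: "\<And>a. a \<in> carrier A \<Longrightarrow> mat_norm (\<phi> a) \<le> vnorm A a"
    and low: "\<And>a. a \<in> \<Omega>' \<Longrightarrow> vnorm A a - \<epsilon> / 4 \<le> mat_norm (\<phi> a)"
    using assms e unfolding pre_RFD_def by (metis zero_less_divide_iff zero_less_numeral)
  have car: "\<phi> a \<in> carrier_mat d d" if "a \<in> carrier A" for a using hom that by (simp add: star_hom_mat_def)
  have add: "\<phi> (a + b) = \<phi> a + \<phi> b" if "a \<in> carrier A" "b \<in> carrier A" for a b
    using hom that by (simp add: star_hom_mat_def vadd_eq[symmetric])
  have df: "\<phi> (a - b) $$ (i, j) = \<phi> a $$ (i, j) - \<phi> b $$ (i, j)"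
    if "a \<in> carrier A" "b \<in> carrier A" "i < d" "j < d" for a b i j
    using add[of "a - b" b] that car[of "a - b"] car[of b] diff_closed[of a b] by simp
  have ent: "cmod (\<phi> a $$ (i, j) - \<phi> b $$ (i, j)) \<le> vnorm A (a - b)"
    if "a \<in> carrier A" "b \<in> carrier A" "i < d" "j < d" for a b i j
    using order_trans[OF mat_norm_entry[of i "\<phi> (a - b)" j] con[of "a - b"]] that
      car[of "a - b"] diff_closed[of a b] by (simp add: df)
  define \<Phi> where "\<Phi> = (\<lambda>P. mat d d (\<lambda>(i, j). lim (\<lambda>n. \<phi> (rep P n) $$ (i, j))))"
  \<comment> \<open>\<open>\<Phi>\<close> is defined by a chosen representative. Convergence along
    every representative allows the laws to be checked on termwise sums, products and
    adjoints.\<close>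
  have L: "(\<lambda>n. \<phi> (x n) $$ (i, j)) \<longlonglongrightarrow> \<Phi> (cauchy_class x) $$ (i, j)"
    if x: "x \<in> cauchy_seqs A" and ij: "i < d" "j < d" for x i j
  proof -
    let ?y = "rep (cauchy_class x)"
    have y: "?y \<in> cauchy_seqs A" "cauchy_class x = cauchy_class ?y"
      using rep[of "cauchy_class x"] x by (simp_all add: star_alg_completion_def cauchy_class_in_quotient)
    have "Cauchy (\<lambda>n. \<phi> (?y n) $$ (i, j))"
    proof (rule CauchyI)
      fix e :: real assume "0 < e"
      then obtain N where "\<forall>m\<ge>N. \<forall>n\<ge>N. vnorm A (?y m - ?y n) < e" using cauchyD[OF y(1)] by blast
      then show "\<exists>M. \<forall>m\<ge>M. \<forall>n\<ge>M. norm (\<phi> (?y m) $$ (i, j) - \<phi> (?y n) $$ (i, j)) < e"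
        using ent[OF cauchy_closed[OF y(1)] cauchy_closed[OF y(1)] ij] by (meson order_le_less_trans)
    qed
    then have "convergent (\<lambda>n. \<phi> (?y n) $$ (i, j))" by (rule Cauchy_convergent)
    then have l: "(\<lambda>n. \<phi> (?y n) $$ (i, j)) \<longlonglongrightarrow> \<Phi> (cauchy_class x) $$ (i, j)"
      using ij by (simp add: \<Phi>_def convergent_LIMSEQ_iff)
    have "(x, ?y) \<in> null_rel A" using cauchy_class_eq_iff[OF x y(1)] y(2) by simp
    then have n0: "(\<lambda>n. vnorm A (x n - ?y n)) \<longlonglongrightarrow> 0" by (simp add: null_rel_iff)
    have "(\<lambda>n. \<phi> (x n) $$ (i, j) - \<phi> (?y n) $$ (i, j)) \<longlonglongrightarrow> 0"
      by (rule Lim_null_comparison[OF _ n0])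
        (use ent[OF cauchy_closed[OF x] cauchy_closed[OF y(1)] ij] in simp)
    from tendsto_add[OF this l] show ?thesis by simp
  qed
  have Car: "\<Phi> P \<in> carrier_mat d d" for P by (simp add: \<Phi>_def)
  have Phi: "star_hom_mat ?C d \<Phi>"
    unfolding star_hom_mat_def
  proof (intro conjI ballI allI)
    fix P Q c assume P: "P \<in> carrier ?C"
    obtain x where x: "x \<in> cauchy_seqs A" "P = cauchy_class x" using rep[OF P] by blast
    note xc = cauchy_closed[OF x(1)]
    show "\<Phi> P \<in> carrier_mat d d" by (rule Car)
    have sc: "vscale ?C c P = cauchy_class (\<lambda>n. vscale A c (x n))" "(\<lambda>n. vscale A c (x n)) \<in> cauchy_seqs A"
      using lift1_vscale[OF x(1), of c] by (simp_all add: star_alg_completion_def x(2))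
    have st: "astar ?C P = cauchy_class (\<lambda>n. astar A (x n))" "(\<lambda>n. astar A (x n)) \<in> cauchy_seqs A"
      using lift1_astar[OF x(1)] by (simp_all add: star_alg_completion_def x(2))
    show "\<Phi> (vscale ?C c P) = c \<cdot>\<^sub>m \<Phi> P"
    proof (rule eq_matI)
      fix i j assume "i < dim_row (c \<cdot>\<^sub>m \<Phi> P)" "j < dim_col (c \<cdot>\<^sub>m \<Phi> P)"
      then have ij: "i < d" "j < d" using Car[of P] by auto
      have "\<phi> (vscale A c (x n)) $$ (i, j) = c * \<phi> (x n) $$ (i, j)" for n
        using hom xc[of n] car[OF xc[of n]] ij by (auto simp: star_hom_mat_def)
      then have "(\<lambda>n. \<phi> (vscale A c (x n)) $$ (i, j)) \<longlonglongrightarrow> c * \<Phi> P $$ (i, j)"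
        using tendsto_mult_left[OF L[OF x(1) ij], of c] by (simp add: x(2))
      with L[OF sc(2) ij] show "\<Phi> (vscale ?C c P) $$ (i, j) = (c \<cdot>\<^sub>m \<Phi> P) $$ (i, j)"
        using LIMSEQ_unique ij Car[of P] by (force simp: sc(1))
    qed (use Car[of P] Car[of "vscale ?C c P"] in auto)
    show "\<Phi> (astar ?C P) = mat_adjoint (\<Phi> P)"
    proof (rule eq_matI)
      fix i j assume "i < dim_row (mat_adjoint (\<Phi> P))" "j < dim_col (mat_adjoint (\<Phi> P))"
      then have ij: "i < d" "j < d" using adjoint_carrier[OF Car[of P]] by auto
      have "\<phi> (astar A (x n)) $$ (i, j) = cnj (\<phi> (x n) $$ (j, i))" for n
        using hom xc[of n] adjoint_index[OF car[OF xc[of n]] ij] by (auto simp: star_hom_mat_def)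
      then have "(\<lambda>n. \<phi> (astar A (x n)) $$ (i, j)) \<longlonglongrightarrow> cnj (\<Phi> P $$ (j, i))"
        using tendsto_cnj[OF L[OF x(1) ij(2,1)]] by (simp add: x(2))
      with L[OF st(2) ij] show "\<Phi> (astar ?C P) $$ (i, j) = mat_adjoint (\<Phi> P) $$ (i, j)"
        unfolding adjoint_index[OF Car ij] using LIMSEQ_unique by (force simp: st(1))
    qed (use adjoint_carrier[OF Car[of P]] Car[of "astar ?C P"] in auto)
    assume Q: "Q \<in> carrier ?C"
    obtain y where y: "y \<in> cauchy_seqs A" "Q = cauchy_class y" using rep[OF Q] by blast
    note yc = cauchy_closed[OF y(1)]
    have ad: "vadd ?C P Q = cauchy_class (\<lambda>n. x n + y n)" "(\<lambda>n. x n + y n) \<in> cauchy_seqs A"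
      using lift2_vadd[OF x(1) y(1)] by (simp_all add: star_alg_completion_def x(2) y(2))
    have mu: "amult ?C P Q = cauchy_class (\<lambda>n. amult A (x n) (y n))" "(\<lambda>n. amult A (x n) (y n)) \<in> cauchy_seqs A"
      using lift2_amult[OF x(1) y(1)] by (simp_all add: star_alg_completion_def x(2) y(2))
    show "\<Phi> (vadd ?C P Q) = \<Phi> P + \<Phi> Q"
    proof (rule eq_matI)
      fix i j assume "i < dim_row (\<Phi> P + \<Phi> Q)" "j < dim_col (\<Phi> P + \<Phi> Q)"
      then have ij: "i < d" "j < d" using Car[of Q] by auto
      have "\<phi> (x n + y n) $$ (i, j) = \<phi> (x n) $$ (i, j) + \<phi> (y n) $$ (i, j)" for n
        using add[OF xc[of n] yc[of n]] car[OF yc[of n]] ij by auto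
      then have "(\<lambda>n. \<phi> (x n + y n) $$ (i, j)) \<longlonglongrightarrow> \<Phi> P $$ (i, j) + \<Phi> Q $$ (i, j)"
        using tendsto_add[OF L[OF x(1) ij] L[OF y(1) ij]] by (simp add: x(2) y(2))
      with L[OF ad(2) ij] show "\<Phi> (vadd ?C P Q) $$ (i, j) = (\<Phi> P + \<Phi> Q) $$ (i, j)"
        using LIMSEQ_unique ij Car[of Q] by (force simp: ad(1))
    qed (use Car[of Q] Car[of "vadd ?C P Q"] in auto)
    show "\<Phi> (amult ?C P Q) = \<Phi> P * \<Phi> Q"
    proof (rule eq_matI)
      fix i j assume "i < dim_row (\<Phi> P * \<Phi> Q)" "j < dim_col (\<Phi> P * \<Phi> Q)"
      then have ij: "i < d" "j < d" using Car[of Q] Car[of P] by auto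
      have "\<phi> (amult A (x n) (y n)) $$ (i, j) = (\<Sum>k<d. \<phi> (x n) $$ (i, k) * \<phi> (y n) $$ (k, j))" for n
        using hom xc[of n] yc[of n] mat_mult_index[OF car[OF xc[of n]] car[OF yc[of n]] ij]
        by (simp add: star_hom_mat_def)
      moreover have "(\<lambda>n. \<Sum>k<d. \<phi> (x n) $$ (i, k) * \<phi> (y n) $$ (k, j)) \<longlonglongrightarrow>
          (\<Sum>k<d. \<Phi> P $$ (i, k) * \<Phi> Q $$ (k, j))"
        unfolding x(2) y(2) by (intro tendsto_sum tendsto_mult L x(1) y(1) ij) auto
      ultimately have "(\<lambda>n. \<phi> (amult A (x n) (y n)) $$ (i, j)) \<longlonglongrightarrow> (\<Sum>k<d. \<Phi> P $$ (i, k) * \<Phi> Q $$ (k, j))"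
        by simp
      moreover have "(\<Phi> P * \<Phi> Q) $$ (i, j) = (\<Sum>k<d. \<Phi> P $$ (i, k) * \<Phi> Q $$ (k, j))"
        by (rule mat_mult_index[OF Car Car ij])
      ultimately show "\<Phi> (amult ?C P Q) $$ (i, j) = (\<Phi> P * \<Phi> Q) $$ (i, j)"
        using LIMSEQ_unique[OF L[OF mu(2) ij]] by (simp add: mu(1))
    qed (use Car[of P] Car[of Q] Car[of "amult ?C P Q"] in auto)
  qed
  have "mat_norm (\<Phi> P) \<ge> vnorm ?C P - \<epsilon>" if "P \<in> \<Omega>" for P
  proof -
    have P: "P \<in> carrier ?C" using that \<Omega> by auto
    let ?x = "rep P"
    let ?a = "rep P (idx P)"
    have x: "?x \<in> cauchy_seqs A" "P = cauchy_class ?x" using rep[OF P] by auto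
    note xc = cauchy_closed[OF x(1)]
    have "(\<lambda>n. \<Sum>i<d. \<Sum>j<d. cmod (\<phi> (?x n) $$ (i, j) - \<Phi> P $$ (i, j))) \<longlonglongrightarrow> (\<Sum>i<d. \<Sum>j<d. 0)"
    proof (intro tendsto_sum)
      fix i j assume "i \<in> {..<d}" "j \<in> {..<d}"
      then have "(\<lambda>n. \<phi> (?x n) $$ (i, j)) \<longlonglongrightarrow> \<Phi> P $$ (i, j)" using L[OF x(1), of i j] x(2) by simp
      then show "(\<lambda>n. cmod (\<phi> (?x n) $$ (i, j) - \<Phi> P $$ (i, j))) \<longlonglongrightarrow> 0"
        by (simp add: LIM_zero tendsto_norm_zero)
    qed
    then have "\<forall>\<^sub>F n in sequentially. (\<Sum>i<d. \<Sum>j<d. cmod (\<phi> (?x n) $$ (i, j) - \<Phi> P $$ (i, j))) < \<epsilon> / 4"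
      by (rule order_tendstoD) (use e in simp)
    then obtain N where N: "\<And>n. n \<ge> N \<Longrightarrow> (\<Sum>i<d. \<Sum>j<d. cmod (\<phi> (?x n) $$ (i, j) - \<Phi> P $$ (i, j))) < \<epsilon> / 4"
      by (auto simp: eventually_sequentially)
    define n where "n = max N (idx P)"
    have "\<phi> ?a = \<phi> (?a - ?x n) + \<phi> (?x n)" using add[OF diff_closed[OF xc xc] xc, of "idx P" n n] by simp
    then have 1: "mat_norm (\<phi> ?a) \<le> mat_norm (\<phi> (?a - ?x n)) + mat_norm (\<phi> (?x n))"
      using mat_norm_add[OF car[OF diff_closed[OF xc xc]] car[OF xc]] by simp
    have 2: "mat_norm (\<phi> (?a - ?x n)) < \<epsilon> / 4"
      using con[OF diff_closed[OF xc xc], of "idx P" n] idx(1)[OF P, of n] by (simp add: n_def)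
    have cd: "\<phi> (?x n) - \<Phi> P \<in> carrier_mat d d" using minus_carrier_mat[OF Car] .
    have "(\<phi> (?x n) - \<Phi> P) + \<Phi> P = \<phi> (?x n)" using car[OF xc[of n]] Car[of P] by (intro eq_matI) auto
    then have 3: "mat_norm (\<phi> (?x n)) \<le> mat_norm (\<phi> (?x n) - \<Phi> P) + mat_norm (\<Phi> P)"
      using mat_norm_add[OF cd Car[of P]] by simp
    have "mat_norm (\<phi> (?x n) - \<Phi> P) \<le> (\<Sum>i<d. \<Sum>j<d. cmod (\<phi> (?x n) $$ (i, j) - \<Phi> P $$ (i, j)))"
      using mat_norm_le_sum[OF cd] car[OF xc[of n]] Car[of P] by simp
    then have 4: "mat_norm (\<phi> (?x n) - \<Phi> P) < \<epsilon> / 4" using N[of n] by (simp add: n_def)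
    have 5: "vnorm A ?a - \<epsilon> / 4 \<le> mat_norm (\<phi> ?a)" using low that by (simp add: \<Omega>'_def)
    \<comment> \<open>One quarter of \<open>\<epsilon>\<close> each for the norm of the approximant,
      its lower bound under \<open>\<phi>\<close>, its distance to the sequence, and the entrywise
      convergence.\<close>
    show ?thesis using 1 2 3 4 5 idx(2)[OF P] by linarith
  qed
  then show "\<exists>d\<ge>1. \<exists>\<phi>. star_hom_mat ?C d \<phi> \<and> (\<forall>a\<in>\<Omega>. mat_norm (\<phi> a) \<ge> vnorm ?C a - \<epsilon>)"
    using d Phi by blast
qed

lemma RFD_completion_iff: "RFD_algebra (star_alg_completion A) \<longleftrightarrow> pre_RFD A"
  using RFD_completionD RFD_completionI by blast

end

section \<open>Star-algebras normed by kernel representations\<close>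

text \<open>The norm enters as a least upper bound of kernel bounds, through
  \<open>kbounded_norm\<close> and \<open>norm_least\<close>; its metric properties then follow from
  the kernel calculus. The group algebra has a single kernel, the section algebra one for each point
  of \<open>X\<close>.\<close>

locale kernel_algebra =
  fixes A :: "('a::ab_group_add, 'm) star_alg_scheme"
    and I :: "'i set" and k :: "'i \<Rightarrow> 'a \<Rightarrow> 'j \<Rightarrow> 'j \<Rightarrow> complex"
  assumes vadd_eq: "\<And>x y. x \<in> carrier A \<Longrightarrow> y \<in> carrier A \<Longrightarrow> vadd A x y = x + y"
    and zero_closed: "0 \<in> carrier A"
    and add_closed: "\<And>x y. x \<in> carrier A \<Longrightarrow> y \<in> carrier A \<Longrightarrow> x + y \<in> carrier A"
    and scale_closed: "\<And>c x. x \<in> carrier A \<Longrightarrow> vscale A c x \<in> carrier A"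
    and scale_minus_one: "\<And>x. x \<in> carrier A \<Longrightarrow> vscale A (- 1) x = - x"
    and scale_add: "\<And>c x y. x \<in> carrier A \<Longrightarrow> y \<in> carrier A \<Longrightarrow>
      vscale A c (x + y) = vscale A c x + vscale A c y"
    and mult_closed: "\<And>x y. x \<in> carrier A \<Longrightarrow> y \<in> carrier A \<Longrightarrow> amult A x y \<in> carrier A"
    and star_closed: "\<And>x. x \<in> carrier A \<Longrightarrow> astar A x \<in> carrier A"
    and mult_add_left: "\<And>x y z. x \<in> carrier A \<Longrightarrow> y \<in> carrier A \<Longrightarrow> z \<in> carrier A \<Longrightarrow>
      amult A (x + y) z = amult A x z + amult A y z"
    and mult_add_right: "\<And>x y z. x \<in> carrier A \<Longrightarrow> y \<in> carrier A \<Longrightarrow> z \<in> carrier A \<Longrightarrow>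
      amult A z (x + y) = amult A z x + amult A z y"
    and star_add: "\<And>x y. x \<in> carrier A \<Longrightarrow> y \<in> carrier A \<Longrightarrow> astar A (x + y) = astar A x + astar A y"
    and k_row_col_finite: "\<And>i x. i \<in> I \<Longrightarrow> x \<in> carrier A \<Longrightarrow> row_col_finite (k i x)"
    and k_add: "\<And>i x y. i \<in> I \<Longrightarrow> x \<in> carrier A \<Longrightarrow> y \<in> carrier A \<Longrightarrow>
      k i (x + y) = (\<lambda>t r. k i x t r + k i y t r)"
    and k_scale: "\<And>i c x. i \<in> I \<Longrightarrow> x \<in> carrier A \<Longrightarrow> k i (vscale A c x) = (\<lambda>t r. c * k i x t r)"
    and k_mult: "\<And>i x y. i \<in> I \<Longrightarrow> x \<in> carrier A \<Longrightarrow> y \<in> carrier A \<Longrightarrow>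
      k i (amult A x y) = kmul (k i x) (k i y)"
    and k_star: "\<And>i x. i \<in> I \<Longrightarrow> x \<in> carrier A \<Longrightarrow> k i (astar A x) = kadj (k i x)"
    and norm_nonneg: "\<And>x. x \<in> carrier A \<Longrightarrow> 0 \<le> vnorm A x"
    and kbounded_norm: "\<And>i x. i \<in> I \<Longrightarrow> x \<in> carrier A \<Longrightarrow> kbounded (k i x) (vnorm A x)"
    and norm_least: "\<And>x C. x \<in> carrier A \<Longrightarrow> 0 \<le> C \<Longrightarrow> (\<And>i. i \<in> I \<Longrightarrow> kbounded (k i x) C) \<Longrightarrow> vnorm A x \<le> C"
begin

lemma k_zero: "i \<in> I \<Longrightarrow> k i 0 = (\<lambda>t r. 0)"
  using k_add[of i 0 0] zero_closed by (simp add: fun_eq_iff)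

lemma norm_scale: "x \<in> carrier A \<Longrightarrow> vnorm A (vscale A c x) = cmod c * vnorm A x"
proof (rule antisym)
  assume x: "x \<in> carrier A"
  show "vnorm A (vscale A c x) \<le> cmod c * vnorm A x"
    by (rule norm_least) (auto simp: x scale_closed norm_nonneg k_scale kbounded_scale kbounded_norm)
  show "cmod c * vnorm A x \<le> vnorm A (vscale A c x)"
  proof (cases "c = 0")
    case True
    then show ?thesis using norm_nonneg[OF scale_closed[OF x]] by simp
  next
    case False
    have "vnorm A x \<le> cmod (1 / c) * vnorm A (vscale A c x)"
    proof (rule norm_least[OF x])
      fix i assume i: "i \<in> I"
      have "kbounded (\<lambda>t r. 1 / c * k i (vscale A c x) t r) (cmod (1 / c) * vnorm A (vscale A c x))"
        by (intro kbounded_scale kbounded_norm i scale_closed x)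
      then show "kbounded (k i x) (cmod (1 / c) * vnorm A (vscale A c x))"
        using False by (simp add: k_scale[OF i x])
    qed (simp add: norm_nonneg scale_closed x)
    then show ?thesis using False by (simp add: norm_divide field_simps)
  qed
qed

sublocale pre_star_alg A
proof
  show "vnorm A 0 = 0"
    by (rule antisym[OF norm_least norm_nonneg]) (auto simp: zero_closed k_zero kbounded_def kapply_zero)
  fix x y assume x: "x \<in> carrier A" and y: "y \<in> carrier A"
  show "vnorm A (x + y) \<le> vnorm A x + vnorm A y"
    by (rule norm_least) (auto simp: x y add_closed norm_nonneg k_add k_row_col_finite intro!: kbounded_add kbounded_norm)
  show "vnorm A (amult A x y) \<le> vnorm A x * vnorm A y"
    by (rule norm_least) (auto simp: x y mult_closed norm_nonneg k_mult k_row_col_finite intro!: kbounded_kmul kbounded_norm)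
next
  fix x assume x: "x \<in> carrier A"
  show "vnorm A (astar A x) \<le> vnorm A x"
    by (rule norm_least) (auto simp: x star_closed norm_nonneg k_star k_row_col_finite intro!: kbounded_kadj kbounded_norm)
qed (simp_all add: vadd_eq zero_closed add_closed scale_closed scale_minus_one scale_add mult_closed
    star_closed mult_add_left mult_add_right star_add norm_nonneg norm_scale)

end

text \<open>Kernels over an arbitrary finite index set, so that \<open>Z \<times> {..<d}\<close> or
  a finite quotient group can serve as the index set without an enumeration.\<close>

definition fin_rep :: "('a::plus, 'm) star_alg_scheme \<Rightarrow> 'j set \<Rightarrow> ('a \<Rightarrow> 'j \<Rightarrow> 'j \<Rightarrow> complex) \<Rightarrow> bool" where
  "fin_rep A J k \<longleftrightarrow> finite J \<and>
    (\<forall>x\<in>carrier A. \<forall>i j. k x i j \<noteq> 0 \<longrightarrow> i \<in> J \<and> j \<in> J) \<and>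
    (\<forall>x\<in>carrier A. \<forall>y\<in>carrier A. k (x + y) = (\<lambda>i j. k x i j + k y i j)) \<and>
    (\<forall>c. \<forall>x\<in>carrier A. k (vscale A c x) = (\<lambda>i j. c * k x i j)) \<and>
    (\<forall>x\<in>carrier A. \<forall>y\<in>carrier A. k (amult A x y) = kmul (k x) (k y)) \<and>
    (\<forall>x\<in>carrier A. k (astar A x) = kadj (k x))"

lemma fin_rep_row_col_finite: "fin_rep A J k \<Longrightarrow> a \<in> carrier A \<Longrightarrow> row_col_finite (k a)"
  unfolding fin_rep_def by (rule row_col_finite_finite[of J]) blast+

lemma fin_rep_mult_star:
  "fin_rep A J k \<Longrightarrow> (\<And>x. x \<in> carrier A \<Longrightarrow> astar A x \<in> carrier A) \<Longrightarrow> a \<in> carrier A \<Longrightarrow>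
    k (amult A (astar A a) a) = kmul (kadj (k a)) (k a)"
  unfolding fin_rep_def by simp

lemma (in pre_star_alg) pre_RFD_fin_repI:
  assumes "\<And>\<epsilon> \<Omega>. \<epsilon> > 0 \<Longrightarrow> finite \<Omega> \<Longrightarrow> \<Omega> \<subseteq> carrier A \<Longrightarrow>
    \<exists>(J :: 'j set) k. fin_rep A J k \<and> (\<forall>a\<in>carrier A. kbounded (k a) (vnorm A a)) \<and>
      (\<forall>a\<in>\<Omega>. \<forall>C. kbounded (k a) C \<longrightarrow> vnorm A a - \<epsilon> \<le> C)"
  shows "pre_RFD A"
  unfolding pre_RFD_def
proof (intro allI impI, elim conjE)
  fix \<epsilon> :: real and \<Omega> assume "0 < \<epsilon>" and \<Omega>: "finite \<Omega>" "\<Omega> \<subseteq> carrier A"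
  from assms[OF this] obtain J :: "'j set" and k where rep: "fin_rep A J k"
    and up: "\<forall>a\<in>carrier A. kbounded (k a) (vnorm A a)"
    and low: "\<forall>a\<in>\<Omega>. \<forall>C. kbounded (k a) C \<longrightarrow> vnorm A a - \<epsilon> \<le> C"
    by (elim exE conjE)
  note r = rep[unfolded fin_rep_def]
  have J: "finite J" by (rule conjunct1[OF r])
  have sup: "\<And>x i j. x \<in> carrier A \<Longrightarrow> k x i j \<noteq> 0 \<Longrightarrow> i \<in> J \<and> j \<in> J"
    using conjunct1[OF conjunct2[OF r]] by blast
  define n where "n = card J"
  obtain h where h: "bij_betw h {0..<n} J" using ex_bij_betw_nat_finite[OF J] by (auto simp: n_def)
  \<comment> \<open>A zero row and a zero column are added, so the dimension is at least 1 even if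
    \<open>J\<close> is empty.\<close>
  define \<phi> where "\<phi> = (\<lambda>a. mat (Suc n) (Suc n) (\<lambda>(i, j). if i < n \<and> j < n then k a (h i) (h j) else 0))"
  have C: "\<phi> a \<in> carrier_mat (Suc n) (Suc n)" for a by (simp add: \<phi>_def)
  have ix: "\<phi> a $$ (i, j) = (if i < n \<and> j < n then k a (h i) (h j) else 0)" if "i < Suc n" "j < Suc n" for a i j
    using that by (simp add: \<phi>_def)
  have km: "kmat (\<phi> a) i j = (if i < n \<and> j < n then k a (h i) (h j) else 0)" for a i j
    by (auto simp: kmat_def \<phi>_def)
  have one: "kbounded (kmat (\<phi> a)) D" if "a \<in> carrier A" "kbounded (k a) D" for a D
    by (rule kbounded_reindex[OF J h sup[OF that(1)] _ _ that(2)]) (auto simp: km split: if_splits)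
  have two: "kbounded (k a) D" if "a \<in> carrier A" "kbounded (kmat (\<phi> a)) D" for a D
  proof (rule kbounded_reindex[OF _ bij_betw_the_inv_into[OF h] _ sup[OF that(1)] _ that(2)])
    fix i j assume "i \<in> J" "j \<in> J"
    then have "the_inv_into {0..<n} h i \<in> {0..<n}" "h (the_inv_into {0..<n} h i) = i"
      "the_inv_into {0..<n} h j \<in> {0..<n}" "h (the_inv_into {0..<n} h j) = j"
      using h by (auto simp: bij_betw_def f_the_inv_into_f dest: the_inv_into_into[OF _ _ order_refl])
    then show "k a i j = kmat (\<phi> a) (the_inv_into {0..<n} h i) (the_inv_into {0..<n} h j)"
      by (simp add: km)
  qed (auto simp: km split: if_splits)
  have hom: "star_hom_mat A (Suc n) \<phi>"
    unfolding star_hom_mat_def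
  proof (intro conjI ballI allI)
    fix a b c assume a: "a \<in> carrier A"
    show "\<phi> a \<in> carrier_mat (Suc n) (Suc n)" by (rule C)
    show "\<phi> (vscale A c a) = c \<cdot>\<^sub>m \<phi> a"
      using rep a by (intro eq_matI) (auto simp: \<phi>_def fin_rep_def)
    show "\<phi> (astar A a) = mat_adjoint (\<phi> a)"
    proof (rule eq_matI)
      fix i j assume "i < dim_row (mat_adjoint (\<phi> a))" "j < dim_col (mat_adjoint (\<phi> a))"
      then have ij: "i < Suc n" "j < Suc n" using adjoint_carrier[OF C[of a]] by auto
      show "\<phi> (astar A a) $$ (i, j) = mat_adjoint (\<phi> a) $$ (i, j)"
        using rep a by (auto simp: adjoint_index[OF C ij] ix[OF ij] ix[OF ij(2,1)] fin_rep_def kadj_def)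
    qed (use adjoint_carrier[OF C[of a]] C[of "astar A a"] in auto)
    assume b: "b \<in> carrier A"
    show "\<phi> (vadd A a b) = \<phi> a + \<phi> b"
      using rep a b by (intro eq_matI) (auto simp: \<phi>_def fin_rep_def vadd_eq)
    show "\<phi> (amult A a b) = \<phi> a * \<phi> b"
    proof (rule eq_matI)
      fix i j assume "i < dim_row (\<phi> a * \<phi> b)" "j < dim_col (\<phi> a * \<phi> b)"
      then have ij: "i < Suc n" "j < Suc n" using C[of a] C[of b] by auto
      have "(\<phi> a * \<phi> b) $$ (i, j) = (\<Sum>q<Suc n. \<phi> a $$ (i, q) * \<phi> b $$ (q, j))"
        by (rule mat_mult_index[OF C C ij])
      also have "\<dots> = (\<Sum>q\<in>{0..<n}. if i < n \<and> j < n then k a (h i) (h q) * k b (h q) (h j) else 0)"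
        by (rule sum.mono_neutral_cong_right) (use ij in \<open>auto simp: ix\<close>)
      also have "\<dots> = (\<Sum>q\<in>J. if i < n \<and> j < n then k a (h i) q * k b q (h j) else 0)"
        by (rule sum.reindex_bij_betw[OF h])
      also have "\<dots> = \<phi> (amult A a b) $$ (i, j)"
      proof -
        have "k (amult A a b) (h i) (h j) = (\<Sum>q\<in>J. k a (h i) q * k b q (h j))"
          using rep a b kmul_eq[OF J, of "k a" "h i" "k b" "h j"] sup[OF a] by (auto simp: fin_rep_def)
        then show ?thesis using ij by (cases "i < n"; cases "j < n") (simp_all add: ix)
      qed
      finally show "\<phi> (amult A a b) $$ (i, j) = (\<phi> a * \<phi> b) $$ (i, j)" ..
    qed (use C[of a] C[of b] C[of "amult A a b"] in auto)
  qed
  show "\<exists>d\<ge>1. \<exists>\<phi>. star_hom_mat A d \<phi> \<and> (\<forall>a\<in>carrier A. mat_norm (\<phi> a) \<le> vnorm A a) \<and>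
      (\<forall>a\<in>\<Omega>. vnorm A a - \<epsilon> \<le> mat_norm (\<phi> a))"
  proof (intro exI[of _ "Suc n"] exI[of _ \<phi>] conjI hom ballI)
    show "mat_norm (\<phi> a) \<le> vnorm A a" if "a \<in> carrier A" for a
      by (rule mat_norm_least[OF one]) (use up that in auto)
    show "vnorm A a - \<epsilon> \<le> mat_norm (\<phi> a)" if "a \<in> \<Omega>" for a
      using low that two[OF _ kbounded_mat_norm] \<Omega> by blast
  qed simp
qed

text \<open>Iterating b -> b* b raises C*-norms to the power 2^m. This is the device that removes
  constant factors.\<close>

definition star_square_iter :: "('a, 'm) star_alg_scheme \<Rightarrow> nat \<Rightarrow> 'a \<Rightarrow> 'a" where
  "star_square_iter A m = (\<lambda>b. amult A (astar A b) b) ^^ m"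

lemma star_square_iter_0 [simp]: "star_square_iter A 0 a = a"
  by (simp add: star_square_iter_def)

lemma star_square_iter_Suc: "star_square_iter A (Suc m) a = amult A (astar A (star_square_iter A m a)) (star_square_iter A m a)"
  by (simp add: star_square_iter_def)

lemma (in pre_star_alg) star_square_iter_closed: "a \<in> carrier A \<Longrightarrow> star_square_iter A m a \<in> carrier A"
  by (induction m) (simp_all add: star_square_iter_Suc mult_closed star_closed)

text \<open>Each of the m applications of \<open>kbounded_sqrt\<close> takes one square
  root.\<close>

lemma kbounded_star_square_iter_root:
  assumes closed: "\<And>m. star_square_iter A m a \<in> carrier A"
    and mult: "\<And>b. b \<in> carrier A \<Longrightarrow> k (amult A (astar A b) b) = kmul (kadj (k b)) (k b)"
    and row_col_finite: "\<And>b. b \<in> carrier A \<Longrightarrow> row_col_finite (k b)" and E: "0 \<le> E"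
  shows "kbounded (k (star_square_iter A m a)) (E ^ 2 ^ m) \<Longrightarrow> kbounded (k a) E"
proof (induction m)
  case (Suc m)
  have "kbounded (kmul (kadj (k (star_square_iter A m a))) (k (star_square_iter A m a))) ((E ^ 2 ^ m)\<^sup>2)"
    using Suc.prems by (simp add: star_square_iter_Suc mult[OF closed] power_mult[symmetric] mult.commute)
  then have "kbounded (k (star_square_iter A m a)) (E ^ 2 ^ m)"
    by (rule kbounded_sqrt[OF row_col_finite[OF closed]]) (simp add: E)
  then show ?case by (rule Suc.IH)
qed simp

lemma kbounded_star_square_iter_power:
  assumes closed: "\<And>m. star_square_iter A m a \<in> carrier A"
    and mult: "\<And>b. b \<in> carrier A \<Longrightarrow> k (amult A (astar A b) b) = kmul (kadj (k b)) (k b)"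
    and row_col_finite: "\<And>b. b \<in> carrier A \<Longrightarrow> row_col_finite (k b)" and E: "kbounded (k a) E"
  shows "kbounded (k (star_square_iter A m a)) (E ^ 2 ^ m)"
proof (induction m)
  case (Suc m)
  have "kbounded (kmul (kadj (k (star_square_iter A m a))) (k (star_square_iter A m a))) (E ^ 2 ^ m * E ^ 2 ^ m)"
    by (intro kbounded_kmul kbounded_kadj row_col_finite_kadj row_col_finite closed Suc.IH)
  then show ?case by (simp add: star_square_iter_Suc mult[OF closed] power_add[symmetric] mult_2)
qed (simp add: E)

text \<open>Exponential growth beats constants: a factor \<open>C\<close> independent of the
  exponent cannot bridge the gap between \<open>p\<close> and \<open>q\<close>.\<close>

lemma power_gap:
  fixes p q C :: real
  assumes "0 \<le> p" "p < q"
  shows "\<exists>m. C * p ^ 2 ^ m \<le> q ^ 2 ^ m"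
proof -
  have "(\<lambda>n. C * (p / q) ^ n) \<longlonglongrightarrow> C * 0"
    by (intro tendsto_mult tendsto_const LIMSEQ_power_zero) (use assms in simp)
  then have "\<forall>\<^sub>F n in sequentially. C * (p / q) ^ n < 1"
    by (rule order_tendstoD(2)) simp
  then obtain N where N: "\<And>n. n \<ge> N \<Longrightarrow> C * (p / q) ^ n < 1" by (auto simp: eventually_sequentially)
  have "C * (p / q) ^ 2 ^ N < 1" by (rule N) (simp add: less_imp_le)
  then show ?thesis using assms by (intro exI[of _ N]) (simp add: power_divide field_simps)
qed

section \<open>The group algebra\<close>

text \<open>The matrix of left convolution by \<open>c\<close>: the basis vector at r goes to the
  sum over s of c s times the basis vector at s r.\<close>

definition gker :: "('g, 'c) monoid_scheme \<Rightarrow> ('g \<Rightarrow> complex) \<Rightarrow> 'g \<Rightarrow> 'g \<Rightarrow> complex" where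
  "gker G c t r = (if t \<in> carrier G \<and> r \<in> carrier G then c (t \<otimes>\<^bsub>G\<^esub> inv\<^bsub>G\<^esub> r) else 0)"

context group
begin

lemma inv_cancel:
  assumes "x \<in> carrier G" "y \<in> carrier G"
  shows "inv x \<otimes> (x \<otimes> y) = y" "x \<otimes> (inv x \<otimes> y) = y"
  using assms by (simp_all add: m_assoc[symmetric])

lemma div_div: "t \<in> carrier G \<Longrightarrow> p \<in> carrier G \<Longrightarrow> t \<otimes> inv (inv p \<otimes> t) = p"
  by (simp add: inv_mult_group m_assoc[symmetric])

lemma div_div': "t \<in> carrier G \<Longrightarrow> q \<in> carrier G \<Longrightarrow> inv (t \<otimes> inv q) \<otimes> t = q"
  by (simp add: inv_mult_group m_assoc)

text \<open>The substitution p = t (inv q) passes between kernel entries and convolution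
  formulas.\<close>

lemma sum_div:
  assumes "t \<in> carrier G"
  shows "(\<Sum>q | q \<in> carrier G \<and> P (t \<otimes> inv q). F (t \<otimes> inv q) q) = (\<Sum>p | p \<in> carrier G \<and> P p. F p (inv p \<otimes> t))"
  by (rule sum.reindex_bij_witness[where i = "\<lambda>p. inv p \<otimes> t" and j = "\<lambda>q. t \<otimes> inv q"])
    (auto simp: div_div div_div' assms)

lemma finite_div:
  assumes "t \<in> carrier G" "finite {p. p \<in> carrier G \<and> P p}"
  shows "finite {q. q \<in> carrier G \<and> P (t \<otimes> inv q)}"
proof (rule finite_surj[OF assms(2), of _ "\<lambda>p. inv p \<otimes> t"], rule subsetI)
  fix q assume "q \<in> {q. q \<in> carrier G \<and> P (t \<otimes> inv q)}"
  then show "q \<in> (\<lambda>p. inv p \<otimes> t) ` {p. p \<in> carrier G \<and> P p}"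
    using assms(1) by (intro image_eqI[of _ _ "t \<otimes> inv q"]) (auto simp: div_div')
qed

lemma group_alg_carrier:
  "c \<in> carrier (group_alg G) \<longleftrightarrow> (\<forall>t. t \<notin> carrier G \<longrightarrow> c t = 0) \<and> finite {t. c t \<noteq> 0}"
  by (simp add: group_alg_def)

lemma gker_row: "t \<in> carrier G \<Longrightarrow> {q. gker G c t q \<noteq> 0} = {q. q \<in> carrier G \<and> c (t \<otimes> inv q) \<noteq> 0}"
  by (auto simp: gker_def)

lemma row_col_finite_gker:
  assumes c: "c \<in> carrier (group_alg G)"
  shows "row_col_finite (gker G c)"
  unfolding row_col_finite_def
proof (intro conjI allI)
  have f: "finite {p. p \<in> carrier G \<and> c p \<noteq> 0}" using c by (auto simp: group_alg_carrier intro: finite_subset)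
  fix t show "finite {r. gker G c t r \<noteq> 0}"
  proof (cases "t \<in> carrier G")
    case True
    then show ?thesis using finite_div[OF True f] by (simp add: gker_row)
  qed (simp add: gker_def)
next
  have f: "finite {p. p \<in> carrier G \<and> c p \<noteq> 0}" using c by (auto simp: group_alg_carrier intro: finite_subset)
  fix r show "finite {t. gker G c t r \<noteq> 0}"
  proof (cases "r \<in> carrier G")
    case True
    have "{t. gker G c t r \<noteq> 0} \<subseteq> (\<lambda>p. p \<otimes> r) ` {p. p \<in> carrier G \<and> c p \<noteq> 0}"
    proof
      fix t assume "t \<in> {t. gker G c t r \<noteq> 0}"
      then have "t \<in> carrier G" "c (t \<otimes> inv r) \<noteq> 0" by (auto simp: gker_def split: if_splits)
      then show "t \<in> (\<lambda>p. p \<otimes> r) ` {p. p \<in> carrier G \<and> c p \<noteq> 0}"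
        using True by (intro image_eqI[of _ _ "t \<otimes> inv r"]) (auto simp: m_assoc)
    qed
    then show ?thesis using f finite_surj by blast
  qed (simp add: gker_def)
qed

lemma gker_mult:
  assumes a: "a \<in> carrier (group_alg G)" and b: "b \<in> carrier (group_alg G)"
  shows "gker G (amult (group_alg G) a b) = kmul (gker G a) (gker G b)"
proof (intro ext)
  fix t r
  show "gker G (amult (group_alg G) a b) t r = kmul (gker G a) (gker G b) t r"
  proof (cases "t \<in> carrier G \<and> r \<in> carrier G")
    case True
    then have t: "t \<in> carrier G" and r: "r \<in> carrier G" by auto
    have "kmul (gker G a) (gker G b) t r =
        (\<Sum>q | q \<in> carrier G \<and> a (t \<otimes> inv q) \<noteq> 0. a (t \<otimes> inv q) * b (q \<otimes> inv r))"
      unfolding kmul_def gker_row[OF t] by (rule sum.cong) (auto simp: gker_def t r)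
    also have "\<dots> = (\<Sum>p | p \<in> carrier G \<and> a p \<noteq> 0. a p * b (inv p \<otimes> t \<otimes> inv r))"
      by (rule sum_div[OF t, where P = "\<lambda>p. a p \<noteq> 0" and F = "\<lambda>p q. a p * b (q \<otimes> inv r)"])
    also have "\<dots> = gker G (amult (group_alg G) a b) t r"
      unfolding gker_def group_alg_def using t r by (auto simp: m_assoc intro!: sum.cong)
    finally show ?thesis ..
  next
    case False
    then have "gker G a t q * gker G b q r = 0" for q by (auto simp: gker_def)
    then show ?thesis using False by (auto simp: kmul_def gker_def)
  qed
qed

lemma gker_star: "gker G (astar (group_alg G) a) = kadj (gker G a)"
  by (auto simp: gker_def kadj_def group_alg_def fun_eq_iff inv_mult_group)

lemma group_alg_mult_closed:
  assumes a: "a \<in> carrier (group_alg G)" and b: "b \<in> carrier (group_alg G)"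
  shows "amult (group_alg G) a b \<in> carrier (group_alg G)"
  unfolding group_alg_carrier
proof
  show "\<forall>t. t \<notin> carrier G \<longrightarrow> amult (group_alg G) a b t = 0" by (simp add: group_alg_def)
  have "{t. amult (group_alg G) a b t \<noteq> 0} \<subseteq> (\<lambda>(p, q). p \<otimes> q) ` ({t. a t \<noteq> 0} \<times> {t. b t \<noteq> 0})"
  proof
    fix s assume "s \<in> {t. amult (group_alg G) a b t \<noteq> 0}"
    then have s: "s \<in> carrier G" and "(\<Sum>t\<in>{t \<in> carrier G. a t \<noteq> 0}. a t * b (inv t \<otimes> s)) \<noteq> 0"
      by (auto simp: group_alg_def split: if_splits)
    then obtain t where t: "t \<in> carrier G" "a t \<noteq> 0" "b (inv t \<otimes> s) \<noteq> 0"
      by (elim sum.not_neutral_contains_not_neutral) auto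
    then show "s \<in> (\<lambda>(p, q). p \<otimes> q) ` ({t. a t \<noteq> 0} \<times> {t. b t \<noteq> 0})"
      using s by (intro image_eqI[of _ _ "(t, inv t \<otimes> s)"]) (auto simp: m_assoc[symmetric])
  qed
  then show "finite {t. amult (group_alg G) a b t \<noteq> 0}"
    by (rule finite_subset) (use a b in \<open>auto simp: group_alg_carrier\<close>)
qed

lemma group_alg_star_closed:
  assumes a: "a \<in> carrier (group_alg G)"
  shows "astar (group_alg G) a \<in> carrier (group_alg G)"
  unfolding group_alg_carrier
proof
  show "\<forall>t. t \<notin> carrier G \<longrightarrow> astar (group_alg G) a t = 0" by (simp add: group_alg_def)
  have "{t. astar (group_alg G) a t \<noteq> 0} \<subseteq> (\<lambda>p. inv p) ` {t. a t \<noteq> 0}"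
    by (auto simp: group_alg_def image_iff split: if_splits) (metis inv_inv)
  then show "finite {t. astar (group_alg G) a t \<noteq> 0}"
    by (rule finite_subset) (use a in \<open>auto simp: group_alg_carrier\<close>)
qed

lemma left_regular_eq:
  "t \<in> carrier G \<Longrightarrow> left_regular G c v t = (\<Sum>q | gker G c t q \<noteq> 0. gker G c t q * v q)"
proof -
  assume t: "t \<in> carrier G"
  have "(\<Sum>q | gker G c t q \<noteq> 0. gker G c t q * v q) =
      (\<Sum>q | q \<in> carrier G \<and> c (t \<otimes> inv q) \<noteq> 0. c (t \<otimes> inv q) * v q)"
    unfolding gker_row[OF t] by (rule sum.cong) (auto simp: gker_def t)
  also have "\<dots> = (\<Sum>p | p \<in> carrier G \<and> c p \<noteq> 0. c p * v (inv p \<otimes> t))"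
    by (rule sum_div[OF t, where P = "\<lambda>p. c p \<noteq> 0" and F = "\<lambda>p q. c p * v q"])
  finally show ?thesis using t by (simp add: left_regular_def)
qed

lemma left_regular_kapply:
  assumes "c \<in> carrier (group_alg G)" "fsupp v"
  shows "left_regular G c v = kapply (gker G c) v"
proof
  fix t show "left_regular G c v t = kapply (gker G c) v t"
    by (cases "t \<in> carrier G") (simp_all add: left_regular_eq kapply_alt[OF row_col_finite_gker[OF assms(1)] assms(2)],
      simp add: left_regular_def gker_def)
qed

lemma l2_norm_eq:
  assumes "fsupp v" "\<And>t. t \<notin> carrier G \<Longrightarrow> v t = 0"
  shows "v \<in> carrier (l2_group G)" "vnorm (l2_group G) v = nrm v"
proof -
  have f: "finite {t. v t \<noteq> 0}" using assms by (simp add: fsupp_def)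
  have "((\<lambda>t. (cmod (v t))\<^sup>2) summable_on carrier G) = ((\<lambda>t. (cmod (v t))\<^sup>2) summable_on {t. v t \<noteq> 0})"
    by (rule summable_on_cong_neutral) (use assms(2) in auto)
  then show "v \<in> carrier (l2_group G)" using f assms(2) by (simp add: l2_group_def)
  have "(\<Sum>\<^sub>\<infinity>t\<in>carrier G. (cmod (v t))\<^sup>2) = (\<Sum>\<^sub>\<infinity>t\<in>{t. v t \<noteq> 0}. (cmod (v t))\<^sup>2)"
    by (rule infsum_cong_neutral) (use assms(2) in auto)
  then show "vnorm (l2_group G) v = nrm v"
    using f by (simp add: l2_group_def nrm_def L2_set_def)
qed

text \<open>Finitely many output coordinates depend on finitely many coordinates of
  \<open>v\<close>, so the bound on finitely supported vectors extends to square-summable ones by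
  exhausting the sum.\<close>

lemma l2_bound:
  assumes c: "c \<in> carrier (group_alg G)" and bd: "kbounded (gker G c) C" and v: "v \<in> carrier (l2_group G)"
  shows "vnorm (l2_group G) (left_regular G c v) \<le> C * vnorm (l2_group G) v"
proof -
  let ?N = "\<Sum>\<^sub>\<infinity>t\<in>carrier G. (cmod (v t))\<^sup>2"
  have sv: "(\<lambda>t. (cmod (v t))\<^sup>2) summable_on carrier G" using v by (simp add: l2_group_def)
  have N0: "0 \<le> ?N" by (rule infsum_nonneg) simp
  have fb: "(\<Sum>t\<in>F. (cmod (left_regular G c v t))\<^sup>2) \<le> C\<^sup>2 * ?N" if F: "finite F" "F \<subseteq> carrier G" for F
  proof -
    define R where "R = (\<Union>t\<in>F. {r. gker G c t r \<noteq> 0})"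
    have R: "finite R" "R \<subseteq> carrier G"
      using F row_col_finite_gker[OF c] by (auto simp: R_def row_col_finite_def gker_def split: if_splits)
    define w where "w = (\<lambda>r. if r \<in> R then v r else 0)"
    have w: "fsupp w" by (rule fsupp_subset[OF R(1)]) (auto simp: w_def)
    have e: "left_regular G c v t = kapply (gker G c) w t" if "t \<in> F" for t
      unfolding kapply_alt[OF row_col_finite_gker[OF c] w]
      by (subst left_regular_eq) (use that F in \<open>auto simp: w_def R_def intro!: sum.cong\<close>)
    have fk: "fsupp (kapply (gker G c) w)" by (rule kapply_fsupp[OF row_col_finite_gker[OF c] w])
    have "(\<Sum>t\<in>F. (cmod (left_regular G c v t))\<^sup>2) = (\<Sum>t\<in>F. (cmod (kapply (gker G c) w t))\<^sup>2)"
      by (rule sum.cong) (auto simp: e)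
    also have "\<dots> \<le> (\<Sum>t\<in>F \<union> {t. kapply (gker G c) w t \<noteq> 0}. (cmod (kapply (gker G c) w t))\<^sup>2)"
      by (rule sum_mono2) (use F fk in \<open>auto simp: fsupp_def\<close>)
    also have "\<dots> = (nrm (kapply (gker G c) w))\<^sup>2"
      by (rule nrm_sq[symmetric]) (use F fk in \<open>auto simp: fsupp_def\<close>)
    also have "\<dots> \<le> (C * nrm w)\<^sup>2" by (rule power_mono[OF kbdD[OF bd w]]) simp
    also have "\<dots> = C\<^sup>2 * (nrm w)\<^sup>2" by (simp add: power_mult_distrib)
    also have "(nrm w)\<^sup>2 = (\<Sum>t\<in>R. (cmod (w t))\<^sup>2)"
      by (rule nrm_sq[OF R(1)]) (auto simp: w_def)
    also have "\<dots> = (\<Sum>t\<in>R. (cmod (v t))\<^sup>2)" by (rule sum.cong) (auto simp: w_def)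
    also have "\<dots> \<le> ?N" by (rule finite_sum_le_infsum[OF sv R]) simp
    finally show ?thesis by (simp add: mult_left_mono)
  qed
  have sm: "(\<lambda>t. (cmod (left_regular G c v t))\<^sup>2) summable_on carrier G"
    by (rule nonneg_bdd_above_summable_on) (use fb in \<open>auto simp: bdd_above_def\<close>)
  have "(\<Sum>\<^sub>\<infinity>t\<in>carrier G. (cmod (left_regular G c v t))\<^sup>2) \<le> C\<^sup>2 * ?N"
    by (rule infsum_le_finite_sums[OF sm fb])
  then have "sqrt (\<Sum>\<^sub>\<infinity>t\<in>carrier G. (cmod (left_regular G c v t))\<^sup>2) \<le> sqrt (C\<^sup>2 * ?N)" by simp
  then show ?thesis using kbounded_nonneg[OF bd] by (simp add: l2_group_def real_sqrt_mult)
qed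

text \<open>The defining supremum runs over square-summable vectors, kernel bounds over finitely
  supported ones. One comparison is \<open>l2_bound\<close>; the other restricts the supremum to
  finitely supported vectors in the unit ball.\<close>

lemma gker_norm:
  assumes c: "c \<in> carrier (group_alg G)"
  shows "kbounded (gker G c) (vnorm (group_alg G) c)"
    "\<And>C. kbounded (gker G c) C \<Longrightarrow> vnorm (group_alg G) c \<le> C" "0 \<le> vnorm (group_alg G) c"
proof -
  let ?S = "{vnorm (l2_group G) (left_regular G c v) | v. v \<in> carrier (l2_group G) \<and> vnorm (l2_group G) v \<le> 1}"
  have op: "vnorm (group_alg G) c = Sup ?S" by (simp add: group_alg_def op_norm_def)
  have le: "s \<le> C" if "kbounded (gker G c) C" "s \<in> ?S" for s C
    using that l2_bound[OF c that(1)] kbounded_nonneg[OF that(1)] by auto (meson mult_left_le order_trans)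
  have mem: "nrm (kapply (gker G c) v) \<in> ?S" if "fsupp v" "\<And>t. t \<notin> carrier G \<Longrightarrow> v t = 0" "nrm v \<le> 1" for v
  proof -
    have "kapply (gker G c) v t = 0" if "t \<notin> carrier G" for t using that by (simp add: kapply_def gker_def)
    then have "vnorm (l2_group G) (left_regular G c v) = nrm (kapply (gker G c) v)"
      unfolding left_regular_kapply[OF c that(1)] by (intro l2_norm_eq kapply_fsupp row_col_finite_gker c that(1))
    then show ?thesis using l2_norm_eq[of v] that by (auto intro!: exI[of _ v])
  qed
  have zero: "0 \<in> ?S" using mem[of "\<lambda>_. 0"] unfolding kapply_zero_right by simp
  show "vnorm (group_alg G) c \<le> C" if "kbounded (gker G c) C" for C
    unfolding op by (rule cSup_least) (use zero le[OF that] in auto)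
  \<comment> \<open>The l1-norm of \<open>c\<close> is an a priori bound, which makes the supremum
    finite.\<close>
  have "kbounded (gker G c) (\<Sum>s | c s \<noteq> 0. cmod (c s))"
  proof -
    have fin: "finite {s. c s \<noteq> 0}" using c by (simp add: group_alg_carrier)
    have sub: "s \<in> carrier G" if "c s \<noteq> 0" for s using c that by (auto simp: group_alg_carrier)
    let ?L = "\<lambda>t r. \<Sum>s | c s \<noteq> 0. if t \<in> carrier G \<and> r = inv s \<otimes> t then c s else 0"
    have "gker G c t r = ?L t r" for t r
    proof (cases "t \<in> carrier G \<and> r \<in> carrier G")
      case True
      have "?L t r = (\<Sum>s | c s \<noteq> 0. if s = t \<otimes> inv r then c s else 0)"
        by (rule sum.cong) (use True sub in \<open>auto simp: div_div div_div'\<close>)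
      then show ?thesis using True by (simp add: fin gker_def)
    next
      case False
      then have "?L t r = 0" using sub by (intro sum.neutral) auto
      then show ?thesis using False by (auto simp: gker_def)
    qed
    then have "gker G c = ?L" by (intro ext)
    moreover have "kbounded ?L (\<Sum>s | c s \<noteq> 0. cmod (c s))"
      by (intro conjunct1[OF kbounded_translates] fin) (auto intro!: inj_onI dest: sub)
    ultimately show ?thesis by simp
  qed
  then obtain C where C: "kbounded (gker G c) C" by blast
  have ub: "s \<le> vnorm (group_alg G) c" if "s \<in> ?S" for s
    unfolding op by (rule cSup_upper[OF that]) (use le[OF C] in \<open>auto simp: bdd_above_def\<close>)
  show nn: "0 \<le> vnorm (group_alg G) c" by (rule ub[OF zero])
  show "kbounded (gker G c) (vnorm (group_alg G) c)"
    unfolding kbounded_def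
  proof (intro conjI allI impI nn)
    fix \<xi> :: "'a \<Rightarrow> complex" assume \<xi>: "fsupp \<xi>"
    define \<zeta> where "\<zeta> = (\<lambda>t. if t \<in> carrier G then \<xi> t else 0)"
    have z: "fsupp \<zeta>" "nrm \<zeta> \<le> nrm \<xi>"
      unfolding \<zeta>_def by (rule fsupp_restrict[OF \<xi>], rule nrm_restrict[OF \<xi>])
    have k: "kapply (gker G c) \<xi> = kapply (gker G c) \<zeta>"
      unfolding kapply_alt[OF row_col_finite_gker[OF c] \<xi>, abs_def] kapply_alt[OF row_col_finite_gker[OF c] z(1), abs_def]
      by (auto simp: \<zeta>_def gker_def fun_eq_iff intro!: sum.cong split: if_splits)
    show "nrm (kapply (gker G c) \<xi>) \<le> vnorm (group_alg G) c * nrm \<xi>"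
    proof (cases "nrm \<zeta> = 0")
      case True
      then have "\<zeta> = (\<lambda>_. 0)" using nrm_eq_0_iff[OF z(1)] by simp
      then have "kapply (gker G c) \<xi> = (\<lambda>_. 0)" by (simp add: k kapply_def fun_eq_iff)
      then show ?thesis using nn by simp
    next
      case False
      then have p: "nrm \<zeta> > 0" using nrm_nonneg[of \<zeta>] by linarith
      define d where "d = complex_of_real (1 / nrm \<zeta>)"
      have cd: "cmod d = 1 / nrm \<zeta>" "d \<noteq> 0" using p by (simp_all add: d_def norm_divide)
      have "nrm (kapply (gker G c) (\<lambda>t. d * \<zeta> t)) \<in> ?S"
      proof (rule mem)
        show "nrm (\<lambda>t. d * \<zeta> t) \<le> 1" unfolding nrm_scale cd(1) using p by simp
        show "d * \<zeta> t = 0" if "t \<notin> carrier G" for t using that by (simp add: \<zeta>_def)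
      qed (rule fsupp_scale[OF z(1)])
      moreover have "kapply (gker G c) (\<lambda>t. d * \<zeta> t) = (\<lambda>t. d * kapply (gker G c) \<zeta> t)"
        using cd(2) by (auto simp: kapply_def fun_eq_iff sum_distrib_left mult_ac)
      ultimately have "1 / nrm \<zeta> * nrm (kapply (gker G c) \<zeta>) \<le> vnorm (group_alg G) c"
        using ub by (fastforce simp: nrm_scale cd)
      then have "nrm (kapply (gker G c) \<zeta>) \<le> vnorm (group_alg G) c * nrm \<zeta>" using p by (simp add: field_simps)
      also have "\<dots> \<le> vnorm (group_alg G) c * nrm \<xi>" by (rule mult_left_mono[OF z(2) nn])
      finally show ?thesis by (simp add: k)
    qed
  qed
qed

lemma group_kernel_algebra: "kernel_algebra (group_alg G) {()} (\<lambda>_. gker G)"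
proof
  fix x y z :: "'a \<Rightarrow> complex" and c
  show "0 \<in> carrier (group_alg G)" by (simp add: group_alg_carrier)
  assume x: "x \<in> carrier (group_alg G)"
  show "vscale (group_alg G) c x \<in> carrier (group_alg G)"
    using x by (auto simp: group_alg_carrier) (auto simp: group_alg_def intro: finite_subset)
  show "vscale (group_alg G) (- 1) x = - x" by (simp add: group_alg_def fun_eq_iff)
  show "astar (group_alg G) x \<in> carrier (group_alg G)" by (rule group_alg_star_closed[OF x])
  show "row_col_finite (gker G x)" by (rule row_col_finite_gker[OF x])
  show "gker G (vscale (group_alg G) c x) = (\<lambda>t r. c * gker G x t r)"
    by (auto simp: gker_def group_alg_def fun_eq_iff)
  show "gker G (astar (group_alg G) x) = kadj (gker G x)" by (rule gker_star)
  show "0 \<le> vnorm (group_alg G) x" "kbounded (gker G x) (vnorm (group_alg G) x)" by (rule gker_norm[OF x])+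
  assume y: "y \<in> carrier (group_alg G)"
  show "vadd (group_alg G) x y = x + y" by (simp add: group_alg_def fun_eq_iff)
  show "x + y \<in> carrier (group_alg G)"
    using x y by (auto simp: group_alg_carrier intro: finite_subset[of _ "{t. x t \<noteq> 0} \<union> {t. y t \<noteq> 0}"])
  show "vscale (group_alg G) c (x + y) = vscale (group_alg G) c x + vscale (group_alg G) c y"
    by (simp add: group_alg_def fun_eq_iff algebra_simps)
  show "amult (group_alg G) x y \<in> carrier (group_alg G)" by (rule group_alg_mult_closed[OF x y])
  show "astar (group_alg G) (x + y) = astar (group_alg G) x + astar (group_alg G) y"
    by (simp add: group_alg_def fun_eq_iff)
  show "gker G (x + y) = (\<lambda>t r. gker G x t r + gker G y t r)" by (auto simp: gker_def fun_eq_iff)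
  show "gker G (amult (group_alg G) x y) = kmul (gker G x) (gker G y)" by (rule gker_mult[OF x y])
  assume z: "z \<in> carrier (group_alg G)"
  have f: "finite {t \<in> carrier G. x t \<noteq> 0}" "finite {t \<in> carrier G. y t \<noteq> 0}"
    using x y by (auto simp: group_alg_carrier intro: finite_subset)
  \<comment> \<open>The product sums over the support of its left factor, which changes under
    addition; all three products are therefore written over the union of the two supports.\<close>
  have m: "amult (group_alg G) w z s = (if s \<in> carrier G then \<Sum>t\<in>{t \<in> carrier G. x t \<noteq> 0} \<union> {t \<in> carrier G. y t \<noteq> 0}. w t * z (inv t \<otimes> s) else 0)"
    if "\<And>t. x t = 0 \<Longrightarrow> y t = 0 \<Longrightarrow> w t = 0" for w s
    unfolding group_alg_def using f that by (auto intro!: sum.mono_neutral_left)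
  show "amult (group_alg G) (x + y) z = amult (group_alg G) x z + amult (group_alg G) y z"
  proof
    fix s
    have e: "amult (group_alg G) x z s = (if s \<in> carrier G then \<Sum>t\<in>{t \<in> carrier G. x t \<noteq> 0} \<union> {t \<in> carrier G. y t \<noteq> 0}. x t * z (inv t \<otimes> s) else 0)"
      "amult (group_alg G) y z s = (if s \<in> carrier G then \<Sum>t\<in>{t \<in> carrier G. x t \<noteq> 0} \<union> {t \<in> carrier G. y t \<noteq> 0}. y t * z (inv t \<otimes> s) else 0)"
      "amult (group_alg G) (x + y) z s = (if s \<in> carrier G then \<Sum>t\<in>{t \<in> carrier G. x t \<noteq> 0} \<union> {t \<in> carrier G. y t \<noteq> 0}. (x + y) t * z (inv t \<otimes> s) else 0)"
      by (rule m; simp)+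
    show "amult (group_alg G) (x + y) z s = (amult (group_alg G) x z + amult (group_alg G) y z) s"
      unfolding plus_fun_apply[of "amult (group_alg G) x z"] e by (simp add: sum.distrib algebra_simps)
  qed
  show "amult (group_alg G) z (x + y) = amult (group_alg G) z x + amult (group_alg G) z y"
    by (auto simp: group_alg_def fun_eq_iff sum.distrib algebra_simps)
next
  fix x C assume "x \<in> carrier (group_alg G)" "\<And>i :: unit. i \<in> {()} \<Longrightarrow> kbounded (gker G x) C"
  then show "vnorm (group_alg G) x \<le> C" using gker_norm(2) by blast
qed

end

section \<open>Partial actions and their section algebras\<close>

locale partial_act = group G for G :: "('g, 'c) monoid_scheme" (structure) +
  fixes X :: "'x set" and U :: "'g \<Rightarrow> 'x set" and \<theta> :: "'g \<Rightarrow> 'x \<Rightarrow> 'x"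
  assumes pact: "partial_action G X U \<theta>"
begin

lemma U_sub: "t \<in> carrier G \<Longrightarrow> x \<in> U t \<Longrightarrow> x \<in> X"
  using pact by (auto simp: partial_action_def)

lemma th_in: "t \<in> carrier G \<Longrightarrow> x \<in> U (inv t) \<Longrightarrow> \<theta> t x \<in> U t"
  using pact by (auto simp: partial_action_def)

lemma U_one: "U \<one> = X"
  using pact by (auto simp: partial_action_def)

lemma th_one: "x \<in> X \<Longrightarrow> \<theta> \<one> x = x"
  using pact by (auto simp: partial_action_def)

lemma th_comp:
  assumes "s \<in> carrier G" "t \<in> carrier G" "x \<in> U (inv t)" "\<theta> t x \<in> U (inv s)"
  shows "x \<in> U (inv (s \<otimes> t))" "\<theta> (s \<otimes> t) x = \<theta> s (\<theta> t x)"
  using pact assms unfolding partial_action_def by blast+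

lemma th_inv: "t \<in> carrier G \<Longrightarrow> x \<in> U (inv t) \<Longrightarrow> \<theta> (inv t) (\<theta> t x) = x"
  using th_comp(2)[of "inv t" t x] th_in[of t x] th_one[of x] U_sub[of "inv t" x] by simp

lemma th_inv_in: "t \<in> carrier G \<Longrightarrow> x \<in> U t \<Longrightarrow> \<theta> (inv t) x \<in> U (inv t)"
  using th_in[of "inv t" x] by simp

lemma th_inv': "t \<in> carrier G \<Longrightarrow> x \<in> U t \<Longrightarrow> \<theta> t (\<theta> (inv t) x) = x"
  using th_inv[of "inv t" x] by simp

text \<open>Composing with r (inv t) shows that the orbit of \<open>\<theta> t x\<close> is the
  orbit of x with shifted indices. Orbit kernels are compatible with adjoints for this
  reason.\<close>

lemma th_div:
  assumes "t \<in> carrier G" "r \<in> carrier G" "x \<in> U (inv t)"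
  shows "\<theta> t x \<in> U (t \<otimes> inv r) \<longleftrightarrow> x \<in> U (inv r)"
    "x \<in> U (inv r) \<Longrightarrow> \<theta> (r \<otimes> inv t) (\<theta> t x) = \<theta> r x"
proof -
  have i: "inv (r \<otimes> inv t) = t \<otimes> inv r" "r \<otimes> inv t \<otimes> t = r"
    using assms by (simp_all add: inv_mult_group m_assoc)
  have y: "\<theta> t x \<in> U t" "\<theta> (inv t) (\<theta> t x) = x" using th_in th_inv assms by auto
  show "\<theta> t x \<in> U (t \<otimes> inv r) \<longleftrightarrow> x \<in> U (inv r)"
    using th_comp(1)[of "r \<otimes> inv t" t x] th_comp(1)[of r "inv t" "\<theta> t x"] assms i y by auto
  show "\<theta> (r \<otimes> inv t) (\<theta> t x) = \<theta> r x" if "x \<in> U (inv r)"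
    using th_comp(2)[of r "inv t" "\<theta> t x"] assms y that by simp
qed

text \<open>Going back by \<open>\<theta> (inv s)\<close> and then by
  \<open>\<theta> (inv t)\<close> gives a point x with y = \<theta> s (\<theta> t x), so y is in the
  range of the map of s t.\<close>

lemma th_mult_in:
  assumes "s \<in> carrier G" "t \<in> carrier G" "y \<in> U s" "\<theta> (inv s) y \<in> U t"
  shows "y \<in> U (s \<otimes> t)"
proof -
  let ?z = "\<theta> (inv s) y"
  let ?x = "\<theta> (inv t) ?z"
  have x: "?x \<in> U (inv t)" "\<theta> t ?x = ?z" using th_inv_in th_inv' assms by auto
  have z: "?z \<in> U (inv s)" "\<theta> s ?z = y" using th_inv_in th_inv' assms by auto
  show ?thesis using th_comp[of s t ?x] th_in[of "s \<otimes> t" ?x] assms x z by simp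
qed

lemma th_left:
  assumes "p \<in> carrier G" "t \<in> carrier G" "x \<in> U (inv t)" "\<theta> t x \<in> U p"
  shows "x \<in> U (inv (inv p \<otimes> t))" "\<theta> (inv p \<otimes> t) x = \<theta> (inv p) (\<theta> t x)"
  using th_comp[of "inv p" t x] assms by auto

end

lemma sum_apply: "(\<Sum>i\<in>S. f i) x = (\<Sum>i\<in>S. f i x)"
  by (induction S rule: infinite_finite_induct) auto

locale cont_partial_act = group G for G :: "('g, 'c) monoid_scheme" (structure) +
  fixes X :: "'x::metric_space set" and U :: "'g \<Rightarrow> 'x set" and \<theta> :: "'g \<Rightarrow> 'x \<Rightarrow> 'x"
  assumes cX: "compact X" and cpa: "continuous_partial_action G X U \<theta>"
begin

sublocale partial_act
  by unfold_locales (use cpa in \<open>simp add: continuous_partial_action_def\<close>)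

abbreviation B where "B \<equiv> action_bundle G X U \<theta>"
abbreviation D where "D \<equiv> dual_ideal X U"

lemma U_open: "t \<in> carrier G \<Longrightarrow> openin (top_of_set X) (U t)"
  using cpa by (simp add: continuous_partial_action_def)

lemma th_cont: "t \<in> carrier G \<Longrightarrow> continuous_on (U (inv t)) (\<theta> t)"
  using cpa by (force simp: continuous_partial_action_def homeomorphism_def)

section \<open>The fibres: continuous functions vanishing off \<open>U t\<close>, and the dual
  action on them\<close>

lemma D_iff: "f \<in> D t \<longleftrightarrow> continuous_on X f \<and> (\<forall>x. x \<notin> X \<longrightarrow> f x = 0) \<and> (\<forall>x. x \<notin> U t \<longrightarrow> f x = 0)"
  by (auto simp: dual_ideal_def CX_def)

lemma D_bounded: "f \<in> D t \<Longrightarrow> \<exists>M\<ge>0. \<forall>x. cmod (f x) \<le> M"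
proof -
  assume f: "f \<in> D t"
  have "compact (f ` X)" using f cX by (intro compact_continuous_image) (auto simp: D_iff)
  then obtain M where M: "\<forall>y\<in>f ` X. norm y \<le> M" using compact_imp_bounded bounded_iff by blast
  have "cmod (f x) \<le> max M 0" for x using M f by (cases "x \<in> X") (auto simp: D_iff max.coboundedI1)
  then show ?thesis by (intro exI[of _ "max M 0"]) auto
qed

lemma D_zero: "0 \<in> D t"
  by (simp add: D_iff zero_fun_def)

lemma D_add: "f \<in> D t \<Longrightarrow> g \<in> D t \<Longrightarrow> f + g \<in> D t"
  by (auto simp: D_iff plus_fun_def intro: continuous_on_add)

lemma D_sum: "(\<And>i. i \<in> S \<Longrightarrow> f i \<in> D t) \<Longrightarrow> (\<Sum>i\<in>S. f i) \<in> D t"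
  by (induction S rule: infinite_finite_induct) (auto intro: D_zero D_add)

lemma D_scale: "f \<in> D t \<Longrightarrow> (\<lambda>x. c * f x) \<in> D t"
  by (auto simp: D_iff intro: continuous_intros)

text \<open>Continuity is delicate only outside the open set \<open>U t\<close>. There the function
  is small because the set where |f| is at least e is compact, so its image under
  \<open>\<theta> t\<close> is closed and contained in \<open>U t\<close>.\<close>

lemma D_dual_action:
  assumes t: "t \<in> carrier G" and f: "f \<in> D (inv t)"
  shows "dual_action G U \<theta> t f \<in> D t"
proof -
  let ?g = "dual_action G U \<theta> t f"
  have fc: "continuous_on X f" using f by (simp add: D_iff)
  have thc: "continuous_on (U t) (\<theta> (inv t))" using th_cont[of "inv t"] t by simp
  have Ut: "U t \<subseteq> X" using U_sub t by auto
  have gc: "continuous_on (U t) ?g"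
  proof (rule continuous_on_eq)
    show "continuous_on (U t) (f \<circ> \<theta> (inv t))"
      by (rule continuous_on_compose[OF thc continuous_on_subset[OF fc]])
        (use th_inv_in[OF t] U_sub[of "inv t"] t in auto)
  qed (simp add: dual_action_def)
  have "continuous_on X ?g"
    unfolding continuous_on_eq_continuous_within
  proof
    fix y assume y: "y \<in> X"
    show "continuous (at y within X) ?g"
    proof (cases "y \<in> U t")
      case True
      have "continuous (at y within U t) ?g" using gc True by (simp add: continuous_on_eq_continuous_within)
      moreover have "at y within X = at y within U t"
      proof -
        obtain V where V: "open V" "U t = X \<inter> V" using U_open[OF t] by (auto simp: openin_open)
        show ?thesis by (rule at_within_nhd[of y V]) (use True V in auto)
      qed
      ultimately show ?thesis by simp
    next
      case False
      then have gy: "?g y = 0" by (simp add: dual_action_def)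
      show ?thesis unfolding continuous_within gy
      proof (rule tendstoI)
        fix e :: real assume e: "e > 0"
        define K where "K = \<theta> t ` {x \<in> X. e \<le> cmod (f x)}"
        have "closedin (top_of_set X) (X \<inter> (\<lambda>x. cmod (f x)) -` {e..})"
          by (rule continuous_closedin_preimage) (auto intro: continuous_intros fc)
        then have "compact (X \<inter> (\<lambda>x. cmod (f x)) -` {e..})" using cX closedin_compact by blast
        moreover have eq: "X \<inter> (\<lambda>x. cmod (f x)) -` {e..} = {x \<in> X. e \<le> cmod (f x)}" by auto
        ultimately have cK: "compact {x \<in> X. e \<le> cmod (f x)}" by simp
        have sub: "{x \<in> X. e \<le> cmod (f x)} \<subseteq> U (inv t)"
          using f e by (auto simp: D_iff)
        have "compact K" unfolding K_def
          by (rule compact_continuous_image[OF continuous_on_subset[OF th_cont[OF t] sub] cK])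
        then have "open (- K)" by (simp add: compact_imp_closed open_Compl)
        moreover have "y \<in> - K" using False sub th_in[OF t] by (auto simp: K_def)
        ultimately have "\<forall>\<^sub>F x in nhds y. x \<in> - K" by (rule eventually_nhds_in_open)
        then have "\<forall>\<^sub>F x in at y within X. x \<in> - K" by (simp add: eventually_at_filter eventually_mono)
        then show "\<forall>\<^sub>F x in at y within X. dist (?g x) 0 < e"
        proof eventually_elim
          case (elim x)
          show "dist (?g x) 0 < e"
          proof (cases "x \<in> U t")
            case True
            then have "x = \<theta> t (\<theta> (inv t) x)" "\<theta> (inv t) x \<in> X"
              using th_inv'[OF t] th_inv_in[OF t] U_sub[of "inv t"] t by auto
            then have "\<not> e \<le> cmod (f (\<theta> (inv t) x))" using elim by (auto simp: K_def)
            then show ?thesis using True by (simp add: dual_action_def)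
          qed (use e in \<open>simp add: dual_action_def\<close>)
        qed
      qed
    qed
  qed
  then show ?thesis using Ut by (auto simp: D_iff dual_action_def)
qed

lemma fib_B: "fib B = D" and fscale_B: "fscale B c f = (\<lambda>x. c * f x)"
  by (simp_all add: action_bundle_def)

text \<open>The outer dual action undoes the inner one on the first factor, so only the second
  factor is transported. The kernel computations rest on this pointwise form.\<close>

lemma fmult_B:
  assumes "s \<in> carrier G"
  shows "fmult B s a t b y = (if y \<in> U s then a y * b (\<theta> (inv s) y) else 0)"
  using assms th_inv_in[of s y] th_inv'[of s y] by (simp add: action_bundle_def dual_action_def)

lemma fmult_closed:
  assumes s: "s \<in> carrier G" and t: "t \<in> carrier G" and a: "a \<in> D s" and b: "b \<in> D t"
  shows "fmult B s a t b \<in> D (s \<otimes> t)"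
proof -
  have a': "dual_action G U \<theta> (inv s) a \<in> D (inv s)" using D_dual_action[of "inv s" a] s a by simp
  have "(\<lambda>x. dual_action G U \<theta> (inv s) a x * b x) \<in> D (inv s)"
    using a' b by (auto simp: D_iff intro: continuous_on_mult)
  from D_dual_action[OF s this] have c: "fmult B s a t b \<in> D s" by (simp add: action_bundle_def)
  have "fmult B s a t b y = 0" if y: "y \<notin> U (s \<otimes> t)" for y
  proof (rule ccontr)
    assume "fmult B s a t b y \<noteq> 0"
    then have "y \<in> U s" "b (\<theta> (inv s) y) \<noteq> 0" by (auto simp: fmult_B[OF s] split: if_splits)
    then have "\<theta> (inv s) y \<in> U t" using b by (auto simp: D_iff)
    with \<open>y \<in> U s\<close> show False using th_mult_in[OF s t] y by blast
  qed
  with c show ?thesis by (auto simp: D_iff)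
qed

lemma fstar_B: "s \<in> carrier G \<Longrightarrow> fstar B s a y = (if y \<in> U (inv s) then cnj (a (\<theta> s y)) else 0)"
  by (simp add: action_bundle_def dual_action_def)

lemma fstar_closed:
  assumes s: "s \<in> carrier G" and a: "a \<in> D s"
  shows "fstar B s a \<in> D (inv s)"
proof -
  have "(\<lambda>x. cnj (a x)) \<in> D (inv (inv s))" using a s by (auto simp: D_iff intro: continuous_intros)
  from D_dual_action[OF _ this] show ?thesis using s by (simp add: action_bundle_def)
qed

section \<open>Localisation at a point: coordinate vectors and orbit kernels\<close>

lemma sections_iff:
  "\<xi> \<in> sections G B \<longleftrightarrow> (\<forall>t\<in>carrier G. \<xi> t \<in> D t) \<and> (\<forall>t. t \<notin> carrier G \<longrightarrow> \<xi> t = 0) \<and> finite (supp_on G \<xi>)"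
  by (simp add: sections_def fib_B)

text \<open>The image of the section in the Hilbert space obtained from the module by evaluating
  inner products at \<open>x\<close>.\<close>

definition coord :: "'x \<Rightarrow> ('g \<Rightarrow> 'x \<Rightarrow> complex) \<Rightarrow> 'g \<Rightarrow> complex" where
  "coord x \<xi> t = (if t \<in> carrier G \<and> x \<in> U (inv t) then \<xi> t (\<theta> t x) else 0)"

text \<open>The operator of \<open>a\<close> on the space localised at \<open>x\<close>. Only the
  row index is required to belong to the orbit; for the column index this follows from the supports
  of the fibres, see \<open>sker_adj\<close>.\<close>

definition sker :: "'x \<Rightarrow> ('g \<Rightarrow> 'x \<Rightarrow> complex) \<Rightarrow> 'g \<Rightarrow> 'g \<Rightarrow> complex" where
  "sker x a t r = (if t \<in> carrier G \<and> r \<in> carrier G \<and> x \<in> U (inv t) then a (t \<otimes> inv r) (\<theta> t x) else 0)"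

lemma coord_support: "{t. coord x \<xi> t \<noteq> 0} \<subseteq> supp_on G \<xi>"
  by (auto simp: coord_def supp_on_def fun_eq_iff split: if_splits)

lemma coord_fsupp: "\<xi> \<in> sections G B \<Longrightarrow> fsupp (coord x \<xi>)"
  by (rule fsupp_subset[OF _ coord_support]) (simp add: sections_iff)

lemma coord_off: "x \<notin> X \<Longrightarrow> coord x \<xi> = (\<lambda>t. 0)"
  using U_sub by (auto simp: coord_def fun_eq_iff)

lemma section_inner_eq:
  assumes "\<xi> \<in> sections G B"
  shows "section_inner G B \<xi> \<xi> x = complex_of_real ((nrm (coord x \<xi>))\<^sup>2)"
proof -
  have "section_inner G B \<xi> \<xi> x = (\<Sum>t\<in>supp_on G \<xi>. complex_of_real ((cmod (coord x \<xi> t))\<^sup>2))"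
    unfolding section_inner_def sum_apply
  proof (rule sum.cong[OF refl])
    fix t assume "t \<in> supp_on G \<xi>"
    then have t: "t \<in> carrier G" by (simp add: supp_on_def)
    show "fmult B (inv t) (fstar B t (\<xi> t)) t (\<xi> t) x = complex_of_real ((cmod (coord x \<xi> t))\<^sup>2)"
      using t by (simp add: fmult_B fstar_B coord_def complex_norm_square mult.commute del: of_real_power)
  qed
  also have "\<dots> = complex_of_real ((nrm (coord x \<xi>))\<^sup>2)"
    using nrm_sq[OF _ coord_support, of \<xi> x] assms by (simp add: sections_iff)
  finally show ?thesis .
qed

text \<open>The module norm is the supremum over all points of the coordinate norms; it is finite
  because a section has finitely many nonzero values, each a bounded function.\<close>

lemma pre_l2_norm:
  assumes \<xi>: "\<xi> \<in> sections G B"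
  shows "nrm (coord x \<xi>) \<le> vnorm (pre_l2 G B) \<xi>"
    "0 \<le> C \<Longrightarrow> (\<And>x. x \<in> X \<Longrightarrow> nrm (coord x \<xi>) \<le> C) \<Longrightarrow> vnorm (pre_l2 G B) \<xi> \<le> C"
    "0 \<le> vnorm (pre_l2 G B) \<xi>"
proof -
  have v: "vnorm (pre_l2 G B) \<xi> = sqrt (SUP x. (nrm (coord x \<xi>))\<^sup>2)"
    using section_inner_eq[OF \<xi>]
    by (simp add: pre_l2_def action_bundle_def sup_norm_def norm_power[symmetric] del: of_real_power)
  have "\<forall>t\<in>supp_on G \<xi>. \<exists>M\<ge>0. \<forall>x. cmod (\<xi> t x) \<le> M"
    using \<xi> D_bounded by (auto simp: sections_iff supp_on_def)
  then obtain M where M: "\<And>t x. t \<in> supp_on G \<xi> \<Longrightarrow> cmod (\<xi> t x) \<le> M t" "\<And>t. t \<in> supp_on G \<xi> \<Longrightarrow> 0 \<le> M t"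
    by metis
  have "(nrm (coord x \<xi>))\<^sup>2 \<le> (\<Sum>t\<in>supp_on G \<xi>. (M t)\<^sup>2)" for x
  proof -
    have "(nrm (coord x \<xi>))\<^sup>2 = (\<Sum>t\<in>supp_on G \<xi>. (cmod (coord x \<xi> t))\<^sup>2)"
      by (rule nrm_sq[OF _ coord_support]) (use \<xi> in \<open>simp add: sections_iff\<close>)
    also have "\<dots> \<le> (\<Sum>t\<in>supp_on G \<xi>. (M t)\<^sup>2)"
      by (intro sum_mono power_mono) (auto simp: coord_def M)
    finally show ?thesis .
  qed
  then have bdd: "bdd_above (range (\<lambda>x. (nrm (coord x \<xi>))\<^sup>2))" by (auto simp: bdd_above_def)
  show 1: "nrm (coord x \<xi>) \<le> vnorm (pre_l2 G B) \<xi>" for x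
    unfolding v by (rule real_le_rsqrt) (rule cSUP_upper[OF UNIV_I bdd])
  show "vnorm (pre_l2 G B) \<xi> \<le> C" if C: "0 \<le> C" "\<And>x. x \<in> X \<Longrightarrow> nrm (coord x \<xi>) \<le> C" for C
  proof -
    have "(SUP x. (nrm (coord x \<xi>))\<^sup>2) \<le> C\<^sup>2"
    proof (rule cSUP_least)
      fix x show "(nrm (coord x \<xi>))\<^sup>2 \<le> C\<^sup>2"
        using C by (cases "x \<in> X") (auto simp: coord_off intro: power_mono)
    qed simp
    then show ?thesis unfolding v using C by (simp add: real_le_lsqrt sqrt_le_D real_sqrt_le_iff real_sqrt_unique[symmetric])
  qed
  show "0 \<le> vnorm (pre_l2 G B) \<xi>" by (rule order_trans[OF nrm_nonneg 1])
qed

lemma coord_add: "coord x (\<xi> + \<eta>) = (\<lambda>t. coord x \<xi> t + coord x \<eta> t)"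
  by (auto simp: coord_def fun_eq_iff)

lemma sections_zero: "0 \<in> sections G B"
  by (auto simp: sections_iff D_zero supp_on_def)

lemma sections_add: "\<xi> \<in> sections G B \<Longrightarrow> \<eta> \<in> sections G B \<Longrightarrow> \<xi> + \<eta> \<in> sections G B"
proof -
  assume a: "\<xi> \<in> sections G B" "\<eta> \<in> sections G B"
  have "supp_on G (\<xi> + \<eta>) \<subseteq> supp_on G \<xi> \<union> supp_on G \<eta>" by (auto simp: supp_on_def)
  then have "finite (supp_on G (\<xi> + \<eta>))" using a by (auto simp: sections_iff intro: finite_subset)
  then show ?thesis using a by (auto simp: sections_iff D_add)
qed

definition sscale :: "complex \<Rightarrow> ('g \<Rightarrow> 'x \<Rightarrow> complex) \<Rightarrow> 'g \<Rightarrow> 'x \<Rightarrow> complex" where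
  "sscale c \<xi> = (\<lambda>t x. c * \<xi> t x)"

lemma sscale_eq: "\<xi> \<in> sections G B \<Longrightarrow> (\<lambda>t. if t \<in> carrier G then fscale B c (\<xi> t) else 0) = sscale c \<xi>"
  by (auto simp: sscale_def fscale_B sections_iff fun_eq_iff)

lemma sections_scale: "\<xi> \<in> sections G B \<Longrightarrow> sscale c \<xi> \<in> sections G B"
proof -
  assume a: "\<xi> \<in> sections G B"
  have "supp_on G (sscale c \<xi>) \<subseteq> supp_on G \<xi>" by (auto simp: supp_on_def sscale_def fun_eq_iff)
  then have "finite (supp_on G (sscale c \<xi>))" using a by (auto simp: sections_iff intro: finite_subset)
  then show ?thesis using a by (auto simp: sections_iff sscale_def fun_eq_iff intro: D_scale)
qed

lemma coord_scale: "coord x (sscale c \<xi>) = (\<lambda>t. c * coord x \<xi> t)"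
  by (auto simp: coord_def sscale_def fun_eq_iff)

lemma pre_l2_seminormed: "seminormed_space (pre_l2 G B)"
proof
  have car: "carrier (pre_l2 G B) = sections G B" by (simp add: pre_l2_def)
  have sc: "vscale (pre_l2 G B) c \<xi> = sscale c \<xi>" if "\<xi> \<in> sections G B" for c \<xi>
    using sscale_eq[OF that] by (simp add: pre_l2_def)
  show "0 \<in> carrier (pre_l2 G B)" by (simp add: car sections_zero)
  show "vnorm (pre_l2 G B) 0 = 0"
  proof (rule antisym[OF pre_l2_norm(2) pre_l2_norm(3)])
    have "coord x 0 = (\<lambda>t. 0)" for x by (simp add: coord_def fun_eq_iff)
    then show "nrm (coord x 0) \<le> 0" for x by simp
  qed (simp_all add: sections_zero)
  fix \<xi> \<eta> c assume "\<xi> \<in> carrier (pre_l2 G B)"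
  then have x: "\<xi> \<in> sections G B" by (simp add: car)
  show "vscale (pre_l2 G B) c \<xi> \<in> carrier (pre_l2 G B)" using x by (simp add: sc car sections_scale)
  show "vscale (pre_l2 G B) (- 1) \<xi> = - \<xi>" unfolding sc[OF x] by (simp add: sscale_def fun_eq_iff)
  show "0 \<le> vnorm (pre_l2 G B) \<xi>" by (rule pre_l2_norm(3)[OF x])
  have le: "vnorm (pre_l2 G B) (sscale c \<xi>) \<le> cmod c * vnorm (pre_l2 G B) \<xi>" if "\<xi> \<in> sections G B" for c \<xi>
    by (rule pre_l2_norm(2)[OF sections_scale[OF that]])
      (auto simp: coord_scale nrm_scale that intro!: mult_left_mono mult_nonneg_nonneg pre_l2_norm)
  show "vnorm (pre_l2 G B) (vscale (pre_l2 G B) c \<xi>) = cmod c * vnorm (pre_l2 G B) \<xi>"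
    unfolding sc[OF x]
  proof (rule antisym[OF le[OF x]])
    show "cmod c * vnorm (pre_l2 G B) \<xi> \<le> vnorm (pre_l2 G B) (sscale c \<xi>)"
    proof (cases "c = 0")
      case True
      then show ?thesis using pre_l2_norm(3)[OF sections_scale[OF x]] by simp
    next
      case False
      have "sscale (1 / c) (sscale c \<xi>) = \<xi>" using False by (simp add: sscale_def)
      then show ?thesis using le[OF sections_scale[OF x, of c], of "1 / c"] False
        by (simp add: norm_divide field_simps)
    qed
  qed
  assume "\<eta> \<in> carrier (pre_l2 G B)"
  then have y: "\<eta> \<in> sections G B" by (simp add: car)
  show "vadd (pre_l2 G B) \<xi> \<eta> = \<xi> + \<eta>" by (simp add: pre_l2_def fun_eq_iff)
  show "\<xi> + \<eta> \<in> carrier (pre_l2 G B)" using x y by (simp add: car sections_add)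
  show "vscale (pre_l2 G B) c (\<xi> + \<eta>) = vscale (pre_l2 G B) c \<xi> + vscale (pre_l2 G B) c \<eta>"
    unfolding sc[OF x] sc[OF y] sc[OF sections_add[OF x y]] by (simp add: sscale_def fun_eq_iff algebra_simps)
  show "vnorm (pre_l2 G B) (\<xi> + \<eta>) \<le> vnorm (pre_l2 G B) \<xi> + vnorm (pre_l2 G B) \<eta>"
    by (rule pre_l2_norm(2)[OF sections_add[OF x y]])
      (auto simp: coord_add x y intro!: order_trans[OF nrm_triangle] add_mono add_nonneg_nonneg coord_fsupp pre_l2_norm)
qed

abbreviation SA where "SA \<equiv> section_alg G B"

text \<open>One formula in two roles: the regular representation on sections and, by
  \<open>amult_eq\<close>, the product of the section algebra.\<close>

definition section_act :: "('g \<Rightarrow> 'x \<Rightarrow> complex) \<Rightarrow> ('g \<Rightarrow> 'x \<Rightarrow> complex) \<Rightarrow> 'g \<Rightarrow> 'x \<Rightarrow> complex" where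
  "section_act a \<xi> = (\<lambda>r. \<Sum>t\<in>supp_on G a. bundle_lambda G B t (a t) \<xi> r)"

lemma supp_carrier: "t \<in> supp_on G a \<Longrightarrow> t \<in> carrier G"
  by (simp add: supp_on_def)

lemma section_act_apply:
  "section_act a \<xi> t y = (\<Sum>s\<in>supp_on G a. if t \<in> carrier G \<and> y \<in> U s then a s y * \<xi> (inv s \<otimes> t) (\<theta> (inv s) y) else 0)"
  unfolding section_act_def sum_apply
  by (rule sum.cong) (auto simp: bundle_lambda_def fmult_B supp_carrier)

lemma section_act_eq:
  assumes "finite S" "supp_on G a \<subseteq> S" "S \<subseteq> carrier G"
  shows "section_act a \<xi> t y = (\<Sum>s\<in>S. if t \<in> carrier G \<and> y \<in> U s then a s y * \<xi> (inv s \<otimes> t) (\<theta> (inv s) y) else 0)"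
  unfolding section_act_apply
  by (rule sum.mono_neutral_left) (use assms in \<open>auto simp: supp_on_def\<close>)

lemma SA_carrier: "carrier SA = sections G B"
  by (simp add: section_alg_def)

lemma section_act_closed:
  assumes a: "a \<in> sections G B" and x: "\<xi> \<in> sections G B"
  shows "section_act a \<xi> \<in> sections G B"
  unfolding sections_iff
proof (intro conjI ballI allI impI)
  fix t assume t: "t \<in> carrier G"
  show "section_act a \<xi> t \<in> D t"
    unfolding section_act_def
  proof (rule D_sum)
    fix s assume s: "s \<in> supp_on G a"
    then have sc: "s \<in> carrier G" by (rule supp_carrier)
    have "fmult B s (a s) (inv s \<otimes> t) (\<xi> (inv s \<otimes> t)) \<in> D (s \<otimes> (inv s \<otimes> t))"
      by (rule fmult_closed) (use a x sc t in \<open>auto simp: sections_iff\<close>)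
    then show "bundle_lambda G B s (a s) \<xi> t \<in> D t"
      using sc t by (simp add: bundle_lambda_def m_assoc[symmetric])
  qed
next
  fix t assume "t \<notin> carrier G"
  then show "section_act a \<xi> t = 0" by (simp add: section_act_apply fun_eq_iff)
next
  have "supp_on G (section_act a \<xi>) \<subseteq> (\<lambda>(p, q). p \<otimes> q) ` (supp_on G a \<times> supp_on G \<xi>)"
  proof
    fix t assume "t \<in> supp_on G (section_act a \<xi>)"
    then obtain y where t: "t \<in> carrier G" and "section_act a \<xi> t y \<noteq> 0" by (auto simp: supp_on_def fun_eq_iff)
    then obtain s where s: "s \<in> supp_on G a" "\<xi> (inv s \<otimes> t) (\<theta> (inv s) y) \<noteq> 0"
      unfolding section_act_apply by (elim sum.not_neutral_contains_not_neutral) (auto split: if_splits)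
    then have "inv s \<otimes> t \<in> supp_on G \<xi>" using t supp_carrier by (auto simp: supp_on_def fun_eq_iff)
    then show "t \<in> (\<lambda>(p, q). p \<otimes> q) ` (supp_on G a \<times> supp_on G \<xi>)"
      using s t supp_carrier[OF s(1)] by (intro image_eqI[of _ _ "(s, inv s \<otimes> t)"]) (auto simp: m_assoc[symmetric])
  qed
  then show "finite (supp_on G (section_act a \<xi>))"
    by (rule finite_subset) (use a x in \<open>auto simp: sections_iff\<close>)
qed

definition delta_section :: "'g \<Rightarrow> ('x \<Rightarrow> complex) \<Rightarrow> 'g \<Rightarrow> 'x \<Rightarrow> complex" where
  "delta_section s f = (\<lambda>t. if t = s then f else 0)"

lemma delta_section_closed: "s \<in> carrier G \<Longrightarrow> f \<in> D s \<Longrightarrow> delta_section s f \<in> sections G B"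
  unfolding sections_iff
  by (auto simp: delta_section_def D_zero supp_on_def intro: finite_subset[of _ "{s}"])

lemma section_act_delta_section:
  assumes "s \<in> carrier G"
  shows "section_act (delta_section s f) \<xi> t y = (if t \<in> carrier G \<and> y \<in> U s then f y * \<xi> (inv s \<otimes> t) (\<theta> (inv s) y) else 0)"
proof -
  have "section_act (delta_section s f) \<xi> t y = (\<Sum>p\<in>{s}. if t \<in> carrier G \<and> y \<in> U p
      then delta_section s f p y * \<xi> (inv p \<otimes> t) (\<theta> (inv p) y) else 0)"
    by (rule section_act_eq) (use assms in \<open>auto simp: delta_section_def supp_on_def\<close>)
  then show ?thesis by (simp add: delta_section_def)
qed

lemma delta_section_one: "f \<in> D \<one> \<Longrightarrow> delta_section \<one> f \<in> sections G B"
  by (rule delta_section_closed) simp_all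

lemma sker_row: "t \<in> carrier G \<Longrightarrow> x \<in> U (inv t) \<Longrightarrow>
    {q. sker x a t q \<noteq> 0} = {q. q \<in> carrier G \<and> a (t \<otimes> inv q) (\<theta> t x) \<noteq> 0}"
  by (auto simp: sker_def)

lemma sker_sum:
  assumes "t \<in> carrier G" "x \<in> U (inv t)"
  shows "(\<Sum>q | sker x a t q \<noteq> 0. sker x a t q * F q) =
    (\<Sum>p | p \<in> carrier G \<and> a p (\<theta> t x) \<noteq> 0. a p (\<theta> t x) * F (inv p \<otimes> t))"
proof -
  have "(\<Sum>q | sker x a t q \<noteq> 0. sker x a t q * F q) =
      (\<Sum>q | q \<in> carrier G \<and> a (t \<otimes> inv q) (\<theta> t x) \<noteq> 0. a (t \<otimes> inv q) (\<theta> t x) * F q)"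
    unfolding sker_row[OF assms] by (rule sum.cong) (auto simp: sker_def assms)
  also have "\<dots> = (\<Sum>p | p \<in> carrier G \<and> a p (\<theta> t x) \<noteq> 0. a p (\<theta> t x) * F (inv p \<otimes> t))"
    by (rule sum_div[OF assms(1), where P = "\<lambda>p. a p (\<theta> t x) \<noteq> 0" and F = "\<lambda>p q. a p (\<theta> t x) * F q"])
  finally show ?thesis .
qed

lemma sections_nonzeroD:
  "a \<in> sections G B \<Longrightarrow> p \<in> carrier G \<Longrightarrow> a p y \<noteq> 0 \<Longrightarrow> y \<in> U p \<and> p \<in> supp_on G a"
  by (auto simp: sections_iff D_iff supp_on_def)

text \<open>A value of a fibre element over t (inv r) that is nonzero at \<open>\<theta> t x\<close>
  puts this point into the corresponding open set, and \<open>th_div\<close> moves the condition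
  back to \<open>x\<close>.\<close>

lemma sker_adj:
  assumes a: "a \<in> sections G B" and t: "t \<in> carrier G" and r: "r \<in> carrier G"
    and "sker x a t r \<noteq> 0"
  shows "x \<in> U (inv t)" "x \<in> U (inv r)"
proof -
  show x: "x \<in> U (inv t)" using assms by (auto simp: sker_def split: if_splits)
  have "a (t \<otimes> inv r) (\<theta> t x) \<noteq> 0" using assms by (auto simp: sker_def split: if_splits)
  then have "\<theta> t x \<in> U (t \<otimes> inv r)" using sections_nonzeroD[OF a] t r by simp
  then show "x \<in> U (inv r)" using th_div(1)[OF t r x] by simp
qed

text \<open>The bound is a sum, over the support, of bounds for the values of the section, hence
  independent of \<open>x\<close>.\<close>

lemma sker_bound:
  assumes a: "a \<in> sections G B"
  shows "\<exists>C. \<forall>x. kbounded (sker x a) C" "row_col_finite (sker x a)"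
proof -
  have "\<forall>t\<in>supp_on G a. \<exists>M\<ge>0. \<forall>x. cmod (a t x) \<le> M"
    using a D_bounded by (auto simp: sections_iff supp_on_def)
  then obtain M where M: "\<And>t x. t \<in> supp_on G a \<Longrightarrow> cmod (a t x) \<le> M t" "\<And>t. t \<in> supp_on G a \<Longrightarrow> 0 \<le> M t"
    by metis
  have fin: "finite (supp_on G a)" using a by (simp add: sections_iff)
  have "kbounded (sker x a) (\<Sum>s\<in>supp_on G a. M s) \<and> row_col_finite (sker x a)" for x
  proof -
    let ?D = "{t \<in> carrier G. x \<in> U (inv t)}"
    let ?L = "\<lambda>t r. \<Sum>s\<in>supp_on G a. if t \<in> ?D \<and> r = inv s \<otimes> t then a s (\<theta> t x) else 0"
    have "sker x a t r = ?L t r" for t r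
    proof (cases "t \<in> ?D \<and> r \<in> carrier G")
      case True
      have "?L t r = (\<Sum>s\<in>supp_on G a. if s = t \<otimes> inv r then a s (\<theta> t x) else 0)"
        by (rule sum.cong) (use True in \<open>auto simp: div_div div_div' supp_carrier\<close>)
      then show ?thesis using True by (simp add: fin sker_def) (auto simp: supp_on_def)
    next
      case False
      then have "?L t r = 0" by (intro sum.neutral) (auto dest: supp_carrier)
      then show ?thesis using False by (auto simp: sker_def)
    qed
    then have "sker x a = ?L" by (intro ext)
    moreover have "kbounded ?L (\<Sum>s\<in>supp_on G a. M s) \<and> row_col_finite ?L"
      by (rule kbounded_translates[OF fin]) (auto intro!: inj_onI M dest: supp_carrier)
    ultimately show ?thesis by simp
  qed
  then show "\<exists>C. \<forall>x. kbounded (sker x a) C" "row_col_finite (sker x a)" by blast+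
qed

text \<open>Localisation at \<open>x\<close> intertwines the regular representation with the orbit
  kernel.\<close>

lemma coord_section_act:
  assumes a: "a \<in> sections G B" and \<xi>: "\<xi> \<in> sections G B"
  shows "coord x (section_act a \<xi>) = kapply (sker x a) (coord x \<xi>)"
proof
  fix t
  show "coord x (section_act a \<xi>) t = kapply (sker x a) (coord x \<xi>) t"
  proof (cases "t \<in> carrier G \<and> x \<in> U (inv t)")
    case True
    then have t: "t \<in> carrier G" "x \<in> U (inv t)" by auto
    have "kapply (sker x a) (coord x \<xi>) t =
        (\<Sum>p | p \<in> carrier G \<and> a p (\<theta> t x) \<noteq> 0. a p (\<theta> t x) * coord x \<xi> (inv p \<otimes> t))"
      unfolding kapply_alt[OF sker_bound(2)[OF a] coord_fsupp[OF \<xi>]] by (rule sker_sum[OF t])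
    also have "\<dots> = (\<Sum>p | p \<in> carrier G \<and> a p (\<theta> t x) \<noteq> 0.
        if t \<in> carrier G \<and> \<theta> t x \<in> U p then a p (\<theta> t x) * \<xi> (inv p \<otimes> t) (\<theta> (inv p) (\<theta> t x)) else 0)"
      by (rule sum.cong) (use t sections_nonzeroD[OF a] in \<open>auto simp: coord_def th_left\<close>)
    also have "\<dots> = section_act a \<xi> t (\<theta> t x)"
      unfolding section_act_apply
      by (rule sum.mono_neutral_left) (use a in \<open>auto simp: sections_iff supp_on_def\<close>)
    finally show ?thesis using t by (simp add: coord_def)
  next
    case False
    then have "sker x a t r = 0" for r by (auto simp: sker_def)
    then show ?thesis using False by (auto simp: coord_def kapply_def)
  qed
qed

text \<open>Only one inequality between the norm and the orbit kernels is obtained here. The reverse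
  one takes sections with prescribed coordinates and is \<open>kbounded_sker\<close>.\<close>

lemma section_norm_eq:
  assumes a: "a \<in> sections G B"
  shows "vnorm SA a = op_norm (pre_l2 G B) (section_act a)"
    "\<And>C. 0 \<le> C \<Longrightarrow> (\<And>x. x \<in> X \<Longrightarrow> kbounded (sker x a) C) \<Longrightarrow> vnorm SA a \<le> C"
    "0 \<le> vnorm SA a"
    "\<And>\<xi>. \<xi> \<in> sections G B \<Longrightarrow> vnorm (pre_l2 G B) (section_act a \<xi>) \<le> vnorm SA a * vnorm (pre_l2 G B) \<xi>"
proof -
  interpret V: seminormed_space "pre_l2 G B" by (rule pre_l2_seminormed)
  have car: "carrier (pre_l2 G B) = sections G B" by (simp add: pre_l2_def)
  have sc: "vscale (pre_l2 G B) c \<xi> = sscale c \<xi>" if "\<xi> \<in> sections G B" for c \<xi>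
    using sscale_eq[OF that] by (simp add: pre_l2_def)
  have T: "section_act a \<xi> \<in> carrier (pre_l2 G B)" if "\<xi> \<in> carrier (pre_l2 G B)" for \<xi>
    using section_act_closed[OF a] that by (simp add: car)
  have Ts: "section_act a (vscale (pre_l2 G B) c \<xi>) = vscale (pre_l2 G B) c (section_act a \<xi>)"
    if "\<xi> \<in> carrier (pre_l2 G B)" for c \<xi>
  proof -
    have x: "\<xi> \<in> sections G B" using that by (simp add: car)
    show ?thesis unfolding sc[OF x] sc[OF section_act_closed[OF a x]]
      by (auto simp: fun_eq_iff section_act_apply sscale_def sum_distrib_left intro!: sum.cong)
  qed
  have Td: "section_act a (\<xi> - \<eta>) = section_act a \<xi> - section_act a \<eta>" for \<xi> \<eta>
    by (auto simp: fun_eq_iff section_act_apply sum_subtractf[symmetric] algebra_simps intro!: sum.cong)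
  have bd: "vnorm (pre_l2 G B) (section_act a \<xi>) \<le> C * vnorm (pre_l2 G B) \<xi>"
    if C: "0 \<le> C" "\<And>x. x \<in> X \<Longrightarrow> kbounded (sker x a) C" and \<xi>: "\<xi> \<in> carrier (pre_l2 G B)" for C \<xi>
  proof (rule pre_l2_norm(2))
    have x: "\<xi> \<in> sections G B" using \<xi> by (simp add: car)
    show "section_act a \<xi> \<in> sections G B" by (rule section_act_closed[OF a x])
    show "0 \<le> C * vnorm (pre_l2 G B) \<xi>" using C pre_l2_norm(3)[OF x] by simp
    fix y assume "y \<in> X"
    then have "nrm (coord y (section_act a \<xi>)) \<le> C * nrm (coord y \<xi>)"
      unfolding coord_section_act[OF a x] by (intro kbdD C coord_fsupp x)
    also have "\<dots> \<le> C * vnorm (pre_l2 G B) \<xi>" by (rule mult_left_mono[OF pre_l2_norm(1)[OF x] C(1)])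
    finally show "nrm (coord y (section_act a \<xi>)) \<le> C * vnorm (pre_l2 G B) \<xi>" .
  qed
  obtain C where C: "\<forall>x. kbounded (sker x a) C" using sker_bound(1)[OF a] by blast
  then have C0: "0 \<le> C" using kbounded_nonneg by blast
  have bC: "vnorm (pre_l2 G B) (section_act a v) \<le> C * vnorm (pre_l2 G B) v" if "v \<in> carrier (pre_l2 G B)" for v
    using bd[OF C0 _ that] C by blast
  have "vnorm SA a = op_norm (nspace_completion (pre_l2 G B)) (lift1 (pre_l2 G B) (section_act a))"
    unfolding section_alg_def l2_bundle_def bundle_regular_def section_act_def[abs_def] by simp
  also have "\<dots> = op_norm (pre_l2 G B) (section_act a)"
    by (rule V.op_norm_completion[of "section_act a" C]) (use T Ts Td bC C0 in auto)
  finally show e: "vnorm SA a = op_norm (pre_l2 G B) (section_act a)" .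
  show "vnorm SA a \<le> C'" if "0 \<le> C'" "\<And>x. x \<in> X \<Longrightarrow> kbounded (sker x a) C'" for C'
    unfolding e by (rule V.op_norm_bounds(1)[of "section_act a" C']) (use T Ts bd[OF that] that in auto)
  show "0 \<le> vnorm SA a"
    unfolding e by (rule V.op_norm_bounds(2)[of "section_act a" C]) (use T Ts bC C0 in auto)
  show "vnorm (pre_l2 G B) (section_act a \<xi>) \<le> vnorm SA a * vnorm (pre_l2 G B) \<xi>" if "\<xi> \<in> sections G B" for \<xi>
    unfolding e by (rule V.op_norm_bounds(3)[of "section_act a" C]) (use T Ts bC C0 that in \<open>auto simp: car\<close>)
qed

section \<open>Bump functions and sections with prescribed coordinates\<close>

lemma D_one: "f \<in> D \<one> \<longleftrightarrow> continuous_on X f \<and> (\<forall>x. x \<notin> X \<longrightarrow> f x = 0)"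
  by (auto simp: D_iff U_one)

text \<open>A tent of height 1 around \<open>c\<close>. It is real-valued, so that its image under a
  star-homomorphism is Hermitian.\<close>

definition bump :: "'x \<Rightarrow> real \<Rightarrow> 'x \<Rightarrow> complex" where
  "bump c r = (\<lambda>y. if y \<in> X then complex_of_real (max 0 (1 - dist y c / r)) else 0)"

lemma bump_continuous: "r > 0 \<Longrightarrow> continuous_on X (bump c r)"
proof -
  assume "r > 0"
  then have "continuous_on X (\<lambda>y. complex_of_real (max 0 (1 - dist y c / r)))"
    by (intro continuous_intros) auto
  then show ?thesis by (rule continuous_on_eq) (simp add: bump_def)
qed

lemma bump_D: "r > 0 \<Longrightarrow> bump c r \<in> D \<one>"
  using bump_continuous by (simp add: D_one bump_def)

lemma bump_nonzero: "r > 0 \<Longrightarrow> bump c r y \<noteq> 0 \<Longrightarrow> dist y c < r"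
  by (rule ccontr) (auto simp: bump_def field_simps split: if_splits)

lemma bump_self: "c \<in> X \<Longrightarrow> bump c r c = 1"
  by (simp add: bump_def)

lemma bump_real: "cnj (bump c r y) = bump c r y"
  by (simp add: bump_def)

lemma bump_le_1: "r > 0 \<Longrightarrow> cmod (bump c r y) \<le> 1"
  by (simp add: bump_def)

text \<open>A vector \<open>\<zeta>\<close> over the orbit of \<open>x\<close> is the coordinate vector at \<open>x\<close> of the section
  \<open>t \<mapsto> \<zeta> t * (\<beta> \<circ> \<theta> (inv t))\<close>, for a bump function \<open>\<beta>\<close> at \<open>x\<close>.\<close>

lemma coord_surj:
  assumes x: "x \<in> X" and \<zeta>: "fsupp \<zeta>" and z: "\<And>t. \<zeta> t \<noteq> 0 \<Longrightarrow> t \<in> carrier G \<and> x \<in> U (inv t)"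
  obtains \<xi> where "\<xi> \<in> sections G B" "coord x \<xi> = \<zeta>" "vnorm (pre_l2 G B) \<xi> \<le> nrm \<zeta>"
proof -
  have fin: "finite {t. \<zeta> t \<noteq> 0}" using \<zeta> by (simp add: fsupp_def)
  have "\<forall>t\<in>{t. \<zeta> t \<noteq> 0}. \<exists>r>0. \<forall>y\<in>X. dist y x < r \<longrightarrow> y \<in> U (inv t)"
  proof
    fix t assume "t \<in> {t. \<zeta> t \<noteq> 0}"
    then have t: "t \<in> carrier G" "x \<in> U (inv t)" using z by auto
    obtain W where W: "open W" "U (inv t) = X \<inter> W" using U_open[of "inv t"] t by (auto simp: openin_open)
    then have "x \<in> W" using t by auto
    then obtain r where "r > 0" "\<forall>y. dist y x < r \<longrightarrow> y \<in> W" using W open_dist by blast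
    then show "\<exists>r>0. \<forall>y\<in>X. dist y x < r \<longrightarrow> y \<in> U (inv t)" using W by auto
  qed
  from bchoice[OF this] obtain \<rho>
    where "\<forall>t\<in>{t. \<zeta> t \<noteq> 0}. \<rho> t > 0 \<and> (\<forall>y\<in>X. dist y x < \<rho> t \<longrightarrow> y \<in> U (inv t))" ..
  then have \<rho>: "\<And>t. \<zeta> t \<noteq> 0 \<Longrightarrow> \<rho> t > 0"
    "\<And>t y. \<zeta> t \<noteq> 0 \<Longrightarrow> y \<in> X \<Longrightarrow> dist y x < \<rho> t \<Longrightarrow> y \<in> U (inv t)" by auto
  \<comment> \<open>Inserting 1 keeps the minimum defined when \<zeta> vanishes.\<close>
  define R where "R = Min (insert 1 (\<rho> ` {t. \<zeta> t \<noteq> 0}))"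
  have R: "R > 0" unfolding R_def using fin \<rho> by (subst Min_gr_iff) auto
  have Rle: "R \<le> \<rho> t" if "\<zeta> t \<noteq> 0" for t unfolding R_def using fin that by (intro Min_le) auto
  define \<beta> where "\<beta> = bump x R"
  have \<beta>x: "\<beta> x = 1" using x by (simp add: \<beta>_def bump_self)
  have \<beta>1: "cmod (\<beta> y) \<le> 1" for y using R by (simp add: \<beta>_def bump_le_1)
  have \<beta>D: "\<beta> \<in> D (inv t)" if t: "\<zeta> t \<noteq> 0" for t
  proof -
    have "y \<in> U (inv t)" if "\<beta> y \<noteq> 0" for y
      using \<rho>(2)[OF t, of y] bump_nonzero[OF R, of x y] Rle[OF t] that by (auto simp: \<beta>_def bump_def split: if_splits)
    then show ?thesis using bump_D[OF R, of x] by (auto simp: D_iff D_one \<beta>_def)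
  qed
  define \<xi> where "\<xi> = (\<lambda>t y. \<zeta> t * dual_action G U \<theta> t \<beta> y)"
  have s0: "supp_on G \<xi> \<subseteq> {t. \<zeta> t \<noteq> 0}" by (auto simp: supp_on_def \<xi>_def fun_eq_iff)
  have \<xi>: "\<xi> \<in> sections G B"
    unfolding sections_iff
  proof (intro conjI ballI allI impI)
    fix t assume t: "t \<in> carrier G"
    show "\<xi> t \<in> D t"
    proof (cases "\<zeta> t = 0")
      case True
      then show ?thesis using D_zero by (simp add: \<xi>_def zero_fun_def)
    next
      case False
      then show ?thesis unfolding \<xi>_def using D_dual_action[OF t \<beta>D] by (intro D_scale)
    qed
  next
    fix t assume "t \<notin> carrier G"
    then show "\<xi> t = 0" using z by (auto simp: \<xi>_def fun_eq_iff)
  qed (use finite_subset[OF s0 fin] in simp)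
  \<comment> \<open>At every point \<open>y\<close> of \<open>X\<close> all coordinates of \<zeta>
    are multiplied by the same number \<open>\<beta> y\<close> of modulus at most 1, so the norm of
    the section does not exceed that of \<zeta>.\<close>
  have co: "coord y \<xi> t = \<zeta> t * \<beta> y" if "y \<in> X" for y t
  proof (cases "\<zeta> t = 0")
    case False
    then have t: "t \<in> carrier G" using z by auto
    show ?thesis
    proof (cases "y \<in> U (inv t)")
      case True
      then show ?thesis using t th_in[OF t True] th_inv[OF t True] by (simp add: coord_def \<xi>_def dual_action_def)
    next
      case False
      then show ?thesis using \<beta>D[OF \<open>\<zeta> t \<noteq> 0\<close>] by (simp add: coord_def D_iff)
    qed
  qed (simp add: coord_def \<xi>_def)
  show ?thesis
  proof (rule that[OF \<xi>])
    show "coord x \<xi> = \<zeta>" using co[OF x] by (simp add: \<beta>x fun_eq_iff)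
    show "vnorm (pre_l2 G B) \<xi> \<le> nrm \<zeta>"
    proof (rule pre_l2_norm(2)[OF \<xi>])
      fix y assume y: "y \<in> X"
      show "nrm (coord y \<xi>) \<le> nrm \<zeta>"
        by (rule nrm_mono[OF \<zeta>]) (use \<beta>1[of y] in \<open>simp add: co[OF y] norm_mult mult_left_le\<close>)
    qed simp
  qed
qed

text \<open>The kernel ignores coordinates outside the index set of the orbit, so the vector may
  first be cut down to that set.\<close>

lemma orbit_section:
  assumes a: "a \<in> sections G B" and x: "x \<in> X" and \<zeta>: "fsupp \<zeta>"
  obtains \<xi> where "\<xi> \<in> sections G B" "kapply (sker x a) \<zeta> = coord x (section_act a \<xi>)"
    "vnorm (pre_l2 G B) \<xi> \<le> nrm \<zeta>"
proof -
  define \<omega> where "\<omega> = (\<lambda>t. if t \<in> carrier G \<and> x \<in> U (inv t) then \<zeta> t else 0)"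
  have w: "fsupp \<omega>" "nrm \<omega> \<le> nrm \<zeta>"
    unfolding \<omega>_def by (rule fsupp_restrict[OF \<zeta>], rule nrm_restrict[OF \<zeta>])
  have k: "kapply (sker x a) \<zeta> = kapply (sker x a) \<omega>"
  proof
    fix t
    have "sker x a t q * \<zeta> q = sker x a t q * \<omega> q" for q
      using sker_adj(2)[OF a, of t q x] by (cases "sker x a t q = 0") (auto simp: \<omega>_def sker_def split: if_splits)
    then show "kapply (sker x a) \<zeta> t = kapply (sker x a) \<omega> t"
      unfolding kapply_alt[OF sker_bound(2)[OF a] \<zeta>] kapply_alt[OF sker_bound(2)[OF a] w(1)] by (intro sum.cong refl)
  qed
  obtain \<xi> where \<xi>: "\<xi> \<in> sections G B" "coord x \<xi> = \<omega>" "vnorm (pre_l2 G B) \<xi> \<le> nrm \<omega>"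
    by (rule coord_surj[OF x w(1)]) (auto simp: \<omega>_def split: if_splits)
  show ?thesis
    by (rule that[OF \<xi>(1)]) (use \<xi>(3) w(2) in \<open>simp_all add: k coord_section_act[OF a \<xi>(1)] \<xi>(2)\<close>)
qed

text \<open>Lifting a vector at \<open>x\<close> to a section does not increase its norm, so the
  operator norm on sections dominates the kernel at each single point.\<close>

lemma kbounded_sker:
  assumes a: "a \<in> sections G B" and x: "x \<in> X"
  shows "kbounded (sker x a) (vnorm SA a)"
  unfolding kbounded_def
proof (intro conjI allI impI)
  show n0: "0 \<le> vnorm SA a" by (rule section_norm_eq(3)[OF a])
  fix \<zeta> :: "'g \<Rightarrow> complex" assume \<zeta>: "fsupp \<zeta>"
  obtain \<xi> where \<xi>: "\<xi> \<in> sections G B" "kapply (sker x a) \<zeta> = coord x (section_act a \<xi>)"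
    "vnorm (pre_l2 G B) \<xi> \<le> nrm \<zeta>"
    using orbit_section[OF a x \<zeta>] .
  have "nrm (kapply (sker x a) \<zeta>) \<le> vnorm (pre_l2 G B) (section_act a \<xi>)"
    unfolding \<xi>(2) by (rule pre_l2_norm(1)[OF section_act_closed[OF a \<xi>(1)]])
  also have "\<dots> \<le> vnorm SA a * vnorm (pre_l2 G B) \<xi>" by (rule section_norm_eq(4)[OF a \<xi>(1)])
  also have "\<dots> \<le> vnorm SA a * nrm \<zeta>" by (rule mult_left_mono[OF \<xi>(3) n0])
  finally show "nrm (kapply (sker x a) \<zeta>) \<le> vnorm SA a * nrm \<zeta>" .
qed

section \<open>The orbit kernels as star-representations of the section algebra\<close>

lemma amult_eq: "amult SA a b = section_act a b"
  by (auto simp: section_alg_def section_act_def bundle_lambda_def fun_eq_iff sum_apply)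

lemma sker_mult:
  assumes a: "a \<in> sections G B" and b: "b \<in> sections G B"
  shows "sker x (amult SA a b) = kmul (sker x a) (sker x b)"
proof (intro ext)
  fix t r
  show "sker x (amult SA a b) t r = kmul (sker x a) (sker x b) t r"
  proof (cases "t \<in> carrier G \<and> r \<in> carrier G \<and> x \<in> U (inv t)")
    case True
    then have t: "t \<in> carrier G" "x \<in> U (inv t)" and r: "r \<in> carrier G" by auto
    have "kmul (sker x a) (sker x b) t r =
        (\<Sum>p | p \<in> carrier G \<and> a p (\<theta> t x) \<noteq> 0. a p (\<theta> t x) * sker x b (inv p \<otimes> t) r)"
      unfolding kmul_def by (rule sker_sum[OF t])
    also have "\<dots> = (\<Sum>p | p \<in> carrier G \<and> a p (\<theta> t x) \<noteq> 0.
        if t \<otimes> inv r \<in> carrier G \<and> \<theta> t x \<in> U p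
        then a p (\<theta> t x) * b (inv p \<otimes> (t \<otimes> inv r)) (\<theta> (inv p) (\<theta> t x)) else 0)"
      by (rule sum.cong) (use t r sections_nonzeroD[OF a] in \<open>auto simp: sker_def th_left m_assoc\<close>)
    also have "\<dots> = section_act a b (t \<otimes> inv r) (\<theta> t x)"
      unfolding section_act_apply
      by (rule sum.mono_neutral_left) (use a in \<open>auto simp: sections_iff supp_on_def\<close>)
    finally show ?thesis using t r by (simp add: amult_eq sker_def)
  next
    case False
    then have "sker x a t q * sker x b q r = 0" for q by (auto simp: sker_def)
    then show ?thesis using False by (auto simp: kmul_def sker_def)
  qed
qed

lemma astar_apply:
  "astar SA a s y = (if s \<in> carrier G \<and> y \<in> U s then cnj (a (inv s) (\<theta> (inv s) y)) else 0)"
  by (simp add: section_alg_def fstar_B)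

lemma sker_star:
  assumes a: "a \<in> sections G B"
  shows "sker x (astar SA a) = kadj (sker x a)"
proof (intro ext)
  fix t r
  show "sker x (astar SA a) t r = kadj (sker x a) t r"
  proof (cases "t \<in> carrier G \<and> r \<in> carrier G")
    case True
    then have t: "t \<in> carrier G" and r: "r \<in> carrier G" by auto
    have i: "inv (t \<otimes> inv r) = r \<otimes> inv t" using t r by (simp add: inv_mult_group)
    show ?thesis
    proof (cases "x \<in> U (inv t)")
      case True
      then show ?thesis
        using th_div[OF t r True] t r by (auto simp: sker_def kadj_def astar_apply i)
    next
      case False
      then have "sker x a r t = 0" using sker_adj(2)[OF a r t] by blast
      then show ?thesis using False by (simp add: sker_def kadj_def)
    qed
  qed (auto simp: sker_def kadj_def)
qed

lemma section_star_closed: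
  assumes a: "a \<in> sections G B"
  shows "astar SA a \<in> sections G B"
  unfolding sections_iff
proof (intro conjI ballI allI impI)
  fix t assume t: "t \<in> carrier G"
  then have "a (inv t) \<in> D (inv t)" using a by (simp add: sections_iff)
  from fstar_closed[OF _ this] t show "astar SA a t \<in> D t" by (simp add: section_alg_def)
next
  fix t assume "t \<notin> carrier G"
  then show "astar SA a t = 0" by (simp add: section_alg_def)
next
  have "supp_on G (astar SA a) \<subseteq> (\<lambda>t. inv t) ` supp_on G a"
  proof
    fix t assume "t \<in> supp_on G (astar SA a)"
    then obtain y where "t \<in> carrier G" "astar SA a t y \<noteq> 0" by (auto simp: supp_on_def fun_eq_iff)
    then show "t \<in> (\<lambda>t. inv t) ` supp_on G a"
      by (intro image_eqI[of _ _ "inv t"]) (auto simp: supp_on_def astar_apply fun_eq_iff split: if_splits)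
  qed
  then show "finite (supp_on G (astar SA a))" by (rule finite_subset) (use a in \<open>simp add: sections_iff\<close>)
qed

lemma section_kernel_algebra: "kernel_algebra SA X sker"
proof
  have car: "carrier SA = sections G B" by (simp add: section_alg_def)
  have sc: "vscale SA c \<xi> = sscale c \<xi>" if "\<xi> \<in> sections G B" for c \<xi>
    using sscale_eq[OF that] by (simp add: section_alg_def)
  fix x y z :: "'g \<Rightarrow> 'x \<Rightarrow> complex" and c i
  show "0 \<in> carrier SA" by (simp add: car sections_zero)
  assume "x \<in> carrier SA"
  then have x: "x \<in> sections G B" by (simp add: car)
  show "vscale SA c x \<in> carrier SA" using sections_scale[OF x] by (simp add: car sc x)
  show "vscale SA (- 1) x = - x" by (simp add: sc x sscale_def fun_eq_iff)
  show "astar SA x \<in> carrier SA" using section_star_closed[OF x] by (simp add: car)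
  show "0 \<le> vnorm SA x" by (rule section_norm_eq(3)[OF x])
  show "row_col_finite (sker i x)" by (rule sker_bound(2)[OF x])
  show "sker i (vscale SA c x) = (\<lambda>t r. c * sker i x t r)" by (auto simp: sc x sker_def sscale_def fun_eq_iff)
  show "sker i (astar SA x) = kadj (sker i x)" by (rule sker_star[OF x])
  show "i \<in> X \<Longrightarrow> kbounded (sker i x) (vnorm SA x)" by (rule kbounded_sker[OF x])
  assume "y \<in> carrier SA"
  then have y: "y \<in> sections G B" by (simp add: car)
  show "vadd SA x y = x + y" by (simp add: section_alg_def fun_eq_iff)
  show "x + y \<in> carrier SA" using sections_add[OF x y] by (simp add: car)
  show "vscale SA c (x + y) = vscale SA c x + vscale SA c y"
    unfolding sc[OF x] sc[OF y] sc[OF sections_add[OF x y]] by (simp add: sscale_def fun_eq_iff algebra_simps)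
  show "amult SA x y \<in> carrier SA" using section_act_closed[OF x y] by (simp add: amult_eq car)
  show "astar SA (x + y) = astar SA x + astar SA y" by (auto simp: fun_eq_iff astar_apply)
  show "sker i (x + y) = (\<lambda>t r. sker i x t r + sker i y t r)" by (auto simp: sker_def fun_eq_iff)
  show "sker i (amult SA x y) = kmul (sker i x) (sker i y)" by (rule sker_mult[OF x y])
  assume "z \<in> carrier SA"
  show "amult SA z (x + y) = amult SA z x + amult SA z y"
  proof (intro ext)
    fix s p
    show "amult SA z (x + y) s p = (amult SA z x + amult SA z y) s p"
      unfolding amult_eq plus_fun_apply section_act_apply sum.distrib[symmetric]
      by (rule sum.cong) (auto simp: distrib_left)
  qed
  show "amult SA (x + y) z = amult SA x z + amult SA y z"
  proof (intro ext)
    fix s p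
    have S: "finite (supp_on G x \<union> supp_on G y)" "supp_on G x \<union> supp_on G y \<subseteq> carrier G"
      using x y by (auto simp: sections_iff supp_on_def)
    have "supp_on G (x + y) \<subseteq> supp_on G x \<union> supp_on G y" by (auto simp: supp_on_def)
    note e = section_act_eq[OF S(1) this S(2), of z s p] section_act_eq[OF S(1) Un_upper1 S(2), of z s p] section_act_eq[OF S(1) Un_upper2 S(2), of z s p]
    show "amult SA (x + y) z s p = (amult SA x z + amult SA y z) s p"
      unfolding amult_eq plus_fun_apply e sum.distrib[symmetric]
      by (rule sum.cong) (auto simp: distrib_right)
  qed
next
  fix x C assume "x \<in> carrier SA" "0 \<le> C" "\<And>i. i \<in> X \<Longrightarrow> kbounded (sker i x) C"
  then show "vnorm SA x \<le> C" using section_norm_eq(2)[of x C] by (simp add: section_alg_def)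
qed

end

section \<open>Finite models of a partial action\<close>

text \<open>The two inclusions of condition (i) are combined into the equivalence \<open>VU\<close>;
  a point of the model therefore has the same orbit index set as its image in
  \<open>X\<close>.\<close>

locale fin_model = cont_partial_act G X U \<theta>
  for G :: "('g, 'c) monoid_scheme" (structure) and X :: "'x::metric_space set" and U \<theta> +
  fixes Z :: "'z set" and V :: "'g \<Rightarrow> 'z set" and \<eta> :: "'g \<Rightarrow> 'z \<Rightarrow> 'z" and \<rho> :: "'z \<Rightarrow> 'x"
  assumes fZ: "finite Z" and pZ: "partial_action G Z V \<eta>" and \<rho>X: "\<rho> ` Z \<subseteq> X"
    and VU: "\<And>t z. t \<in> carrier G \<Longrightarrow> z \<in> Z \<Longrightarrow> z \<in> V t \<longleftrightarrow> \<rho> z \<in> U t"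
    and equiv: "\<And>t z. t \<in> carrier G \<Longrightarrow> z \<in> V (inv t) \<Longrightarrow> \<rho> (\<eta> t z) = \<theta> t (\<rho> z)"
begin

sublocale Z: partial_act G Z V \<eta>
  by unfold_locales (rule pZ)

abbreviation GA where "GA \<equiv> group_alg G"

sublocale GA: kernel_algebra GA "{()}" "\<lambda>_. gker G"
  by (rule group_kernel_algebra)

sublocale SA: kernel_algebra SA X sker
  by (rule section_kernel_algebra)

text \<open>The matrix coefficients of the representation on \<open>\<ell>\<^sup>2(Z) \<otimes> \<ell>\<^sup>2(G)\<close> that maps \<open>f \<delta>\<^sub>s\<close> to the sum of
  \<open>f (\<rho> y) E\<^bsub>y,w\<^esub> \<otimes> \<lambda>\<^sub>s\<close> over the pairs with \<open>\<eta>\<^sub>s w = y\<close>.\<close>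

definition coef :: "('g \<Rightarrow> 'x \<Rightarrow> complex) \<Rightarrow> 'z \<Rightarrow> 'z \<Rightarrow> 'g \<Rightarrow> complex" where
  "coef a y w s = (if s \<in> carrier G \<and> y \<in> V s \<and> \<eta> (inv s) y = w then a s (\<rho> y) else 0)"

lemma coef_closed: "a \<in> sections G B \<Longrightarrow> coef a y w \<in> carrier GA"
proof -
  assume a: "a \<in> sections G B"
  have "{s. coef a y w s \<noteq> 0} \<subseteq> supp_on G a"
    by (auto simp: coef_def supp_on_def fun_eq_iff split: if_splits)
  then have "finite {s. coef a y w s \<noteq> 0}" using a by (auto simp: sections_iff intro: finite_subset)
  then show ?thesis by (auto simp: group_alg_carrier coef_def)
qed

lemma coef_add: "coef (a + b) y w = coef a y w + coef b y w"
  by (auto simp: coef_def fun_eq_iff)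

lemma coef_scale: "a \<in> sections G B \<Longrightarrow> coef (vscale SA c a) y w = vscale GA c (coef a y w)"
  by (auto simp: coef_def fun_eq_iff section_alg_def group_alg_def fscale_B)

text \<open>The arrows labelled s from w to y, described once from the target and once from the
  source.\<close>

lemma V_iff: "s \<in> carrier G \<Longrightarrow> y \<in> V s \<and> \<eta> (inv s) y = w \<longleftrightarrow> w \<in> V (inv s) \<and> \<eta> s w = y"
  using Z.th_inv[of s w] Z.th_inv'[of s y] Z.th_in[of s w] Z.th_inv_in[of s y] by auto

lemma coef_star:
  assumes a: "a \<in> sections G B" and y: "y \<in> Z" and w: "w \<in> Z"
  shows "coef (astar SA a) y w = astar GA (coef a w y)"
proof
  fix s
  show "coef (astar SA a) y w s = astar GA (coef a w y) s"
  proof (cases "s \<in> carrier G \<and> y \<in> V s \<and> \<eta> (inv s) y = w")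
    case True
    then have s: "s \<in> carrier G" "y \<in> V s" "\<eta> (inv s) y = w" by auto
    then have "w \<in> V (inv s)" "\<eta> s w = y" using V_iff[of s y w] by auto
    moreover have "\<rho> y \<in> U s" using VU[OF s(1) y] s by simp
    moreover have "\<theta> (inv s) (\<rho> y) = \<rho> w" using equiv[of "inv s" y] s by simp
    ultimately show ?thesis using s by (simp add: coef_def astar_apply group_alg_def)
  next
    case False
    then have "\<not> (s \<in> carrier G \<and> w \<in> V (inv s) \<and> \<eta> s w = y)" using V_iff[of s y w] by auto
    then show ?thesis using False by (auto simp: coef_def group_alg_def)
  qed
qed

text \<open>Once the first label p is fixed, an arrow from w to y can factor only through the middle
  point \<open>\<eta> (inv p) y\<close>, so the matrix product over all middle points reproduces the
  convolution.\<close>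

lemma coef_mult:
  assumes a: "a \<in> sections G B" and b: "b \<in> sections G B" and y: "y \<in> Z" and w: "w \<in> Z"
  shows "coef (amult SA a b) y w = (\<Sum>v\<in>Z. amult GA (coef a y v) (coef b v w))"
proof
  fix s
  show "coef (amult SA a b) y w s = (\<Sum>v\<in>Z. amult GA (coef a y v) (coef b v w)) s"
  proof (cases "s \<in> carrier G")
    case s: True
    have fin: "finite (supp_on G a)" using a by (simp add: sections_iff)
    have m: "amult GA (coef a y v) (coef b v w) s =
        (\<Sum>p\<in>supp_on G a. coef a y v p * coef b v w (inv p \<otimes> s))" for v
    proof -
      have "{t \<in> carrier G. coef a y v t \<noteq> 0} \<subseteq> supp_on G a"
        by (auto simp: coef_def supp_on_def fun_eq_iff split: if_splits)
      then show ?thesis using s fin by (auto simp: group_alg_def dest: supp_carrier intro!: sum.mono_neutral_left)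
    qed
    have in1: "(\<Sum>v\<in>Z. coef a y v p * coef b v w (inv p \<otimes> s)) =
        (if y \<in> V s \<and> \<eta> (inv s) y = w then if y \<in> V p then a p (\<rho> y) * b (inv p \<otimes> s) (\<theta> (inv p) (\<rho> y)) else 0 else 0)"
      if "p \<in> supp_on G a" for p
    proof -
      have p: "p \<in> carrier G" using that by (rule supp_carrier)
      show ?thesis
      proof (cases "y \<in> V p")
        case False
        then show ?thesis by (simp add: coef_def)
      next
        case True
        define v0 where "v0 = \<eta> (inv p) y"
        have v0: "v0 \<in> V (inv p)" "v0 \<in> Z" "\<eta> p v0 = y"
          using Z.th_inv_in[OF p True] Z.U_sub[of "inv p"] Z.th_inv'[OF p True] p by (auto simp: v0_def)
        have \<rho>v: "\<theta> (inv p) (\<rho> y) = \<rho> v0" using equiv[of "inv p" y] True p by (simp add: v0_def)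
        have "(\<Sum>v\<in>Z. coef a y v p * coef b v w (inv p \<otimes> s)) =
            (\<Sum>v\<in>Z. if v = v0 then a p (\<rho> y) * coef b v0 w (inv p \<otimes> s) else 0)"
          by (rule sum.cong) (auto simp: coef_def p True v0_def)
        also have "\<dots> = a p (\<rho> y) * coef b v0 w (inv p \<otimes> s)" using v0 fZ by simp
        also have "coef b v0 w (inv p \<otimes> s) =
            (if y \<in> V s \<and> \<eta> (inv s) y = w then b (inv p \<otimes> s) (\<rho> v0) else 0)"
        proof (cases "b (inv p \<otimes> s) (\<rho> v0) = 0")
          case False
          have "\<rho> v0 \<in> U (inv p \<otimes> s)"
            using sections_nonzeroD[OF b _ False] p s by simp
          then have v1: "v0 \<in> V (inv p \<otimes> s)" using VU[OF _ v0(2), of "inv p \<otimes> s"] p s by simp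
          have "y \<in> V (p \<otimes> (inv p \<otimes> s))"
            by (rule Z.th_mult_in[OF p _ True]) (use v1 p s in \<open>auto simp: v0_def\<close>)
          then have ys: "y \<in> V s" using p s by (simp add: m_assoc[symmetric])
          have "\<eta> (inv (inv p \<otimes> s) \<otimes> inv p) y = \<eta> (inv (inv p \<otimes> s)) (\<eta> (inv p) y)"
            by (rule Z.th_comp(2)) (use p s v1 True in \<open>auto simp: v0_def\<close>)
          then have "\<eta> (inv (inv p \<otimes> s)) v0 = \<eta> (inv s) y"
            using p s by (simp add: v0_def inv_mult_group m_assoc)
          then show ?thesis using v1 ys p s by (simp add: coef_def)
        qed (simp add: coef_def)
        finally show ?thesis using True by (simp add: \<rho>v)
      qed
    qed
    have "(\<Sum>v\<in>Z. amult GA (coef a y v) (coef b v w)) s =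
        (\<Sum>p\<in>supp_on G a. \<Sum>v\<in>Z. coef a y v p * coef b v w (inv p \<otimes> s))"
      unfolding sum_apply m by (rule sum.swap)
    also have "\<dots> = coef (amult SA a b) y w s"
    proof -
      have eqv: "y \<in> V p \<longleftrightarrow> \<rho> y \<in> U p" if "p \<in> supp_on G a" for p
        using VU[OF supp_carrier[OF that] y] .
      have "(\<Sum>p\<in>supp_on G a. \<Sum>v\<in>Z. coef a y v p * coef b v w (inv p \<otimes> s)) =
          (\<Sum>p\<in>supp_on G a. if y \<in> V s \<and> \<eta> (inv s) y = w
            then if s \<in> carrier G \<and> \<rho> y \<in> U p then a p (\<rho> y) * b (inv p \<otimes> s) (\<theta> (inv p) (\<rho> y)) else 0 else 0)"
        by (rule sum.cong) (auto simp: in1 eqv s)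
      also have "\<dots> = coef (amult SA a b) y w s"
        using s by (cases "y \<in> V s \<and> \<eta> (inv s) y = w") (auto simp: coef_def amult_eq section_act_apply)
      finally show ?thesis .
    qed
    finally show ?thesis ..
  next
    case False
    then show ?thesis by (simp add: sum_apply coef_def group_alg_def)
  qed
qed

text \<open>Sorting the index set of the orbit by the values y = \<open>\<eta> t z\<close> and w =
  \<open>\<eta> r z\<close> cuts the orbit kernel into blocks, each a compression of a kernel on the
  group.\<close>

lemma sker_coef:
  assumes a: "a \<in> sections G B" and z: "z \<in> Z"
  shows "sker (\<rho> z) a t r = (\<Sum>y\<in>Z. \<Sum>w\<in>Z. if t \<in> carrier G \<and> z \<in> V (inv t) \<and> \<eta> t z = y \<and>
    r \<in> carrier G \<and> z \<in> V (inv r) \<and> \<eta> r z = w then gker G (coef a y w) t r else 0)"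
    (is "_ = ?R")
proof (cases "t \<in> carrier G \<and> r \<in> carrier G \<and> z \<in> V (inv t) \<and> z \<in> V (inv r)")
  case True
  then have t: "t \<in> carrier G" "z \<in> V (inv t)" and r: "r \<in> carrier G" "z \<in> V (inv r)" by auto
  have yZ: "\<eta> t z \<in> Z" "\<eta> r z \<in> Z"
    using Z.th_in[OF t] Z.th_in[OF r] Z.U_sub[OF t(1)] Z.U_sub[OF r(1)] by auto
  have "?R = (\<Sum>y\<in>Z. \<Sum>w\<in>Z. if w = \<eta> r z then if y = \<eta> t z then gker G (coef a (\<eta> t z) (\<eta> r z)) t r else 0 else 0)"
    by (intro sum.cong refl) (use t r in auto)
  also have "\<dots> = gker G (coef a (\<eta> t z) (\<eta> r z)) t r" using yZ fZ by simp
  also have "\<dots> = sker (\<rho> z) a t r"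
  proof -
    have i: "inv (t \<otimes> inv r) = r \<otimes> inv t" using t r by (simp add: inv_mult_group)
    have "\<eta> t z \<in> V (t \<otimes> inv r)" "\<eta> (r \<otimes> inv t) (\<eta> t z) = \<eta> r z"
      using Z.th_div[OF t(1) r(1) t(2)] r by auto
    moreover have "\<rho> z \<in> U (inv t)" using VU[of "inv t" z] t z by simp
    ultimately show ?thesis using t r equiv[OF t] by (simp add: gker_def coef_def sker_def i)
  qed
  finally show ?thesis ..
next
  case False
  then have "?R = 0" by (intro sum.neutral ballI) auto
  moreover have "sker (\<rho> z) a t r = 0"
  proof (rule ccontr)
    assume n: "sker (\<rho> z) a t r \<noteq> 0"
    then have "t \<in> carrier G" "r \<in> carrier G" by (auto simp: sker_def split: if_splits)
    with sker_adj[OF a this n] VU[of "inv t" z] VU[of "inv r" z] z False show False by simp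
  qed
  ultimately show ?thesis by simp
qed

text \<open>There are \<open>card Z * card Z\<close> blocks, and each is a compression of a kernel
  with bound \<open>M\<close>; hence the constant.\<close>

lemma kbounded_sker_coef:
  assumes a: "a \<in> sections G B" and z: "z \<in> Z"
    and M: "\<And>y w. y \<in> Z \<Longrightarrow> w \<in> Z \<Longrightarrow> kbounded (gker G (coef a y w)) M" and M0: "0 \<le> M"
  shows "kbounded (sker (\<rho> z) a) (real (card Z * card Z) * M)"
  unfolding kbounded_def
proof (intro conjI allI impI)
  fix \<xi> :: "'g \<Rightarrow> complex" assume \<xi>: "fsupp \<xi>"
  have fin: "finite {r. \<xi> r \<noteq> 0}" using \<xi> by (simp add: fsupp_def)
  define \<zeta> where "\<zeta> w r = (if r \<in> carrier G \<and> z \<in> V (inv r) \<and> \<eta> r z = w then \<xi> r else 0)" for w r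
  have fz: "fsupp (\<zeta> w)" "nrm (\<zeta> w) \<le> nrm \<xi>" for w
    unfolding \<zeta>_def by (rule fsupp_restrict[OF \<xi>], rule nrm_restrict[OF \<xi>])
  define g where "g y w t = (if t \<in> carrier G \<and> z \<in> V (inv t) \<and> \<eta> t z = y
    then kapply (gker G (coef a y w)) (\<zeta> w) t else 0)" for y w t
  have fk: "fsupp (kapply (gker G (coef a y w)) (\<zeta> w))" for y w
    by (rule kapply_fsupp[OF row_col_finite_gker[OF coef_closed[OF a]] fz(1)])
  have gf: "fsupp (g y w)" "nrm (g y w) \<le> nrm (kapply (gker G (coef a y w)) (\<zeta> w))" for y w
    unfolding g_def by (rule fsupp_restrict[OF fk], rule nrm_restrict[OF fk])
  have "kapply (sker (\<rho> z) a) \<xi> t = (\<Sum>y\<in>Z. \<Sum>w\<in>Z. g y w t)" for t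
  proof -
    have "g y w t = (\<Sum>r | \<xi> r \<noteq> 0. (if t \<in> carrier G \<and> z \<in> V (inv t) \<and> \<eta> t z = y \<and>
        r \<in> carrier G \<and> z \<in> V (inv r) \<and> \<eta> r z = w then gker G (coef a y w) t r else 0) * \<xi> r)" for y w
    proof -
      have "kapply (gker G (coef a y w)) (\<zeta> w) t = (\<Sum>r | \<xi> r \<noteq> 0. gker G (coef a y w) t r * \<zeta> w r)"
        by (rule kapply_eq[OF fin]) (auto simp: \<zeta>_def)
      then show ?thesis by (auto simp: g_def \<zeta>_def intro!: sum.cong)
    qed
    then have "(\<Sum>y\<in>Z. \<Sum>w\<in>Z. g y w t) = (\<Sum>y\<in>Z. \<Sum>r | \<xi> r \<noteq> 0. \<Sum>w\<in>Z. (if t \<in> carrier G \<and> z \<in> V (inv t) \<and> \<eta> t z = y \<and>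
        r \<in> carrier G \<and> z \<in> V (inv r) \<and> \<eta> r z = w then gker G (coef a y w) t r else 0) * \<xi> r)"
      by (intro sum.cong refl) (simp only:, rule sum.swap)
    also have "\<dots> = (\<Sum>r | \<xi> r \<noteq> 0. sker (\<rho> z) a t r * \<xi> r)"
      by (subst sum.swap) (simp only: sker_coef[OF a z] sum_distrib_right)
    finally show ?thesis by (simp add: kapply_def)
  qed
  then have "nrm (kapply (sker (\<rho> z) a) \<xi>) = nrm (\<lambda>t. \<Sum>y\<in>Z. \<Sum>w\<in>Z. g y w t)" by presburger
  also have "\<dots> \<le> (\<Sum>y\<in>Z. nrm (\<lambda>t. \<Sum>w\<in>Z. g y w t))"
    by (rule nrm_sum) (auto intro: fZ fsupp_sum gf)
  also have "\<dots> \<le> (\<Sum>y\<in>Z. \<Sum>w\<in>Z. nrm (g y w))"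
    by (intro sum_mono nrm_sum fZ gf)
  also have "\<dots> \<le> (\<Sum>y\<in>Z. \<Sum>w\<in>Z. M * nrm \<xi>)"
  proof (intro sum_mono)
    fix y w assume yw: "y \<in> Z" "w \<in> Z"
    have "nrm (g y w) \<le> M * nrm (\<zeta> w)" using gf(2) kbdD[OF M[OF yw] fz(1)] order_trans by blast
    also have "\<dots> \<le> M * nrm \<xi>" by (rule mult_left_mono[OF fz(2) M0])
    finally show "nrm (g y w) \<le> M * nrm \<xi>" .
  qed
  finally show "nrm (kapply (sker (\<rho> z) a) \<xi>) \<le> real (card Z * card Z) * M * nrm \<xi>" by (simp add: mult_ac)
qed (simp add: M0)


text \<open>Right translation by \<open>r\<close> identifies the operator, on vectors supported in the coset \<open>H r\<close> of the
  stabiliser \<open>H\<close> of \<open>w\<close>, with a compression of the representation at \<open>\<rho> w\<close>; different cosets have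
  orthogonal images.\<close>

lemma kbounded_coef:
  assumes a: "a \<in> sections G B" and y: "y \<in> Z" and w: "w \<in> Z"
  shows "kbounded (gker G (coef a y w)) (vnorm SA a)"
  unfolding kbounded_def
proof (intro conjI allI impI)
  let ?K = "gker G (coef a y w)"
  let ?x = "\<rho> w"
  have n0: "0 \<le> vnorm SA a" by (rule section_norm_eq(3)[OF a])
  show "0 \<le> vnorm SA a" by (rule n0)
  have x: "?x \<in> X" using \<rho>X w by auto
  have rK: "row_col_finite ?K" by (rule row_col_finite_gker[OF coef_closed[OF a]])
  define H where "H = {h \<in> carrier G. w \<in> V (inv h) \<and> \<eta> h w = w}"
  have H1: "\<one> \<in> H" using w Z.U_one Z.th_one by (simp add: H_def)
  have Hm: "h \<otimes> k \<in> H" if "h \<in> H" "k \<in> H" for h k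
    using that Z.th_comp[of h k w] by (auto simp: H_def)
  have Hi: "inv h \<in> H" if "h \<in> H" for h
    using that Z.th_inv[of h w] Z.th_in[of h w] by (auto simp: H_def)
  have c0: "w \<in> V (inv s) \<and> \<eta> s w = y" if "s \<in> carrier G" "coef a y w s \<noteq> 0" for s
    using that V_iff[of s y w] by (auto simp: coef_def split: if_splits)
  have coset: "nrm (kapply ?K \<xi>) \<le> vnorm SA a * nrm \<xi>"
    if \<xi>: "fsupp \<xi>" and r: "r \<in> carrier G" and supp: "\<And>q. \<xi> q \<noteq> 0 \<Longrightarrow> q \<in> carrier G \<and> q \<otimes> inv r \<in> H" for \<xi> r
  proof -
    define \<zeta> where "\<zeta> k = (if k \<in> carrier G then \<xi> (k \<otimes> r) else 0)" for k
    have z: "fsupp \<zeta>" "nrm \<zeta> \<le> nrm \<xi>"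
      unfolding \<zeta>_def by (rule nrm_translate[OF _ \<xi>], use r in \<open>auto intro: inj_onI\<close>)+
    have fk: "fsupp (kapply (sker ?x a) \<zeta>)" by (rule kapply_fsupp[OF sker_bound(2)[OF a] z(1)])
    let ?T = "\<lambda>t. if t \<in> carrier G then kapply (sker ?x a) \<zeta> (t \<otimes> inv r) else 0"
    have T: "fsupp ?T" "nrm ?T \<le> nrm (kapply (sker ?x a) \<zeta>)"
      by (rule nrm_translate[OF _ fk], use r in \<open>auto intro: inj_onI\<close>)+
    have "cmod (kapply ?K \<xi> t) \<le> cmod (?T t)" for t
    proof (cases "t \<in> carrier G \<and> kapply ?K \<xi> t \<noteq> 0")
      case True
      then have t: "t \<in> carrier G" by simp
      define u where "u = t \<otimes> inv r"
      have u: "u \<in> carrier G" using t r by (simp add: u_def)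
      \<comment> \<open>An element of \<open>H\<close> does not move w, so whether the arrow
        condition in \<open>coef\<close> holds depends on \<open>u\<close> alone and not on
        \<open>k\<close>.\<close>
      have key: "coef a y w (u \<otimes> inv k) =
          (if w \<in> V (inv u) \<and> \<eta> u w = y then a (u \<otimes> inv k) (\<rho> y) else 0)" if k: "k \<in> H" for k
      proof -
        have kc: "k \<in> carrier G" "w \<in> V (inv k)" "\<eta> k w = w" using k by (auto simp: H_def)
        have ic: "inv k \<in> carrier G" "w \<in> V (inv (inv k))" "\<eta> (inv k) w = w" using Hi[OF k] by (auto simp: H_def)
        have s: "u \<otimes> inv k \<in> carrier G" "u \<otimes> inv k \<otimes> k = u" using u kc by (simp_all add: m_assoc)
        have "w \<in> V (inv (u \<otimes> inv k)) \<and> \<eta> (u \<otimes> inv k) w = y \<longleftrightarrow> w \<in> V (inv u) \<and> \<eta> u w = y"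
        proof
          assume A: "w \<in> V (inv (u \<otimes> inv k)) \<and> \<eta> (u \<otimes> inv k) w = y"
          then have "\<eta> k w \<in> V (inv (u \<otimes> inv k))" using kc by simp
          from Z.th_comp[OF s(1) kc(1,2) this] show "w \<in> V (inv u) \<and> \<eta> u w = y"
            using A unfolding s(2) kc(3) by simp
        next
          assume A: "w \<in> V (inv u) \<and> \<eta> u w = y"
          then have "\<eta> (inv k) w \<in> V (inv u)" using ic by simp
          from Z.th_comp[OF u ic(1,2) this] show "w \<in> V (inv (u \<otimes> inv k)) \<and> \<eta> (u \<otimes> inv k) w = y"
            using A unfolding ic(3) by simp
        qed
        then show ?thesis using V_iff[OF s(1), of y w] s(1) by (auto simp: coef_def)
      qed
      have "kapply ?K \<xi> t = (\<Sum>q | \<xi> q \<noteq> 0. coef a y w (u \<otimes> inv (q \<otimes> inv r)) * \<xi> q)"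
        unfolding kapply_def by (rule sum.cong) (use t r supp in \<open>auto simp: gker_def u_def inv_mult_group m_assoc inv_cancel\<close>)
      also have "\<dots> = (\<Sum>q | \<xi> q \<noteq> 0. if w \<in> V (inv u) \<and> \<eta> u w = y then a (u \<otimes> inv (q \<otimes> inv r)) (\<rho> y) * \<xi> q else 0)"
        by (rule sum.cong) (use key supp in auto)
      finally have e1: "kapply ?K \<xi> t = (if w \<in> V (inv u) \<and> \<eta> u w = y
          then \<Sum>q | \<xi> q \<noteq> 0. a (u \<otimes> inv (q \<otimes> inv r)) (\<rho> y) * \<xi> q else 0)"
        by (cases "w \<in> V (inv u) \<and> \<eta> u w = y") auto
      with True have wy: "w \<in> V (inv u)" "\<eta> u w = y" by (auto split: if_splits)
      have xu: "?x \<in> U (inv u)" using VU[of "inv u" w] u w wy by simp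
      have th: "\<theta> u ?x = \<rho> y" using equiv[OF u wy(1)] wy(2) by simp
      have "kapply (sker ?x a) \<zeta> u = (\<Sum>k | \<zeta> k \<noteq> 0. a (u \<otimes> inv k) (\<rho> y) * \<zeta> k)"
        unfolding kapply_def by (rule sum.cong) (use u xu in \<open>auto simp: sker_def th \<zeta>_def split: if_splits\<close>)
      also have "\<dots> = (\<Sum>q | \<xi> q \<noteq> 0. a (u \<otimes> inv (q \<otimes> inv r)) (\<rho> y) * \<xi> q)"
        by (rule sum.reindex_bij_witness[where i = "\<lambda>q. q \<otimes> inv r" and j = "\<lambda>k. k \<otimes> r"])
          (use r supp in \<open>auto simp: \<zeta>_def m_assoc split: if_splits\<close>)
      finally have "kapply (sker ?x a) \<zeta> u = kapply ?K \<xi> t" using e1 wy by simp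
      then show ?thesis using t by (simp add: u_def)
    next
      case False
      then have "kapply ?K \<xi> t = 0" by (cases "t \<in> carrier G") (simp_all add: kapply_def gker_def)
      then show ?thesis by simp
    qed
    then have "nrm (kapply ?K \<xi>) \<le> nrm ?T" by (rule nrm_mono[OF T(1)])
    also have "\<dots> \<le> nrm (kapply (sker ?x a) \<zeta>)" by (rule T(2))
    also have "\<dots> \<le> vnorm SA a * nrm \<zeta>" by (rule kbdD[OF kbounded_sker[OF a x] z(1)])
    also have "\<dots> \<le> vnorm SA a * nrm \<xi>" by (rule mult_left_mono[OF z(2) n0])
    finally show ?thesis .
  qed
  \<comment> \<open>Induction on the size of the support: one coset is split off at a time, and
    Pythagoras adds up the estimates.\<close>
  have main: "fsupp \<xi> \<Longrightarrow> (\<And>q. \<xi> q \<noteq> 0 \<Longrightarrow> q \<in> carrier G) \<Longrightarrow> (nrm (kapply ?K \<xi>))\<^sup>2 \<le> (vnorm SA a)\<^sup>2 * (nrm \<xi>)\<^sup>2" for \<xi>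
  proof (induction "card {q. \<xi> q \<noteq> 0}" arbitrary: \<xi> rule: less_induct)
    case less
    show ?case
    proof (cases "\<exists>r. \<xi> r \<noteq> 0")
      case False
      then have "\<xi> = (\<lambda>_. 0)" by auto
      then show ?thesis by (simp add: kapply_zero_right)
    next
      case True
      then obtain r where r: "\<xi> r \<noteq> 0" by blast
      then have rc: "r \<in> carrier G" using less.prems by blast
      define \<xi>1 where "\<xi>1 q = (if q \<otimes> inv r \<in> H then \<xi> q else 0)" for q
      define \<xi>2 where "\<xi>2 q = (if \<not> q \<otimes> inv r \<in> H then \<xi> q else 0)" for q
      have f1: "fsupp \<xi>1" unfolding \<xi>1_def by (rule fsupp_restrict[OF less.prems(1)])
      have f2: "fsupp \<xi>2" unfolding \<xi>2_def by (rule fsupp_restrict[OF less.prems(1)])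
      have sum: "\<xi> = (\<lambda>q. \<xi>1 q + \<xi>2 q)" by (auto simp: \<xi>1_def \<xi>2_def)
      have nn: "(nrm \<xi>)\<^sup>2 = (nrm \<xi>1)\<^sup>2 + (nrm \<xi>2)\<^sup>2"
        unfolding sum by (rule nrm_disjoint[OF f1 f2]) (auto simp: \<xi>1_def \<xi>2_def)
      have "card {q. \<xi>2 q \<noteq> 0} < card {q. \<xi> q \<noteq> 0}"
      proof (rule psubset_card_mono)
        show "finite {q. \<xi> q \<noteq> 0}" using less.prems by (simp add: fsupp_def)
        have "r \<otimes> inv r \<in> H" using H1 rc by simp
        then show "{q. \<xi>2 q \<noteq> 0} \<subset> {q. \<xi> q \<noteq> 0}" using r by (auto simp: \<xi>2_def)
      qed
      moreover have "q \<in> carrier G" if "\<xi>2 q \<noteq> 0" for q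
        using less.prems(2) that by (auto simp: \<xi>2_def split: if_splits)
      ultimately have i2: "(nrm (kapply ?K \<xi>2))\<^sup>2 \<le> (vnorm SA a)\<^sup>2 * (nrm \<xi>2)\<^sup>2"
        using less.hyps[OF _ f2] by blast
      have "nrm (kapply ?K \<xi>1) \<le> vnorm SA a * nrm \<xi>1"
        by (rule coset[OF f1 rc]) (use less.prems(2) in \<open>auto simp: \<xi>1_def split: if_splits\<close>)
      then have i1: "(nrm (kapply ?K \<xi>1))\<^sup>2 \<le> (vnorm SA a)\<^sup>2 * (nrm \<xi>1)\<^sup>2"
        using power_mono[OF _ nrm_nonneg, of "kapply ?K \<xi>1" _ 2] by (metis power_mult_distrib)
      have k: "kapply ?K \<xi> = (\<lambda>t. kapply ?K \<xi>1 t + kapply ?K \<xi>2 t)"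
        unfolding kapply_alt[OF rK f1] kapply_alt[OF rK f2] sum.distrib[symmetric]
        by (rule ext, unfold kapply_alt[OF rK less.prems(1)]) (rule sum.cong, auto simp: \<xi>1_def \<xi>2_def)
      have "(nrm (kapply ?K \<xi>))\<^sup>2 = (nrm (kapply ?K \<xi>1))\<^sup>2 + (nrm (kapply ?K \<xi>2))\<^sup>2"
        unfolding k
      proof (rule nrm_disjoint[OF kapply_fsupp[OF rK f1] kapply_fsupp[OF rK f2]])
        fix t
        show "kapply ?K \<xi>1 t = 0 \<or> kapply ?K \<xi>2 t = 0"
        proof (rule ccontr)
          \<comment> \<open>Two indices contributing to the same t give elements s and s' that both
            send w to y; then (inv s') s is in \<open>H\<close>, so both indices lie in one
            coset.\<close>
          assume n: "\<not> (kapply ?K \<xi>1 t = 0 \<or> kapply ?K \<xi>2 t = 0)"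
          then have "kapply ?K \<xi>1 t \<noteq> 0" "kapply ?K \<xi>2 t \<noteq> 0" by auto
          then obtain q q' where q: "?K t q \<noteq> 0" "\<xi>1 q \<noteq> 0" and q': "?K t q' \<noteq> 0" "\<xi>2 q' \<noteq> 0"
            unfolding kapply_def by (elim sum.not_neutral_contains_not_neutral) auto
          have t: "t \<in> carrier G" "q \<in> carrier G" "q' \<in> carrier G"
            using q q' by (auto simp: gker_def split: if_splits)
          define s where "s = t \<otimes> inv q"
          define s' where "s' = t \<otimes> inv q'"
          have sc: "s \<in> carrier G" "s' \<in> carrier G" using t by (auto simp: s_def s'_def)
          have "w \<in> V (inv s) \<and> \<eta> s w = y" "w \<in> V (inv s') \<and> \<eta> s' w = y"
            using c0[OF sc(1)] c0[OF sc(2)] q q' t by (auto simp: gker_def s_def s'_def)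
          then have "inv s' \<otimes> s \<in> H"
            using Z.th_comp[of "inv s'" s w] Z.th_in[of s' w] Z.th_inv[of s' w] sc by (auto simp: H_def)
          moreover have "inv s' \<otimes> s = q' \<otimes> inv q"
          proof -
            have "inv s' \<otimes> s = q' \<otimes> (inv t \<otimes> t) \<otimes> inv q"
              unfolding s_def s'_def using t by (simp add: inv_mult_group m_assoc inv_cancel)
            then show ?thesis using t by simp
          qed
          moreover have "q \<otimes> inv r \<in> H" using q by (auto simp: \<xi>1_def split: if_splits)
          ultimately have "q' \<otimes> inv q \<otimes> (q \<otimes> inv r) \<in> H" using Hm by metis
          moreover have "q' \<otimes> inv q \<otimes> (q \<otimes> inv r) = q' \<otimes> inv r"
          proof -
            have "q' \<otimes> inv q \<otimes> (q \<otimes> inv r) = q' \<otimes> (inv q \<otimes> q) \<otimes> inv r"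
              using t rc by (simp add: m_assoc inv_cancel)
            then show ?thesis using t by simp
          qed
          ultimately show False using q' by (auto simp: \<xi>2_def split: if_splits)
        qed
      qed
      then show ?thesis using i1 i2 nn by (simp add: distrib_left)
    qed
  qed
  fix \<xi> :: "'g \<Rightarrow> complex" assume \<xi>: "fsupp \<xi>"
  define \<xi>' where "\<xi>' t = (if t \<in> carrier G then \<xi> t else 0)" for t
  have f': "fsupp \<xi>'" "nrm \<xi>' \<le> nrm \<xi>"
    unfolding \<xi>'_def by (rule fsupp_restrict[OF \<xi>], rule nrm_restrict[OF \<xi>])
  have k: "kapply ?K \<xi> = kapply ?K \<xi>'"
    unfolding kapply_alt[OF rK f'(1), abs_def] kapply_alt[OF rK \<xi>, abs_def]
    by (intro ext sum.cong refl) (auto simp: \<xi>'_def gker_def split: if_splits)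
  have "q \<in> carrier G" if "\<xi>' q \<noteq> 0" for q using that by (simp add: \<xi>'_def split: if_splits)
  then have "(nrm (kapply ?K \<xi>'))\<^sup>2 \<le> (vnorm SA a * nrm \<xi>')\<^sup>2"
    using main[OF f'(1)] unfolding power_mult_distrib by blast
  then have "nrm (kapply ?K \<xi>') \<le> vnorm SA a * nrm \<xi>'" by (rule power2_le_imp_le) (simp add: n0)
  also have "\<dots> \<le> vnorm SA a * nrm \<xi>" by (rule mult_left_mono[OF f'(2) n0])
  finally show "nrm (kapply ?K \<xi>) \<le> vnorm SA a * nrm \<xi>" by (simp add: k)
qed

section \<open>Amplification of representations of the group algebra to matrices indexed by
  \<open>Z\<close>\<close>

definition amplify :: "nat \<Rightarrow> (('g \<Rightarrow> complex) \<Rightarrow> complex mat) \<Rightarrow> ('g \<Rightarrow> 'x \<Rightarrow> complex) \<Rightarrow>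
    'z \<times> nat \<Rightarrow> 'z \<times> nat \<Rightarrow> complex" where
  "amplify d \<phi> a p q = (if p \<in> Z \<times> {..<d} \<and> q \<in> Z \<times> {..<d}
    then \<phi> (coef a (fst p) (fst q)) $$ (snd p, snd q) else 0)"

lemma amplify_fin_rep:
  assumes \<phi>: "star_hom_mat GA d \<phi>"
  shows "fin_rep SA (Z \<times> {..<d}) (amplify d \<phi>)"
proof -
  have C: "\<phi> c \<in> carrier_mat d d" if "c \<in> carrier GA" for c using \<phi> that by (simp add: star_hom_mat_def)
  have add: "\<phi> (c + c') $$ (i, j) = \<phi> c $$ (i, j) + \<phi> c' $$ (i, j)"
    if "c \<in> carrier GA" "c' \<in> carrier GA" "i < d" "j < d" for c c' i j
  proof -
    have "\<phi> (c + c') = \<phi> c + \<phi> c'" using \<phi> that by (simp add: star_hom_mat_def GA.vadd_eq[symmetric])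
    then show ?thesis using C[OF that(1)] C[OF that(2)] that by simp
  qed
  have zero: "\<phi> 0 $$ (i, j) = 0" if "i < d" "j < d" for i j
    using add[OF GA.zero_closed GA.zero_closed that] by simp
  have sm: "\<phi> (\<Sum>v\<in>S. f v) $$ (i, j) = (\<Sum>v\<in>S. \<phi> (f v) $$ (i, j)) \<and> (\<Sum>v\<in>S. f v) \<in> carrier GA"
    if "finite S" "\<And>v. v \<in> S \<Longrightarrow> f v \<in> carrier GA" "i < d" "j < d" for S i j and f :: "'z \<Rightarrow> 'g \<Rightarrow> complex"
    using that by (induction S rule: finite_induct) (auto simp: zero add GA.zero_closed GA.add_closed)
  have J: "finite (Z \<times> {..<d})" using fZ by simp
  show ?thesis
    unfolding fin_rep_def
  proof (intro conjI ballI allI impI J)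
    fix a b c assume a': "a \<in> carrier SA"
    then have a: "a \<in> sections G B" by (simp add: SA_carrier)
    show "p \<in> Z \<times> {..<d}" "q \<in> Z \<times> {..<d}" if "amplify d \<phi> a p q \<noteq> 0" for p q
      using that by (auto simp: amplify_def split: if_splits)
    show "amplify d \<phi> (vscale SA c a) = (\<lambda>p q. c * amplify d \<phi> a p q)"
    proof (intro ext)
      fix p q :: "'z \<times> nat"
      have "\<phi> (vscale GA c (coef a (fst p) (fst q))) = c \<cdot>\<^sub>m \<phi> (coef a (fst p) (fst q))"
        using \<phi> coef_closed[OF a] by (simp add: star_hom_mat_def)
      then show "amplify d \<phi> (vscale SA c a) p q = c * amplify d \<phi> a p q"
        using C[OF coef_closed[OF a, of "fst p" "fst q"]] by (auto simp: amplify_def coef_scale[OF a])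
    qed
    show "amplify d \<phi> (astar SA a) = kadj (amplify d \<phi> a)"
    proof (intro ext)
      fix p q :: "'z \<times> nat"
      have "\<phi> (astar GA (coef a (fst q) (fst p))) = mat_adjoint (\<phi> (coef a (fst q) (fst p)))"
        using \<phi> coef_closed[OF a] by (simp add: star_hom_mat_def)
      then show "amplify d \<phi> (astar SA a) p q = kadj (amplify d \<phi> a) p q"
        using coef_star[OF a, of "fst p" "fst q"] adjoint_index[OF C[OF coef_closed[OF a, of "fst q" "fst p"]]]
        by (auto simp: amplify_def kadj_def)
    qed
    assume b': "b \<in> carrier SA"
    then have b: "b \<in> sections G B" by (simp add: SA_carrier)
    show "amplify d \<phi> (a + b) = (\<lambda>p q. amplify d \<phi> a p q + amplify d \<phi> b p q)"
      by (auto simp: amplify_def coef_add add coef_closed a b fun_eq_iff)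
    show "amplify d \<phi> (amult SA a b) = kmul (amplify d \<phi> a) (amplify d \<phi> b)"
    proof (intro ext)
      fix p q :: "'z \<times> nat"
      show "amplify d \<phi> (amult SA a b) p q = kmul (amplify d \<phi> a) (amplify d \<phi> b) p q"
      proof (cases "p \<in> Z \<times> {..<d} \<and> q \<in> Z \<times> {..<d}")
        case True
        then have p: "fst p \<in> Z" "snd p < d" and q: "fst q \<in> Z" "snd q < d" by auto
        have "kmul (amplify d \<phi> a) (amplify d \<phi> b) p q = (\<Sum>r\<in>Z \<times> {..<d}. amplify d \<phi> a p r * amplify d \<phi> b r q)"
          by (rule kmul_eq[OF J]) (auto simp: amplify_def split: if_splits)
        also have "\<dots> = (\<Sum>v\<in>Z. \<Sum>k<d. amplify d \<phi> a p (v, k) * amplify d \<phi> b (v, k) q)"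
          by (simp add: sum.cartesian_product)
        also have "\<dots> = (\<Sum>v\<in>Z. \<phi> (amult GA (coef a (fst p) v) (coef b v (fst q))) $$ (snd p, snd q))"
        proof (rule sum.cong[OF refl])
          fix v assume v: "v \<in> Z"
          have "\<phi> (amult GA (coef a (fst p) v) (coef b v (fst q))) = \<phi> (coef a (fst p) v) * \<phi> (coef b v (fst q))"
            using \<phi> coef_closed[OF a] coef_closed[OF b] by (simp add: star_hom_mat_def)
          then have "\<phi> (amult GA (coef a (fst p) v) (coef b v (fst q))) $$ (snd p, snd q) =
              (\<Sum>k<d. \<phi> (coef a (fst p) v) $$ (snd p, k) * \<phi> (coef b v (fst q)) $$ (k, snd q))"
            using mat_mult_index[OF C[OF coef_closed[OF a]] C[OF coef_closed[OF b]] p(2) q(2)] by simp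
          then show "(\<Sum>k<d. amplify d \<phi> a p (v, k) * amplify d \<phi> b (v, k) q) =
              \<phi> (amult GA (coef a (fst p) v) (coef b v (fst q))) $$ (snd p, snd q)"
            using v True by (auto simp: amplify_def)
        qed
        also have "\<dots> = \<phi> (\<Sum>v\<in>Z. amult GA (coef a (fst p) v) (coef b v (fst q))) $$ (snd p, snd q)"
          using sm[OF fZ _ p(2) q(2), of "\<lambda>v. amult GA (coef a (fst p) v) (coef b v (fst q))"]
            GA.mult_closed coef_closed[OF a] coef_closed[OF b] by simp
        finally show ?thesis using True coef_mult[OF a b p(1) q(1)] by (simp add: amplify_def)
      next
        case False
        then have "amplify d \<phi> a p r * amplify d \<phi> b r q = 0" for r by (auto simp: amplify_def)
        then show ?thesis using False by (auto simp: kmul_def amplify_def)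
      qed
    qed
  qed
qed

text \<open>A vector placed in the component \<open>w\<close> is sent to one whose component
  \<open>y\<close> is its image under the block; embedding and extraction do not increase
  norms.\<close>

lemma amplify_block:
  assumes \<phi>: "star_hom_mat GA d \<phi>" and a: "a \<in> sections G B" and y: "y \<in> Z" and w: "w \<in> Z"
    and bd: "kbounded (amplify d \<phi> a) C"
  shows "mat_norm (\<phi> (coef a y w)) \<le> C"
proof (rule mat_norm_least)
  let ?M = "\<phi> (coef a y w)"
  have M: "?M \<in> carrier_mat d d" using \<phi> coef_closed[OF a] by (simp add: star_hom_mat_def)
  show "kbounded (kmat ?M) C"
    unfolding kbounded_def
  proof (intro conjI allI impI)
    show C0: "0 \<le> C" by (rule kbounded_nonneg[OF bd])
    fix \<xi> :: "nat \<Rightarrow> complex" assume \<xi>: "fsupp \<xi>"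
    define \<Xi> where "\<Xi> p = (if p \<in> {w} \<times> {..<d} then \<xi> (snd p) else 0)" for p :: "'z \<times> nat"
    have X: "fsupp \<Xi>" "nrm \<Xi> \<le> nrm \<xi>"
      unfolding \<Xi>_def by (rule nrm_translate[OF _ \<xi>], auto intro: inj_onI)+
    have rA: "row_col_finite (amplify d \<phi> a)"
      by (rule row_col_finite_finite[of "Z \<times> {..<d}"]) (use fZ in \<open>auto simp: amplify_def split: if_splits\<close>)
    have fk: "fsupp (kapply (amplify d \<phi> a) \<Xi>)" by (rule kapply_fsupp[OF rA X(1)])
    have "kapply (kmat ?M) \<xi> i = (if i \<in> {..<d} then kapply (amplify d \<phi> a) \<Xi> (y, i) else 0)" for i
    proof -
      have "kapply (amplify d \<phi> a) \<Xi> (y, i) = (\<Sum>p\<in>{w} \<times> {..<d}. amplify d \<phi> a (y, i) p * \<Xi> p)"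
        by (rule kapply_eq) (auto simp: \<Xi>_def)
      also have "\<dots> = (\<Sum>v\<in>{w}. \<Sum>j<d. amplify d \<phi> a (y, i) (v, j) * \<Xi> (v, j))"
        by (simp only: sum.cartesian_product split_def prod.collapse)
      also have "\<dots> = (\<Sum>j<d. amplify d \<phi> a (y, i) (w, j) * \<xi> j)" by (simp add: \<Xi>_def)
      finally have e: "kapply (amplify d \<phi> a) \<Xi> (y, i) = (\<Sum>j<d. amplify d \<phi> a (y, i) (w, j) * \<xi> j)" .
      have "kapply (kmat ?M) \<xi> i = (\<Sum>j\<in>{j. \<xi> j \<noteq> 0} \<union> {..<d}. kmat ?M i j * \<xi> j)"
        by (rule kapply_eq) (use \<xi> in \<open>auto simp: fsupp_def\<close>)
      also have "\<dots> = (\<Sum>j<d. kmat ?M i j * \<xi> j)"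
        by (rule sum.mono_neutral_right) (use \<xi> M in \<open>auto simp: fsupp_def kmat_def\<close>)
      also have "\<dots> = (if i \<in> {..<d} then kapply (amplify d \<phi> a) \<Xi> (y, i) else 0)"
        unfolding e using M y w by (auto simp: kmat_def amplify_def)
      finally show ?thesis .
    qed
    then have "nrm (kapply (kmat ?M) \<xi>) = nrm (\<lambda>i. if i \<in> {..<d} then kapply (amplify d \<phi> a) \<Xi> (y, i) else 0)"
      by presburger
    also have "\<dots> \<le> nrm (kapply (amplify d \<phi> a) \<Xi>)"
      by (rule nrm_translate(2)[OF _ fk]) (auto intro: inj_onI)
    also have "\<dots> \<le> C * nrm \<Xi>" by (rule kbdD[OF bd X(1)])
    also have "\<dots> \<le> C * nrm \<xi>" by (rule mult_left_mono[OF X(2) C0])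
    finally show "nrm (kapply (kmat ?M) \<xi>) \<le> C * nrm \<xi>" .
  qed
qed

lemma star_square_iter_sections: "a \<in> sections G B \<Longrightarrow> star_square_iter SA m a \<in> carrier SA"
  using SA.star_square_iter_closed[of a m] by (simp add: SA_carrier)

lemma norm_star_square_iter:
  assumes a: "a \<in> sections G B"
  shows "vnorm SA (star_square_iter SA m a) \<le> vnorm SA a ^ 2 ^ m"
proof (rule SA.norm_least[OF star_square_iter_sections[OF a]])
  show "0 \<le> vnorm SA a ^ 2 ^ m" using section_norm_eq(3)[OF a] by simp
  fix x assume x: "x \<in> X"
  show "kbounded (sker x (star_square_iter SA m a)) (vnorm SA a ^ 2 ^ m)"
    by (rule kbounded_star_square_iter_power[OF star_square_iter_sections[OF a]])
      (auto simp: SA.k_mult SA.k_star SA.star_closed SA.k_row_col_finite x intro!: kbounded_sker a)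
qed

text \<open>Contractivity of \<open>\<phi>\<close> controls one entry at a time, which bounds the
  whole matrix up to the square of its size. For the iterate of order m the entries are at most the
  norm of \<open>a\<close> to the power 2^m, and after taking roots the size disappears.\<close>

lemma amplify_contractive:
  assumes \<phi>: "star_hom_mat GA d \<phi>" and con: "\<And>c. c \<in> carrier GA \<Longrightarrow> mat_norm (\<phi> c) \<le> vnorm GA c"
    and a: "a \<in> sections G B"
  shows "kbounded (amplify d \<phi> a) (vnorm SA a)"
proof (rule kbounded_dense)
  show n0: "0 \<le> vnorm SA a" by (rule section_norm_eq(3)[OF a])
  fix E assume E: "vnorm SA a < E"
  let ?N = "real (card (Z \<times> {..<d}))"
  obtain m where m: "?N * ?N * vnorm SA a ^ 2 ^ m \<le> E ^ 2 ^ m" using power_gap[OF n0 E] by blast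
  let ?b = "star_square_iter SA m a"
  have b: "?b \<in> sections G B" using star_square_iter_sections[OF a] by (simp add: SA_carrier)
  note rep = amplify_fin_rep[OF \<phi>]
  have ent: "cmod (amplify d \<phi> ?b p q) \<le> vnorm SA a ^ 2 ^ m" if "p \<in> Z \<times> {..<d}" "q \<in> Z \<times> {..<d}" for p q
  proof -
    have c: "coef ?b (fst p) (fst q) \<in> carrier GA" by (rule coef_closed[OF b])
    have "cmod (amplify d \<phi> ?b p q) \<le> mat_norm (\<phi> (coef ?b (fst p) (fst q)))"
      using mat_norm_entry[of "snd p" "\<phi> (coef ?b (fst p) (fst q))" "snd q"] that \<phi> c
      by (force simp: amplify_def star_hom_mat_def)
    also have "\<dots> \<le> vnorm GA (coef ?b (fst p) (fst q))" by (rule con[OF c])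
    also have "\<dots> \<le> vnorm SA ?b" by (rule gker_norm(2)[OF c kbounded_coef[OF b]]) (use that in auto)
    also have "\<dots> \<le> vnorm SA a ^ 2 ^ m" by (rule norm_star_square_iter[OF a])
    finally show ?thesis .
  qed
  have "kbounded (amplify d \<phi> ?b) (\<Sum>p\<in>Z \<times> {..<d}. \<Sum>q\<in>Z \<times> {..<d}. cmod (amplify d \<phi> ?b p q))"
    by (rule kbounded_finite) (use fZ in \<open>auto simp: amplify_def split: if_splits\<close>)
  moreover have "(\<Sum>p\<in>Z \<times> {..<d}. \<Sum>q\<in>Z \<times> {..<d}. cmod (amplify d \<phi> ?b p q)) \<le>
      (\<Sum>p\<in>Z \<times> {..<d}. \<Sum>q\<in>Z \<times> {..<d}. vnorm SA a ^ 2 ^ m)"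
    by (intro sum_mono ent)
  moreover have "(\<Sum>p\<in>Z \<times> {..<d}. \<Sum>q\<in>Z \<times> {..<d}. vnorm SA a ^ 2 ^ m) = ?N * ?N * vnorm SA a ^ 2 ^ m"
    by (simp only: sum_constant mult.assoc of_nat_mult)
  ultimately have "kbounded (amplify d \<phi> ?b) (E ^ 2 ^ m)" using m kbounded_mono by fastforce
  then show "kbounded (amplify d \<phi> a) E"
    by (rule kbounded_star_square_iter_root[OF star_square_iter_sections[OF a], rotated -1])
      (use E n0 in \<open>auto intro!: fin_rep_mult_star[OF rep] fin_rep_row_col_finite[OF rep] SA.star_closed\<close>)
qed

end

section \<open>Local lower bounds for the norm, and the proof of (2)\<close>

context cont_partial_act
begin

text \<open>The inner product of a section with itself lies in the unit fibre, so it is a continuous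
  function.\<close>

lemma coord_continuous:
  assumes \<xi>: "\<xi> \<in> sections G B"
  shows "continuous_on X (\<lambda>x. (nrm (coord x \<xi>))\<^sup>2)"
proof -
  have "section_inner G B \<xi> \<xi> \<in> D \<one>"
    unfolding section_inner_def
  proof (rule D_sum)
    fix t assume "t \<in> supp_on G \<xi>"
    then have t: "t \<in> carrier G" by (rule supp_carrier)
    have "fmult B (inv t) (fstar B t (\<xi> t)) t (\<xi> t) \<in> D (inv t \<otimes> t)"
      by (rule fmult_closed) (use \<xi> t in \<open>auto simp: sections_iff intro: fstar_closed\<close>)
    then show "fmult B (inv t) (fstar B t (\<xi> t)) t (\<xi> t) \<in> D \<one>" using t by simp
  qed
  then have "continuous_on X (\<lambda>x. Re (section_inner G B \<xi> \<xi> x))"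
    by (auto simp: D_iff intro: continuous_intros)
  then show ?thesis by (simp add: section_inner_eq[OF \<xi>])
qed

text \<open>A vector that beats the bound \<open>e\<close> at \<open>x\<close> is lifted to a
  section of no larger norm. At nearby points its coordinates still have norm at most
  \<open>nrm \<zeta>\<close>, while the norm of their images varies continuously, so the bound is
  beaten there too.\<close>

lemma norm_witness:
  assumes a: "a \<in> sections G B" and e: "e < vnorm SA a" "0 \<le> e"
  shows "\<exists>x\<in>X. \<exists>\<delta>>0. \<forall>y\<in>X. dist y x < \<delta> \<longrightarrow> (\<forall>C. kbounded (sker y a) C \<longrightarrow> e \<le> C)"
proof -
  have "\<exists>x\<in>X. \<not> kbounded (sker x a) e"
    using section_norm_eq(2)[OF a e(2)] e(1) by force
  then obtain x \<zeta> where x: "x \<in> X" and \<zeta>: "fsupp \<zeta>" and g: "nrm (kapply (sker x a) \<zeta>) > e * nrm \<zeta>"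
    using e by (auto simp: kbounded_def not_le)
  obtain \<xi> where \<xi>: "\<xi> \<in> sections G B" "kapply (sker x a) \<zeta> = coord x (section_act a \<xi>)"
    "vnorm (pre_l2 G B) \<xi> \<le> nrm \<zeta>"
    using orbit_section[OF a x \<zeta>] .
  let ?g = "\<lambda>y. (nrm (coord y (section_act a \<xi>)))\<^sup>2"
  have gx: "(e * nrm \<zeta>)\<^sup>2 < ?g x" using g e(2) unfolding \<xi>(2) by (intro power_strict_mono) auto
  have "continuous_on X ?g" by (rule coord_continuous[OF section_act_closed[OF a \<xi>(1)]])
  then obtain \<delta> where \<delta>: "\<delta> > 0" "\<forall>y\<in>X. dist y x < \<delta> \<longrightarrow> dist (?g y) (?g x) < ?g x - (e * nrm \<zeta>)\<^sup>2"
    using gx x unfolding continuous_on_iff by (metis diff_gt_0_iff_gt)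
  have "e \<le> C" if y: "y \<in> X" "dist y x < \<delta>" and C: "kbounded (sker y a) C" for y C
  proof (rule ccontr)
    assume "\<not> e \<le> C"
    have n: "nrm (coord y \<xi>) \<le> nrm \<zeta>" using pre_l2_norm(1)[OF \<xi>(1), of y] \<xi>(3) by simp
    have "nrm (coord y (section_act a \<xi>)) \<le> C * nrm (coord y \<xi>)"
      unfolding coord_section_act[OF a \<xi>(1)] by (rule kbdD[OF C coord_fsupp[OF \<xi>(1)]])
    also have "\<dots> \<le> e * nrm \<zeta>"
      by (rule mult_mono) (use n \<open>\<not> e \<le> C\<close> e in auto)
    finally have "?g y \<le> (e * nrm \<zeta>)\<^sup>2" by (rule power_mono) simp
    moreover have "dist (?g y) (?g x) < ?g x - (e * nrm \<zeta>)\<^sup>2" using \<delta>(2) y by blast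
    ultimately show False unfolding dist_real_def by linarith
  qed
  then show ?thesis using x \<delta>(1) by blast
qed

text \<open>A matrix over the group algebra is compared with its entries up to a factor \<open>(card Z)\<^sup>2\<close>, which
  disappears in the limit when \<open>a\<close> is replaced by high powers of \<open>a\<^sup>*a\<close>.\<close>

lemma pre_RFD_section_alg:
  assumes rfd: "RFD_partial_action G X U \<theta>" and grp: "pre_RFD (group_alg G)"
  shows "pre_RFD SA"
proof -
  interpret K: kernel_algebra SA X sker by (rule section_kernel_algebra)
  have car: "carrier SA = sections G B" by (simp add: section_alg_def)
  show ?thesis
  proof (rule K.pre_RFD_fin_repI)
    fix \<epsilon> :: real and \<Omega> assume e: "\<epsilon> > 0" and \<Omega>: "finite \<Omega>" "\<Omega> \<subseteq> carrier SA"
    \<comment> \<open>Half of \<open>\<epsilon>\<close> pays for the move to a point of the model,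
      the other half for the comparison of powers.\<close>
    define \<gamma> where "\<gamma> a = vnorm SA a - \<epsilon> / 2" for a
    define \<Omega>1 where "\<Omega>1 = {a \<in> \<Omega>. \<gamma> a > 0}"
    have \<Omega>1: "finite \<Omega>1" "\<And>a. a \<in> \<Omega>1 \<Longrightarrow> a \<in> sections G B" "\<And>a. a \<in> \<Omega>1 \<Longrightarrow> \<gamma> a > 0"
      using \<Omega> car by (auto simp: \<Omega>1_def)
    have "\<forall>a\<in>\<Omega>1. \<exists>p. fst p \<in> X \<and> snd p > 0 \<and>
        (\<forall>y\<in>X. dist y (fst p) < snd p \<longrightarrow> (\<forall>C. kbounded (sker y a) C \<longrightarrow> \<gamma> a \<le> C))"
    proof
      fix a assume a: "a \<in> \<Omega>1"
      then obtain x \<delta> where "x \<in> X" "\<delta> > 0" "\<forall>y\<in>X. dist y x < \<delta> \<longrightarrow> (\<forall>C. kbounded (sker y a) C \<longrightarrow> \<gamma> a \<le> C)"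
        using norm_witness[OF \<Omega>1(2)[OF a], of "\<gamma> a"] \<Omega>1(3)[OF a] e by (auto simp: \<gamma>_def)
      then show "\<exists>p. fst p \<in> X \<and> snd p > 0 \<and>
        (\<forall>y\<in>X. dist y (fst p) < snd p \<longrightarrow> (\<forall>C. kbounded (sker y a) C \<longrightarrow> \<gamma> a \<le> C))"
        by (intro exI[of _ "(x, \<delta>)"]) auto
    qed
    from bchoice[OF this] obtain P where P: "\<forall>a\<in>\<Omega>1. fst (P a) \<in> X \<and> snd (P a) > 0 \<and>
        (\<forall>y\<in>X. dist y (fst (P a)) < snd (P a) \<longrightarrow> (\<forall>C. kbounded (sker y a) C \<longrightarrow> \<gamma> a \<le> C))" ..
    define \<delta> where "\<delta> = Min (insert 1 ((\<lambda>a. snd (P a)) ` \<Omega>1))"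
    have \<delta>: "\<delta> > 0" unfolding \<delta>_def using \<Omega>1(1) P by (subst Min_gr_iff) auto
    have \<delta>le: "\<delta> \<le> snd (P a)" if "a \<in> \<Omega>1" for a unfolding \<delta>_def using \<Omega>1(1) that by (intro Min_le) auto
    obtain Z :: "nat set" and V \<eta> \<rho> where Z: "finite Z" "partial_action G Z V \<eta>" "\<rho> ` Z \<subseteq> X"
      and VU: "\<forall>t\<in>carrier G. \<rho> ` V t \<subseteq> U t \<and> {z \<in> Z. \<rho> z \<in> U t} \<subseteq> V t"
      and eqv: "\<forall>t\<in>carrier G. \<forall>z\<in>V (inv t). \<rho> (\<eta> t z) = \<theta> t (\<rho> z)"
      and dense: "\<forall>x\<in>X. \<exists>z\<in>Z. dist (\<rho> z) x < \<delta>"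
      using rfd[unfolded RFD_partial_action_def, THEN spec, THEN mp, OF \<delta>] by (elim exE conjE)
    interpret F: fin_model G X U \<theta> Z V \<eta> \<rho>
      by unfold_locales (use Z VU eqv in auto)
    have "\<exists>z\<in>Z. \<forall>C. kbounded (sker (\<rho> z) a) C \<longrightarrow> \<gamma> a \<le> C" if a: "a \<in> \<Omega>1" for a
    proof -
      obtain z where z: "z \<in> Z" "dist (\<rho> z) (fst (P a)) < \<delta>" using dense P a by blast
      then have "dist (\<rho> z) (fst (P a)) < snd (P a)" using \<delta>le[OF a] by simp
      moreover have "\<rho> z \<in> X" using z Z by auto
      ultimately show ?thesis using P a z(1) by blast
    qed
    then obtain zz where zz: "\<And>a. a \<in> \<Omega>1 \<Longrightarrow> zz a \<in> Z"
      "\<And>a C. a \<in> \<Omega>1 \<Longrightarrow> kbounded (sker (\<rho> (zz a)) a) C \<Longrightarrow> \<gamma> a \<le> C" by metis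
    define n where "n = real (card Z * card Z)"
    \<comment> \<open>The factor 2 leaves half of the power of \<open>\<gamma> a\<close> to the
      bound on the amplification and half to the error of \<open>\<phi>\<close>. The maximum with 0
      keeps the base nonnegative.\<close>
    have "\<exists>m. 2 * n * max 0 (\<gamma> a - \<epsilon> / 2) ^ 2 ^ m \<le> \<gamma> a ^ 2 ^ m" if "a \<in> \<Omega>1" for a
      by (rule power_gap) (use \<Omega>1(3)[OF that] e in auto)
    then obtain m where m: "\<And>a. a \<in> \<Omega>1 \<Longrightarrow> 2 * n * max 0 (\<gamma> a - \<epsilon> / 2) ^ 2 ^ m a \<le> \<gamma> a ^ 2 ^ m a" by metis
    \<comment> \<open>With this precision \<open>n * e'\<close> stays below half of the power of
      \<open>\<gamma> a\<close>; the n + 1 keeps the denominator positive.\<close>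
    define e' where "e' = Min (insert 1 ((\<lambda>a. \<gamma> a ^ 2 ^ m a / (2 * (n + 1))) ` \<Omega>1))"
    have n0: "n \<ge> 0" by (simp add: n_def)
    have e'0: "e' > 0" unfolding e'_def using \<Omega>1 n0 by (subst Min_gr_iff) auto
    have e'le: "e' \<le> \<gamma> a ^ 2 ^ m a / (2 * (n + 1))" if "a \<in> \<Omega>1" for a
      unfolding e'_def using \<Omega>1(1) that by (intro Min_le) auto
    define \<Omega>2 where "\<Omega>2 = (\<lambda>(a, y, w). F.coef (star_square_iter SA (m a) a) y w) ` (\<Omega>1 \<times> Z \<times> Z)"
    have b: "star_square_iter SA (m a) a \<in> sections G B" if "a \<in> \<Omega>1" for a
      using F.star_square_iter_sections[OF \<Omega>1(2)[OF that]] by (simp add: car)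
    have "finite \<Omega>2" "\<Omega>2 \<subseteq> carrier (group_alg G)"
      using \<Omega>1(1) Z(1) b F.coef_closed by (auto simp: \<Omega>2_def)
    then obtain d \<phi> where hom: "star_hom_mat (group_alg G) d \<phi>"
      and con: "\<And>c. c \<in> carrier (group_alg G) \<Longrightarrow> mat_norm (\<phi> c) \<le> vnorm (group_alg G) c"
      and low: "\<And>c. c \<in> \<Omega>2 \<Longrightarrow> vnorm (group_alg G) c - e' \<le> mat_norm (\<phi> c)"
      using grp e'0 unfolding pre_RFD_def by meson
    note rep = F.amplify_fin_rep[OF hom]
    have lower: "vnorm SA a - \<epsilon> \<le> C" if a\<Omega>: "a \<in> \<Omega>" and C: "kbounded (F.amplify d \<phi> a) C" for a C
    proof (cases "a \<in> \<Omega>1")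
      case False
      then have "vnorm SA a \<le> \<epsilon> / 2" using a\<Omega> by (simp add: \<Omega>1_def \<gamma>_def)
      then show ?thesis using kbounded_nonneg[OF C] e by simp
    next
      case a: True
      show ?thesis
      proof (rule ccontr)
        assume "\<not> vnorm SA a - \<epsilon> \<le> C"
        then have Cl: "C < \<gamma> a - \<epsilon> / 2" by (simp add: \<gamma>_def)
        have C0: "0 \<le> C" by (rule kbounded_nonneg[OF C])
        let ?b = "star_square_iter SA (m a) a" and ?k = "2 ^ m a :: nat"
        have "kbounded (F.amplify d \<phi> ?b) (C ^ ?k)"
          by (rule kbounded_star_square_iter_power[OF F.star_square_iter_sections[OF \<Omega>1(2)[OF a]], rotated -1])
            (use C in \<open>auto intro!: fin_rep_mult_star[OF rep] fin_rep_row_col_finite[OF rep] K.star_closed\<close>)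
        \<comment> \<open>Each coefficient of the iterate is seen by \<open>\<phi>\<close> up to
          \<open>e'\<close>, so a bound on the amplification gives one on the group kernels and then
          on the orbit kernel.\<close>
        then have "kbounded (gker G (F.coef ?b y w)) (C ^ ?k + e')" if "y \<in> Z" "w \<in> Z" for y w
        proof -
          have "vnorm (group_alg G) (F.coef ?b y w) - e' \<le> mat_norm (\<phi> (F.coef ?b y w))"
            by (rule low) (use a that in \<open>force simp: \<Omega>2_def\<close>)
          also have "\<dots> \<le> C ^ ?k"
            by (rule F.amplify_block[OF hom b[OF a] that]) fact
          finally show ?thesis
            by (intro kbounded_mono[OF gker_norm(1)[OF F.coef_closed[OF b[OF a]]]]) simp
        qed
        then have "kbounded (sker (\<rho> (zz a)) ?b) (real (card Z * card Z) * (C ^ ?k + e'))"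
          by (rule F.kbounded_sker_coef[OF b[OF a] zz(1)[OF a]]) (use C0 e'0 in simp_all)
        then have bb: "kbounded (sker (\<rho> (zz a)) ?b) (n * (C ^ ?k + e'))" by (simp add: n_def)
        define E where "E = root ?k (n * (C ^ ?k + e'))"
        have r0: "0 \<le> n * (C ^ ?k + e')" using n0 C0 e'0 by simp
        have E: "0 \<le> E" "E ^ ?k = n * (C ^ ?k + e')"
          using r0 by (simp_all add: E_def real_root_pow_pos2)
        have zX: "\<rho> (zz a) \<in> X" using zz(1)[OF a] Z by auto
        have "kbounded (sker (\<rho> (zz a)) a) E"
          by (rule kbounded_star_square_iter_root[of SA a "sker (\<rho> (zz a))" E "m a"])
            (use bb E zX F.star_square_iter_sections[OF \<Omega>1(2)[OF a]] in \<open>auto simp: K.k_mult K.k_star K.star_closed K.k_row_col_finite\<close>)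
        then have "\<gamma> a \<le> E" by (rule zz(2)[OF a])
        then have "\<gamma> a ^ ?k \<le> E ^ ?k" using \<Omega>1(3)[OF a] by (intro power_mono) auto
        then have 1: "\<gamma> a ^ ?k \<le> n * C ^ ?k + n * e'" using E by (simp add: distrib_left)
        have g: "\<gamma> a ^ ?k > 0" using \<Omega>1(3)[OF a] by simp
        have "n * e' \<le> n * (\<gamma> a ^ ?k / (2 * (n + 1)))" by (rule mult_left_mono[OF e'le[OF a] n0])
        also have "\<dots> < \<gamma> a ^ ?k / 2" using n0 g by (simp add: field_simps)
        finally have 2: "n * e' < \<gamma> a ^ ?k / 2" .
        have "C ^ ?k \<le> max 0 (\<gamma> a - \<epsilon> / 2) ^ ?k" using C0 Cl by (intro power_mono) auto
        then have "2 * n * C ^ ?k \<le> 2 * n * max 0 (\<gamma> a - \<epsilon> / 2) ^ ?k" using n0 by (intro mult_left_mono) auto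
        then have "n * C ^ ?k \<le> \<gamma> a ^ ?k / 2" using m[OF a] by simp
        with 1 2 show False by linarith
      qed
    qed
    show "\<exists>(J :: (nat \<times> nat) set) k. fin_rep SA J k \<and> (\<forall>a\<in>carrier SA. kbounded (k a) (vnorm SA a)) \<and>
        (\<forall>a\<in>\<Omega>. \<forall>C. kbounded (k a) C \<longrightarrow> vnorm SA a - \<epsilon> \<le> C)"
      using rep lower F.amplify_contractive[OF hom con] by (intro exI conjI) (auto simp: car)
  qed
qed

end

section \<open>The spectrum of a finite-dimensional representation\<close>

lemma smult_mat_vec:
  fixes A :: "complex mat"
  shows "A \<in> carrier_mat d d \<Longrightarrow> v \<in> carrier_vec d \<Longrightarrow> (c \<cdot>\<^sub>m A) *\<^sub>v v = c \<cdot>\<^sub>v (A *\<^sub>v v)"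
  by (intro eq_vecI) auto

text \<open>If 0 were the only eigenvalue, \<open>hermitian_mat_norm_le\<close> would bound the norm
  by every positive c.\<close>

lemma hermitian_eigenvector:
  fixes A :: "complex mat"
  assumes A: "A \<in> carrier_mat d d" and h: "mat_adjoint A = A" and nz: "A \<noteq> 0\<^sub>m d d"
  shows "\<exists>\<mu> v. \<mu> \<noteq> 0 \<and> v \<in> carrier_vec d \<and> v \<noteq> 0\<^sub>v d \<and> A *\<^sub>v v = \<mu> \<cdot>\<^sub>v v"
proof (rule ccontr)
  assume n: "\<nexists>\<mu> v. \<mu> \<noteq> 0 \<and> v \<in> carrier_vec d \<and> v \<noteq> 0\<^sub>v d \<and> A *\<^sub>v v = \<mu> \<cdot>\<^sub>v v"
  have "mat_norm A \<le> c" if c: "0 < c" for c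
  proof (rule hermitian_mat_norm_le[OF A h c])
    fix \<mu> v assume "v \<in> carrier_vec d" "v \<noteq> 0\<^sub>v d" "A *\<^sub>v v = \<mu> \<cdot>\<^sub>v v"
    then have "\<mu> = 0" using n by blast
    then show "cmod \<mu> < c" using c by simp
  qed
  then have "mat_norm A \<le> 0" by (rule dense_ge)
  then show False using mat_norm_zero_imp[OF A] nz by blast
qed

locale section_rep = cont_partial_act G X U \<theta>
  for G :: "('g, 'c) monoid_scheme" (structure) and X :: "'x::metric_space set" and U \<theta> +
  fixes d :: nat and \<phi> :: "('g \<Rightarrow> 'x \<Rightarrow> complex) \<Rightarrow> complex mat"
  assumes hom: "star_hom_mat SA d \<phi>"
begin

definition \<psi> :: "('x \<Rightarrow> complex) \<Rightarrow> complex mat" where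
  "\<psi> f = \<phi> (delta_section \<one> f)"

lemma hom_closed: "a \<in> sections G B \<Longrightarrow> \<phi> a \<in> carrier_mat d d"
  using hom by (simp add: star_hom_mat_def section_alg_def)

lemma hom_mult: "a \<in> sections G B \<Longrightarrow> b \<in> sections G B \<Longrightarrow> \<phi> (amult SA a b) = \<phi> a * \<phi> b"
  using hom by (simp add: star_hom_mat_def section_alg_def)

lemma hom_star: "a \<in> sections G B \<Longrightarrow> \<phi> (astar SA a) = mat_adjoint (\<phi> a)"
  using hom by (simp add: star_hom_mat_def section_alg_def)

lemma \<psi>_closed: "f \<in> D \<one> \<Longrightarrow> \<psi> f \<in> carrier_mat d d"
  unfolding \<psi>_def by (intro hom_closed delta_section_one)

lemma D_one_mult: "f \<in> D \<one> \<Longrightarrow> g \<in> D t \<Longrightarrow> (\<lambda>x. f x * g x) \<in> D t"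
  by (auto simp: D_iff U_one intro: continuous_on_mult)

lemma D_one_cnj: "f \<in> D \<one> \<Longrightarrow> (\<lambda>x. cnj (f x)) \<in> D \<one>"
  by (auto simp: D_one intro: continuous_intros)

lemma delta_section_mult: "f \<in> D \<one> \<Longrightarrow> t \<in> carrier G \<Longrightarrow> amult SA (delta_section \<one> f) (delta_section t g) = delta_section t (\<lambda>x. f x * g x)"
  by (auto simp: amult_eq fun_eq_iff section_act_delta_section U_one th_one D_one) (auto simp: delta_section_def D_one)

lemma \<psi>_mult: "f \<in> D \<one> \<Longrightarrow> g \<in> D \<one> \<Longrightarrow> \<psi> (\<lambda>x. f x * g x) = \<psi> f * \<psi> g"
  using delta_section_mult[of f \<one> g] hom_mult[OF delta_section_one delta_section_one, of f g] by (simp add: \<psi>_def)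

lemma \<psi>_star: "f \<in> D \<one> \<Longrightarrow> \<psi> (\<lambda>x. cnj (f x)) = mat_adjoint (\<psi> f)"
proof -
  assume f: "f \<in> D \<one>"
  have "astar SA (delta_section \<one> f) = delta_section \<one> (\<lambda>x. cnj (f x))"
  proof (intro ext)
    fix s y
    show "astar SA (delta_section \<one> f) s y = delta_section \<one> (\<lambda>x. cnj (f x)) s y"
    proof (cases "s = \<one>")
      case True
      then show ?thesis using f by (cases "y \<in> X") (auto simp: astar_apply delta_section_def U_one th_one D_one)
    qed (auto simp: astar_apply delta_section_def inv_eq_1_iff)
  qed
  then show ?thesis using hom_star[OF delta_section_one[OF f]] by (simp add: \<psi>_def)
qed

lemma \<psi>_add: "f \<in> D \<one> \<Longrightarrow> g \<in> D \<one> \<Longrightarrow> \<psi> (\<lambda>x. f x + g x) = \<psi> f + \<psi> g"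
proof -
  assume f: "f \<in> D \<one>" and g: "g \<in> D \<one>"
  have "vadd SA (delta_section \<one> f) (delta_section \<one> g) = delta_section \<one> (\<lambda>x. f x + g x)" by (auto simp: section_alg_def delta_section_def fun_eq_iff)
  moreover have "\<phi> (vadd SA (delta_section \<one> f) (delta_section \<one> g)) = \<phi> (delta_section \<one> f) + \<phi> (delta_section \<one> g)"
    using hom delta_section_one[OF f] delta_section_one[OF g] unfolding star_hom_mat_def SA_carrier by blast
  ultimately show ?thesis by (simp add: \<psi>_def)
qed

lemma \<psi>_scale: "f \<in> D \<one> \<Longrightarrow> \<psi> (\<lambda>x. c * f x) = c \<cdot>\<^sub>m \<psi> f"
proof -
  assume f: "f \<in> D \<one>"
  have "vscale SA c (delta_section \<one> f) = delta_section \<one> (\<lambda>x. c * f x)" by (auto simp: section_alg_def delta_section_def fun_eq_iff fscale_B)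
  moreover have "\<phi> (vscale SA c (delta_section \<one> f)) = c \<cdot>\<^sub>m \<phi> (delta_section \<one> f)"
    using hom delta_section_one[OF f] unfolding star_hom_mat_def SA_carrier by blast
  ultimately show ?thesis by (simp add: \<psi>_def)
qed

text \<open>The zero set of the kernel ideal of \<open>\<psi>\<close>; by Gelfand duality it is the
  spectrum of the image of C(X).\<close>

definition rep_support :: "'x set" where
  "rep_support = {x \<in> X. \<forall>f\<in>D \<one>. \<psi> f = 0\<^sub>m d d \<longrightarrow> f x = 0}"

lemma \<psi>_vec: "f \<in> D \<one> \<Longrightarrow> g \<in> D \<one> \<Longrightarrow> v \<in> carrier_vec d \<Longrightarrow>
    \<psi> (\<lambda>x. f x * g x) *\<^sub>v v = \<psi> f *\<^sub>v (\<psi> g *\<^sub>v v)"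
  by (simp add: \<psi>_mult assoc_mult_mat_vec[OF \<psi>_closed \<psi>_closed])

text \<open>Conjugation by \<open>g \<delta>\<^sub>t\<close> moves the kernel at \<open>\<theta>\<^sub>t x\<close> to \<open>x\<close>.\<close>

lemma rep_support_invariant:
  assumes t: "t \<in> carrier G" and x: "x \<in> rep_support" "x \<in> U (inv t)"
  shows "\<theta> t x \<in> rep_support"
proof -
  let ?y = "\<theta> t x"
  have y: "?y \<in> U t" "?y \<in> X" using th_in[OF t x(2)] U_sub[OF t] by auto
  obtain W where W: "open W" "U t = X \<inter> W" using U_open[OF t] by (auto simp: openin_open)
  then have "?y \<in> W" using y by auto
  then obtain r where r: "r > 0" "\<forall>z. dist z ?y < r \<longrightarrow> z \<in> W" using W open_dist by blast
  \<comment> \<open>A function in the fibre over t with value 1 at the point to be tested.\<close>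
  define g where "g = bump ?y r"
  have gD: "g \<in> D t"
    using bump_D[OF r(1), of ?y] bump_nonzero[OF r(1), of ?y] r(2) W(2) by (auto simp: D_iff D_one g_def)
  have gy: "g ?y = 1" using y by (simp add: g_def bump_self)
  have "f ?y = 0" if f: "f \<in> D \<one>" "\<psi> f = 0\<^sub>m d d" for f
  proof -
    let ?h = "\<lambda>z. f z * g z"
    let ?k = "\<lambda>z. if z \<in> U (inv t) then cnj (g (\<theta> t z)) * ?h (\<theta> t z) else 0"
    have hD: "?h \<in> D t" by (rule D_one_mult[OF f(1) gD])
    note gs = delta_section_closed[OF t gD] and hs = delta_section_closed[OF t hD]
    have it: "inv t \<in> carrier G" using t by simp
    have st: "astar SA (delta_section t g) = delta_section (inv t) (\<lambda>z. if z \<in> U (inv t) then cnj (g (\<theta> t z)) else 0)"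
    proof (intro ext)
      fix s z
      show "astar SA (delta_section t g) s z = delta_section (inv t) (\<lambda>z. if z \<in> U (inv t) then cnj (g (\<theta> t z)) else 0) s z"
      proof (cases "s = inv t")
        case False
        then have "s \<in> carrier G \<Longrightarrow> inv s \<noteq> t" using t by auto
        then show ?thesis using False by (auto simp: astar_apply delta_section_def)
      qed (use t in \<open>auto simp: astar_apply delta_section_def\<close>)
    qed
    \<comment> \<open>The adjoint of g at t times f g at t lies in the unit fibre and has the value
      f (\<theta> t x) at x, whereas its image contains the factor \<psi>(f) = 0.\<close>
    have e: "amult SA (astar SA (delta_section t g)) (delta_section t ?h) = delta_section \<one> ?k"
    proof (intro ext)
      fix s z
      have "s \<in> carrier G \<Longrightarrow> (t \<otimes> s = t) = (s = \<one>)" using t by (metis l_cancel_one' r_one)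
      then show "amult SA (astar SA (delta_section t g)) (delta_section t ?h) s z = delta_section \<one> ?k s z"
        unfolding amult_eq st section_act_delta_section[OF it] using t by (auto simp: delta_section_def)
    qed
    have ks: "delta_section \<one> ?k \<in> sections G B"
      unfolding e[symmetric] amult_eq by (rule section_act_closed[OF section_star_closed[OF gs] hs])
    then have kD: "?k \<in> D \<one>" by (auto simp: sections_iff delta_section_def dest: bspec[of _ _ \<one>])
    have "\<phi> (delta_section t ?h) = \<psi> f * \<phi> (delta_section t g)"
      unfolding \<psi>_def delta_section_mult[OF f(1) t, symmetric] by (rule hom_mult[OF delta_section_one[OF f(1)] gs])
    also have "\<dots> = 0\<^sub>m d d" using f(2) hom_closed[OF gs] by simp
    finally have "\<psi> ?k = mat_adjoint (\<phi> (delta_section t g)) * 0\<^sub>m d d"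
      unfolding \<psi>_def e[symmetric] hom_mult[OF section_star_closed[OF gs] hs] hom_star[OF gs] by simp
    also have "\<dots> = 0\<^sub>m d d" using adjoint_carrier[OF hom_closed[OF gs]] by simp
    finally have "?k x = 0" using x(1) kD by (auto simp: rep_support_def)
    then show ?thesis using x(2) gy by simp
  qed
  then show ?thesis using y by (auto simp: rep_support_def)
qed

text \<open>Bumps with disjoint supports, around points of the support, have nonzero orthogonal images, and a suitable
  linear combination of them has as many eigenvalues as there are points.\<close>

lemma rep_support_finite: "finite rep_support"
proof (rule ccontr)
  assume "infinite rep_support"
  then obtain T where T: "finite T" "card T = Suc d" "T \<subseteq> rep_support"
    using infinite_arbitrarily_large by blast
  \<comment> \<open>The least distance between distinct points, so that tents of radius r / 2 are
    disjoint; the 1 covers a one-point \<open>T\<close>.\<close>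
  define r where "r = Min (insert 1 ((\<lambda>(z, z'). dist z z') ` {(z, z') \<in> T \<times> T. z \<noteq> z'}))"
  have fin: "finite {(z, z') \<in> T \<times> T. z \<noteq> z'}"
    by (rule finite_subset[of _ "T \<times> T"]) (use T in auto)
  have r: "r > 0" unfolding r_def using fin by (subst Min_gr_iff) auto
  have rle: "r \<le> dist z z'" if "z \<in> T" "z' \<in> T" "z \<noteq> z'" for z z'
    unfolding r_def by (rule Min_le) (use fin that in auto)
  define f where "f z = bump z (r / 2)" for z
  have fD: "f z \<in> D \<one>" for z using r by (simp add: f_def bump_D)
  have TX: "z \<in> X" if "z \<in> T" for z using T that by (auto simp: rep_support_def)
  have disj: "f z y * f z' y = 0" if "z \<in> T" "z' \<in> T" "z \<noteq> z'" for z z' y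
  proof (rule ccontr)
    assume "f z y * f z' y \<noteq> 0"
    then have "dist y z < r / 2" "dist y z' < r / 2" using bump_nonzero[of "r / 2"] r by (auto simp: f_def)
    then have "dist z z' < r" using dist_triangle_half_r[of y z r z'] by (simp add: dist_commute)
    then show False using rle[OF that] by simp
  qed
  have "\<exists>\<mu> v. \<mu> \<noteq> 0 \<and> v \<in> carrier_vec d \<and> v \<noteq> 0\<^sub>v d \<and> \<psi> (f z) *\<^sub>v v = \<mu> \<cdot>\<^sub>v v" if z: "z \<in> T" for z
  proof -
    have "\<psi> (f z) \<noteq> 0\<^sub>m d d"
    proof
      assume "\<psi> (f z) = 0\<^sub>m d d"
      then have "f z z = 0" using T z fD by (auto simp: rep_support_def)
      then show False using TX[OF z] by (simp add: f_def bump_self)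
    qed
    moreover have "mat_adjoint (\<psi> (f z)) = \<psi> (f z)"
      using \<psi>_star[OF fD[of z], symmetric] by (simp add: f_def bump_real)
    ultimately show ?thesis by (intro hermitian_eigenvector[OF \<psi>_closed[OF fD]])
  qed
  then obtain \<mu> v where \<mu>: "\<And>z. z \<in> T \<Longrightarrow> \<mu> z \<noteq> 0" and v: "\<And>z. z \<in> T \<Longrightarrow> v z \<in> carrier_vec d"
    "\<And>z. z \<in> T \<Longrightarrow> v z \<noteq> 0\<^sub>v d" "\<And>z. z \<in> T \<Longrightarrow> \<psi> (f z) *\<^sub>v v z = \<mu> z \<cdot>\<^sub>v v z" by metis
  obtain e :: "'x \<Rightarrow> nat" where e: "inj_on e T" using finite_imp_inj_to_nat_seg[OF T(1)] by blast
  \<comment> \<open>These coefficients make the eigenvalue of the combination at \<open>v z\<close>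
    equal to the number \<open>e z\<close>, and such numbers are distinct for distinct z.\<close>
  define c where "c z = of_nat (e z) / \<mu> z" for z
  define g where "g y = (\<Sum>z\<in>T. c z * f z y)" for y
  have gD: "g \<in> D \<one>"
    using D_sum[of T "\<lambda>z y. c z * f z y" \<one>] D_scale[OF fD] by (simp add: g_def[abs_def] sum_apply[abs_def] cong: sum.cong)
  have ev: "eigenvalue (\<psi> g) (of_nat (e z))" if z: "z \<in> T" for z
  proof -
    have gf: "g y * f z y = c z * (f z y * f z y)" for y
    proof -
      have "g y * f z y = (\<Sum>z'\<in>T. if z' = z then c z * (f z y * f z y) else 0)"
        unfolding g_def sum_distrib_right using disj z by (intro sum.cong) (auto simp: mult.assoc)
      then show ?thesis using z T by simp
    qed
    have "\<mu> z \<cdot>\<^sub>v (\<psi> g *\<^sub>v v z) = \<psi> g *\<^sub>v (\<psi> (f z) *\<^sub>v v z)"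
      using mult_mat_vec[OF \<psi>_closed[OF gD] v(1)[OF z]] by (simp add: v(3)[OF z])
    also have "\<dots> = \<psi> (\<lambda>y. c z * (f z y * f z y)) *\<^sub>v v z"
      using \<psi>_vec[OF gD fD v(1)[OF z], of z] by (simp add: gf)
    also have "\<dots> = (c z \<cdot>\<^sub>m \<psi> (\<lambda>y. f z y * f z y)) *\<^sub>v v z"
      by (simp add: \<psi>_scale[OF D_one_mult[OF fD fD]])
    also have "\<dots> = c z \<cdot>\<^sub>v (\<psi> (f z) *\<^sub>v (\<psi> (f z) *\<^sub>v v z))"
      by (simp add: smult_mat_vec[OF \<psi>_closed[OF D_one_mult[OF fD fD]] v(1)[OF z]] \<psi>_vec[OF fD fD v(1)[OF z]])
    also have "\<dots> = (c z * \<mu> z * \<mu> z) \<cdot>\<^sub>v v z"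
      using mult_mat_vec[OF \<psi>_closed[OF fD] v(1)[OF z]] by (simp add: v(3)[OF z] smult_smult_assoc mult.assoc)
    finally have "\<mu> z \<cdot>\<^sub>v (\<psi> g *\<^sub>v v z) = (c z * \<mu> z * \<mu> z) \<cdot>\<^sub>v v z" .
    from arg_cong[OF this, of "\<lambda>w. (1 / \<mu> z) \<cdot>\<^sub>v w"]
    have "\<psi> g *\<^sub>v v z = of_nat (e z) \<cdot>\<^sub>v v z" using \<mu>[OF z] by (simp add: smult_smult_assoc c_def)
    then show ?thesis using v(1,2)[OF z] \<psi>_closed[OF gD]
      by (auto simp: eigenvalue_def eigenvector_def)
  qed
  then have "(\<lambda>z. of_nat (e z)) ` T \<subseteq> spectrum (\<psi> g)" by (auto simp: spectrum_def)
  then have "card ((\<lambda>z. of_nat (e z) :: complex) ` T) \<le> d"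
    using card_finite_spectrum[OF \<psi>_closed[OF gD]] card_mono by (meson order_trans)
  moreover have "inj_on (\<lambda>z. of_nat (e z) :: complex) T" using e by (auto simp: inj_on_def)
  ultimately show False using T by (simp add: card_image)
qed

text \<open>If \<open>f\<close> vanished on the support, then a function in the kernel plus \<open>|f - \<mu>|\<^sup>2\<close>, for an eigenvalue
  \<open>\<mu>\<close> of \<open>\<psi> f\<close>, would be invertible although its image kills the eigenvector.\<close>

lemma rep_support_separates:
  assumes f: "f \<in> D \<one>" and real: "\<And>x. cnj (f x) = f x" and nz: "\<psi> f \<noteq> 0\<^sub>m d d"
  shows "\<exists>x\<in>rep_support. f x \<noteq> 0"
proof (rule ccontr)
  assume "\<not> (\<exists>x\<in>rep_support. f x \<noteq> 0)"
  then have van: "\<And>x. x \<in> rep_support \<Longrightarrow> f x = 0" by blast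
  have "mat_adjoint (\<psi> f) = \<psi> f" using \<psi>_star[OF f, symmetric] by (simp add: real)
  from hermitian_eigenvector[OF \<psi>_closed[OF f] this nz]
  obtain \<mu> v where \<mu>: "\<mu> \<noteq> 0" and v: "v \<in> carrier_vec d" "v \<noteq> 0\<^sub>v d" "\<psi> f *\<^sub>v v = \<mu> \<cdot>\<^sub>v v"
    by (elim exE conjE)
  \<comment> \<open>The unit of C(X). \<open>\<psi> u\<close> need not be the identity matrix, but
    it fixes \<open>v\<close>, which lies in the range of \<open>\<psi> f\<close>.\<close>
  define u where "u = (\<lambda>x. if x \<in> X then 1 else (0::complex))"
  have uD: "u \<in> D \<one>"
  proof -
    have "continuous_on X u" by (rule continuous_on_eq[of _ "\<lambda>_. 1"]) (auto simp: u_def)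
    then show ?thesis by (simp add: D_one u_def)
  qed
  have uf: "u x * f x = f x" for x using f by (auto simp: u_def D_one)
  have uv: "\<psi> u *\<^sub>v v = v"
  proof -
    have "\<mu> \<cdot>\<^sub>v (\<psi> u *\<^sub>v v) = \<psi> u *\<^sub>v (\<psi> f *\<^sub>v v)"
      using mult_mat_vec[OF \<psi>_closed[OF uD] v(1)] by (simp add: v(3))
    also have "\<dots> = \<mu> \<cdot>\<^sub>v v" using \<psi>_vec[OF uD f v(1)] by (simp add: uf v(3))
    finally have "\<mu> \<cdot>\<^sub>v (\<psi> u *\<^sub>v v) = \<mu> \<cdot>\<^sub>v v" .
    from arg_cong[OF this, of "\<lambda>w. (1 / \<mu>) \<cdot>\<^sub>v w"] show ?thesis using \<mu> by (simp add: smult_smult_assoc)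
  qed
  \<comment> \<open>On this compact level set f equals the nonzero number \<mu>, so it misses the
    support, and each of its points has a function in the kernel that does not vanish there.\<close>
  define K where "K = {x \<in> X. f x = \<mu>}"
  have fc: "continuous_on X f" using f by (simp add: D_one)
  have "closedin (top_of_set X) (X \<inter> f -` {\<mu>})" by (rule continuous_closedin_preimage[OF fc]) simp
  moreover have "X \<inter> f -` {\<mu>} = K" by (auto simp: K_def)
  ultimately have cK: "compact K" using cX closedin_compact by metis
  have "\<exists>g. g \<in> D \<one> \<and> \<psi> g = 0\<^sub>m d d \<and> g x \<noteq> 0" if x: "x \<in> K" for x
  proof -
    have "x \<notin> rep_support" using van[of x] x \<mu> by (auto simp: K_def)
    then show ?thesis using x by (auto simp: rep_support_def K_def)
  qed
  then obtain g where g: "\<And>x. x \<in> K \<Longrightarrow> g x \<in> D \<one>" "\<And>x. x \<in> K \<Longrightarrow> \<psi> (g x) = 0\<^sub>m d d"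
    "\<And>x. x \<in> K \<Longrightarrow> g x x \<noteq> 0" by metis
  have "\<exists>W. open W \<and> X \<inter> W = {y \<in> X. g x y \<noteq> 0}" if x: "x \<in> K" for x
  proof -
    have "openin (top_of_set X) (X \<inter> g x -` (- {0}))"
      by (rule continuous_openin_preimage_gen) (use g(1)[OF x] in \<open>auto simp: D_one\<close>)
    then obtain W where "open W" "X \<inter> g x -` (- {0}) = X \<inter> W" by (auto simp: openin_open)
    then show ?thesis by (intro exI[of _ W]) auto
  qed
  then obtain W where W: "\<And>x. x \<in> K \<Longrightarrow> open (W x)" "\<And>x. x \<in> K \<Longrightarrow> X \<inter> W x = {y \<in> X. g x y \<noteq> 0}" by metis
  have "K \<subseteq> (\<Union>x\<in>K. W x)"
  proof
    fix x assume x: "x \<in> K"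
    then have "x \<in> X \<inter> W x" using W(2)[OF x] g(3)[OF x] by (auto simp: K_def)
    then show "x \<in> (\<Union>x\<in>K. W x)" using x by blast
  qed
  then obtain T where T: "T \<subseteq> K" "finite T" "K \<subseteq> (\<Union>x\<in>T. W x)"
    using compactE_image[OF cK, of K W] W(1) by metis
  \<comment> \<open>Compactness combines finitely many of these into a single kernel function that
    is positive on all of \<open>K\<close>.\<close>
  define h where "h y = (\<Sum>x\<in>T. cnj (g x y) * g x y)" for y
  have h: "h \<in> D \<one> \<and> \<psi> h = 0\<^sub>m d d"
  proof -
    have z: "\<psi> (\<lambda>x. 0) = 0\<^sub>m d d" "(\<lambda>x. 0) \<in> D \<one>"
    proof -
      show "(\<lambda>x. 0) \<in> D \<one>" using D_zero by (simp add: zero_fun_def)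
      have "0 \<cdot>\<^sub>m \<psi> u = 0\<^sub>m d d" using \<psi>_closed[OF uD] by (intro eq_matI) auto
      then show "\<psi> (\<lambda>x. 0) = 0\<^sub>m d d" using \<psi>_scale[OF uD, of 0] by simp
    qed
    have "finite S \<Longrightarrow> S \<subseteq> K \<Longrightarrow> (\<lambda>y. \<Sum>x\<in>S. cnj (g x y) * g x y) \<in> D \<one> \<and>
        \<psi> (\<lambda>y. \<Sum>x\<in>S. cnj (g x y) * g x y) = 0\<^sub>m d d" for S
    proof (induction S rule: finite_induct)
      case (insert x S)
      then have x: "x \<in> K" by simp
      let ?a = "\<lambda>y. cnj (g x y) * g x y" and ?b = "\<lambda>y. \<Sum>x\<in>S. cnj (g x y) * g x y"
      have a: "?a \<in> D \<one>" by (rule D_one_mult[OF D_one_cnj[OF g(1)[OF x]] g(1)[OF x]])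
      have "\<psi> ?a = 0\<^sub>m d d"
        using \<psi>_mult[OF D_one_cnj[OF g(1)[OF x]] g(1)[OF x]] \<psi>_closed[OF D_one_cnj[OF g(1)[OF x]]] g(2)[OF x] by simp
      moreover have b: "?b \<in> D \<one>" "\<psi> ?b = 0\<^sub>m d d" using insert by auto
      moreover have "(\<lambda>y. ?a y + ?b y) \<in> D \<one>" using D_add[OF a b(1)] by (simp add: plus_fun_def)
      ultimately show ?case using \<psi>_add[OF a b(1)] insert.hyps by simp
    qed (simp add: z)
    from this[OF T(2,1)] show ?thesis by (simp add: h_def[abs_def])
  qed
  define w where "w x = f x + (- \<mu>) * u x" for x
  have wD: "w \<in> D \<one>" using D_add[OF f D_scale[OF uD, of "- \<mu>"]] by (simp add: w_def[abs_def] plus_fun_def)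
  have wv: "\<psi> w *\<^sub>v v = 0\<^sub>v d"
  proof -
    have c: "(- \<mu>) \<cdot>\<^sub>m \<psi> u \<in> carrier_mat d d" using \<psi>_closed[OF uD] by simp
    have "\<psi> w = \<psi> f + (- \<mu>) \<cdot>\<^sub>m \<psi> u"
      unfolding w_def using \<psi>_add[OF f D_scale[OF uD, of "- \<mu>"]] \<psi>_scale[OF uD, of "- \<mu>"] by simp
    then have "\<psi> w *\<^sub>v v = \<psi> f *\<^sub>v v + ((- \<mu>) \<cdot>\<^sub>m \<psi> u) *\<^sub>v v"
      using add_mult_distrib_mat_vec[OF \<psi>_closed[OF f] c v(1)] by simp
    also have "((- \<mu>) \<cdot>\<^sub>m \<psi> u) *\<^sub>v v = (- \<mu>) \<cdot>\<^sub>v (\<psi> u *\<^sub>v v)"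
      using \<psi>_closed[OF uD] v(1) by (intro eq_vecI) auto
    finally show ?thesis using v(1) by (intro eq_vecI) (auto simp: uv v(3))
  qed
  \<comment> \<open>The first summand is positive on \<open>K\<close>, the second off
    \<open>K\<close>, and the image of each annihilates \<open>v\<close>.\<close>
  define q where "q x = h x + cnj (w x) * w x" for x
  have cwD: "(\<lambda>x. cnj (w x) * w x) \<in> D \<one>" by (rule D_one_mult[OF D_one_cnj[OF wD] wD])
  have qD: "q \<in> D \<one>" using D_add[OF conjunct1[OF h] cwD] by (simp add: q_def[abs_def] plus_fun_def)
  have qv: "\<psi> q *\<^sub>v v = 0\<^sub>v d"
  proof -
    have "\<psi> q = 0\<^sub>m d d + \<psi> (\<lambda>x. cnj (w x) * w x)"
      unfolding q_def using \<psi>_add[OF conjunct1[OF h] cwD] h by simp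
    then have "\<psi> q *\<^sub>v v = \<psi> (\<lambda>x. cnj (w x) * w x) *\<^sub>v v" using \<psi>_closed[OF cwD] by simp
    also have "\<dots> = \<psi> (\<lambda>x. cnj (w x)) *\<^sub>v 0\<^sub>v d"
      using \<psi>_vec[OF D_one_cnj[OF wD] wD v(1)] wv by simp
    finally show ?thesis using \<psi>_closed[OF D_one_cnj[OF wD]] by (intro eq_vecI) auto
  qed
  have q0: "q x \<noteq> 0" if x: "x \<in> X" for x
  proof -
    have hr: "h x = complex_of_real (\<Sum>y\<in>T. (cmod (g y x))\<^sup>2)"
      by (simp add: h_def mult.commute complex_norm_square flip: of_real_power)
    have "q x = complex_of_real ((\<Sum>y\<in>T. (cmod (g y x))\<^sup>2) + (cmod (w x))\<^sup>2)"
      unfolding q_def hr by (simp add: mult.commute complex_norm_square flip: of_real_power)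
    moreover have "(\<Sum>y\<in>T. (cmod (g y x))\<^sup>2) + (cmod (w x))\<^sup>2 > 0"
    proof (cases "x \<in> K")
      case True
      then obtain y where y: "y \<in> T" "x \<in> W y" using T(3) by blast
      then have "g y x \<noteq> 0" using W(2)[of y] T(1) x by blast
      then have "(\<Sum>y\<in>T. (cmod (g y x))\<^sup>2) > 0"
        by (intro sum_pos2[OF T(2) y(1)]) auto
      then show ?thesis by (simp add: add_pos_nonneg)
    next
      case False
      then have "w x \<noteq> 0" using x by (auto simp: w_def u_def K_def)
      then show ?thesis by (simp add: add_nonneg_pos sum_nonneg)
    qed
    ultimately show ?thesis by (metis less_irrefl of_real_eq_0_iff)
  qed
  define k where "k x = (if x \<in> X then 1 / q x else 0)" for x
  have kD: "k \<in> D \<one>"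
  proof -
    have "continuous_on X (\<lambda>x. 1 / q x)" using qD q0 by (intro continuous_intros) (auto simp: D_one)
    then have "continuous_on X k" by (rule continuous_on_eq) (simp add: k_def)
    then show ?thesis by (simp add: D_one k_def)
  qed
  have kq: "k x * q x = u x" for x using q0[of x] by (auto simp: k_def u_def)
  have "v = \<psi> k *\<^sub>v (\<psi> q *\<^sub>v v)" using \<psi>_vec[OF kD qD v(1)] uv by (simp add: kq)
  also have "\<dots> = 0\<^sub>v d" unfolding qv using \<psi>_closed[OF kD] by (intro eq_vecI) auto
  finally show False using v(2) by simp
qed

end

section \<open>From a finite-dimensional representation to a finite model\<close>

context cont_partial_act
begin

text \<open>The model is the support of one representation that is nonzero on a bump at each point
  of a finite net: invariance restricts the partial action to it, and separation puts a point of it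
  near each point of the net.\<close>

lemma pre_RFD_imp_RFD_partial_action:
  assumes rfd: "pre_RFD SA"
  shows "RFD_partial_action G X U \<theta>"
  unfolding RFD_partial_action_def
proof (intro allI impI)
  fix \<delta> :: real assume \<delta>: "\<delta> > 0"
  have "X \<subseteq> (\<Union>c\<in>X. ball c (\<delta> / 2))" using \<delta> by auto
  then obtain C where C: "C \<subseteq> X" "finite C" "X \<subseteq> (\<Union>c\<in>C. ball c (\<delta> / 2))"
    using compactE_image[OF cX, of X "\<lambda>c. ball c (\<delta> / 2)"] by auto
  define f where "f c = bump c (\<delta> / 2)" for c
  have fD: "f c \<in> D \<one>" for c using \<delta> by (simp add: f_def bump_D)
  define F where "F c = delta_section \<one> (f c)" for c
  have Fs: "F c \<in> sections G B" for c unfolding F_def by (rule delta_section_one[OF fD])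
  have "finite (F ` C)" "F ` C \<subseteq> carrier SA" using C Fs by (auto simp: section_alg_def)
  \<comment> \<open>Each bump section has norm at least 1, so accuracy 1 / 2 keeps its image
    nonzero.\<close>
  then obtain d \<phi> where hom: "star_hom_mat SA d \<phi>"
    and low: "\<forall>a\<in>F ` C. vnorm SA a - 1 / 2 \<le> mat_norm (\<phi> a)"
    using rfd[unfolded pre_RFD_def, rule_format, of "1 / 2" "F ` C"] by auto
  interpret R: section_rep G X U \<theta> d \<phi> by unfold_locales (rule hom)
  have net: "\<exists>x\<in>R.rep_support. dist x c < \<delta> / 2" if c: "c \<in> C" for c
  proof -
    have cX': "c \<in> X" using C c by auto
    have "cmod (sker c (F c) \<one> \<one>) \<le> vnorm SA (F c)"
      by (rule kbounded_entry[OF sker_bound(2)[OF Fs] kbounded_sker[OF Fs cX']])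
    then have "1 \<le> vnorm SA (F c)" using cX' by (simp add: sker_def F_def delta_section_def U_one th_one f_def bump_self)
    then have pos: "mat_norm (\<phi> (F c)) > 0" using low c by force
    have "R.\<psi> (f c) \<noteq> 0\<^sub>m d d"
    proof
      assume "R.\<psi> (f c) = 0\<^sub>m d d"
      then have "\<phi> (F c) = 0\<^sub>m d d" by (simp add: R.\<psi>_def F_def)
      then have "mat_norm (\<phi> (F c)) \<le> 0" using mat_norm_le_sum[of "0\<^sub>m d d" d] by simp
      then show False using pos by simp
    qed
    moreover have "cnj (f c x) = f c x" for x by (simp add: f_def bump_real)
    ultimately obtain x where x: "x \<in> R.rep_support" "f c x \<noteq> 0" using R.rep_support_separates[OF fD, of c] by blast
    then have "dist x c < \<delta> / 2" using bump_nonzero[of "\<delta> / 2" c x] \<delta> by (simp add: f_def)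
    then show ?thesis using x by blast
  qed
  \<comment> \<open>The support is enumerated because models are sets of natural numbers.\<close>
  obtain h where h: "bij_betw h {0..<card R.rep_support} R.rep_support"
    using ex_bij_betw_nat_finite[OF R.rep_support_finite] by blast
  define Z where "Z = {0..<card R.rep_support}"
  define g where "g = the_inv_into Z h"
  have hZ: "bij_betw h Z R.rep_support" using h by (simp add: Z_def)
  have hin: "h z \<in> R.rep_support" "h z \<in> X" if "z \<in> Z" for z
    using hZ that by (auto simp: bij_betw_def R.rep_support_def)
  have hg: "h (g x) = x" "g x \<in> Z" if "x \<in> R.rep_support" for x
    using hZ that bij_betw_the_inv_into[OF hZ] f_the_inv_into_f_bij_betw[OF hZ]
    by (auto simp: g_def bij_betw_def)
  have inj: "z = z'" if "z \<in> Z" "z' \<in> Z" "h z = h z'" for z z'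
    using hZ that by (auto simp: bij_betw_def inj_on_def)
  define V where "V t = {z \<in> Z. h z \<in> U t}" for t
  define \<eta> where "\<eta> t z = g (\<theta> t (h z))" for t z
  have eq: "h (\<eta> t z) = \<theta> t (h z)" "\<eta> t z \<in> Z" if "t \<in> carrier G" "z \<in> V (inv t)" for t z
    using hg[OF R.rep_support_invariant[OF that(1) hin(1)]] that by (auto simp: \<eta>_def V_def)
  have "partial_action G Z V \<eta>"
    unfolding partial_action_def
  proof (intro conjI ballI impI)
    fix t assume t: "t \<in> carrier G"
    show "V t \<subseteq> Z" by (auto simp: V_def)
    show "\<eta> t ` V (inv t) \<subseteq> V t" using eq[OF t] th_in[OF t] by (auto simp: V_def)
  next
    show "V \<one> = Z" using hin by (auto simp: V_def U_one)
    fix z assume "z \<in> Z"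
    then show "\<eta> \<one> z = z" using hin hg hZ inj by (simp add: \<eta>_def th_one)
  next
    fix s t z assume s: "s \<in> carrier G" and t: "t \<in> carrier G" and z: "z \<in> V (inv t)" and a: "\<eta> t z \<in> V (inv s)"
    have z': "z \<in> Z" "h z \<in> U (inv t)" "\<theta> t (h z) \<in> U (inv s)"
      using z a eq(1)[OF t z] by (auto simp: V_def)
    note c = th_comp[OF s t z'(2,3)]
    show zst: "z \<in> V (inv (s \<otimes> t))" using c z' by (simp add: V_def)
    show "\<eta> (s \<otimes> t) z = \<eta> s (\<eta> t z)" using c eq(1)[OF t z] by (simp add: \<eta>_def)
  qed
  moreover have "\<exists>z\<in>Z. dist (h z) x < \<delta>" if x: "x \<in> X" for x
  proof -
    obtain c where c: "c \<in> C" "dist c x < \<delta> / 2" using C(3) x by auto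
    obtain y where y: "y \<in> R.rep_support" "dist y c < \<delta> / 2" using net[OF c(1)] by blast
    have "dist y x < \<delta>" using dist_triangle_half_l[of y c \<delta> x] y c by (simp add: dist_commute)
    then show ?thesis using hg[OF y(1)] by (intro bexI[of _ "g y"]) auto
  qed
  ultimately show "\<exists>(Z :: nat set) V \<eta> \<rho>.
      finite Z \<and> partial_action G Z V \<eta> \<and> \<rho> ` Z \<subseteq> X \<and>
      (\<forall>t\<in>carrier G. \<rho> ` V t \<subseteq> U t \<and> {z\<in>Z. \<rho> z \<in> U t} \<subseteq> V t) \<and>
      (\<forall>t\<in>carrier G. \<forall>z\<in>V (inv t). \<rho> (\<eta> t z) = \<theta> t (\<rho> z)) \<and>
      (\<forall>x\<in>X. \<exists>z\<in>Z. dist (\<rho> z) x < \<delta>)"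
    using eq hin by (intro exI[of _ Z] exI[of _ V] exI[of _ \<eta>] exI[of _ h]) (auto simp: V_def Z_def)
qed

end

section \<open>Reiter's property of amenable groups\<close>

text \<open>Tychonoff's theorem, for the topology of pointwise convergence.\<close>

lemma compact_PiE_UNIV:
  fixes S :: "'i \<Rightarrow> real set"
  assumes "\<And>i. compact (S i)"
  shows "compact (PiE UNIV S)"
  using compactin_PiE[of "\<lambda>i. euclidean :: real topology" UNIV S] assms
  by (simp add: euclidean_product_topology)

definition prob_on :: "'i set \<Rightarrow> ('i \<Rightarrow> real) set" where
  "prob_on F = {f. (\<forall>t. 0 \<le> f t) \<and> (\<forall>t. t \<notin> F \<longrightarrow> f t = 0) \<and> (\<Sum>t\<in>F. f t) = 1}"

lemma compact_prob_on:
  assumes F: "finite F"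
  shows "compact (prob_on F)"
proof -
  let ?K = "PiE UNIV (\<lambda>t. if t \<in> F then {0..1} else {0 :: real})"
  have "compact ?K" by (rule compact_PiE_UNIV) auto
  moreover have "closed {f :: 'a \<Rightarrow> real. (\<Sum>t\<in>F. f t) = 1}"
    by (intro closed_Collect_eq continuous_intros continuous_on_product_coordinates)
  ultimately have "compact (?K \<inter> {f. (\<Sum>t\<in>F. f t) = 1})" by (rule compact_Int_closed)
  moreover have "?K \<inter> {f. (\<Sum>t\<in>F. f t) = 1} = prob_on F"
  proof (intro equalityI subsetI)
    fix f assume "f \<in> ?K \<inter> {f. (\<Sum>t\<in>F. f t) = 1}"
    then have f: "\<And>t. f t \<in> (if t \<in> F then {0..1} else {0})" "(\<Sum>t\<in>F. f t) = 1" by (simp_all add: PiE_UNIV_domain Pi_iff)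
    have "0 \<le> f t" "t \<notin> F \<Longrightarrow> f t = 0" for t using f(1)[of t] by (auto split: if_splits)
    then show "f \<in> prob_on F" using f(2) by (simp add: prob_on_def)
  next
    fix f assume f: "f \<in> prob_on F"
    have "f t \<le> 1" if "t \<in> F" for t
      using member_le_sum[OF that, of f] f F by (auto simp: prob_on_def)
    then show "f \<in> ?K \<inter> {f. (\<Sum>t\<in>F. f t) = 1}" using f by (auto simp: prob_on_def PiE_UNIV_domain)
  qed
  ultimately show ?thesis by simp
qed

text \<open>The absolute value is smoothed to sqrt(e^2 + v^2). Pairing the derivative with v
  recovers |v| up to \<open>e\<close>, because the square root is at most e + |v|.\<close>

lemma sqrt_smooth_lower:
  fixes v e :: real
  assumes e: "e > 0"
  shows "\<bar>v\<bar> - e \<le> v / sqrt (e\<^sup>2 + v\<^sup>2) * v"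
proof -
  have s: "sqrt (e\<^sup>2 + v\<^sup>2) \<le> e + \<bar>v\<bar>"
    by (rule real_le_lsqrt) (use e in \<open>auto simp: power2_eq_square algebra_simps\<close>)
  have p: "sqrt (e\<^sup>2 + v\<^sup>2) > 0" using e by (simp add: add_pos_nonneg)
  have "(\<bar>v\<bar> - e) * sqrt (e\<^sup>2 + v\<^sup>2) \<le> v\<^sup>2"
  proof (cases "\<bar>v\<bar> \<le> e")
    case True
    then have "(\<bar>v\<bar> - e) * sqrt (e\<^sup>2 + v\<^sup>2) \<le> 0" using p by (intro mult_nonpos_nonneg) auto
    also have "0 \<le> v\<^sup>2" by simp
    finally show ?thesis .
  next
    case False
    then have "(\<bar>v\<bar> - e) * sqrt (e\<^sup>2 + v\<^sup>2) \<le> (\<bar>v\<bar> - e) * (e + \<bar>v\<bar>)" by (intro mult_left_mono s) auto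
    also have "\<dots> = v\<^sup>2 - e\<^sup>2" by (simp add: power2_eq_square algebra_simps)
    also have "\<dots> \<le> v\<^sup>2" by simp
    finally show ?thesis .
  qed
  then have "\<bar>v\<bar> - e \<le> v\<^sup>2 / sqrt (e\<^sup>2 + v\<^sup>2)" using p by (simp add: pos_le_divide_eq)
  then show ?thesis by (simp add: power2_eq_square)
qed

lemma sqrt_smooth_deriv:
  fixes v u e :: real
  assumes e: "e > 0"
  shows "((\<lambda>\<tau>. sqrt (e\<^sup>2 + (v + \<tau> * u)\<^sup>2)) has_real_derivative v / sqrt (e\<^sup>2 + v\<^sup>2) * u) (at 0)"
proof -
  have "e\<^sup>2 + v\<^sup>2 > 0" using e by (simp add: add_pos_nonneg)
  then show ?thesis by (auto intro!: derivative_eq_intros simp: field_simps)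
qed

context group
begin

text \<open>The finite minimax step: at a minimiser of a smoothed \<open>\<ell>\<^sup>1\<close>-norm over the simplex, the first-order
  condition provides the bounded functions \<open>h s\<close>.\<close>

lemma finite_minimax:
  assumes S: "finite S" "S \<subseteq> carrier G" and F: "finite F" "F \<subseteq> carrier G" "F \<noteq> {}"
    and W: "finite W" "\<And>t. t \<in> F \<Longrightarrow> t \<in> W" "\<And>s t. s \<in> S \<Longrightarrow> t \<in> F \<Longrightarrow> s \<otimes> t \<in> W" "W \<subseteq> carrier G"
    and large: "\<And>f. f \<in> prob_on F \<Longrightarrow> \<kappa> \<le> (\<Sum>s\<in>S. \<Sum>r\<in>W. \<bar>f (inv s \<otimes> r) - f r\<bar>)" and \<kappa>: "\<kappa> > 0"
  shows "\<exists>h :: 'a \<times> 'a \<Rightarrow> real. (\<forall>p. \<bar>h p\<bar> \<le> 1) \<and>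
    (\<forall>t\<in>F. \<kappa> / 2 \<le> (\<Sum>s\<in>S. h (s, s \<otimes> t) - h (s, t)))"
proof -
  define n where "n = real (card S * card W)"
  \<comment> \<open>Chosen so that the smoothing error of all \<open>n\<close> terms together is at
    most \<kappa> / 2.\<close>
  define e where "e = \<kappa> / (2 * (n + 1))"
  have n: "n \<ge> 0" by (simp add: n_def)
  have e: "e > 0" using \<kappa> n by (simp add: e_def)
  have ne: "n * e \<le> \<kappa> / 2" using \<kappa> n by (simp add: e_def field_simps)
  define v where "v f s r = f (inv s \<otimes> r) - f r" for f :: "'a \<Rightarrow> real" and s r
  define J where "J f = (\<Sum>s\<in>S. \<Sum>r\<in>W. sqrt (e\<^sup>2 + (v f s r)\<^sup>2))" for f
  have "continuous_on UNIV J"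
    unfolding J_def v_def by (intro continuous_intros continuous_on_product_coordinates)
  then have cJ: "continuous_on (prob_on F) J" by (rule continuous_on_subset) simp
  obtain t0 where t0: "t0 \<in> F" using F by blast
  define \<delta> where "\<delta> t = (\<lambda>r. if r = t then 1 else (0::real))" for t :: 'a
  have \<delta>: "\<delta> t \<in> prob_on F" if "t \<in> F" for t using that F by (auto simp: \<delta>_def prob_on_def)
  then have "prob_on F \<noteq> {}" using t0 by blast
  from continuous_attains_inf[OF compact_prob_on[OF F(1)] this cJ]
  obtain f where f: "f \<in> prob_on F" "\<And>g. g \<in> prob_on F \<Longrightarrow> J f \<le> J g" by blast
  \<comment> \<open>The derivatives of the smoothed terms at the minimiser; their modulus is at most
    1.\<close>
  define h where "h = (\<lambda>(s, r). if r \<in> W then v f s r / sqrt (e\<^sup>2 + (v f s r)\<^sup>2) else 0)"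
  have h1: "\<bar>h p\<bar> \<le> 1" for p
  proof -
    have "\<bar>x\<bar> / sqrt (e\<^sup>2 + x\<^sup>2) \<le> 1" for x :: real
    proof -
      have "\<bar>x\<bar> \<le> sqrt (e\<^sup>2 + x\<^sup>2)" by (rule real_le_rsqrt) simp
      moreover have "sqrt (e\<^sup>2 + x\<^sup>2) > 0" using e by (simp add: add_pos_nonneg)
      ultimately show ?thesis by simp
    qed
    then show ?thesis by (cases p) (simp add: h_def abs_div)
  qed
  have "\<kappa> / 2 \<le> (\<Sum>s\<in>S. h (s, s \<otimes> t) - h (s, t))" if t: "t \<in> F" for t
  proof -
    define u where "u s r = v (\<delta> t) s r - v f s r" for s r
    let ?l = "\<Sum>s\<in>S. \<Sum>r\<in>W. v f s r / sqrt (e\<^sup>2 + (v f s r)\<^sup>2) * u s r"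
    let ?j = "\<lambda>\<tau>. \<Sum>s\<in>S. \<Sum>r\<in>W. sqrt (e\<^sup>2 + (v f s r + \<tau> * u s r)\<^sup>2)"
    have D: "(?j has_real_derivative ?l) (at 0)"
      by (intro DERIV_sum sqrt_smooth_deriv e)
    \<comment> \<open>The segment from the minimiser to the point mass at t stays in the simplex, so
      the derivative of \<open>J\<close> in this direction is nonnegative.\<close>
    have min: "?j 0 \<le> ?j \<tau>" if \<tau>: "0 \<le> \<tau>" "\<tau> \<le> 1" for \<tau>
    proof -
      define g where "g r = (1 - \<tau>) * f r + \<tau> * \<delta> t r" for r
      have "(\<Sum>r\<in>F. g r) = (1 - \<tau>) * (\<Sum>r\<in>F. f r) + \<tau> * (\<Sum>r\<in>F. \<delta> t r)"
        by (simp add: g_def sum.distrib sum_distrib_left)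
      then have "g \<in> prob_on F" using f(1) \<delta>[OF t] \<tau> by (auto simp: prob_on_def g_def)
      from f(2)[OF this] have "J f \<le> J g" .
      moreover have "v g s r = v f s r + \<tau> * u s r" for s r by (simp add: v_def u_def g_def algebra_simps)
      ultimately show ?thesis by (simp add: J_def)
    qed
    have l0: "0 \<le> ?l"
    proof (rule ccontr)
      assume "\<not> 0 \<le> ?l"
      then obtain d where d: "d > 0" "\<And>\<tau>. \<tau> > 0 \<Longrightarrow> \<tau> < d \<Longrightarrow> ?j (0 + \<tau>) < ?j 0"
        using DERIV_neg_dec_right[OF D] by auto
      define \<tau> where "\<tau> = min 1 (d / 2)"
      have "0 < \<tau>" "\<tau> < d" "\<tau> \<le> 1" using d(1) by (auto simp: \<tau>_def)
      then show False using d(2)[of \<tau>] min[of \<tau>] by simp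
    qed
    have "\<kappa> - n * e \<le> (\<Sum>s\<in>S. \<Sum>r\<in>W. \<bar>v f s r\<bar>) - n * e" using large[OF f(1)] by (simp add: v_def)
    also have "\<dots> = (\<Sum>s\<in>S. \<Sum>r\<in>W. \<bar>v f s r\<bar> - e)" by (simp add: sum_subtractf n_def)
    also have "\<dots> \<le> (\<Sum>s\<in>S. \<Sum>r\<in>W. v f s r / sqrt (e\<^sup>2 + (v f s r)\<^sup>2) * v f s r)"
      by (intro sum_mono sqrt_smooth_lower e)
    also have "\<dots> \<le> (\<Sum>s\<in>S. \<Sum>r\<in>W. v f s r / sqrt (e\<^sup>2 + (v f s r)\<^sup>2) * v f s r) + ?l" using l0 by simp
    also have "\<dots> = (\<Sum>s\<in>S. \<Sum>r\<in>W. h (s, r) * v (\<delta> t) s r)"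
      unfolding sum.distrib[symmetric] by (intro sum.cong refl) (simp add: u_def h_def add_divide_distrib diff_divide_distrib algebra_simps)
    \<comment> \<open>Pairing with the translation difference of the point mass at t evaluates
      \<open>h\<close> at s t and at t, both of which belong to \<open>W\<close>.\<close>
    also have "\<dots> = (\<Sum>s\<in>S. h (s, s \<otimes> t) - h (s, t))"
    proof (rule sum.cong[OF refl])
      fix s assume s: "s \<in> S"
      then have sc: "s \<in> carrier G" and tc: "t \<in> carrier G" using S t F by auto
      have "inv s \<otimes> r = t \<longleftrightarrow> r = s \<otimes> t" if "r \<in> W" for r
        using that W(4) sc tc by (auto simp: m_assoc[symmetric])
      then have "(\<Sum>r\<in>W. h (s, r) * v (\<delta> t) s r) =
          (\<Sum>r\<in>W. (if r = s \<otimes> t then h (s, r) else 0) - (if r = t then h (s, r) else 0))"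
        by (intro sum.cong) (auto simp: v_def \<delta>_def)
      also have "\<dots> = h (s, s \<otimes> t) - h (s, t)"
        unfolding sum_subtractf using W(1) W(2)[OF t] W(3)[OF s t] by simp
      finally show "(\<Sum>r\<in>W. h (s, r) * v (\<delta> t) s r) = h (s, s \<otimes> t) - h (s, t)" .
    qed
    finally show ?thesis using ne by linarith
  qed
  then show ?thesis using h1 by blast
qed

text \<open>If every density were moved by at least \<kappa>, then compactness of a product of
  intervals would turn the functions of the finite step into one \<open>h\<close> that works for all
  t. An invariant mean annihilates h (s, s t) - h (s, t), although the sum of these differences is
  bounded below by \<kappa> / 2.\<close>

lemma amenable_almost_invariant:
  assumes am: "amenable G" and S: "finite S" "S \<subseteq> carrier G" and \<kappa>: "\<kappa> > 0"
  shows "\<exists>F W f. finite F \<and> F \<subseteq> carrier G \<and> finite W \<and> F \<subseteq> W \<and> (\<forall>s\<in>S. \<forall>t\<in>F. s \<otimes> t \<in> W) \<and>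
    W \<subseteq> carrier G \<and> f \<in> prob_on F \<and> (\<Sum>s\<in>S. \<Sum>r\<in>W. \<bar>f (inv s \<otimes> r) - f r\<bar>) < \<kappa>"
proof (rule ccontr)
  assume no: "\<not> ?thesis"
  define C where "C t = {h :: 'a \<times> 'a \<Rightarrow> real. \<kappa> / 2 \<le> (\<Sum>s\<in>S. h (s, s \<otimes> t) - h (s, t))}" for t
  let ?K = "PiE UNIV (\<lambda>p :: 'a \<times> 'a. {- 1..1 :: real})"
  have "?K \<inter> \<Inter> (C ` carrier G) \<noteq> {}"
  proof (rule compact_imp_fip)
    show "compact ?K" by (rule compact_PiE_UNIV) simp
    show "closed T" if "T \<in> C ` carrier G" for T
      using that unfolding C_def
      by (auto intro!: closed_Collect_le continuous_intros continuous_on_product_coordinates)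
    fix \<F> assume "finite \<F>" "\<F> \<subseteq> C ` carrier G"
    then obtain F0 where F0: "F0 \<subseteq> carrier G" "finite F0" "\<F> = C ` F0" by (meson finite_subset_image)
    \<comment> \<open>The unit element makes the finite set nonempty, as the simplex must
      be.\<close>
    define F where "F = insert \<one> F0"
    have F: "finite F" "F \<subseteq> carrier G" "F \<noteq> {}" using F0 by (auto simp: F_def)
    define W where "W = F \<union> (\<lambda>(s, t). s \<otimes> t) ` (S \<times> F)"
    have W: "finite W" "F \<subseteq> W" "\<And>s t. s \<in> S \<Longrightarrow> t \<in> F \<Longrightarrow> s \<otimes> t \<in> W" "W \<subseteq> carrier G"
      using F S by (auto simp: W_def)
    have "\<kappa> \<le> (\<Sum>s\<in>S. \<Sum>r\<in>W. \<bar>f (inv s \<otimes> r) - f r\<bar>)" if "f \<in> prob_on F" for f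
      using no F W that by (meson not_le)
    then obtain h :: "'a \<times> 'a \<Rightarrow> real" where h: "\<forall>p. \<bar>h p\<bar> \<le> 1"
      "\<forall>t\<in>F. \<kappa> / 2 \<le> (\<Sum>s\<in>S. h (s, s \<otimes> t) - h (s, t))"
      using finite_minimax[OF S F W(1) _ W(3,4) _ \<kappa>] W(2) by blast
    have "h \<in> ?K" using h(1) by (auto simp: PiE_UNIV_domain abs_le_iff minus_le_iff)
    moreover have "h \<in> \<Inter> \<F>" using h(2) by (auto simp: F0(3) C_def F_def)
    ultimately show "?K \<inter> \<Inter> \<F> \<noteq> {}" by blast
  qed
  then obtain h where hK: "h \<in> ?K" and hC: "\<And>t. t \<in> carrier G \<Longrightarrow> h \<in> C t" by blast
  have h1: "\<bar>h p\<bar> \<le> 1" for p using PiE_mem[OF hK, of p] by (auto simp: abs_le_iff)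
  from am[unfolded amenable_def] obtain m :: "('a \<Rightarrow> real) \<Rightarrow> real" where
    m1: "\<forall>f h. bounded (f ` carrier G) \<and> bounded (h ` carrier G) \<longrightarrow> m (\<lambda>t. f t + h t) = m f + m h"
    and m2: "\<forall>c f. bounded (f ` carrier G) \<longrightarrow> m (\<lambda>t. c * f t) = c * m f"
    and m3: "\<forall>f. bounded (f ` carrier G) \<and> (\<forall>t\<in>carrier G. f t \<ge> 0) \<longrightarrow> m f \<ge> 0"
    and one: "m (\<lambda>t. 1) = 1"
    and m4: "\<forall>s\<in>carrier G. \<forall>f. bounded (f ` carrier G) \<longrightarrow> m (\<lambda>t. f (s \<otimes> t)) = m f"
    by (elim exE conjE)
  have add: "m (\<lambda>t. f t + g t) = m f + m g"
    if "bounded (f ` carrier G)" "bounded (g ` carrier G)" for f g using m1 that by blast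
  have sc: "m (\<lambda>t. c * f t) = c * m f" if "bounded (f ` carrier G)" for c f using m2 that by blast
  have pos: "0 \<le> m f" if "bounded (f ` carrier G)" "\<And>t. t \<in> carrier G \<Longrightarrow> 0 \<le> f t" for f
    using m3 that by blast
  have inv: "m (\<lambda>t. f (s \<otimes> t)) = m f" if "s \<in> carrier G" "bounded (f ` carrier G)" for s f
    using m4 that by blast
  have bI: "bounded (f ` carrier G)" if "\<And>t. \<bar>f t\<bar> \<le> M" for f :: "'a \<Rightarrow> real" and M
    using that by (auto simp: bounded_iff)
  have b1: "bounded ((\<lambda>t. h (s, g t)) ` carrier G)" for s g by (rule bI[of _ 1]) (rule h1)
  have diff: "m (\<lambda>t. h (s, s \<otimes> t) - h (s, t)) = 0" if s: "s \<in> S" for s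
  proof -
    have "m (\<lambda>t. h (s, s \<otimes> t) + (- 1) * h (s, t)) = m (\<lambda>t. h (s, s \<otimes> t)) + m (\<lambda>t. (- 1) * h (s, t))"
      by (intro add b1 bI[of _ 1]) (simp add: h1)
    also have "\<dots> = m (\<lambda>t. h (s, t)) + (- 1) * m (\<lambda>t. h (s, t))"
      using inv[OF _ b1[of s "\<lambda>t. t"], of s] sc[OF b1[of s "\<lambda>t. t"], of "- 1"] s S by auto
    finally show ?thesis by simp
  qed
  have sm: "bounded ((\<lambda>t. \<Sum>s\<in>T. h (s, s \<otimes> t) - h (s, t)) ` carrier G) \<and>
      m (\<lambda>t. \<Sum>s\<in>T. h (s, s \<otimes> t) - h (s, t)) = 0" if "finite T" "T \<subseteq> S" for T
    using that
  proof (induction T rule: finite_induct)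
    case empty
    \<comment> \<open>Homogeneity with factor 0 shows that the zero function has mean 0.\<close>
    have "m (\<lambda>t. 0 * 1) = 0 * m (\<lambda>t. 1)" by (rule sc) (auto intro: bI[of _ 1])
    then show ?case by (auto intro: bI[of _ 1])
  next
    case (insert s T)
    have b: "bounded ((\<lambda>t. h (s, s \<otimes> t) - h (s, t)) ` carrier G)"
    proof (rule bI[of _ 2])
      fix t show "\<bar>h (s, s \<otimes> t) - h (s, t)\<bar> \<le> 2" using h1[of "(s, s \<otimes> t)"] h1[of "(s, t)"] by linarith
    qed
    have "bounded ((\<lambda>t. (h (s, s \<otimes> t) - h (s, t)) + (\<Sum>s\<in>T. h (s, s \<otimes> t) - h (s, t))) ` carrier G)"
      by (rule bounded_plus_comp[OF b]) (use insert in auto)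
    then show ?case using insert add[OF b] diff[of s] by simp
  qed
  let ?g = "\<lambda>t. \<Sum>s\<in>S. h (s, s \<otimes> t) - h (s, t)"
  have g: "bounded (?g ` carrier G)" "m ?g = 0" using sm[OF S(1)] by auto
  have b1': "bounded ((\<lambda>t. 1 :: real) ` carrier G)" by (rule bI[of _ 1]) simp
  have b2: "bounded ((\<lambda>t. - (\<kappa> / 2) * 1 :: real) ` carrier G)" by (rule bI[of _ "\<bar>\<kappa>\<bar>"]) simp
  have "0 \<le> m (\<lambda>t. ?g t + - (\<kappa> / 2) * 1)"
  proof (rule pos)
    show "bounded ((\<lambda>t. ?g t + - (\<kappa> / 2) * 1) ` carrier G)" by (rule bounded_plus_comp[OF g(1) b2])
    show "0 \<le> ?g t + - (\<kappa> / 2) * 1" if "t \<in> carrier G" for t using hC[OF that] by (simp add: C_def)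
  qed
  also have "\<dots> = m ?g + m (\<lambda>t. - (\<kappa> / 2) * 1)" by (rule add[OF g(1) b2])
  also have "m (\<lambda>t. - (\<kappa> / 2) * 1) = - (\<kappa> / 2)" using sc[OF b1', of "- (\<kappa> / 2)"] one by simp
  finally show False using g(2) \<kappa> by simp
qed

lemma sqrt_diff_sq: "0 \<le> a \<Longrightarrow> 0 \<le> b \<Longrightarrow> (sqrt a - sqrt b)\<^sup>2 \<le> \<bar>a - b\<bar>"
proof -
  assume ab: "0 \<le> a" "0 \<le> b"
  have "(sqrt a - sqrt b)\<^sup>2 = \<bar>sqrt a - sqrt b\<bar> * \<bar>sqrt a - sqrt b\<bar>" by (simp add: power2_eq_square flip: abs_mult)
  also have "\<dots> \<le> \<bar>sqrt a - sqrt b\<bar> * (sqrt a + sqrt b)"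
    by (rule mult_left_mono) (use ab in \<open>auto simp: abs_le_iff\<close>)
  also have "\<dots> = \<bar>(sqrt a - sqrt b) * (sqrt a + sqrt b)\<bar>" using ab by (simp add: abs_mult)
  also have "(sqrt a - sqrt b) * (sqrt a + sqrt b) = a - b" using ab by (simp add: algebra_simps)
  finally show ?thesis .
qed

text \<open>Square roots turn almost invariant densities in l1 into almost invariant unit vectors in
  l2, by \<open>sqrt_diff_sq\<close>; hence the accuracy \<kappa>^2 for the densities.\<close>

lemma reiter:
  assumes am: "amenable G" and S: "finite S" "S \<subseteq> carrier G" and \<kappa>: "\<kappa> > 0"
  shows "\<exists>\<xi> :: 'a \<Rightarrow> complex. fsupp \<xi> \<and> nrm \<xi> = 1 \<and> (\<forall>t. t \<notin> carrier G \<longrightarrow> \<xi> t = 0) \<and>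
    (\<forall>s\<in>S. nrm (\<lambda>t. if t \<in> carrier G then \<xi> (inv s \<otimes> t) - \<xi> t else 0) \<le> \<kappa>)"
proof -
  have "\<kappa>\<^sup>2 > 0" using \<kappa> by simp
  from amenable_almost_invariant[OF am S this] obtain F W f where F: "finite F" "F \<subseteq> carrier G"
    and W: "finite W" "F \<subseteq> W" "\<forall>s\<in>S. \<forall>t\<in>F. s \<otimes> t \<in> W" "W \<subseteq> carrier G"
    and f: "f \<in> prob_on F" and small: "(\<Sum>s\<in>S. \<Sum>r\<in>W. \<bar>f (inv s \<otimes> r) - f r\<bar>) < \<kappa>\<^sup>2" by blast
  have f0: "f t \<ge> 0" "t \<notin> F \<Longrightarrow> f t = 0" "(\<Sum>t\<in>F. f t) = 1" for t using f by (auto simp: prob_on_def)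
  define \<xi> where "\<xi> t = complex_of_real (sqrt (f t))" for t
  have s: "{t. \<xi> t \<noteq> 0} \<subseteq> F" using f0 by (auto simp: \<xi>_def)
  have "(nrm \<xi>)\<^sup>2 = (\<Sum>t\<in>F. (cmod (\<xi> t))\<^sup>2)" by (rule nrm_sq[OF F(1) s])
  also have "\<dots> = (\<Sum>t\<in>F. f t)" by (rule sum.cong) (simp_all add: \<xi>_def f0)
  finally have "nrm \<xi> = 1" using f0(3) nrm_nonneg[of \<xi>] by (simp add: power2_eq_1_iff)
  moreover have "nrm (\<lambda>t. if t \<in> carrier G then \<xi> (inv s \<otimes> t) - \<xi> t else 0) \<le> \<kappa>" if sS: "s \<in> S" for s
  proof (rule power2_le_imp_le)
    have sc: "s \<in> carrier G" using S sS by auto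
    let ?z = "\<lambda>t. if t \<in> carrier G then \<xi> (inv s \<otimes> t) - \<xi> t else 0"
    have "{t. ?z t \<noteq> 0} \<subseteq> W"
    proof
      fix t assume "t \<in> {t. ?z t \<noteq> 0}"
      then have t: "t \<in> carrier G" "\<xi> (inv s \<otimes> t) \<noteq> 0 \<or> \<xi> t \<noteq> 0" by (auto split: if_splits)
      from t(2) show "t \<in> W"
      proof
        assume "\<xi> (inv s \<otimes> t) \<noteq> 0"
        then have "s \<otimes> (inv s \<otimes> t) \<in> W" using s W(3) sS by blast
        then show ?thesis using t sc by (simp add: inv_cancel)
      qed (use s W in auto)
    qed
    then have "(nrm ?z)\<^sup>2 = (\<Sum>t\<in>W. (cmod (?z t))\<^sup>2)" by (rule nrm_sq[OF W(1)])
    also have "\<dots> \<le> (\<Sum>t\<in>W. \<bar>f (inv s \<otimes> t) - f t\<bar>)"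
    proof (rule sum_mono)
      fix t assume "t \<in> W"
      then have "cmod (?z t) = \<bar>sqrt (f (inv s \<otimes> t)) - sqrt (f t)\<bar>"
        using W(4) by (auto simp: \<xi>_def simp flip: of_real_diff)
      then show "(cmod (?z t))\<^sup>2 \<le> \<bar>f (inv s \<otimes> t) - f t\<bar>" using sqrt_diff_sq f0 by simp
    qed
    also have "\<dots> \<le> (\<Sum>s\<in>S. \<Sum>r\<in>W. \<bar>f (inv s \<otimes> r) - f r\<bar>)"
      by (rule member_le_sum[OF sS]) (auto intro: sum_nonneg S)
    finally show "(nrm ?z)\<^sup>2 \<le> \<kappa>\<^sup>2" using small by simp
  qed (use \<kappa> in simp)
  moreover have "fsupp \<xi>" by (rule fsupp_subset[OF F(1) s])
  moreover have "\<xi> t = 0" if "t \<notin> carrier G" for t using that s F by auto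
  ultimately show ?thesis by blast
qed

end

section \<open>Finite quotients of amenable groups\<close>

lemma nrm_tensor:
  assumes "fsupp \<alpha>" "fsupp \<beta>"
  shows "fsupp (\<lambda>(t, p). \<alpha> t * \<beta> p)" "nrm (\<lambda>(t, p). \<alpha> t * \<beta> p) = nrm \<alpha> * nrm \<beta>"
proof -
  let ?S = "{t. \<alpha> t \<noteq> 0}" and ?T = "{p. \<beta> p \<noteq> 0}"
  have f: "finite ?S" "finite ?T" using assms by (auto simp: fsupp_def)
  have sub: "{x. (\<lambda>(t, p). \<alpha> t * \<beta> p) x \<noteq> 0} \<subseteq> ?S \<times> ?T" by auto
  show "fsupp (\<lambda>(t, p). \<alpha> t * \<beta> p)" by (rule fsupp_subset[OF _ sub]) (use f in simp)
  have "(nrm (\<lambda>(t, p). \<alpha> t * \<beta> p))\<^sup>2 = (\<Sum>x\<in>?S \<times> ?T. (cmod ((\<lambda>(t, p). \<alpha> t * \<beta> p) x))\<^sup>2)"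
    by (rule nrm_sq[OF _ sub]) (use f in simp)
  also have "\<dots> = (\<Sum>t\<in>?S. \<Sum>p\<in>?T. (cmod (\<alpha> t))\<^sup>2 * (cmod (\<beta> p))\<^sup>2)"
    by (simp add: sum.cartesian_product norm_mult power_mult_distrib split_def)
  also have "\<dots> = (nrm \<alpha>)\<^sup>2 * (nrm \<beta>)\<^sup>2"
    by (simp add: nrm_sq[OF f(1)] nrm_sq[OF f(2)] sum_product)
  finally have "(nrm (\<lambda>(t, p). \<alpha> t * \<beta> p))\<^sup>2 = (nrm \<alpha> * nrm \<beta>)\<^sup>2" by (simp add: power_mult_distrib)
  then show "nrm (\<lambda>(t, p). \<alpha> t * \<beta> p) = nrm \<alpha> * nrm \<beta>" by (rule power2_eq_imp_eq) auto
qed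

locale fin_quot = group_hom G Q q for G :: "('g, 'c) monoid_scheme" (structure)
  and Q :: "('q, 'e) monoid_scheme" (structure) and q :: "'g \<Rightarrow> 'q" +
  assumes finQ: "finite (carrier Q)"
begin

text \<open>The homomorphism of group algebras induced by \<open>q\<close>.\<close>

definition push :: "('g \<Rightarrow> complex) \<Rightarrow> 'q \<Rightarrow> complex" where
  "push a p = (\<Sum>t | a t \<noteq> 0 \<and> q t = p. a t)"

text \<open>The representation of the group on functions on the finite group \<open>Q\<close>,
  through the left regular representation of \<open>Q\<close>.\<close>

definition qker :: "('g \<Rightarrow> complex) \<Rightarrow> 'q \<Rightarrow> 'q \<Rightarrow> complex" where
  "qker a = gker Q (push a)"

abbreviation GA where "GA \<equiv> group_alg G"

lemma GA_fin: "a \<in> carrier GA \<Longrightarrow> finite {t. a t \<noteq> 0}"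
  by (simp add: G.group_alg_carrier)

lemma GA_supp: "a \<in> carrier GA \<Longrightarrow> a t \<noteq> 0 \<Longrightarrow> t \<in> carrier G"
  by (auto simp: G.group_alg_carrier)

lemma push_eq:
  assumes "finite S" "{t. a t \<noteq> 0} \<subseteq> S"
  shows "push a p = (\<Sum>t\<in>S. if q t = p then a t else 0)"
proof -
  have "push a p = (\<Sum>t | a t \<noteq> 0 \<and> q t = p. if q t = p then a t else 0)"
    unfolding push_def by (rule sum.cong) auto
  also have "\<dots> = (\<Sum>t\<in>S. if q t = p then a t else 0)"
    by (rule sum.mono_neutral_left) (use assms in auto)
  finally show ?thesis .
qed

lemma qker_support: "qker a p r \<noteq> 0 \<Longrightarrow> p \<in> carrier Q \<and> r \<in> carrier Q"
  by (auto simp: qker_def gker_def split: if_splits)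

lemma q_solve:
  assumes "s \<in> carrier G" "p \<in> carrier Q" "r \<in> carrier Q"
  shows "q s = p \<otimes>\<^bsub>Q\<^esub> inv\<^bsub>Q\<^esub> r \<longleftrightarrow> r = inv\<^bsub>Q\<^esub> (q s) \<otimes>\<^bsub>Q\<^esub> p"
proof
  have qs: "q s \<in> carrier Q" using assms by simp
  show "r = inv\<^bsub>Q\<^esub> (q s) \<otimes>\<^bsub>Q\<^esub> p" if "q s = p \<otimes>\<^bsub>Q\<^esub> inv\<^bsub>Q\<^esub> r"
    using H.div_div'[of p r] assms that by simp
  show "q s = p \<otimes>\<^bsub>Q\<^esub> inv\<^bsub>Q\<^esub> r" if "r = inv\<^bsub>Q\<^esub> (q s) \<otimes>\<^bsub>Q\<^esub> p"
    using H.div_div[of p "q s"] assms that qs by simp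
qed

lemma qker_sum:
  assumes a: "a \<in> carrier GA" and p: "p \<in> carrier Q"
  shows "(\<Sum>r\<in>carrier Q. qker a p r * v r) = (\<Sum>s | a s \<noteq> 0. a s * v (inv\<^bsub>Q\<^esub> (q s) \<otimes>\<^bsub>Q\<^esub> p))"
proof -
  have "(\<Sum>r\<in>carrier Q. qker a p r * v r) =
      (\<Sum>r\<in>carrier Q. \<Sum>s | a s \<noteq> 0. if r = inv\<^bsub>Q\<^esub> (q s) \<otimes>\<^bsub>Q\<^esub> p then a s * v r else 0)"
  proof (rule sum.cong[OF refl])
    fix r assume r: "r \<in> carrier Q"
    have "qker a p r * v r = (\<Sum>s | a s \<noteq> 0. (if q s = p \<otimes>\<^bsub>Q\<^esub> inv\<^bsub>Q\<^esub> r then a s else 0) * v r)"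
      using p r push_eq[OF GA_fin[OF a] order_refl] by (simp add: qker_def gker_def sum_distrib_right)
    also have "\<dots> = (\<Sum>s | a s \<noteq> 0. if r = inv\<^bsub>Q\<^esub> (q s) \<otimes>\<^bsub>Q\<^esub> p then a s * v r else 0)"
      by (rule sum.cong) (use q_solve[OF GA_supp[OF a] p r] in auto)
    finally show "qker a p r * v r = (\<Sum>s | a s \<noteq> 0. if r = inv\<^bsub>Q\<^esub> (q s) \<otimes>\<^bsub>Q\<^esub> p then a s * v r else 0)" .
  qed
  also have "\<dots> = (\<Sum>s | a s \<noteq> 0. \<Sum>r\<in>carrier Q. if r = inv\<^bsub>Q\<^esub> (q s) \<otimes>\<^bsub>Q\<^esub> p then a s * v r else 0)"
    by (rule sum.swap)
  also have "\<dots> = (\<Sum>s | a s \<noteq> 0. a s * v (inv\<^bsub>Q\<^esub> (q s) \<otimes>\<^bsub>Q\<^esub> p))"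
    by (rule sum.cong) (use finQ p GA_supp[OF a] in auto)
  finally show ?thesis .
qed

text \<open>For a fixed left factor s, left translation by inv s carries the fibre of
  \<open>q\<close> over p onto the fibre over inv (q s) p, which turns the inner sum into a value of
  \<open>push b\<close>.\<close>

lemma push_mult:
  assumes a: "a \<in> carrier GA" and b: "b \<in> carrier GA" and p: "p \<in> carrier Q"
  shows "push (amult GA a b) p = (\<Sum>s | a s \<noteq> 0. a s * push b (inv\<^bsub>Q\<^esub> (q s) \<otimes>\<^bsub>Q\<^esub> p))"
proof -
  define T where "T = (\<lambda>(s, s'). s \<otimes> s') ` ({s. a s \<noteq> 0} \<times> {s. b s \<noteq> 0})"
  have T: "finite T" "T \<subseteq> carrier G" using GA_fin[OF a] GA_fin[OF b] GA_supp[OF a] GA_supp[OF b] by (auto simp: T_def)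
  have S: "{t \<in> carrier G. a t \<noteq> 0} = {t. a t \<noteq> 0}" using GA_supp[OF a] by auto
  have ab: "amult GA a b u = (if u \<in> carrier G then \<Sum>s | a s \<noteq> 0. a s * b (inv s \<otimes> u) else 0)" for u
    by (simp add: group_alg_def S[unfolded group_alg_def])
  have "{u. amult GA a b u \<noteq> 0} \<subseteq> T"
  proof
    fix u assume "u \<in> {u. amult GA a b u \<noteq> 0}"
    then have u: "u \<in> carrier G" and "(\<Sum>s | a s \<noteq> 0. a s * b (inv s \<otimes> u)) \<noteq> 0" by (auto simp: ab split: if_splits)
    then obtain s where "a s \<noteq> 0" "b (inv s \<otimes> u) \<noteq> 0"
      by (elim sum.not_neutral_contains_not_neutral) auto
    then show "u \<in> T" unfolding T_def using u GA_supp[OF a]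
      by (intro image_eqI[of _ _ "(s, inv s \<otimes> u)"]) (auto simp: G.inv_cancel)
  qed
  then have "push (amult GA a b) p = (\<Sum>u\<in>T. if q u = p then amult GA a b u else 0)"
    by (rule push_eq[OF T(1)])
  also have "\<dots> = (\<Sum>u\<in>T. \<Sum>s | a s \<noteq> 0. if q u = p then a s * b (inv s \<otimes> u) else 0)"
    by (rule sum.cong) (use T(2) in \<open>auto simp: ab\<close>)
  also have "\<dots> = (\<Sum>s | a s \<noteq> 0. \<Sum>u\<in>T. if q u = p then a s * b (inv s \<otimes> u) else 0)" by (rule sum.swap)
  also have "\<dots> = (\<Sum>s | a s \<noteq> 0. a s * push b (inv\<^bsub>Q\<^esub> (q s) \<otimes>\<^bsub>Q\<^esub> p))"
  proof (rule sum.cong[OF refl])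
    fix s assume "s \<in> {s. a s \<noteq> 0}"
    then have s: "a s \<noteq> 0" "s \<in> carrier G" using GA_supp[OF a] by auto
    have "(\<Sum>u\<in>T. if q u = p then a s * b (inv s \<otimes> u) else 0) =
        (\<Sum>u\<in>{u \<in> T. b (inv s \<otimes> u) \<noteq> 0 \<and> q u = p}. a s * b (inv s \<otimes> u))"
      by (rule sum.mono_neutral_cong_right) (use T in auto)
    also have "\<dots> = (\<Sum>t\<in>{t. b t \<noteq> 0 \<and> q t = inv\<^bsub>Q\<^esub> (q s) \<otimes>\<^bsub>Q\<^esub> p}. a s * b t)"
    proof (rule sum.reindex_bij_witness[where i = "\<lambda>t. s \<otimes> t" and j = "\<lambda>u. inv s \<otimes> u"])
      fix u assume "u \<in> {u \<in> T. b (inv s \<otimes> u) \<noteq> 0 \<and> q u = p}"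
      then have u: "u \<in> carrier G" "b (inv s \<otimes> u) \<noteq> 0" "q u = p" using T by auto
      show "s \<otimes> (inv s \<otimes> u) = u" using u s by (simp add: G.inv_cancel)
      show "inv s \<otimes> u \<in> {t. b t \<noteq> 0 \<and> q t = inv\<^bsub>Q\<^esub> (q s) \<otimes>\<^bsub>Q\<^esub> p}" using u s by (simp add: hom_mult hom_inv)
    next
      fix t assume "t \<in> {t. b t \<noteq> 0 \<and> q t = inv\<^bsub>Q\<^esub> (q s) \<otimes>\<^bsub>Q\<^esub> p}"
      then have t: "b t \<noteq> 0" "t \<in> carrier G" "q t = inv\<^bsub>Q\<^esub> (q s) \<otimes>\<^bsub>Q\<^esub> p" using GA_supp[OF b] by auto
      show "inv s \<otimes> (s \<otimes> t) = t" using t s by (simp add: G.inv_cancel)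
      have "s \<otimes> t \<in> T" unfolding T_def using t s by (intro image_eqI[of _ _ "(s, t)"]) auto
      then show "s \<otimes> t \<in> {u \<in> T. b (inv s \<otimes> u) \<noteq> 0 \<and> q u = p}"
        using t s p by (simp add: G.inv_cancel hom_mult H.inv_cancel)
    qed simp
    also have "\<dots> = a s * push b (inv\<^bsub>Q\<^esub> (q s) \<otimes>\<^bsub>Q\<^esub> p)"
      by (simp add: push_def sum_distrib_left)
    finally show "(\<Sum>u\<in>T. if q u = p then a s * b (inv s \<otimes> u) else 0) = a s * push b (inv\<^bsub>Q\<^esub> (q s) \<otimes>\<^bsub>Q\<^esub> p)" .
  qed
  finally show ?thesis .
qed

lemma push_star:
  assumes a: "a \<in> carrier GA" and p: "p \<in> carrier Q"
  shows "push (astar GA a) p = cnj (push a (inv\<^bsub>Q\<^esub> p))"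
proof -
  have "push (astar GA a) p = (\<Sum>t | a t \<noteq> 0 \<and> q t = inv\<^bsub>Q\<^esub> p. cnj (a t))"
    unfolding push_def
  proof (rule sum.reindex_bij_witness[where i = "\<lambda>t. inv t" and j = "\<lambda>t. inv t"])
    fix t assume "t \<in> {t. a t \<noteq> 0 \<and> q t = inv\<^bsub>Q\<^esub> p}"
    then show "inv (inv t) = t" "inv t \<in> {t. astar GA a t \<noteq> 0 \<and> q t = p}"
      using GA_supp[OF a] p by (auto simp: group_alg_def hom_inv)
  next
    fix t assume "t \<in> {t. astar GA a t \<noteq> 0 \<and> q t = p}"
    then show "inv (inv t) = t" "inv t \<in> {t. a t \<noteq> 0 \<and> q t = inv\<^bsub>Q\<^esub> p}" "cnj (a (inv t)) = astar GA a t"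
      by (auto simp: group_alg_def hom_inv split: if_splits)
  qed
  then show ?thesis by (simp add: push_def)
qed

lemma qker_fin_rep: "fin_rep GA (carrier Q) qker"
  unfolding fin_rep_def
proof (intro conjI ballI allI impI finQ)
  fix a b c assume a: "a \<in> carrier GA"
  show "p \<in> carrier Q" "r \<in> carrier Q" if "qker a p r \<noteq> 0" for p r using qker_support[OF that] by auto
  show "qker (vscale GA c a) = (\<lambda>p r. c * qker a p r)"
  proof -
    have "{t. vscale GA c a t \<noteq> 0} \<subseteq> {t. a t \<noteq> 0}" by (auto simp: group_alg_def)
    then have "push (vscale GA c a) p = c * push a p" for p
      unfolding push_eq[OF GA_fin[OF a] order_refl] push_eq[OF GA_fin[OF a] \<open>_ \<subseteq> _\<close>]
      by (auto simp: group_alg_def sum_distrib_left intro!: sum.cong)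
    then show ?thesis by (auto simp: qker_def gker_def fun_eq_iff)
  qed
  show "qker (astar GA a) = kadj (qker a)"
    by (auto simp: qker_def gker_def kadj_def fun_eq_iff push_star[OF a] H.inv_mult_group)
  assume b: "b \<in> carrier GA"
  show "qker (a + b) = (\<lambda>p r. qker a p r + qker b p r)"
  proof -
    let ?S = "{t. a t \<noteq> 0} \<union> {t. b t \<noteq> 0}"
    have S: "finite ?S" using GA_fin a b by simp
    have "push (a + b) p = push a p + push b p" for p
    proof -
      have "push (a + b) p = (\<Sum>t\<in>?S. if q t = p then (a + b) t else 0)" by (rule push_eq[OF S]) auto
      also have "\<dots> = (\<Sum>t\<in>?S. if q t = p then a t else 0) + (\<Sum>t\<in>?S. if q t = p then b t else 0)"
        unfolding sum.distrib[symmetric] by (rule sum.cong) auto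
      also have "\<dots> = push a p + push b p" by (simp add: push_eq[OF S Un_upper1] push_eq[OF S Un_upper2])
      finally show ?thesis .
    qed
    then show ?thesis by (auto simp: qker_def gker_def fun_eq_iff)
  qed
  show "qker (amult GA a b) = kmul (qker a) (qker b)"
  proof (intro ext)
    fix p r
    have k: "kmul (qker a) (qker b) p r = (\<Sum>x\<in>carrier Q. qker a p x * qker b x r)"
      by (rule kmul_eq[OF finQ]) (auto dest: qker_support)
    show "qker (amult GA a b) p r = kmul (qker a) (qker b) p r"
    proof (cases "p \<in> carrier Q \<and> r \<in> carrier Q")
      case True
      then have "kmul (qker a) (qker b) p r = (\<Sum>s | a s \<noteq> 0. a s * qker b (inv\<^bsub>Q\<^esub> (q s) \<otimes>\<^bsub>Q\<^esub> p) r)"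
        unfolding k by (intro qker_sum[OF a]) simp
      also have "\<dots> = (\<Sum>s | a s \<noteq> 0. a s * push b (inv\<^bsub>Q\<^esub> (q s) \<otimes>\<^bsub>Q\<^esub> (p \<otimes>\<^bsub>Q\<^esub> inv\<^bsub>Q\<^esub> r)))"
        by (rule sum.cong) (use True GA_supp[OF a] in \<open>auto simp: qker_def gker_def H.m_assoc\<close>)
      also have "\<dots> = qker (amult GA a b) p r"
        using True push_mult[OF a b, of "p \<otimes>\<^bsub>Q\<^esub> inv\<^bsub>Q\<^esub> r"] by (simp add: qker_def gker_def)
      finally show ?thesis ..
    next
      case False
      then show ?thesis unfolding k by (auto simp: qker_def gker_def)
    qed
  qed
qed

lemma kapply_qker:
  assumes a: "a \<in> carrier GA" and v: "\<And>p. p \<notin> carrier Q \<Longrightarrow> v p = 0" and p: "p \<in> carrier Q"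
  shows "kapply (qker a) v p = (\<Sum>s | a s \<noteq> 0. a s * v (inv\<^bsub>Q\<^esub> (q s) \<otimes>\<^bsub>Q\<^esub> p))"
proof -
  have "kapply (qker a) v p = (\<Sum>r\<in>carrier Q. qker a p r * v r)" by (rule kapply_eq[OF finQ]) (use v in auto)
  then show ?thesis using qker_sum[OF a p] by simp
qed

text \<open>Fell absorption: twisting by the quotient map turns the tensor product of the regular and the
  quotient representation into a multiple of the regular one; almost invariant vectors then embed
  the quotient representation.\<close>

lemma qker_contractive:
  assumes a: "a \<in> carrier GA" and am: "amenable G"
  shows "kbounded (qker a) (vnorm GA a)"
proof (rule kbounded_dense)
  let ?A = "vnorm GA a"
  show A0: "0 \<le> ?A" by (rule G.gker_norm(3)[OF a])
  fix E assume E: "?A < E"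
  define S where "S = {s. a s \<noteq> 0}"
  have S: "finite S" "S \<subseteq> carrier G" using GA_fin[OF a] GA_supp[OF a] by (auto simp: S_def)
  define M where "M = (\<Sum>s\<in>S. cmod (a s))"
  have M: "M \<ge> 0" by (simp add: M_def sum_nonneg)
  \<comment> \<open>\<open>M * \<kappa>\<close> bounds the total error of replacing the translates
    of \<xi> by \<xi>, and it fits into the margin; the 1 keeps the denominator positive.\<close>
  define \<kappa> where "\<kappa> = (E - ?A) / (M + 1)"
  have \<kappa>: "\<kappa> > 0" using E M by (simp add: \<kappa>_def)
  have M\<kappa>: "M * \<kappa> \<le> E - ?A" using E M by (simp add: \<kappa>_def field_simps)
  from G.reiter[OF am S \<kappa>] obtain \<xi> :: "'g \<Rightarrow> complex" where \<xi>: "fsupp \<xi>" "nrm \<xi> = 1"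
    "\<And>t. t \<notin> carrier G \<Longrightarrow> \<xi> t = 0"
    "\<And>s. s \<in> S \<Longrightarrow> nrm (\<lambda>t. if t \<in> carrier G then \<xi> (inv s \<otimes> t) - \<xi> t else 0) \<le> \<kappa>" by blast
  show "kbounded (qker a) E"
    unfolding kbounded_def
  proof (intro conjI allI impI)
    show "0 \<le> E" using E A0 by simp
    fix v' :: "'q \<Rightarrow> complex" assume v': "fsupp v'"
    define v where "v p = (if p \<in> carrier Q then v' p else 0)" for p
    have v: "fsupp v" "nrm v \<le> nrm v'" "\<And>p. p \<notin> carrier Q \<Longrightarrow> v p = 0"
      unfolding v_def by (rule fsupp_restrict[OF v'], rule nrm_restrict[OF v'], simp)
    have rq: "row_col_finite (qker a)" by (rule fin_rep_row_col_finite[OF qker_fin_rep a])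
    have kv: "kapply (qker a) v' = kapply (qker a) v"
      unfolding kapply_alt[OF rq v', abs_def] kapply_alt[OF rq v(1), abs_def]
      by (intro ext sum.cong refl) (auto simp: v_def dest: qker_support)
    define g where "g s p = (if p \<in> carrier Q then a s * v (inv\<^bsub>Q\<^esub> (q s) \<otimes>\<^bsub>Q\<^esub> p) else 0)" for s p
    have g: "fsupp (g s)" "nrm (g s) \<le> cmod (a s) * nrm v" if "s \<in> S" for s
    proof -
      have i: "inj_on (\<lambda>p. inv\<^bsub>Q\<^esub> (q s) \<otimes>\<^bsub>Q\<^esub> p) (carrier Q)" using S that by (auto intro!: inj_onI)
      have "g s = (\<lambda>p. a s * (if p \<in> carrier Q then v (inv\<^bsub>Q\<^esub> (q s) \<otimes>\<^bsub>Q\<^esub> p) else 0))" by (auto simp: g_def)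
      then show "fsupp (g s)" "nrm (g s) \<le> cmod (a s) * nrm v"
        using nrm_translate[OF i v(1)] by (auto simp: nrm_scale intro: fsupp_scale mult_left_mono)
    qed
    define w where "w = kapply (qker a) v"
    have w: "w p = (\<Sum>s\<in>S. g s p)" for p
    proof (cases "p \<in> carrier Q")
      case True
      then show ?thesis using kapply_qker[OF a _ True, of v] v(3) by (simp add: w_def g_def S_def)
    next
      case False
      then have "qker a p r = 0" for r using qker_support by blast
      then show ?thesis using False by (simp add: w_def kapply_def g_def)
    qed
    have fw: "fsupp w" unfolding w_def by (rule kapply_fsupp[OF rq v(1)])
    \<comment> \<open>The operator of \<open>a\<close> in the tensor product of the regular and the
      quotient representation, applied to the tensor of \<xi> and v.\<close>
    define \<Psi>1 where "\<Psi>1 = (\<lambda>(t, p). \<Sum>s\<in>S. (if t \<in> carrier G then \<xi> (inv s \<otimes> t) else 0) * g s p)"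
    define dd where "dd s t = (if t \<in> carrier G then \<xi> (inv s \<otimes> t) - \<xi> t else 0)" for s t
    have tr: "fsupp (\<lambda>t. if t \<in> carrier G then \<xi> (inv s \<otimes> t) else 0)" if "s \<in> S" for s
      by (rule nrm_translate(1)[OF _ \<xi>(1)]) (use S that in \<open>auto intro!: inj_onI\<close>)
    have fdd: "fsupp (dd s)" if "s \<in> S" for s
    proof -
      have "dd s = (\<lambda>t. (if t \<in> carrier G then \<xi> (inv s \<otimes> t) else 0) + (- 1) * \<xi> t)"
        using \<xi>(3) by (auto simp: dd_def fun_eq_iff)
      moreover have "fsupp \<dots>" by (intro fsupp_add fsupp_scale tr[OF that] \<xi>(1))
      ultimately show ?thesis by simp
    qed
    have f1: "fsupp \<Psi>1"
    proof -
      have "\<Psi>1 = (\<lambda>x. \<Sum>s\<in>S. (\<lambda>(t, p). (if t \<in> carrier G then \<xi> (inv s \<otimes> t) else 0) * g s p) x)"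
        by (auto simp: \<Psi>1_def)
      then show ?thesis using S nrm_tensor(1)[OF tr g(1)] by (auto intro!: fsupp_sum)
    qed
    \<comment> \<open>The tensor of \<xi> and w differs from \<open>\<Psi>1\<close> only by terms
      with a small factor \<open>dd s\<close>.\<close>
    have decomp: "(\<lambda>(t, p). \<xi> t * w p) = (\<lambda>x. \<Psi>1 x + (\<Sum>s\<in>S. (\<lambda>(t, p). (- 1) * (dd s t * g s p)) x))"
    proof
      fix x :: "'g \<times> 'q"
      obtain t p where x: "x = (t, p)" by (cases x)
      have "\<xi> t * (\<Sum>s\<in>S. g s p) = (\<Sum>s\<in>S. (if t \<in> carrier G then \<xi> (inv s \<otimes> t) else 0) * g s p) +
          (\<Sum>s\<in>S. (- 1) * (dd s t * g s p))"
        unfolding sum.distrib[symmetric] sum_distrib_left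
        by (rule sum.cong) (auto simp: dd_def \<xi>(3) algebra_simps)
      then show "(\<lambda>(t, p). \<xi> t * w p) x = \<Psi>1 x + (\<Sum>s\<in>S. (\<lambda>(t, p). (- 1) * (dd s t * g s p)) x)"
        by (simp add: x w \<Psi>1_def)
    qed
    have d1: "fsupp (\<lambda>(t, p). (- 1) * (dd s t * g s p))" "nrm (\<lambda>(t, p). (- 1) * (dd s t * g s p)) \<le> \<kappa> * (cmod (a s) * nrm v)"
      if s: "s \<in> S" for s
    proof -
      have e: "(\<lambda>(t, p). (- 1) * (dd s t * g s p)) = (\<lambda>x. (- 1) * (\<lambda>(t, p). dd s t * g s p) x)" by auto
      note T = nrm_tensor[OF fdd[OF s] g(1)[OF s]]
      show "fsupp (\<lambda>(t, p). (- 1) * (dd s t * g s p))" unfolding e by (rule fsupp_scale[OF T(1)])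
      have "nrm (\<lambda>(t, p). (- 1) * (dd s t * g s p)) = nrm (dd s) * nrm (g s)"
        unfolding e nrm_scale T(2) by simp
      also have "\<dots> \<le> \<kappa> * (cmod (a s) * nrm v)"
        using \<xi>(4)[OF s] g(2)[OF s] \<kappa> by (intro mult_mono) (auto simp: dd_def[abs_def])
      finally show "nrm (\<lambda>(t, p). (- 1) * (dd s t * g s p)) \<le> \<kappa> * (cmod (a s) * nrm v)" .
    qed
    have "nrm w = nrm (\<lambda>(t, p). \<xi> t * w p)" using nrm_tensor(2)[OF \<xi>(1) fw] \<xi>(2) by simp
    also have "\<dots> \<le> nrm \<Psi>1 + nrm (\<lambda>x. \<Sum>s\<in>S. (\<lambda>(t, p). (- 1) * (dd s t * g s p)) x)"
      unfolding decomp by (rule nrm_triangle[OF f1 fsupp_sum[OF S(1) d1(1)]])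
    also have "\<dots> \<le> nrm \<Psi>1 + (\<Sum>s\<in>S. \<kappa> * (cmod (a s) * nrm v))"
      by (intro add_left_mono order_trans[OF nrm_sum[OF S(1) d1(1)]] sum_mono d1(2))
    also have "(\<Sum>s\<in>S. \<kappa> * (cmod (a s) * nrm v)) = M * \<kappa> * nrm v"
      by (simp add: M_def sum_distrib_left sum_distrib_right mult_ac)
    also have "nrm \<Psi>1 \<le> ?A * nrm v"
    proof (rule power2_le_imp_le)
      \<comment> \<open>The twist (t, p) -> (t, q t p) makes \<open>\<Psi>1\<close> a direct sum
        over p of the regular operator applied to \<open>\<zeta> p\<close>, and it preserves the
        total norm.\<close>
      define \<zeta> where "\<zeta> p t = (if t \<in> carrier G then \<xi> t * v (q t \<otimes>\<^bsub>Q\<^esub> p) else 0)" for p t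
      have fz: "fsupp (\<zeta> p)" for p
        by (rule fsupp_subset[of "{t. \<xi> t \<noteq> 0}"]) (use \<xi>(1) in \<open>auto simp: fsupp_def \<zeta>_def\<close>)
      define R where "R = {t. \<xi> t \<noteq> 0}"
      have R: "finite R" "R \<subseteq> carrier G" using \<xi> by (auto simp: R_def fsupp_def)
      have bij: "bij_betw (\<lambda>p. q t \<otimes>\<^bsub>Q\<^esub> p) (carrier Q) (carrier Q)" if "t \<in> carrier G" for t
        by (rule bij_betwI[where g = "\<lambda>p. inv\<^bsub>Q\<^esub> (q t) \<otimes>\<^bsub>Q\<^esub> p"]) (use that in \<open>auto simp: H.inv_cancel\<close>)
      have nz: "(\<Sum>p\<in>carrier Q. (nrm (\<zeta> p))\<^sup>2) = (nrm v)\<^sup>2"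
      proof -
        have "(\<Sum>p\<in>carrier Q. (nrm (\<zeta> p))\<^sup>2) = (\<Sum>p\<in>carrier Q. \<Sum>t\<in>R. (cmod (\<xi> t))\<^sup>2 * (cmod (v (q t \<otimes>\<^bsub>Q\<^esub> p)))\<^sup>2)"
        proof (rule sum.cong[OF refl])
          fix p
          have "(nrm (\<zeta> p))\<^sup>2 = (\<Sum>t\<in>R. (cmod (\<zeta> p t))\<^sup>2)" by (rule nrm_sq[OF R(1)]) (auto simp: \<zeta>_def R_def)
          then show "(nrm (\<zeta> p))\<^sup>2 = (\<Sum>t\<in>R. (cmod (\<xi> t))\<^sup>2 * (cmod (v (q t \<otimes>\<^bsub>Q\<^esub> p)))\<^sup>2)"
            using R(2) by (auto simp: \<zeta>_def norm_mult power_mult_distrib intro!: sum.cong)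
        qed
        also have "\<dots> = (\<Sum>t\<in>R. (cmod (\<xi> t))\<^sup>2 * (\<Sum>p\<in>carrier Q. (cmod (v (q t \<otimes>\<^bsub>Q\<^esub> p)))\<^sup>2))"
          by (subst sum.swap) (simp add: sum_distrib_left)
        also have "\<dots> = (\<Sum>t\<in>R. (cmod (\<xi> t))\<^sup>2 * (nrm v)\<^sup>2)"
        proof (rule sum.cong[OF refl])
          fix t assume "t \<in> R"
          then have "(\<Sum>p\<in>carrier Q. (cmod (v (q t \<otimes>\<^bsub>Q\<^esub> p)))\<^sup>2) = (\<Sum>p\<in>carrier Q. (cmod (v p))\<^sup>2)"
            using sum.reindex_bij_betw[OF bij, of t "\<lambda>p. (cmod (v p))\<^sup>2"] R by auto
          also have "\<dots> = (nrm v)\<^sup>2" by (rule nrm_sq[symmetric, OF finQ]) (use v(3) in auto)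
          finally show "(cmod (\<xi> t))\<^sup>2 * (\<Sum>p\<in>carrier Q. (cmod (v (q t \<otimes>\<^bsub>Q\<^esub> p)))\<^sup>2) = (cmod (\<xi> t))\<^sup>2 * (nrm v)\<^sup>2" by simp
        qed
        also have "\<dots> = (nrm \<xi>)\<^sup>2 * (nrm v)\<^sup>2"
          using nrm_sq[OF R(1), of \<xi>] by (simp add: sum_distrib_right R_def)
        finally show ?thesis using \<xi>(2) by simp
      qed
      define R1 where "R1 = fst ` {x. \<Psi>1 x \<noteq> 0}"
      define R2 where "R2 = R1 \<union> (\<Union>p\<in>carrier Q. {t. kapply (gker G a) (\<zeta> p) t \<noteq> 0})"
      have fk: "fsupp (kapply (gker G a) (\<zeta> p))" for p by (rule kapply_fsupp[OF G.row_col_finite_gker[OF a] fz])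
      have R1: "{x. \<Psi>1 x \<noteq> 0} \<subseteq> R1 \<times> carrier Q" "finite R1" "R1 \<subseteq> carrier G"
      proof -
        show "finite R1" using f1 by (simp add: R1_def fsupp_def)
        have "t \<in> carrier G \<and> p \<in> carrier Q" if "\<Psi>1 (t, p) \<noteq> 0" for t p
          using that by (rule contrapos_np) (auto simp: \<Psi>1_def g_def intro!: sum.neutral)
        then show "{x. \<Psi>1 x \<noteq> 0} \<subseteq> R1 \<times> carrier Q" "R1 \<subseteq> carrier G" by (force simp: R1_def)+
      qed
      have "kapply (gker G a) (\<zeta> p) t = 0" if "t \<notin> carrier G" for p t
        using that by (simp add: kapply_def gker_def)
      then have R2: "finite R2" "R2 \<subseteq> carrier G"
        using R1 finQ fk by (auto simp: R2_def fsupp_def)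
      have "(nrm \<Psi>1)\<^sup>2 = (\<Sum>x\<in>R2 \<times> carrier Q. (cmod (\<Psi>1 x))\<^sup>2)"
        by (rule nrm_sq) (use R1 R2 finQ in \<open>auto simp: R2_def\<close>)
      also have "\<dots> = (\<Sum>t\<in>R2. \<Sum>p\<in>carrier Q. (cmod (\<Psi>1 (t, p)))\<^sup>2)"
        by (simp add: sum.cartesian_product)
      also have "\<dots> = (\<Sum>t\<in>R2. \<Sum>p\<in>carrier Q. (cmod (\<Psi>1 (t, q t \<otimes>\<^bsub>Q\<^esub> p)))\<^sup>2)"
      proof (rule sum.cong[OF refl])
        fix t assume "t \<in> R2"
        then have "t \<in> carrier G" using R2 by auto
        from sum.reindex_bij_betw[OF bij[OF this], of "\<lambda>p. (cmod (\<Psi>1 (t, p)))\<^sup>2"]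
        show "(\<Sum>p\<in>carrier Q. (cmod (\<Psi>1 (t, p)))\<^sup>2) = (\<Sum>p\<in>carrier Q. (cmod (\<Psi>1 (t, q t \<otimes>\<^bsub>Q\<^esub> p)))\<^sup>2)" by simp
      qed
      also have "\<dots> = (\<Sum>t\<in>R2. \<Sum>p\<in>carrier Q. (cmod (kapply (gker G a) (\<zeta> p) t))\<^sup>2)"
      proof (intro sum.cong refl)
        fix t p assume "t \<in> R2" and p: "p \<in> carrier Q"
        then have t: "t \<in> carrier G" using R2 by auto
        have "kapply (gker G a) (\<zeta> p) t = left_regular G a (\<zeta> p) t" by (simp add: G.left_regular_kapply[OF a fz])
        also have "\<dots> = (\<Sum>s\<in>S. a s * \<zeta> p (inv s \<otimes> t))"
        proof -
          have "{s \<in> carrier G. a s \<noteq> 0} = S" using S(2) by (auto simp: S_def)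
          then show ?thesis using t by (simp add: left_regular_def)
        qed
        also have "\<dots> = \<Psi>1 (t, q t \<otimes>\<^bsub>Q\<^esub> p)"
          unfolding \<Psi>1_def using t p S(2)
          by (auto simp: \<zeta>_def g_def hom_mult hom_inv H.m_assoc intro!: sum.cong)
        finally show "(cmod (\<Psi>1 (t, q t \<otimes>\<^bsub>Q\<^esub> p)))\<^sup>2 = (cmod (kapply (gker G a) (\<zeta> p) t))\<^sup>2" by simp
      qed
      also have "\<dots> = (\<Sum>p\<in>carrier Q. \<Sum>t\<in>R2. (cmod (kapply (gker G a) (\<zeta> p) t))\<^sup>2)" by (rule sum.swap)
      also have "\<dots> = (\<Sum>p\<in>carrier Q. (nrm (kapply (gker G a) (\<zeta> p)))\<^sup>2)"
        by (intro sum.cong refl nrm_sq[symmetric] R2) (auto simp: R2_def)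
      also have "\<dots> \<le> (\<Sum>p\<in>carrier Q. (?A * nrm (\<zeta> p))\<^sup>2)"
        by (intro sum_mono power_mono kbdD[OF G.gker_norm(1)[OF a] fz]) simp
      also have "\<dots> = (?A * nrm v)\<^sup>2"
        by (simp add: power_mult_distrib sum_distrib_left[symmetric] nz)
      finally show "(nrm \<Psi>1)\<^sup>2 \<le> (?A * nrm v)\<^sup>2" .
    qed (simp add: A0)
    finally have "nrm w \<le> (?A + M * \<kappa>) * nrm v" by (simp add: distrib_right)
    also have "\<dots> \<le> E * nrm v" by (rule mult_right_mono) (use M\<kappa> in auto)
    also have "\<dots> \<le> E * nrm v'" by (rule mult_left_mono[OF v(2)]) (use E A0 in simp)
    finally show "nrm (kapply (qker a) v') \<le> E * nrm v'" by (simp add: kv w_def)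
  qed
qed

text \<open>Injectivity of \<open>q\<close> on the support prevents values from being added up; they
  are merely relabelled.\<close>

lemma nrm_push:
  assumes f: "f \<in> carrier GA" and inj: "inj_on q E" and E: "{t. f t \<noteq> 0} \<subseteq> E"
  shows "nrm (push f) = nrm f"
proof -
  let ?S = "{t. f t \<noteq> 0}"
  have S: "finite ?S" by (rule GA_fin[OF f])
  have i: "inj_on q ?S" by (rule inj_on_subset[OF inj E])
  have p: "push f (q t) = f t" if "t \<in> ?S" for t
  proof -
    have "push f (q t) = (\<Sum>t'\<in>?S. if t' = t then f t' else 0)"
      unfolding push_eq[OF S order_refl] by (rule sum.cong) (use i that in \<open>auto simp: inj_on_def\<close>)
    then show ?thesis using S that by simp
  qed
  have sub: "{p. push f p \<noteq> 0} \<subseteq> q ` ?S"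
  proof
    fix p assume "p \<in> {p. push f p \<noteq> 0}"
    then have "(\<Sum>t | f t \<noteq> 0 \<and> q t = p. f t) \<noteq> 0" by (simp add: push_def)
    then show "p \<in> q ` ?S" by (elim sum.not_neutral_contains_not_neutral) auto
  qed
  have "(nrm (push f))\<^sup>2 = (\<Sum>p\<in>q ` ?S. (cmod (push f p))\<^sup>2)" by (rule nrm_sq[OF _ sub]) (use S in simp)
  also have "\<dots> = (\<Sum>t\<in>?S. (cmod (f t))\<^sup>2)" by (simp add: sum.reindex[OF i] p)
  also have "\<dots> = (nrm f)\<^sup>2" by (rule nrm_sq[symmetric, OF S]) simp
  finally show ?thesis by (rule power2_eq_imp_eq) simp_all
qed

lemma push_fsupp: "f \<in> carrier GA \<Longrightarrow> fsupp (push f) \<and> (\<forall>p. p \<notin> carrier Q \<longrightarrow> push f p = 0)"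
proof -
  assume f: "f \<in> carrier GA"
  have z: "push f p = 0" if "p \<notin> carrier Q" for p
    unfolding push_def by (rule sum.neutral) (use that GA_supp[OF f] in auto)
  then show ?thesis by (auto intro: fsupp_subset[OF finQ])
qed

text \<open>\<open>push\<close> intertwines multiplication by \<open>a\<close> with the quotient
  representation, so a test vector on the group can be used on the quotient.\<close>

lemma kapply_qker_push:
  assumes a: "a \<in> carrier GA" and f: "f \<in> carrier GA"
  shows "kapply (qker a) (push f) = push (amult GA a f)"
proof
  fix p
  show "kapply (qker a) (push f) p = push (amult GA a f) p"
  proof (cases "p \<in> carrier Q")
    case True
    then show ?thesis using kapply_qker[OF a _ True, of "push f"] push_mult[OF a f True] push_fsupp[OF f] by simp
  next
    case False
    then have "qker a p r = 0" for r using qker_support by blast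
    then show ?thesis using push_fsupp[OF G.group_alg_mult_closed[OF a f]] False by (simp add: kapply_def)
  qed
qed

end

section \<open>Separation by finite quotients, and residual finite-dimensionality of the group
  algebra\<close>

context group
begin

text \<open>A coset of the intersection is the intersection of a coset of M with a coset of
  N.\<close>

lemma finite_index_inter:
  assumes M: "M \<lhd> G" "finite (carrier (G Mod M))" and N: "N \<lhd> G" "finite (carrier (G Mod N))"
  shows "finite (carrier (G Mod (M \<inter> N)))"
proof -
  have "carrier (G Mod (M \<inter> N)) \<subseteq> (\<lambda>(A, B). A \<inter> B) ` (carrier (G Mod M) \<times> carrier (G Mod N))"
  proof
    fix C assume "C \<in> carrier (G Mod (M \<inter> N))"
    then obtain x where x: "x \<in> carrier G" "C = (M \<inter> N) #> x" by (auto simp: FactGroup_def RCOSETS_def)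
    have sub: "M \<subseteq> carrier G" "N \<subseteq> carrier G"
      using M(1) N(1) by (auto dest: normal_imp_subgroup subgroup.subset)
    have "C = (M #> x) \<inter> (N #> x)"
      unfolding x(2) r_coset_def using sub x(1) by (auto simp: right_cancel subset_iff)
    then show "C \<in> (\<lambda>(A, B). A \<inter> B) ` (carrier (G Mod M) \<times> carrier (G Mod N))"
      using x(1) by (auto simp: FactGroup_def RCOSETS_def)
  qed
  then show ?thesis using M(2) N(2) finite_subset by blast
qed

text \<open>It suffices that N avoids the finitely many elements x (inv y) with x and y distinct in
  \<open>E\<close>; a finite index subgroup for each of them exists, and finitely many are
  intersected.\<close>

lemma separating_quotient:
  assumes rf: "residually_finite G" and E: "finite E" "E \<subseteq> carrier G"
  shows "\<exists>N. N \<lhd> G \<and> finite (carrier (G Mod N)) \<and> inj_on (\<lambda>t. N #> t) E"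
proof -
  have avoid: "finite D \<Longrightarrow> D \<subseteq> carrier G \<Longrightarrow> \<one> \<notin> D \<Longrightarrow>
    \<exists>N. N \<lhd> G \<and> finite (carrier (G Mod N)) \<and> D \<inter> N = {}" for D
  proof (induction D rule: finite_induct)
    case empty
    \<comment> \<open>The empty set is avoided by the whole group, whose quotient is
      trivial.\<close>
    have c: "carrier G \<lhd> G" by (simp add: normal_inv_iff subgroup_self)
    have "carrier (G Mod carrier G) \<subseteq> {carrier G}"
      by (auto simp: FactGroup_def RCOSETS_def coset_join2 subgroup_self)
    then have "finite (carrier (G Mod carrier G))" by (rule finite_subset) simp
    with c show ?case by blast
  next
    case (insert g D)
    then obtain N where N: "N \<lhd> G" "finite (carrier (G Mod N))" "D \<inter> N = {}" by auto
    obtain M where M: "M \<lhd> G" "finite (carrier (G Mod M))" "g \<notin> M"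
      using rf[unfolded residually_finite_def, rule_format, of g] insert.prems by auto
    show ?case
      using normal_subgroup_intersect[OF M(1) N(1)] finite_index_inter[OF M(1,2) N(1,2)] M(3) N(3) by blast
  qed
  define D where "D = (\<lambda>(x, y). x \<otimes> inv y) ` {(x, y). x \<in> E \<and> y \<in> E \<and> x \<noteq> y}"
  have "finite D" unfolding D_def
    by (rule finite_imageI, rule finite_subset[of _ "E \<times> E"]) (use E in auto)
  moreover have "D \<subseteq> carrier G" using E by (auto simp: D_def)
  moreover have "\<one> \<notin> D"
  proof
    assume "\<one> \<in> D"
    then obtain x y where "x \<in> E" "y \<in> E" "x \<noteq> y" "x \<otimes> inv y = \<one>" by (auto simp: D_def)
    then show False using E by (metis inv_closed inv_equality inv_inv subsetD)
  qed
  ultimately obtain N where N: "N \<lhd> G" "finite (carrier (G Mod N))" "D \<inter> N = {}" using avoid by blast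
  have sg: "subgroup N G" by (rule normal_imp_subgroup[OF N(1)])
  have "inj_on (\<lambda>t. N #> t) E"
  proof (rule inj_onI, rule ccontr)
    fix x y assume xy: "x \<in> E" "y \<in> E" "N #> x = N #> y" "x \<noteq> y"
    then have c: "x \<in> carrier G" "y \<in> carrier G" using E by auto
    have "x \<in> N #> y" using xy(3) rcos_self[OF c(1) sg] by simp
    then obtain n where "n \<in> N" "x = n \<otimes> y" by (auto simp: r_coset_def)
    then have "x \<otimes> inv y \<in> N" using c sg subgroup.mem_carrier by (fastforce simp: m_assoc)
    then show False using N(3) xy by (auto simp: D_def)
  qed
  then show ?thesis using N by blast
qed

text \<open>A finitely supported f for which the norm of a f is almost maximal remains a test vector
  in every quotient that is injective on the supports of f and a f. The upper bound is
  \<open>qker_contractive\<close>.\<close>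

lemma pre_RFD_group_alg:
  assumes am: "amenable G" and rf: "residually_finite G"
  shows "pre_RFD (group_alg G)"
proof -
  interpret K: kernel_algebra "group_alg G" "{()}" "\<lambda>_. gker G" by (rule group_kernel_algebra)
  show ?thesis
  proof (rule K.pre_RFD_fin_repI)
    fix \<epsilon> :: real and \<Omega> assume e: "\<epsilon> > 0" and \<Omega>: "finite \<Omega>" "\<Omega> \<subseteq> carrier (group_alg G)"
    \<comment> \<open>For the remaining elements the required lower bound is negative, so every
      bound \<open>C\<close> satisfies it.\<close>
    define \<Omega>1 where "\<Omega>1 = {a \<in> \<Omega>. vnorm (group_alg G) a - \<epsilon> \<ge> 0}"
    have "\<exists>f. f \<in> carrier (group_alg G) \<and>
        (vnorm (group_alg G) a - \<epsilon>) * nrm f < nrm (amult (group_alg G) a f)" if a1: "a \<in> \<Omega>1" for a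
    proof -
      have a: "a \<in> carrier (group_alg G)" using a1 \<Omega> by (auto simp: \<Omega>1_def)
      have "\<not> kbounded (gker G a) (vnorm (group_alg G) a - \<epsilon>)" using gker_norm(2)[OF a] e by fastforce
      then obtain \<xi> where \<xi>: "fsupp \<xi>" "(vnorm (group_alg G) a - \<epsilon>) * nrm \<xi> < nrm (kapply (gker G a) \<xi>)"
        using a1 by (auto simp: kbounded_def \<Omega>1_def not_le)
      define f where "f t = (if t \<in> carrier G then \<xi> t else 0)" for t
      have f: "fsupp f" "nrm f \<le> nrm \<xi>" unfolding f_def by (rule fsupp_restrict[OF \<xi>(1)], rule nrm_restrict[OF \<xi>(1)])
      have fc: "f \<in> carrier (group_alg G)" using f by (simp add: group_alg_carrier fsupp_def f_def)
      have "kapply (gker G a) \<xi> = kapply (gker G a) f"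
        unfolding kapply_alt[OF row_col_finite_gker[OF a] f(1), abs_def] kapply_alt[OF row_col_finite_gker[OF a] \<xi>(1), abs_def]
        by (intro ext sum.cong refl) (auto simp: f_def gker_def split: if_splits)
      also have "\<dots> = amult (group_alg G) a f"
        unfolding left_regular_kapply[OF a f(1), symmetric] by (simp add: left_regular_def group_alg_def fun_eq_iff)
      finally have "kapply (gker G a) \<xi> = amult (group_alg G) a f" .
      moreover have "(vnorm (group_alg G) a - \<epsilon>) * nrm f \<le> (vnorm (group_alg G) a - \<epsilon>) * nrm \<xi>"
        using a1 by (intro mult_left_mono f) (simp add: \<Omega>1_def)
      ultimately show ?thesis using \<xi>(2) fc by auto
    qed
    then obtain f where f: "\<And>a. a \<in> \<Omega>1 \<Longrightarrow> f a \<in> carrier (group_alg G)"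
      "\<And>a. a \<in> \<Omega>1 \<Longrightarrow> (vnorm (group_alg G) a - \<epsilon>) * nrm (f a) < nrm (amult (group_alg G) a (f a))" by metis
    define E where "E = (\<Union>a\<in>\<Omega>1. {t. f a t \<noteq> 0} \<union> {t. amult (group_alg G) a (f a) t \<noteq> 0})"
    have \<Omega>1: "finite \<Omega>1" "\<And>a. a \<in> \<Omega>1 \<Longrightarrow> a \<in> carrier (group_alg G)" using \<Omega> by (auto simp: \<Omega>1_def)
    have m: "amult (group_alg G) a (f a) \<in> carrier (group_alg G)" if "a \<in> \<Omega>1" for a
      by (rule group_alg_mult_closed[OF \<Omega>1(2)[OF that] f(1)[OF that]])
    have "finite E" using \<Omega>1(1) f(1) m by (auto simp: E_def group_alg_carrier)
    moreover have "E \<subseteq> carrier G"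
    proof -
      have "t \<in> carrier G" if "c \<in> carrier (group_alg G)" "c t \<noteq> 0" for c t
        using that by (auto simp: group_alg_carrier)
      then show ?thesis using f(1) m by (fastforce simp: E_def)
    qed
    ultimately obtain N where N: "N \<lhd> G" "finite (carrier (G Mod N))" "inj_on (\<lambda>t. N #> t) E"
      using separating_quotient[OF rf] by blast
    interpret F: fin_quot G "G Mod N" "\<lambda>t. N #> t"
    proof (intro fin_quot.intro group_hom.intro group_hom_axioms.intro fin_quot_axioms.intro)
      show "group G" by (rule is_group)
      show "group (G Mod N)" by (rule normal.factorgroup_is_group[OF N(1)])
      show "(\<lambda>t. N #> t) \<in> hom G (G Mod N)" by (rule normal.r_coset_hom_Mod[OF N(1)])
    qed (rule N(2))
    have low: "vnorm (group_alg G) a - \<epsilon> \<le> C" if a: "a \<in> \<Omega>" and C: "kbounded (F.qker a) C" for a C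
    proof (cases "a \<in> \<Omega>1")
      case False
      then show ?thesis using a kbounded_nonneg[OF C] by (auto simp: \<Omega>1_def)
    next
      case True
      note ac = \<Omega>1(2)[OF True] and fc = f(1)[OF True]
      have n1: "nrm (F.push (f a)) = nrm (f a)"
        by (rule F.nrm_push[OF fc N(3)]) (use True in \<open>auto simp: E_def\<close>)
      have n2: "nrm (F.push (amult (group_alg G) a (f a))) = nrm (amult (group_alg G) a (f a))"
        by (rule F.nrm_push[OF m[OF True] N(3)]) (use True in \<open>auto simp: E_def\<close>)
      have "nrm (kapply (F.qker a) (F.push (f a))) \<le> C * nrm (F.push (f a))"
        by (rule kbdD[OF C]) (use F.push_fsupp[OF fc] in blast)
      then have "nrm (amult (group_alg G) a (f a)) \<le> C * nrm (f a)"
        by (simp add: F.kapply_qker_push[OF ac fc] n1 n2)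
      with f(2)[OF True] have "(vnorm (group_alg G) a - \<epsilon>) * nrm (f a) < C * nrm (f a)" by linarith
      then show ?thesis using nrm_nonneg[of "f a"] by (meson less_imp_le mult_right_mono not_less)
    qed
    show "\<exists>(J :: 'a set set) k. fin_rep (group_alg G) J k \<and>
        (\<forall>a\<in>carrier (group_alg G). kbounded (k a) (vnorm (group_alg G) a)) \<and>
        (\<forall>a\<in>\<Omega>. \<forall>C. kbounded (k a) C \<longrightarrow> vnorm (group_alg G) a - \<epsilon> \<le> C)"
      using F.qker_fin_rep F.qker_contractive[OF _ am] low by blast
  qed
qed

end

theorem theorem4p9:
  fixes G :: "('g, 'c) monoid_scheme"
    and X :: "'x::metric_space set"
    and U :: "'g \<Rightarrow> 'x set"
    and \<theta> :: "'g \<Rightarrow> 'x \<Rightarrow> 'x"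
  assumes "group G"
    and "countable (carrier G)"
    and "compact X"
    and "continuous_partial_action G X U \<theta>"
  shows "(RFD_algebra (reduced_crossed_product G X U \<theta>) \<longrightarrow> RFD_partial_action G X U \<theta>) \<and>
    (RFD_partial_action G X U \<theta> \<and> RFD_algebra (reduced_group_cstar G) \<longrightarrow>
      RFD_algebra (reduced_crossed_product G X U \<theta>)) \<and>
    (amenable G \<and> residually_finite G \<and> RFD_partial_action G X U \<theta> \<longrightarrow>
      RFD_algebra (reduced_crossed_product G X U \<theta>))"
proof -
  interpret group G by (rule assms(1))
  interpret cont_partial_act G X U \<theta> by unfold_locales (rule assms)+
  interpret S: kernel_algebra "section_alg G (action_bundle G X U \<theta>)" X sker
    by (rule section_kernel_algebra)
  interpret A: kernel_algebra "group_alg G" "{()}" "\<lambda>_. gker G" by (rule group_kernel_algebra)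
  have "RFD_algebra (reduced_crossed_product G X U \<theta>) \<longleftrightarrow> pre_RFD (section_alg G (action_bundle G X U \<theta>))"
    unfolding reduced_crossed_product_def reduced_bundle_cstar_def by (rule S.RFD_completion_iff)
  moreover have "RFD_algebra (reduced_group_cstar G) \<longleftrightarrow> pre_RFD (group_alg G)"
    unfolding reduced_group_cstar_def by (rule A.RFD_completion_iff)
  \<comment> \<open>Statement (3) follows from the argument for (2), with the hypothesis on the
    group algebra supplied by \<open>pre_RFD_group_alg\<close>.\<close>
  ultimately show ?thesis
    using pre_RFD_imp_RFD_partial_action pre_RFD_section_alg pre_RFD_group_alg by blast
qed

end
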